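(* Let $n\ge 2$, let $D\subset\mathbb R^n$ be an open set, let $m\ge 1$ be an integer, let $1<p<\infty$, and let $w:\mathbb R^n\to[0,\infty)$ be a weight satisfying the $A_p$-condition. Then $W^m_p(D,w)$ is a Banach space, and the smooth functions belonging to $W^m_p(D,w)$ (that is, $C^\infty(D)\cap W^m_p(D,w)$) are dense in $W^m_p(D,w)$.
   Context: A weight is a locally summable function $w:\mathbb R^n\to[0,\infty)$. It satisfies the $A_p$-condition ($1<p<\infty$) if $\sup_{B}\left(\frac1{|B|}\int_B w\right)\left(\frac1{|B|}\int_B w^{1/(1-p)}\right)^{p-1}<+\infty$, the supremum being over all balls $B\subset\mathbb R^n$ ($|B|$ is Lebesgue measure). $W^m_p(D,w)$ is the space of locally summable, $m$ times weakly differentiable functions $f:D\to\mathbb R$ with finite norm $\|f\mid W^m_p(D,w)\|=\left(\int_D|f|^p w\,dx\right)^{1/p}+\sum_{|\alpha|=m}\left(\int_D|D^\alpha f|^p w\,dx\right)^{1/p}$, where $D^\alpha f$ denotes the weak derivative for the multiindex $\alpha$. *)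

theory Defs
  imports "HOL-Analysis.Analysis" "HOL-Library.Multiset"
begin

section \<open>Normed and Banach spaces on a carrier set\<close>

text \<open>
  The elements of a weighted Sobolev space are classes of functions modulo equality almost
  everywhere, and they do not form a type; hence the carrier-based notion of a real Banach space.
\<close>

text \<open>The value \<open>0\<close> off the carrier is needed because \<^locale>\<open>Metric_space\<close> asks for
  non-negativity and symmetry of the distance on the whole type.\<close>

definition norm_dist ::
    "'v set \<Rightarrow> ('v \<Rightarrow> 'v \<Rightarrow> 'v) \<Rightarrow> (real \<Rightarrow> 'v \<Rightarrow> 'v) \<Rightarrow> ('v \<Rightarrow> real) \<Rightarrow> 'v \<Rightarrow> 'v \<Rightarrow> real"
  where "norm_dist V add smul nrm u v =
    (if u \<in> V \<and> v \<in> V then nrm (add u (smul (-1) v)) else 0)"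

locale normed_space_on =
  fixes V :: "'v set"
    and add :: "'v \<Rightarrow> 'v \<Rightarrow> 'v"
    and zero :: 'v
    and smul :: "real \<Rightarrow> 'v \<Rightarrow> 'v"
    and nrm :: "'v \<Rightarrow> real"
  assumes zero_closed: "zero \<in> V"
    and add_closed: "\<lbrakk>u \<in> V; v \<in> V\<rbrakk> \<Longrightarrow> add u v \<in> V"
    and smul_closed: "u \<in> V \<Longrightarrow> smul a u \<in> V"
    and add_assoc: "\<lbrakk>u \<in> V; v \<in> V; z \<in> V\<rbrakk> \<Longrightarrow> add (add u v) z = add u (add v z)"
    and add_commute: "\<lbrakk>u \<in> V; v \<in> V\<rbrakk> \<Longrightarrow> add u v = add v u"
    and add_zero: "u \<in> V \<Longrightarrow> add u zero = u"
    and add_inverse: "u \<in> V \<Longrightarrow> add u (smul (-1) u) = zero"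
    and smul_add_right: "\<lbrakk>u \<in> V; v \<in> V\<rbrakk> \<Longrightarrow> smul a (add u v) = add (smul a u) (smul a v)"
    and smul_add_left: "u \<in> V \<Longrightarrow> smul (a + b) u = add (smul a u) (smul b u)"
    and smul_smul: "u \<in> V \<Longrightarrow> smul a (smul b u) = smul (a * b) u"
    and smul_one: "u \<in> V \<Longrightarrow> smul 1 u = u"
    and nrm_nonneg: "u \<in> V \<Longrightarrow> 0 \<le> nrm u"
    and nrm_eq_zero_iff: "u \<in> V \<Longrightarrow> nrm u = 0 \<longleftrightarrow> u = zero"
    and nrm_smul: "u \<in> V \<Longrightarrow> nrm (smul a u) = \<bar>a\<bar> * nrm u"
    and nrm_triangle: "\<lbrakk>u \<in> V; v \<in> V\<rbrakk> \<Longrightarrow> nrm (add u v) \<le> nrm u + nrm v"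
begin

lemma diff_add_diff:
  assumes "u \<in> V" "v \<in> V" "z \<in> V"
  shows "add (add u (smul (-1) v)) (add v (smul (-1) z)) = add u (smul (-1) z)"
proof -
  let ?v = "smul (-1) v" and ?z = "smul (-1) z"
  have c: "?v \<in> V" "?z \<in> V" using assms by (auto intro: smul_closed)
  have "add (add u ?v) (add v ?z) = add u (add ?v (add v ?z))"
    using assms c by (simp add: add_assoc add_closed)
  also have "add ?v (add v ?z) = add (add v ?v) ?z"
    using assms c by (simp add: add_assoc [symmetric] add_commute)
  also have "\<dots> = ?z"
    using assms c by (metis add_inverse add_zero add_commute zero_closed)
  finally show ?thesis .
qed

lemma diff_eq_zero_iff:
  assumes "u \<in> V" "v \<in> V"
  shows "add u (smul (-1) v) = zero \<longleftrightarrow> u = v"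
proof
  assume *: "add u (smul (-1) v) = zero"
  have c: "smul (-1) v \<in> V" using assms by (auto intro: smul_closed)
  have "u = add u (add (smul (-1) v) v)"
    using assms c by (metis add_inverse add_zero add_commute)
  also have "\<dots> = add zero v" using assms c * by (simp add: add_assoc [symmetric])
  also have "\<dots> = v" using assms by (metis add_zero add_commute zero_closed)
  finally show "u = v" .
qed (simp add: assms add_inverse)

lemma norm_dist_commute: "norm_dist V add smul nrm u v = norm_dist V add smul nrm v u"
proof (cases "u \<in> V \<and> v \<in> V")
  case True
  have "smul (-1) (add u (smul (-1) v)) = add v (smul (-1) u)"
    using True by (simp add: smul_add_right smul_closed smul_smul smul_one add_commute)
  with True nrm_smul [of "add u (smul (-1) v)" "-1"] show ?thesis
    by (simp add: norm_dist_def add_closed smul_closed)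
qed (auto simp: norm_dist_def)

sublocale Metric_space V "norm_dist V add smul nrm"
proof
  show "0 \<le> norm_dist V add smul nrm u v" for u v
    by (simp add: norm_dist_def add_closed smul_closed nrm_nonneg)
  show "norm_dist V add smul nrm u v = norm_dist V add smul nrm v u" for u v
    by (rule norm_dist_commute)
  show "norm_dist V add smul nrm u v = 0 \<longleftrightarrow> u = v" if "u \<in> V" "v \<in> V" for u v
    using that
    by (simp add: norm_dist_def add_closed smul_closed nrm_eq_zero_iff diff_eq_zero_iff)
  show "norm_dist V add smul nrm u z
      \<le> norm_dist V add smul nrm u v + norm_dist V add smul nrm v z"
    if "u \<in> V" "v \<in> V" "z \<in> V" for u v z
    using that nrm_triangle [of "add u (smul (-1) v)" "add v (smul (-1) z)"]
    by (simp add: norm_dist_def add_closed smul_closed diff_add_diff)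
qed

end

locale banach_space_on = normed_space_on +
  assumes complete: mcomplete


section \<open>Partial derivatives and smooth functions\<close>

definition partial_deriv :: "'n::finite \<Rightarrow> (real^'n \<Rightarrow> real) \<Rightarrow> real^'n \<Rightarrow> real"
  where "partial_deriv i f x = frechet_derivative f (at x) (axis i 1)"

primrec Ck_on :: "nat \<Rightarrow> (real^'n::finite) set \<Rightarrow> (real^'n \<Rightarrow> real) \<Rightarrow> bool" where
  "Ck_on 0 D f \<longleftrightarrow> continuous_on D f"
| "Ck_on (Suc k) D f \<longleftrightarrow> (\<forall>x\<in>D. f differentiable (at x)) \<and> (\<forall>i. Ck_on k D (partial_deriv i f))"

definition smooth_on :: "(real^'n::finite) set \<Rightarrow> (real^'n \<Rightarrow> real) \<Rightarrow> bool"
  where "smooth_on D f \<longleftrightarrow> (\<forall>k. Ck_on k D f)"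

definition multiindex_order :: "('n::finite \<Rightarrow> nat) \<Rightarrow> nat"
  where "multiindex_order \<alpha> = (\<Sum>i\<in>UNIV. \<alpha> i)"

text \<open>
  The index type carries no order, so the order in which the \<open>\<alpha> i\<close> derivatives in the directions
  \<open>i\<close> are taken is left to \<open>SOME\<close>. The operator is only applied to smooth functions, for which
  mixed partial derivatives commute.
\<close>

definition multi_deriv :: "('n::finite \<Rightarrow> nat) \<Rightarrow> (real^'n \<Rightarrow> real) \<Rightarrow> real^'n \<Rightarrow> real"
  where "multi_deriv \<alpha> f = foldr partial_deriv (SOME xs. \<forall>i. count_list xs i = \<alpha> i) f"

lemma multiindex_list_exists:
  fixes \<alpha> :: "'n::finite \<Rightarrow> nat"
  shows "\<exists>xs. \<forall>i. count_list xs i = \<alpha> i"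
proof -
  obtain xs where xs: "mset xs = (\<Sum>i\<in>UNIV. replicate_mset (\<alpha> i) i)"
    using ex_mset by blast
  have "count_list xs i = \<alpha> i" for i
    by (simp add: count_mset [symmetric] xs count_sum if_distrib cong: if_cong)
  then show ?thesis by blast
qed

lemma finite_multiindices: "finite {\<alpha> :: 'n::finite \<Rightarrow> nat. multiindex_order \<alpha> = m}"
proof (rule finite_subset)
  show "{\<alpha> :: 'n \<Rightarrow> nat. multiindex_order \<alpha> = m} \<subseteq> (UNIV :: 'n set) \<rightarrow>\<^sub>E {..m}"
    by (auto simp: multiindex_order_def intro: member_le_sum)
qed (auto intro: finite_PiE)


section \<open>Weak derivatives\<close>

definition locally_summable :: "(real^'n::finite) set \<Rightarrow> (real^'n \<Rightarrow> real) \<Rightarrow> bool"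
  where "locally_summable D f \<longleftrightarrow>
    (\<forall>K. compact K \<and> K \<subseteq> D \<longrightarrow> set_integrable lebesgue K f)"

definition test_function :: "(real^'n::finite) set \<Rightarrow> (real^'n \<Rightarrow> real) \<Rightarrow> bool"
  where "test_function D \<phi> \<longleftrightarrow>
    smooth_on UNIV \<phi> \<and> compact (closure {x. \<phi> x \<noteq> 0}) \<and> closure {x. \<phi> x \<noteq> 0} \<subseteq> D"

definition has_weak_deriv ::
    "(real^'n::finite) set \<Rightarrow> ('n \<Rightarrow> nat) \<Rightarrow> (real^'n \<Rightarrow> real) \<Rightarrow> (real^'n \<Rightarrow> real) \<Rightarrow> bool"
  where "has_weak_deriv D \<alpha> f g \<longleftrightarrow>
    locally_summable D f \<and> locally_summable D g \<and>
    (\<forall>\<phi>. test_function D \<phi> \<longrightarrow>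
      (LINT x:D|lebesgue. f x * multi_deriv \<alpha> \<phi> x) =
      (-1) ^ multiindex_order \<alpha> * (LINT x:D|lebesgue. g x * \<phi> x))"

text \<open>Determined up to equality almost everywhere on \<open>D\<close>, when \<open>D\<close> is open.\<close>

definition weak_deriv ::
    "(real^'n::finite) set \<Rightarrow> ('n \<Rightarrow> nat) \<Rightarrow> (real^'n \<Rightarrow> real) \<Rightarrow> real^'n \<Rightarrow> real"
  where "weak_deriv D \<alpha> f = (SOME g. has_weak_deriv D \<alpha> f g)"

definition weakly_differentiable ::
    "(real^'n::finite) set \<Rightarrow> nat \<Rightarrow> (real^'n \<Rightarrow> real) \<Rightarrow> bool"
  where "weakly_differentiable D m f \<longleftrightarrow>
    (\<forall>\<alpha>. multiindex_order \<alpha> \<le> m \<longrightarrow> (\<exists>g. has_weak_deriv D \<alpha> f g))"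


section \<open>Muckenhoupt weights\<close>

definition weight :: "(real^'n::finite \<Rightarrow> real) \<Rightarrow> bool"
  where "weight w \<longleftrightarrow> (\<forall>x. 0 \<le> w x) \<and> locally_summable UNIV w"

text \<open>
  The exponent of \<open>w\<close> is negative, so the power is \<open>\<infinity>\<close> where \<open>w\<close> vanishes (whereas
  \<open>0 powr a = 0\<close> in the library).
\<close>

definition dual_average :: "(real^'n::finite \<Rightarrow> real) \<Rightarrow> real \<Rightarrow> (real^'n) set \<Rightarrow> ennreal"
  where "dual_average w p B =
    (\<integral>\<^sup>+x\<in>B. (if w x = 0 then \<infinity> else ennreal (w x powr (1 / (1 - p)))) \<partial>lebesgue)
      / emeasure lebesgue B"

text \<open>
  The product is \<open>\<infinity>\<close> as soon as its second factor is. The convention \<open>0 * \<infinity> = \<infinity>\<close> implied by this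
  makes a difference for the \<open>A_p\<close> condition only if \<open>w\<close> vanishes almost everywhere: such a \<open>w\<close>
  is not an \<open>A_p\<close> weight.
\<close>

definition Ap_product :: "(real^'n::finite \<Rightarrow> real) \<Rightarrow> real \<Rightarrow> (real^'n) set \<Rightarrow> ennreal"
  where "Ap_product w p B =
    (if dual_average w p B = \<infinity> then \<infinity>
     else ennreal ((LINT x:B|lebesgue. w x) / measure lebesgue B
                     * enn2real (dual_average w p B) powr (p - 1)))"

definition Ap_condition :: "real \<Rightarrow> (real^'n::finite \<Rightarrow> real) \<Rightarrow> bool"
  where "Ap_condition p w \<longleftrightarrow> (SUP (c, r) \<in> UNIV \<times> {0<..}. Ap_product w p (ball c r)) < \<infinity>"


section \<open>Weighted Sobolev spaces\<close>

text \<open>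
  Functions on \<open>D\<close> are represented by functions on the whole space, of which only the values on
  \<open>D\<close> matter.
\<close>

definition weighted_Lp_norm ::
    "(real^'n::finite) set \<Rightarrow> real \<Rightarrow> (real^'n \<Rightarrow> real) \<Rightarrow> (real^'n \<Rightarrow> real) \<Rightarrow> real"
  where "weighted_Lp_norm D p w f = (LINT x:D|lebesgue. \<bar>f x\<bar> powr p * w x) powr (1 / p)"

definition sobolev_functions ::
    "(real^'n::finite) set \<Rightarrow> nat \<Rightarrow> real \<Rightarrow> (real^'n \<Rightarrow> real) \<Rightarrow> (real^'n \<Rightarrow> real) set"
  where "sobolev_functions D m p w =
    {f. locally_summable D f \<and> weakly_differentiable D m f \<and>
        set_integrable lebesgue D (\<lambda>x. \<bar>f x\<bar> powr p * w x) \<and>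
        (\<forall>\<alpha>. multiindex_order \<alpha> = m \<longrightarrow>
          set_integrable lebesgue D (\<lambda>x. \<bar>weak_deriv D \<alpha> f x\<bar> powr p * w x))}"

definition sobolev_norm ::
    "(real^'n::finite) set \<Rightarrow> nat \<Rightarrow> real \<Rightarrow> (real^'n \<Rightarrow> real) \<Rightarrow> (real^'n \<Rightarrow> real) \<Rightarrow> real"
  where "sobolev_norm D m p w f =
    weighted_Lp_norm D p w f
      + (\<Sum>\<alpha> | multiindex_order \<alpha> = m. weighted_Lp_norm D p w (weak_deriv D \<alpha> f))"

definition ae_rel ::
    "(real^'n::finite) set \<Rightarrow> nat \<Rightarrow> real \<Rightarrow> (real^'n \<Rightarrow> real)
      \<Rightarrow> ((real^'n \<Rightarrow> real) \<times> (real^'n \<Rightarrow> real)) set"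
  where "ae_rel D m p w =
    {(f, g). f \<in> sobolev_functions D m p w \<and> g \<in> sobolev_functions D m p w \<and>
             (AE x in lebesgue. x \<in> D \<longrightarrow> f x = g x)}"

definition sobolev_space ::
    "(real^'n::finite) set \<Rightarrow> nat \<Rightarrow> real \<Rightarrow> (real^'n \<Rightarrow> real) \<Rightarrow> (real^'n \<Rightarrow> real) set set"
  where "sobolev_space D m p w = sobolev_functions D m p w // ae_rel D m p w"

definition class_zero ::
    "(real^'n::finite) set \<Rightarrow> nat \<Rightarrow> real \<Rightarrow> (real^'n \<Rightarrow> real) \<Rightarrow> (real^'n \<Rightarrow> real) set"
  where "class_zero D m p w = ae_rel D m p w `` {\<lambda>x. 0}"

definition class_add ::
    "(real^'n::finite) set \<Rightarrow> nat \<Rightarrow> real \<Rightarrow> (real^'n \<Rightarrow> real)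
      \<Rightarrow> (real^'n \<Rightarrow> real) set \<Rightarrow> (real^'n \<Rightarrow> real) set \<Rightarrow> (real^'n \<Rightarrow> real) set"
  where "class_add D m p w F G = (\<Union>f\<in>F. \<Union>g\<in>G. ae_rel D m p w `` {\<lambda>x. f x + g x})"

definition class_smul ::
    "(real^'n::finite) set \<Rightarrow> nat \<Rightarrow> real \<Rightarrow> (real^'n \<Rightarrow> real)
      \<Rightarrow> real \<Rightarrow> (real^'n \<Rightarrow> real) set \<Rightarrow> (real^'n \<Rightarrow> real) set"
  where "class_smul D m p w a F = (\<Union>f\<in>F. ae_rel D m p w `` {\<lambda>x. a * f x})"

text \<open>The norm takes a single value on each class.\<close>

definition class_norm ::
    "(real^'n::finite) set \<Rightarrow> nat \<Rightarrow> real \<Rightarrow> (real^'n \<Rightarrow> real) \<Rightarrow> (real^'n \<Rightarrow> real) set \<Rightarrow> real"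
  where "class_norm D m p w F = the_elem (sobolev_norm D m p w ` F)"

definition sobolev_topology ::
    "(real^'n::finite) set \<Rightarrow> nat \<Rightarrow> real \<Rightarrow> (real^'n \<Rightarrow> real) \<Rightarrow> (real^'n \<Rightarrow> real) set topology"
  where "sobolev_topology D m p w =
    Metric_space.mtopology (sobolev_space D m p w)
      (norm_dist (sobolev_space D m p w) (class_add D m p w) (class_smul D m p w)
        (class_norm D m p w))"

definition smooth_classes ::
    "(real^'n::finite) set \<Rightarrow> nat \<Rightarrow> real \<Rightarrow> (real^'n \<Rightarrow> real) \<Rightarrow> (real^'n \<Rightarrow> real) set set"
  where "smooth_classes D m p w =
    {ae_rel D m p w `` {f} | f. f \<in> sobolev_functions D m p w \<and> smooth_on D f}"

end

theory Submission
  imports Defs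
begin

text \<open>
  Averages over balls of a fixed radius are bounded on \<open>L\<^sup>p(w)\<close>, uniformly in the radius: this follows
  from the Hoelder inequality, Fubini and the \<open>A_p\<close> condition alone. Hence mollifications converge
  in \<open>L\<^sup>p(w)\<close>. Writing a derivative of order \<open>k\<close> as its mollification, integrated by parts, plus
  an average of derivatives of order \<open>k + 1\<close> along segments, one controls the intermediate
  derivatives locally by the function and its derivatives of top order. This makes the limits of
  Cauchy sequences weakly differentiable up to order \<open>m\<close>, and it makes the product of a
  function in the space with a cutoff a limit of test functions. Density then follows as in the
  theorem of Meyers and Serrin, the correction term being a series in the complete space.
\<close>

section \<open>Calculus of smooth functions\<close>

text \<open>The norm sees only the orders 0 and \<open>m\<close>, whereas membership also asks for
  the weak derivatives in between, and \<open>D\<close> is an arbitrary open set; so intermediate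
  orders are controlled on compact subsets only, each estimate at the price of a larger compact set.
  The order of differentiation is a second obstacle. Derivatives are indexed by lists of directions,
  and only for the mollifier, a product of functions of one variable, is a derivative known to
  depend on the multiplicities alone; this is what links \<open>multi_deriv\<close>, whose order of
  differentiation is left open, with the lists. Convergence is measured by p-th powers of norms in
  \<open>ennreal\<close>: the triangle inequality then costs a factor \<open>2 powr p\<close>, but
  finiteness need not be known in advance, and the Minkowski inequality enters only for the norm
  itself. Finally, a weight may vanish on a null set and be merely Lebesgue measurable; it is
  exchanged for an everywhere positive Borel function that agrees with it almost everywhere, which
  leaves every object in the theorem literally unchanged.\<close>

abbreviation list_deriv :: "'n::finite list \<Rightarrow> (real^'n \<Rightarrow> real) \<Rightarrow> real^'n \<Rightarrow> real"
  where "list_deriv \<equiv> foldr partial_deriv"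

lemma partial_deriv_eq:
  "(f has_derivative f') (at x) \<Longrightarrow> partial_deriv i f x = f' (axis i 1)"
  unfolding partial_deriv_def by (metis frechet_derivative_at)

lemma has_derivative_cong_open:
  assumes "open D" "x \<in> D" "\<And>y. y \<in> D \<Longrightarrow> f y = g y"
  shows "(f has_derivative f') (at x) \<longleftrightarrow> (g has_derivative f') (at x)"
  using has_derivative_transform_within_open[of _ _ x UNIV D] assms
  by (metis (no_types, lifting))

lemma partial_deriv_cong:
  assumes "open D" "x \<in> D" "\<And>y. y \<in> D \<Longrightarrow> f y = g y"
  shows "partial_deriv i f x = partial_deriv i g x"
  unfolding partial_deriv_def frechet_derivative_def
  using has_derivative_cong_open[OF assms] by simp

lemma differentiable_cong_open:
  assumes "open D" "x \<in> D" "\<And>y. y \<in> D \<Longrightarrow> f y = g y"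
  shows "f differentiable (at x) \<longleftrightarrow> g differentiable (at x)"
  unfolding differentiable_def using has_derivative_cong_open[OF assms] by simp

lemma Ck_on_cong:
  assumes "open D" "\<And>y. y \<in> D \<Longrightarrow> f y = g y"
  shows "Ck_on k D f \<longleftrightarrow> Ck_on k D g"
  using assms(2)
proof (induction k arbitrary: f g)
  case 0
  then show ?case by (simp cong: continuous_on_cong)
next
  case (Suc k)
  have "Ck_on k D (partial_deriv i f) \<longleftrightarrow> Ck_on k D (partial_deriv i g)" for i
    by (rule Suc.IH) (use partial_deriv_cong[OF assms(1)] Suc.prems in blast)
  moreover have "f differentiable (at x) \<longleftrightarrow> g differentiable (at x)" if "x \<in> D" for x
    using differentiable_cong_open[OF assms(1) that] Suc.prems by blast
  ultimately show ?case by simp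
qed

lemma smooth_on_cong:
  assumes "open D" "\<And>y. y \<in> D \<Longrightarrow> f y = g y"
  shows "smooth_on D f \<longleftrightarrow> smooth_on D g"
  unfolding smooth_on_def using Ck_on_cong[OF assms] by simp

lemma Ck_on_subset: "Ck_on k D f \<Longrightarrow> S \<subseteq> D \<Longrightarrow> Ck_on k S f"
  by (induction k arbitrary: f) (auto intro: continuous_on_subset)

lemma smooth_on_subset: "smooth_on D f \<Longrightarrow> S \<subseteq> D \<Longrightarrow> smooth_on S f"
  unfolding smooth_on_def using Ck_on_subset by blast

lemma differentiable_imp_continuous_on':
  "\<forall>x\<in>D. f differentiable (at x) \<Longrightarrow> continuous_on D f"
  by (meson differentiable_imp_continuous_on differentiable_on_def differentiable_at_withinI)

lemma Ck_on_Suc_imp: "Ck_on (Suc k) D f \<Longrightarrow> Ck_on k D f"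
proof (induction k arbitrary: f)
  case 0
  then show ?case by (auto intro: differentiable_imp_continuous_on')
qed auto

lemma smooth_on_partial: "smooth_on D f \<Longrightarrow> smooth_on D (partial_deriv i f)"
  unfolding smooth_on_def by (metis Ck_on.simps(2))

lemma smooth_on_list: "smooth_on D f \<Longrightarrow> smooth_on D (list_deriv xs f)"
  by (induction xs) (auto intro: smooth_on_partial)

lemma smooth_on_differentiable: "smooth_on D f \<Longrightarrow> x \<in> D \<Longrightarrow> f differentiable (at x)"
  unfolding smooth_on_def by (metis Ck_on.simps(2))

lemma smooth_on_continuous: "smooth_on D f \<Longrightarrow> continuous_on D f"
  unfolding smooth_on_def by (metis Ck_on.simps(1))

lemma smooth_on_has_derivative:
  assumes "smooth_on D f" "x \<in> D"
  shows "(f has_derivative (\<lambda>h. \<Sum>i\<in>UNIV. h $ i * partial_deriv i f x)) (at x)"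
proof -
  obtain f' where f': "(f has_derivative f') (at x)"
    using smooth_on_differentiable[OF assms] by (auto simp: differentiable_def)
  interpret bounded_linear f' using f' by (rule has_derivative_bounded_linear)
  have "f' h = (\<Sum>i\<in>UNIV. h $ i * partial_deriv i f x)" for h
  proof -
    have "f' h = f' (\<Sum>i\<in>UNIV. h $ i *\<^sub>R axis i 1)"
      using basis_expansion[of h] by (simp add: scalar_mult_eq_scaleR)
    then show ?thesis by (simp add: sum scaleR partial_deriv_eq[OF f'])
  qed
  then have "f' = (\<lambda>h. \<Sum>i\<in>UNIV. h $ i * partial_deriv i f x)" by blast
  then show ?thesis using f' by simp
qed

text \<open>Smoothness by coinduction: induction on the order \<open>k\<close>, for all members of
  \<open>P\<close> at once. It suits families whose partial derivatives stay in the family, here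
  affine substitutions, products of functions of one variable, and convolutions. A derivative has to
  agree with a member only on the open set \<open>D\<close>.\<close>

lemma smooth_on_coinduct:
  assumes "open D" "P f"
    and step: "\<And>f. P f \<Longrightarrow> (\<forall>x\<in>D. f differentiable (at x)) \<and>
      (\<forall>i. \<exists>g. P g \<and> (\<forall>x\<in>D. partial_deriv i f x = g x))"
  shows "smooth_on D f"
proof -
  have "Ck_on k D f" if "P f" for k f
    using that
  proof (induction k arbitrary: f)
    case 0
    then show ?case using step[OF 0] by (auto intro: differentiable_imp_continuous_on')
  next
    case (Suc k)
    have "Ck_on k D (partial_deriv i f)" for i
      using step[OF Suc.prems] Suc.IH Ck_on_cong[OF assms(1)] by metis
    then show ?case using step[OF Suc.prems] by auto
  qed
  then show ?thesis using assms(2) by (simp add: smooth_on_def)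
qed

lemma partial_deriv_const [simp]: "partial_deriv i (\<lambda>x. c) = (\<lambda>x. 0)"
  by (rule ext, rule partial_deriv_eq[where f'="\<lambda>_. 0", simplified]) simp

lemma partial_deriv_add:
  assumes "f differentiable (at x)" "g differentiable (at x)"
  shows "partial_deriv i (\<lambda>x. f x + g x) x = partial_deriv i f x + partial_deriv i g x"
  using assms unfolding differentiable_def
  by (auto simp: partial_deriv_eq intro!: partial_deriv_eq[THEN trans] has_derivative_add)

lemma partial_deriv_mult:
  assumes "f differentiable (at x)" "g differentiable (at x)"
  shows "partial_deriv i (\<lambda>x. f x * g x) x = f x * partial_deriv i g x + partial_deriv i f x * g x"
  using assms unfolding differentiable_def
  by (auto simp: partial_deriv_eq intro!: partial_deriv_eq[THEN trans] has_derivative_mult)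

lemma smooth_on_const [simp]: "smooth_on D (\<lambda>x. c)"
proof -
  have "Ck_on k D (\<lambda>x. c)" for k
    by (induction k arbitrary: c) auto
  then show ?thesis by (simp add: smooth_on_def)
qed

lemma Ck_on_add:
  assumes "open D"
  shows "Ck_on k D f \<Longrightarrow> Ck_on k D g \<Longrightarrow> Ck_on k D (\<lambda>x. f x + g x)"
proof (induction k arbitrary: f g)
  case 0
  then show ?case by (auto intro: continuous_intros)
next
  case (Suc k)
  have "Ck_on k D (partial_deriv i (\<lambda>x. f x + g x)) \<longleftrightarrow>
        Ck_on k D (\<lambda>x. partial_deriv i f x + partial_deriv i g x)" for i
    by (rule Ck_on_cong[OF assms]) (use Suc.prems in \<open>auto intro: partial_deriv_add\<close>)
  then show ?case using Suc by (auto intro: derivative_intros)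
qed

lemma Ck_on_mult:
  assumes "open D"
  shows "Ck_on k D f \<Longrightarrow> Ck_on k D g \<Longrightarrow> Ck_on k D (\<lambda>x. f x * g x)"
proof (induction k arbitrary: f g)
  case 0
  then show ?case by (auto intro: continuous_intros)
next
  case (Suc k)
  have "Ck_on k D (partial_deriv i (\<lambda>x. f x * g x)) \<longleftrightarrow>
        Ck_on k D (\<lambda>x. f x * partial_deriv i g x + partial_deriv i f x * g x)" for i
    by (rule Ck_on_cong[OF assms]) (use Suc.prems in \<open>auto intro: partial_deriv_mult\<close>)
  moreover have "Ck_on k D f" "Ck_on k D g"
    using Suc.prems Ck_on_Suc_imp by blast+
  ultimately show ?case using Suc by (auto intro!: derivative_intros Ck_on_add[OF assms])
qed

lemma smooth_on_add: "open D \<Longrightarrow> smooth_on D f \<Longrightarrow> smooth_on D g \<Longrightarrow> smooth_on D (\<lambda>x. f x + g x)"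
  unfolding smooth_on_def using Ck_on_add by blast

lemma smooth_on_mult: "open D \<Longrightarrow> smooth_on D f \<Longrightarrow> smooth_on D g \<Longrightarrow> smooth_on D (\<lambda>x. f x * g x)"
  unfolding smooth_on_def using Ck_on_mult by blast

lemma smooth_on_cmult: "open D \<Longrightarrow> smooth_on D f \<Longrightarrow> smooth_on D (\<lambda>x. c * f x)"
  by (rule smooth_on_mult) auto

lemma smooth_on_sum:
  "open D \<Longrightarrow> (\<And>i. i \<in> I \<Longrightarrow> smooth_on D (f i)) \<Longrightarrow> smooth_on D (\<lambda>x. \<Sum>i\<in>I. f i x)"
  by (induction I rule: infinite_finite_induct) (auto intro: smooth_on_add)

text \<open>Differentiability is asked at each point, so only the continuity at order 0 has to be
  glued, and openness of the two sets does that.\<close>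

lemma smooth_on_Un:
  assumes "open A" "open B" "smooth_on A f" "smooth_on B f"
  shows "smooth_on (A \<union> B) f"
proof -
  have "Ck_on k A f \<Longrightarrow> Ck_on k B f \<Longrightarrow> Ck_on k (A \<union> B) f" for k
    by (induction k arbitrary: f) (auto intro: continuous_on_open_Un assms)
  then show ?thesis using assms by (simp add: smooth_on_def)
qed

lemma list_deriv_cong:
  assumes "open D" "\<And>y. y \<in> D \<Longrightarrow> f y = g y" "x \<in> D"
  shows "list_deriv xs f x = list_deriv xs g x"
  using assms(3)
proof (induction xs arbitrary: x)
  case (Cons i xs)
  show ?case unfolding foldr.simps o_def
    by (intro partial_deriv_cong[OF assms(1) Cons.prems] Cons.IH)
qed (use assms in auto)

lemma list_deriv_add:
  assumes "open D" "smooth_on D f" "smooth_on D g" "x \<in> D"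
  shows "list_deriv xs (\<lambda>x. f x + g x) x = list_deriv xs f x + list_deriv xs g x"
  using assms(4)
proof (induction xs arbitrary: x)
  case (Cons i xs)
  have "partial_deriv i (list_deriv xs (\<lambda>x. f x + g x)) x =
      partial_deriv i (\<lambda>x. list_deriv xs f x + list_deriv xs g x) x"
    using Cons by (intro partial_deriv_cong[OF assms(1)]) auto
  also have "\<dots> = list_deriv (i # xs) f x + list_deriv (i # xs) g x"
    using Cons.prems assms
    by (simp add: partial_deriv_add smooth_on_differentiable[OF smooth_on_list])
  finally show ?case by simp
qed simp

lemma list_deriv_cmult:
  assumes "open D" "smooth_on D f" "x \<in> D"
  shows "list_deriv xs (\<lambda>x. c * f x) x = c * list_deriv xs f x"
  using assms(3)
proof (induction xs arbitrary: x)
  case (Cons i xs)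
  have "partial_deriv i (list_deriv xs (\<lambda>x. c * f x)) x =
      partial_deriv i (\<lambda>x. c * list_deriv xs f x) x"
    using Cons by (intro partial_deriv_cong[OF assms(1)]) auto
  also have "\<dots> = c * list_deriv (i # xs) f x"
    using Cons.prems assms
    by (simp add: partial_deriv_mult smooth_on_differentiable[OF smooth_on_list])
  finally show ?case by simp
qed simp

lemma list_deriv_diff:
  assumes "open D" "smooth_on D f" "smooth_on D g" "x \<in> D"
  shows "list_deriv xs (\<lambda>x. f x - g x) x = list_deriv xs f x - list_deriv xs g x"
  using list_deriv_add[OF assms(1,2) smooth_on_cmult[OF assms(1,3), of "-1"] assms(4), of xs]
    list_deriv_cmult[OF assms(1,3,4), of xs "-1"] by simp

lemma smooth_on_diff: "open D \<Longrightarrow> smooth_on D f \<Longrightarrow> smooth_on D g \<Longrightarrow> smooth_on D (\<lambda>x. f x - g x)"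
  using smooth_on_add[of D f "\<lambda>x. (-1) * g x"] smooth_on_cmult[of D g "-1"] by simp

lemma list_deriv_zero [simp]: "list_deriv xs (\<lambda>x. 0) = (\<lambda>x. 0)"
  by (induction xs) auto

section \<open>Affine changes of variables\<close>

lemma partial_deriv_affine:
  assumes "f differentiable (at (c + a *\<^sub>R y))"
  shows "(\<lambda>y. f (c + a *\<^sub>R y)) differentiable (at y)"
    and "partial_deriv i (\<lambda>y. f (c + a *\<^sub>R y)) y = a * partial_deriv i f (c + a *\<^sub>R y)"
proof -
  obtain f' where f': "(f has_derivative f') (at (c + a *\<^sub>R y))"
    using assms by (auto simp: differentiable_def)
  interpret bounded_linear f' using f' by (rule has_derivative_bounded_linear)
  have "((\<lambda>y. c + a *\<^sub>R y) has_derivative (\<lambda>h. a *\<^sub>R h)) (at y)"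
    by (auto intro!: derivative_eq_intros)
  from diff_chain_at[OF this f'] have *: "((\<lambda>y. f (c + a *\<^sub>R y)) has_derivative (\<lambda>h. f' (a *\<^sub>R h))) (at y)"
    by (simp add: o_def)
  then show "(\<lambda>y. f (c + a *\<^sub>R y)) differentiable (at y)" by (auto simp: differentiable_def)
  show "partial_deriv i (\<lambda>y. f (c + a *\<^sub>R y)) y = a * partial_deriv i f (c + a *\<^sub>R y)"
    using partial_deriv_eq[OF *] partial_deriv_eq[OF f'] by (simp add: scaleR)
qed

lemma open_affine_preimage:
  fixes T :: "'a::real_normed_vector set"
  shows "open T \<Longrightarrow> open {y. c + a *\<^sub>R y \<in> T}"
proof -
  assume "open T"
  then have "open ((\<lambda>y. c + a *\<^sub>R y) -` T)" by (intro open_vimage continuous_intros)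
  then show ?thesis by (simp add: vimage_def)
qed

lemma list_deriv_affine:
  assumes "open T" "smooth_on T f" "c + a *\<^sub>R y \<in> T"
  shows "list_deriv xs (\<lambda>y. f (c + a *\<^sub>R y)) y = a ^ length xs * list_deriv xs f (c + a *\<^sub>R y)"
  using assms(3)
proof (induction xs arbitrary: y)
  case (Cons i xs)
  let ?T = "{y. c + a *\<^sub>R y \<in> T}"
  have "partial_deriv i (list_deriv xs (\<lambda>y. f (c + a *\<^sub>R y))) y =
      partial_deriv i (\<lambda>y. a ^ length xs * list_deriv xs f (c + a *\<^sub>R y)) y"
    using Cons open_affine_preimage[OF assms(1)] by (intro partial_deriv_cong[of ?T]) auto
  also have "\<dots> = a ^ length xs * partial_deriv i (\<lambda>y. list_deriv xs f (c + a *\<^sub>R y)) y"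
    by (subst partial_deriv_mult)
      (use Cons.prems assms in \<open>auto intro!: partial_deriv_affine smooth_on_differentiable[OF smooth_on_list]\<close>)
  also have "\<dots> = a ^ length (i # xs) * list_deriv (i # xs) f (c + a *\<^sub>R y)"
    by (subst partial_deriv_affine(2))
      (use Cons.prems assms in \<open>auto intro!: smooth_on_differentiable[OF smooth_on_list]\<close>)
  finally show ?case by simp
qed simp

lemma smooth_on_affine:
  assumes "open T" "smooth_on T f"
  shows "smooth_on {y. c + a *\<^sub>R y \<in> T} (\<lambda>y. f (c + a *\<^sub>R y))"
\<comment> \<open>The factor \<open>b\<close> collects the powers of \<open>a\<close> that the chain
  rule produces, so that the family is closed under differentiation.\<close>
proof (rule smooth_on_coinduct[where
      P="\<lambda>h. \<exists>g b. smooth_on T g \<and> h = (\<lambda>y. b * g (c + a *\<^sub>R y))"])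
  show "open {y. c + a *\<^sub>R y \<in> T}" by (rule open_affine_preimage) fact
  show "\<exists>g b. smooth_on T g \<and> (\<lambda>y. f (c + a *\<^sub>R y)) = (\<lambda>y. b * g (c + a *\<^sub>R y))"
    using assms by (intro exI[of _ f] exI[of _ 1]) auto
next
  fix h assume "\<exists>g b. smooth_on T g \<and> h = (\<lambda>y. b * g (c + a *\<^sub>R y))"
  then obtain g b where g: "smooth_on T g" and h: "h = (\<lambda>y. b * g (c + a *\<^sub>R y))" by blast
  have d: "(\<lambda>y. g (c + a *\<^sub>R y)) differentiable (at y)" if "c + a *\<^sub>R y \<in> T" for y
    using that g by (intro partial_deriv_affine smooth_on_differentiable)
  have "partial_deriv i h y = (b * a) * partial_deriv i g (c + a *\<^sub>R y)" if "c + a *\<^sub>R y \<in> T" for i y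
    unfolding h
    by (subst partial_deriv_mult)
      (use d that g in \<open>auto simp: partial_deriv_affine(2) smooth_on_differentiable\<close>)
  then have "\<exists>ga. (\<exists>g b. smooth_on T g \<and> ga = (\<lambda>y. b * g (c + a *\<^sub>R y))) \<and>
      (\<forall>x\<in>{y. c + a *\<^sub>R y \<in> T}. partial_deriv i h x = ga x)" for i
    using smooth_on_partial[OF g]
    by (intro exI[of _ "\<lambda>y. (b * a) * partial_deriv i g (c + a *\<^sub>R y)"]) blast
  moreover have "h differentiable at y" if "c + a *\<^sub>R y \<in> T" for y
    unfolding h using d[OF that] by simp
  ultimately show "(\<forall>x\<in>{y. c + a *\<^sub>R y \<in> T}. h differentiable at x) \<and>
          (\<forall>i. \<exists>ga. (\<exists>g b. smooth_on T g \<and> ga = (\<lambda>y. b * g (c + a *\<^sub>R y))) \<and>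
                    (\<forall>x\<in>{y. c + a *\<^sub>R y \<in> T}. partial_deriv i h x = ga x))"
    by blast
qed

section \<open>Supports and test functions\<close>

lemma partial_deriv_support:
  "closure {x. partial_deriv i \<phi> x \<noteq> 0} \<subseteq> closure {x. \<phi> x \<noteq> 0}"
proof (rule closure_minimal)
  show "{x. partial_deriv i \<phi> x \<noteq> 0} \<subseteq> closure {x. \<phi> x \<noteq> 0}"
  proof
    fix x assume x: "x \<in> {x. partial_deriv i \<phi> x \<noteq> 0}"
    show "x \<in> closure {x. \<phi> x \<noteq> 0}"
    proof (rule ccontr)
      assume "x \<notin> closure {x. \<phi> x \<noteq> 0}"
      then have "partial_deriv i \<phi> x = partial_deriv i (\<lambda>x. 0) x"
        by (intro partial_deriv_cong[of "- closure {x. \<phi> x \<noteq> 0}"])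
          (use closure_subset[of "{x. \<phi> x \<noteq> 0}"] in auto)
      with x show False by simp
    qed
  qed
qed simp

lemma compact_closure_subset:
  fixes A :: "'a::t2_space set"
  shows "compact B \<Longrightarrow> closure A \<subseteq> B \<Longrightarrow> compact (closure A)"
  by (metis closed_closure compact_Int_closed inf.absorb_iff2)

lemma test_functionI:
  assumes "smooth_on UNIV \<phi>" "compact K" "K \<subseteq> D" "\<And>x. x \<notin> K \<Longrightarrow> \<phi> x = 0"
  shows "test_function D \<phi>"
proof -
  have "closure {x. \<phi> x \<noteq> 0} \<subseteq> K"
    using assms by (intro closure_minimal compact_imp_closed) auto
  then show ?thesis unfolding test_function_def
    using assms compact_closure_subset by blast
qed

text \<open>One compact set, the support, serves the function and all its derivatives, since
  differentiation does not enlarge the support.\<close>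

lemma test_functionE:
  assumes "test_function D \<phi>"
  obtains K where "smooth_on UNIV \<phi>" "compact K" "K \<subseteq> D" "\<And>x. x \<notin> K \<Longrightarrow> \<phi> x = 0"
    "\<And>x xs. x \<notin> K \<Longrightarrow> list_deriv xs \<phi> x = 0"
proof
  let ?K = "closure {x. \<phi> x \<noteq> 0}"
  show "smooth_on UNIV \<phi>" "compact ?K" "?K \<subseteq> D" using assms by (auto simp: test_function_def)
  show "\<phi> x = 0" if "x \<notin> ?K" for x
    using that closure_subset[of "{x. \<phi> x \<noteq> 0}"] by blast
  have *: "closure {x. list_deriv xs \<phi> x \<noteq> 0} \<subseteq> ?K" for xs
  proof (induction xs)
    case (Cons i xs)
    then show ?case
      using partial_deriv_support[of i "list_deriv xs \<phi>"] by auto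
  qed simp
  show "list_deriv xs \<phi> x = 0" if "x \<notin> ?K" for x xs
  proof (rule ccontr)
    assume "list_deriv xs \<phi> x \<noteq> 0"
    then have "x \<in> closure {x. list_deriv xs \<phi> x \<noteq> 0}"
      using closure_subset[of "{x. list_deriv xs \<phi> x \<noteq> 0}"] by blast
    with * that show False by blast
  qed
qed

lemma test_function_list:
  assumes "test_function D \<phi>"
  shows "test_function D (list_deriv xs \<phi>)"
proof -
  obtain K where K: "smooth_on UNIV \<phi>" "compact K" "K \<subseteq> D"
    "\<And>x xs. x \<notin> K \<Longrightarrow> list_deriv xs \<phi> x = 0"
    using assms by (rule test_functionE) blast
  show ?thesis by (rule test_functionI[OF smooth_on_list[OF K(1)] K(2,3)]) (rule K(4))
qed

lemma test_function_mono: "test_function D \<phi> \<Longrightarrow> D \<subseteq> D' \<Longrightarrow> test_function D' \<phi>"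
  by (auto simp: test_function_def)

lemma test_function_smooth: "test_function D \<phi> \<Longrightarrow> smooth_on S \<phi>"
  by (auto simp: test_function_def intro: smooth_on_subset)

lemma test_function_add:
  assumes "test_function D f" "test_function D g"
  shows "test_function D (\<lambda>x. f x + g x)"
proof -
  obtain K where K: "smooth_on UNIV f" "compact K" "K \<subseteq> D" "\<And>x. x \<notin> K \<Longrightarrow> f x = 0"
    using assms(1) by (rule test_functionE) blast
  obtain L where L: "smooth_on UNIV g" "compact L" "L \<subseteq> D" "\<And>x. x \<notin> L \<Longrightarrow> g x = 0"
    using assms(2) by (rule test_functionE) blast
  show ?thesis
    by (rule test_functionI[of _ "K \<union> L"]) (use K L in \<open>auto intro: smooth_on_add\<close>)
qed

lemma test_function_cmult:
  assumes "test_function D f"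
  shows "test_function D (\<lambda>x. c * f x)"
  using assms
  by (elim test_functionE) (rule test_functionI, auto intro: smooth_on_cmult)

lemma test_function_diff:
  assumes "test_function D f" "test_function D g"
  shows "test_function D (\<lambda>x. f x - g x)"
  using test_function_add[OF assms(1) test_function_cmult[OF assms(2), of "-1"]] by simp

text \<open>\<open>g\<close> is smooth on \<open>D\<close> only and arbitrary elsewhere. The product
  is smooth on \<open>D\<close> and vanishes off the compact support of \<open>f\<close>; the two
  open sets cover the space.\<close>

lemma test_function_mult:
  assumes D: "open D" and f: "test_function D f" and g: "smooth_on D g"
  shows "test_function D (\<lambda>x. f x * g x)"
proof -
  obtain K where K: "smooth_on UNIV f" "compact K" "K \<subseteq> D" "\<And>x. x \<notin> K \<Longrightarrow> f x = 0"
    using f by (rule test_functionE) blast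
  show ?thesis
  proof (rule test_functionI[OF _ K(2,3)])
    have o: "open (-K)" using K by (simp add: compact_imp_closed open_Compl)
    have "smooth_on (-K) (\<lambda>x. 0)" by simp
    then have "smooth_on (-K) (\<lambda>x. f x * g x)"
      using smooth_on_cong[OF o, of "\<lambda>x. 0" "\<lambda>x. f x * g x"] K by auto
    moreover have "smooth_on D (\<lambda>x. f x * g x)"
      using D g smooth_on_subset[OF K(1)] by (intro smooth_on_mult) auto
    ultimately have "smooth_on (D \<union> -K) (\<lambda>x. f x * g x)" using D o by (intro smooth_on_Un)
    moreover have "D \<union> -K = UNIV" using K by auto
    ultimately show "smooth_on UNIV (\<lambda>x. f x * g x)" by simp
  qed (use K in auto)
qed

lemma test_function_bounded:
  assumes "test_function D f"
  obtains M where "M > 0" "\<And>x. \<bar>f x\<bar> \<le> M"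
proof -
  obtain K where K: "smooth_on UNIV f" "compact K" "\<And>x. x \<notin> K \<Longrightarrow> f x = 0"
    using assms by (rule test_functionE) blast
  have "continuous_on K f" using smooth_on_continuous[OF K(1)] continuous_on_subset by blast
  then have "bounded (f ` K)" using K by (intro compact_imp_bounded compact_continuous_image)
  then obtain M where M: "M > 0" "\<forall>x\<in>K. \<bar>f x\<bar> \<le> M" by (auto simp: bounded_pos)
  show thesis
    by (rule that[of M]) (use M K in \<open>(force simp: le_less)+\<close>)
qed

lemma test_function_affine:
  assumes "test_function UNIV f" "a \<noteq> 0"
  shows "test_function UNIV (\<lambda>y. f (c + a *\<^sub>R y))"
proof -
  obtain K where K: "smooth_on UNIV f" "compact K" "\<And>x. x \<notin> K \<Longrightarrow> f x = 0"
    using assms(1) by (rule test_functionE) blast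
  have eq: "{y. c + a *\<^sub>R y \<in> K} = (\<lambda>x. (1/a) *\<^sub>R (x - c)) ` K"
    using assms(2) by (auto simp: image_iff intro!: bexI[of _ "c + a *\<^sub>R _"])
  show ?thesis
  proof (rule test_functionI[of _ "{y. c + a *\<^sub>R y \<in> K}"])
    show "compact {y. c + a *\<^sub>R y \<in> K}" unfolding eq
      using K by (intro compact_continuous_image continuous_intros)
    show "smooth_on UNIV (\<lambda>y. f (c + a *\<^sub>R y))"
      using smooth_on_affine[OF _ K(1), of c a] by simp
  qed (use K in auto)
qed

text \<open>Here \<open>d i k\<close> is the derivative of order \<open>k\<close> of the factor in
  the variable \<open>x $ i\<close>. For such products an iterated derivative depends only on how
  often each direction occurs in the list; the mollifier is built as a product for this
  reason.\<close>

lemma smooth_product_family: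
  fixes d :: "'n::finite \<Rightarrow> nat \<Rightarrow> real \<Rightarrow> real"
  assumes d: "\<And>i k t. (d i k has_real_derivative d i (Suc k) t) (at t)"
  shows "smooth_on UNIV (\<lambda>x::real^'n. \<Prod>i\<in>UNIV. d i (\<kappa> i) (x $ i))"
    and "list_deriv xs (\<lambda>x::real^'n. \<Prod>i\<in>UNIV. d i 0 (x $ i)) =
           (\<lambda>x. \<Prod>i\<in>UNIV. d i (count_list xs i) (x $ i))"
proof -
  have 1: "((\<lambda>x::real^'n. \<Prod>i\<in>UNIV. d i (\<kappa> i) (x $ i)) has_derivative
      (\<lambda>h. \<Sum>i\<in>UNIV. (h $ i * d i (Suc (\<kappa> i)) (x $ i)) * (\<Prod>j\<in>UNIV - {i}. d j (\<kappa> j) (x $ j)))) (at x)"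
    for \<kappa> x
  proof (rule has_derivative_prod)
    fix i :: 'n
    have "((\<lambda>x::real^'n. x $ i) has_derivative (\<lambda>h. h $ i)) (at x)"
      by (intro bounded_linear_imp_has_derivative bounded_linear_vec_nth)
    from diff_chain_at[OF this d[of i "\<kappa> i" "x $ i", unfolded has_field_derivative_def]]
    show "((\<lambda>x. d i (\<kappa> i) (x $ i)) has_derivative (\<lambda>h. h $ i * d i (Suc (\<kappa> i)) (x $ i))) (at x)"
      by (simp add: o_def mult.commute)
  qed
  \<comment> \<open>A derivative in direction \<open>i\<close> raises the order of the factor number
    \<open>i\<close> by one and touches no other factor, so iteration merely counts
    occurrences.\<close>
  have 2: "partial_deriv i (\<lambda>x::real^'n. \<Prod>i\<in>UNIV. d i (\<kappa> i) (x $ i)) =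
      (\<lambda>x. \<Prod>j\<in>UNIV. d j ((\<kappa>(i := Suc (\<kappa> i))) j) (x $ j))" for i \<kappa>
  proof
    fix x :: "real^'n"
    have "partial_deriv i (\<lambda>x::real^'n. \<Prod>i\<in>UNIV. d i (\<kappa> i) (x $ i)) x =
      (\<Sum>j\<in>UNIV. (axis i 1 $ j * d j (Suc (\<kappa> j)) (x $ j)) * (\<Prod>k\<in>UNIV - {j}. d k (\<kappa> k) (x $ k)))"
      by (rule partial_deriv_eq[OF 1])
    also have "\<dots> = (\<Sum>j\<in>UNIV. if j = i then d i (Suc (\<kappa> i)) (x $ i) * (\<Prod>k\<in>UNIV - {i}. d k (\<kappa> k) (x $ k)) else 0)"
      by (rule sum.cong) (auto simp: axis_def)
    also have "\<dots> = d i (Suc (\<kappa> i)) (x $ i) * (\<Prod>k\<in>UNIV - {i}. d k (\<kappa> k) (x $ k))" by simp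
    also have "\<dots> = (\<Prod>j\<in>UNIV. d j ((\<kappa>(i := Suc (\<kappa> i))) j) (x $ j))"
      by (subst (2) prod.remove[of _ i]) (auto intro!: prod.cong)
    finally show "partial_deriv i (\<lambda>x::real^'n. \<Prod>i\<in>UNIV. d i (\<kappa> i) (x $ i)) x = \<dots>" .
  qed
  show "smooth_on UNIV (\<lambda>x::real^'n. \<Prod>i\<in>UNIV. d i (\<kappa> i) (x $ i))"
  proof (rule smooth_on_coinduct[where P="\<lambda>f. \<exists>\<kappa>. f = (\<lambda>x::real^'n. \<Prod>i\<in>UNIV. d i (\<kappa> i) (x $ i))"])
    fix f assume "\<exists>\<kappa>. f = (\<lambda>x::real^'n. \<Prod>i\<in>UNIV. d i (\<kappa> i) (x $ i))"
    then obtain \<kappa> where f: "f = (\<lambda>x::real^'n. \<Prod>i\<in>UNIV. d i (\<kappa> i) (x $ i))" by blast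
    show "(\<forall>x\<in>UNIV. f differentiable at x) \<and>
         (\<forall>i. \<exists>g. (\<exists>\<kappa>. g = (\<lambda>x. \<Prod>i\<in>UNIV. d i (\<kappa> i) (x $ i))) \<and> (\<forall>x\<in>UNIV. partial_deriv i f x = g x))"
      unfolding f 2 using 1 by (auto simp: differentiable_def)
  qed auto
  show "list_deriv xs (\<lambda>x::real^'n. \<Prod>i\<in>UNIV. d i 0 (x $ i)) =
           (\<lambda>x. \<Prod>i\<in>UNIV. d i (count_list xs i) (x $ i))"
  proof (induction xs)
    case (Cons a xs)
    show ?case unfolding foldr.simps o_def Cons 2 by (intro ext prod.cong) auto
  qed simp
qed

section \<open>Mollifiers\<close>

text \<open>With \<open>P = 1\<close> and \<open>j = 0\<close> this is the classical bump function.
  Polynomial factors and powers of \<open>inverse (1 - t\<^sup>2)\<close> are included to make the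
  family closed under differentiation.\<close>

definition bump_term :: "real poly \<Rightarrow> nat \<Rightarrow> real \<Rightarrow> real" where
  "bump_term P j t = (if \<bar>t\<bar> < 1
     then poly P t * inverse (1 - t\<^sup>2) ^ j * exp (- inverse (1 - t\<^sup>2)) else 0)"

text \<open>With s = 1 / (1 - t^2) one has s' = 2 t s^2. The three terms are those of the derivative
  of P s^j exp (-s), written over the common power s^(j + 2).\<close>

definition bump_step :: "real poly \<Rightarrow> nat \<Rightarrow> real poly" where
  "bump_step P j = pderiv P * [:1, 0, -1:]\<^sup>2 + smult (2 * real j) ([:0, 1:] * P * [:1, 0, -1:])
      - smult 2 ([:0, 1:] * P)"

lemma DERIV_zero_quadratic:
  fixes f :: "real \<Rightarrow> real"
  assumes "\<And>y. \<bar>f y - f t\<bar> \<le> C * (y - t)\<^sup>2"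
  shows "(f has_real_derivative 0) (at t)"
  unfolding has_field_derivative_iff
proof (rule Lim_null_comparison)
  show "\<forall>\<^sub>F y in at t. norm ((f y - f t) / (y - t)) \<le> C * \<bar>y - t\<bar>"
  proof (rule eventually_at_filter[THEN iffD2], rule always_eventually, intro allI impI)
    fix y assume "y \<noteq> t"
    then show "norm ((f y - f t) / (y - t)) \<le> C * \<bar>y - t\<bar>"
      using assms[of y] by (simp add: field_simps power2_eq_square abs_mult_self_eq)
  qed
  have "((\<lambda>y. C * \<bar>y - t\<bar>) \<longlongrightarrow> C * \<bar>t - t\<bar>) (at t)" by (intro tendsto_intros)
  then show "((\<lambda>y. C * \<bar>y - t\<bar>) \<longlongrightarrow> 0) (at t)" by simp
qed

lemma power_div_fact_le_exp:
  fixes x :: real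
  assumes "0 \<le> x"
  shows "x ^ n / fact n \<le> exp x"
proof -
  have "(\<Sum>k\<in>{n}. x ^ k /\<^sub>R fact k) \<le> (\<Sum>k. x ^ k /\<^sub>R fact k)"
    by (rule sum_le_suminf[OF sums_summable[OF exp_converges]]) (use assms in auto)
  then show ?thesis
    using sums_unique[OF exp_converges[of x]] by (simp add: divide_inverse mult.commute)
qed

text \<open>The exponential series gives s^(j + 2) <= (j + 2)! exp s for s = 1 / (1 - t^2), hence
  s^j exp (-s) <= (j + 2)! / s^2. The vanishing at the ends of the interval is quadratic, as
  \<open>DERIV_zero_quadratic\<close> wants it.\<close>

lemma bump_term_le:
  obtains C where "\<And>y. \<bar>bump_term P j y\<bar> \<le> C * (1 - y\<^sup>2)\<^sup>2"
proof -
  have "compact ((poly P) ` {-1..1})"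
    by (intro compact_continuous_image continuous_intros) auto
  then obtain M where M: "M > 0" "\<And>y. \<bar>y\<bar> \<le> 1 \<Longrightarrow> \<bar>poly P y\<bar> \<le> M"
    by (force dest!: compact_imp_bounded simp: bounded_pos abs_le_iff)
  have "\<bar>bump_term P j y\<bar> \<le> (M * fact (j + 2)) * (1 - y\<^sup>2)\<^sup>2" for y
  proof (cases "\<bar>y\<bar> < 1")
    case True
    define s where "s = inverse (1 - y\<^sup>2)"
    have D: "1 - y\<^sup>2 > 0" using True by (simp add: abs_square_less_1)
    then have s: "s > 0" by (simp add: s_def)
    have "s ^ (j + 2) / fact (j + 2) \<le> exp s"
      by (rule power_div_fact_le_exp) (use s in simp)
    then have "s ^ (j + 2) \<le> fact (j + 2) * exp s"
      by (simp add: field_simps del: fact_Suc power_Suc add_2_eq_Suc')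
    then have "s ^ (j + 2) * (exp (- s) * inverse s ^ 2) \<le> fact (j + 2) * exp s * (exp (- s) * inverse s ^ 2)"
      by (rule mult_right_mono) simp
    moreover have "s ^ (j + 2) * (exp (- s) * inverse s ^ 2) = s ^ j * exp (- s)"
      using s by (simp add: power_add power2_eq_square field_simps)
    moreover have "fact (j + 2) * exp s * (exp (- s) * inverse s ^ 2) = fact (j + 2) * inverse s ^ 2"
      by (simp add: exp_minus del: fact_Suc add_2_eq_Suc')
    ultimately have "s ^ j * exp (- s) \<le> fact (j + 2) * inverse s ^ 2" by metis
    moreover have "\<bar>bump_term P j y\<bar> = \<bar>poly P y\<bar> * (s ^ j * exp (- s))"
      using True s by (simp add: bump_term_def abs_mult s_def power_abs)
    moreover have "\<bar>poly P y\<bar> * (s ^ j * exp (- s)) \<le> M * (fact (j + 2) * inverse s ^ 2)"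
    proof (rule mult_mono)
      show "s ^ j * exp (- s) \<le> fact (j + 2) * inverse s ^ 2" by fact
    qed (use M True s in auto)
    ultimately show ?thesis by (simp add: s_def mult.assoc del: fact_Suc add_2_eq_Suc')
  qed (use M in \<open>auto simp: bump_term_def\<close>)
  then show thesis by (rule that)
qed

lemma bump_term_deriv: "(bump_term P j has_real_derivative bump_term (bump_step P j) (j + 2) t) (at t)"
proof -
  consider "\<bar>t\<bar> < 1" | "\<bar>t\<bar> = 1" | "\<bar>t\<bar> > 1" by linarith
  then show ?thesis
  proof cases
    case 1
    define s where "s = (\<lambda>t::real. inverse (1 - t\<^sup>2))"
    have D: "1 - t\<^sup>2 > 0" using 1 by (simp add: abs_square_less_1)
    have s': "(s has_real_derivative (2 * t * s t ^ 2)) (at t)"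
      unfolding s_def using D by (auto intro!: derivative_eq_intros simp: power2_eq_square divide_simps)
    have sj: "((\<lambda>t. s t ^ j) has_real_derivative (real j * 2 * t * s t ^ (j + 1))) (at t)"
    proof (cases j)
      case (Suc k)
      show ?thesis unfolding Suc
        by (rule DERIV_cong[OF DERIV_power[OF s']]) (simp add: numeral_2_eq_2)
    qed simp
    have "((\<lambda>t. poly P t * s t ^ j * exp (- s t)) has_real_derivative
        (poly (bump_step P j) t * s t ^ (j + 2) * exp (- s t))) (at t)"
    proof (rule DERIV_cong)
      show "((\<lambda>t. poly P t * s t ^ j * exp (- s t)) has_real_derivative
          ((poly (pderiv P) t * s t ^ j + (real j * 2 * t * s t ^ (j + 1)) * poly P t) * exp (- s t) +
            (exp (- s t) * (- (2 * t * s t ^ 2))) * (poly P t * s t ^ j))) (at t)"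
        by (intro DERIV_mult poly_DERIV sj DERIV_fun_exp DERIV_minus s')
      have sD: "s t * (1 - t\<^sup>2) = 1" using D by (simp add: s_def)
      have a: "s t ^ (j + 2) * (1 - t\<^sup>2)\<^sup>2 = s t ^ j"
      proof -
        have "s t ^ (j + 2) * (1 - t\<^sup>2)\<^sup>2 = s t ^ j * (s t * (1 - t\<^sup>2))\<^sup>2"
          by (simp only: power_add power_mult_distrib mult.assoc mult.commute mult.left_commute)
        then show ?thesis by (simp add: sD)
      qed
      have b: "s t ^ (j + 2) * (1 - t\<^sup>2) = s t ^ (j + 1)"
      proof -
        have "s t ^ (j + 2) * (1 - t\<^sup>2) = s t ^ (j + 1) * (s t * (1 - t\<^sup>2))" by (simp add: mult_ac)
        then show ?thesis by (simp add: sD)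
      qed
      have alg: "q = a * D\<^sup>2 + b * D - c \<Longrightarrow> q * X = a * (X * D\<^sup>2) + b * (X * D) - c * X"
        for q a b c D X :: real by (simp only:) (simp add: algebra_simps)
      have "poly (bump_step P j) t = poly (pderiv P) t * (1 - t\<^sup>2)\<^sup>2 + 2 * real j * t * poly P t * (1 - t\<^sup>2) - 2 * t * poly P t"
        by (simp add: bump_step_def power2_eq_square algebra_simps)
      then have "poly (bump_step P j) t * s t ^ (j + 2) =
        poly (pderiv P) t * (s t ^ (j + 2) * (1 - t\<^sup>2)\<^sup>2) + 2 * real j * t * poly P t * (s t ^ (j + 2) * (1 - t\<^sup>2)) - 2 * t * poly P t * s t ^ (j + 2)"
        using alg by metis
      then have *: "poly (bump_step P j) t * s t ^ (j + 2) =
        poly (pderiv P) t * s t ^ j + 2 * real j * t * poly P t * s t ^ (j + 1) - 2 * t * poly P t * s t ^ (j + 2)"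
        unfolding a b .
      show "((poly (pderiv P) t * s t ^ j + (real j * 2 * t * s t ^ (j + 1)) * poly P t) * exp (- s t) +
            (exp (- s t) * (- (2 * t * s t ^ 2))) * (poly P t * s t ^ j)) =
          poly (bump_step P j) t * s t ^ (j + 2) * exp (- s t)"
        unfolding * by (simp add: algebra_simps power_add power2_eq_square)
    qed
    then have "((\<lambda>t. poly P t * s t ^ j * exp (- s t)) has_real_derivative
        bump_term (bump_step P j) (j + 2) t) (at t)"
      using 1 by (simp add: bump_term_def s_def)
    then show ?thesis
      by (rule has_field_derivative_transform_within_open[of _ _ _ "{-1<..<1}"])
        (use 1 in \<open>auto simp: bump_term_def s_def\<close>)
  next
    case 2
    \<comment> \<open>At an end point \<open>t\<close> of the interval, 1 - y^2 is at most twice the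
      distance of \<open>y\<close> from \<open>t\<close>, so \<open>bump_term_le\<close> becomes a
      quadratic bound in that distance.\<close>
    obtain C where C: "\<And>y. \<bar>bump_term P j y\<bar> \<le> C * (1 - y\<^sup>2)\<^sup>2"
      by (rule bump_term_le[of P j]) blast
    have "0 \<le> C" using C[of 0] by simp
    have "\<bar>bump_term P j y - bump_term P j t\<bar> \<le> (4 * C) * (y - t)\<^sup>2" for y
    proof (cases "\<bar>y\<bar> < 1")
      case True
      have "0 \<le> 1 - y\<^sup>2" "1 - y\<^sup>2 \<le> 2 * \<bar>y - t\<bar>"
      proof -
        have "1 - y\<^sup>2 = (1 - \<bar>y\<bar>) * (1 + \<bar>y\<bar>)" by (simp add: algebra_simps power2_eq_square)
        also have "\<dots> \<le> (1 - \<bar>y\<bar>) * 2" using True by (intro mult_left_mono) auto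
        also have "\<dots> \<le> 2 * \<bar>y - t\<bar>"
          using 2 abs_triangle_ineq2[of t y] by (simp add: abs_minus_commute)
        finally show "1 - y\<^sup>2 \<le> 2 * \<bar>y - t\<bar>" .
        show "0 \<le> 1 - y\<^sup>2" using True by (simp add: abs_square_le_1)
      qed
      then have "(1 - y\<^sup>2)\<^sup>2 \<le> (2 * \<bar>y - t\<bar>)\<^sup>2" by (intro power_mono) auto
      then have "C * (1 - y\<^sup>2)\<^sup>2 \<le> C * (2 * \<bar>y - t\<bar>)\<^sup>2" using \<open>0 \<le> C\<close> by (rule mult_left_mono)
      then show ?thesis using C[of y] 2 by (simp add: bump_term_def power_mult_distrib)
    qed (use 2 \<open>0 \<le> C\<close> in \<open>auto simp: bump_term_def\<close>)
    then have "(bump_term P j has_real_derivative 0) (at t)" by (rule DERIV_zero_quadratic)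
    then show ?thesis using 2 by (simp add: bump_term_def)
  next
    case 3
    have "((\<lambda>t. 0) has_real_derivative 0) (at t)" by simp
    then have "(bump_term P j has_real_derivative 0) (at t)"
      by (rule has_field_derivative_transform_within_open[of _ _ _ "{t. \<bar>t\<bar> > 1}"])
        (use 3 in \<open>auto simp: bump_term_def intro!: open_Collect_less continuous_intros\<close>)
    then show ?thesis using 3 by (simp add: bump_term_def)
  qed
qed

text \<open>The pair (P, j) that represents the derivative of order \<open>k\<close> of the bump
  function in the form \<open>bump_term\<close>.\<close>

fun bump_state :: "nat \<Rightarrow> real poly \<times> nat" where
  "bump_state 0 = (1, 0)"
| "bump_state (Suc k) = (case bump_state k of (P, j) \<Rightarrow> (bump_step P j, j + 2))"

definition bump :: "nat \<Rightarrow> real \<Rightarrow> real" where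
  "bump k = (case bump_state k of (P, j) \<Rightarrow> bump_term P j)"

lemma bump_deriv: "(bump k has_real_derivative bump (Suc k) t) (at t)"
  using bump_term_deriv by (simp add: bump_def split: prod.split)

lemma bump_zero_pos: "\<bar>t\<bar> < 1 \<Longrightarrow> bump 0 t > 0" "\<bar>t\<bar> \<ge> 1 \<Longrightarrow> bump k t = 0"
  by (auto simp: bump_def bump_term_def split: prod.split)

lemma bump_zero_nonneg: "bump 0 t \<ge> 0"
  by (simp add: bump_def bump_term_def)

lemma lebesgue_integral_eq_lborel:
  fixes f :: "'a::euclidean_space \<Rightarrow> real"
  shows "f \<in> borel_measurable borel \<Longrightarrow> integral\<^sup>L lebesgue f = integral\<^sup>L lborel f"
  by (rule integral_completion) simp

lemma test_function_measurable:
  "test_function D f \<Longrightarrow> f \<in> borel_measurable borel"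
  by (rule borel_measurable_continuous_onI, rule smooth_on_continuous, rule test_function_smooth)

lemma borel_imp_lebesgue_measurable:
  "f \<in> borel_measurable borel \<Longrightarrow> f \<in> borel_measurable lebesgue"
  by (rule measurable_completion) simp

lemma test_function_integrable:
  assumes "test_function D f"
  shows "integrable lborel f"
proof -
  obtain K where K: "smooth_on UNIV f" "compact K" "\<And>x. x \<notin> K \<Longrightarrow> f x = 0"
    using assms by (rule test_functionE) blast
  have "continuous_on K f" by (rule continuous_on_subset[OF smooth_on_continuous[OF K(1)]]) simp
  from borel_integrable_compact[OF K(2) this] show ?thesis
    by (rule Bochner_Integration.integrable_cong[THEN iffD1, rotated 2])
      (use K in \<open>auto simp: indicator_def\<close>)
qed

text \<open>The support lies in the ball of radius 1/2, strictly inside the unit ball, so that all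
  derivatives vanish from norm 1 on. The last clause is the independence of the order of
  differentiation; it is later needed to pass from the list chosen by \<open>multi_deriv\<close> to
  any other list with the same multiplicities.\<close>

definition is_mollifier :: "(real^'n::finite \<Rightarrow> real) \<Rightarrow> bool" where
  "is_mollifier \<phi> \<longleftrightarrow> test_function UNIV \<phi> \<and> (\<forall>x. 0 \<le> \<phi> x) \<and> (\<forall>x. 1 / 2 \<le> norm x \<longrightarrow> \<phi> x = 0)
     \<and> integral\<^sup>L lborel \<phi> = 1
     \<and> (\<forall>xs ys. (\<forall>i. count_list xs i = count_list ys i) \<longrightarrow> list_deriv xs \<phi> = list_deriv ys \<phi>)"

lemma is_mollifier_exists: "\<exists>\<phi> :: real^'n::finite \<Rightarrow> real. is_mollifier \<phi>"
proof -
  \<comment> \<open>Where the product of the factors is nonzero, each coordinate is below 1 / N in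
    absolute value; with N = 2n the sum of the n coordinates, and with it the norm, stays below
    1/2.\<close>
  define N where "N = 2 * real CARD('n)"
  have N: "N > 0" by (simp add: N_def)
  define d where "d = (\<lambda>(i::'n) k t. N ^ k * bump k (N * t))"
  have d: "(d i k has_real_derivative d i (Suc k) t) (at t)" for i k t
  proof -
    have "((\<lambda>t. bump k (N * t)) has_real_derivative bump (Suc k) (N * t) * N) (at t)"
      by (rule DERIV_chain'[of _ N, OF _ bump_deriv]) (auto intro!: derivative_eq_intros)
    then show ?thesis unfolding d_def by (auto intro!: derivative_eq_intros)
  qed
  define \<psi> where "\<psi> = (\<lambda>x::real^'n. \<Prod>i\<in>UNIV. d i 0 (x $ i))"
  have smooth: "smooth_on UNIV \<psi>" unfolding \<psi>_def by (rule smooth_product_family) (rule d)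
  have list: "list_deriv xs \<psi> = (\<lambda>x. \<Prod>i\<in>UNIV. d i (count_list xs i) (x $ i))" for xs
    unfolding \<psi>_def by (rule smooth_product_family) (rule d)
  have nonneg: "0 \<le> \<psi> x" for x
    unfolding \<psi>_def d_def by (auto intro!: prod_nonneg bump_zero_nonneg)
  have supp: "\<psi> x = 0" if "1 / 2 \<le> norm x" for x
  proof (rule ccontr)
    assume "\<psi> x \<noteq> 0"
    then have "bump 0 (N * x $ i) \<noteq> 0" for i by (auto simp: \<psi>_def d_def)
    then have "\<bar>N * x $ i\<bar> < 1" for i using bump_zero_pos(2)[of "N * x $ i" 0] by force
    then have *: "\<bar>x $ i\<bar> < 1 / N" for i using N by (simp add: abs_mult field_simps)
    have "norm x \<le> (\<Sum>i\<in>UNIV. \<bar>x $ i\<bar>)" by (rule norm_le_l1_cart)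
    also have "\<dots> < (\<Sum>i\<in>(UNIV::'n set). 1 / N)" using * by (intro sum_strict_mono) auto
    also have "\<dots> = 1 / 2" using N by (simp add: N_def)
    finally show False using that by simp
  qed
  have test: "test_function UNIV \<psi>"
    by (rule test_functionI[OF smooth compact_cball[of 0 1]]) (use supp in auto)
  define c where "c = integral\<^sup>L lborel \<psi>"
  have "c \<noteq> 0"
  proof
    assume "c = 0"
    then have "AE x in lborel. \<psi> x = 0"
      using integral_nonneg_eq_0_iff_AE[OF test_function_integrable[OF test]] nonneg
      by (simp add: c_def)
    then have "{x. \<psi> x \<noteq> 0} \<in> null_sets lborel"
      using test_function_measurable[OF test] by (subst AE_iff_null_sets) auto
    then have "negligible {x. \<psi> x \<noteq> 0}"
      by (simp add: negligible_iff_null_sets null_sets_completionI)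
    moreover have "open {x. \<psi> x \<noteq> 0}"
      using smooth_on_continuous[OF smooth] by (intro open_Collect_neq) (auto intro: continuous_intros)
    moreover have "\<psi> 0 > 0" unfolding \<psi>_def d_def using bump_zero_pos(1)[of 0] by (auto intro!: prod_pos)
    then have "{x. \<psi> x \<noteq> 0} \<noteq> {}" by (auto intro: exI[of _ 0])
    ultimately show False using open_not_negligible by blast
  qed
  moreover have "c \<ge> 0" unfolding c_def by (rule Bochner_Integration.integral_nonneg) (use nonneg in auto)
  ultimately have c: "c > 0" by simp
  have "is_mollifier (\<lambda>x. (1 / c) * \<psi> x)"
    unfolding is_mollifier_def
  proof (intro conjI allI impI)
    show "test_function UNIV (\<lambda>x. (1 / c) * \<psi> x)" by (rule test_function_cmult) fact
    show "integral\<^sup>L lborel (\<lambda>x. (1 / c) * \<psi> x) = 1" using c by (simp add: c_def)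
    fix xs ys :: "'n list" assume eq: "\<forall>i. count_list xs i = count_list ys i"
    have "list_deriv xs (\<lambda>x. (1 / c) * \<psi> x) x = (1/c) * list_deriv xs \<psi> x" for xs x
      by (rule list_deriv_cmult[OF open_UNIV smooth]) simp
    then show "list_deriv xs (\<lambda>x. (1 / c) * \<psi> x) = list_deriv ys (\<lambda>x. (1 / c) * \<psi> x)"
      using eq by (intro ext) (simp add: list)
  qed (use nonneg supp c in auto)
  then show ?thesis by blast
qed

definition mollifier :: "real^'n::finite \<Rightarrow> real" where
  "mollifier = (SOME \<phi>. is_mollifier \<phi>)"

lemma mollifier: "is_mollifier mollifier"
  unfolding mollifier_def using is_mollifier_exists by (rule someI_ex)

lemma mollifier_test: "test_function UNIV (mollifier :: real^'n::finite \<Rightarrow> real)"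
  and mollifier_nonneg: "0 \<le> mollifier (x :: real^'n)"
  and mollifier_zero_half: "1 / 2 \<le> norm x \<Longrightarrow> mollifier (x :: real^'n) = 0"
  and mollifier_integral: "integral\<^sup>L lborel (mollifier :: real^'n \<Rightarrow> real) = 1"
  and mollifier_list_deriv: "(\<And>i. count_list xs i = count_list ys i) \<Longrightarrow>
     list_deriv xs mollifier = list_deriv ys (mollifier :: real^'n \<Rightarrow> real)"
  using mollifier unfolding is_mollifier_def by blast+

lemma mollifier_zero: "1 \<le> norm x \<Longrightarrow> mollifier x = 0"
  by (rule mollifier_zero_half) simp

lemma mollifier_list_zero:
  fixes x :: "real^'n::finite"
  assumes "1 \<le> norm x"
  shows "list_deriv xs mollifier x = 0"
proof -
  have "open {x::real^'n. 1 / 2 < norm x}" by (intro open_Collect_less continuous_intros)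
  then have "list_deriv xs mollifier x = list_deriv xs (\<lambda>x. 0) x"
    by (rule list_deriv_cong) (use assms in \<open>auto intro: mollifier_zero_half\<close>)
  then show ?thesis by simp
qed

section \<open>Convolution and integration by parts\<close>

lemma test_function_lipschitz:
  assumes "test_function D f"
  obtains L where "L \<ge> 0" "\<And>x y. \<bar>f x - f y\<bar> \<le> L * norm (x - y)"
proof -
  have "\<forall>i. \<exists>M. M > 0 \<and> (\<forall>x. \<bar>partial_deriv i f x\<bar> \<le> M)"
    using test_function_bounded[OF test_function_list[OF assms, of "[_]"]] by simp metis
  then obtain M where M: "\<And>i. M i > 0" "\<And>i x. \<bar>partial_deriv i f x\<bar> \<le> M i" by metis
  show thesis
  proof
    show "0 \<le> (\<Sum>i\<in>UNIV. M i)" using M by (intro sum_nonneg) (auto intro: less_imp_le)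
    fix x y
    have "norm (f x - f y) \<le> (\<Sum>i\<in>UNIV. M i) * norm (x - y)"
    proof (rule differentiable_bound[of UNIV])
      show "(f has_derivative (\<lambda>h. \<Sum>i\<in>UNIV. h $ i * partial_deriv i f x)) (at x)" for x
        by (rule smooth_on_has_derivative[OF test_function_smooth[OF assms]]) auto
      show "onorm (\<lambda>h. \<Sum>i\<in>UNIV. h $ i * partial_deriv i f x) \<le> (\<Sum>i\<in>UNIV. M i)" for x
      proof (rule onorm_le)
        fix h :: "real^'a"
        have "norm (\<Sum>i\<in>UNIV. h $ i * partial_deriv i f x) \<le> (\<Sum>i\<in>UNIV. norm h * M i)"
          by (rule sum_norm_le) (auto simp: abs_mult intro!: mult_mono M component_le_norm_cart)
        then show "norm (\<Sum>i\<in>UNIV. h $ i * partial_deriv i f x) \<le> (\<Sum>i\<in>UNIV. M i) * norm h"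
          by (simp add: sum_distrib_left mult.commute)
      qed
    qed auto
    then show "\<bar>f x - f y\<bar> \<le> (\<Sum>i\<in>UNIV. M i) * norm (x - y)" by simp
  qed
qed

text \<open>The gradient is Lipschitz with a constant independent of the point, so the quadratic
  remainder is uniform in \<open>x\<close>. This uniformity is what
  \<open>conv_has_derivative\<close> integrates.\<close>

lemma test_function_taylor:
  assumes "test_function D f"
  obtains C where "C \<ge> 0"
    "\<And>x v. \<bar>f (x + v) - f x - (\<Sum>i\<in>UNIV. v $ i * partial_deriv i f x)\<bar> \<le> C * (norm v)\<^sup>2"
proof -
  have "\<forall>i. \<exists>L. L \<ge> 0 \<and> (\<forall>x y. \<bar>partial_deriv i f x - partial_deriv i f y\<bar> \<le> L * norm (x - y))"
    using test_function_lipschitz[OF test_function_list[OF assms, of "[_]"]] by simp metis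
  then obtain L where L: "\<And>i. L i \<ge> 0"
    "\<And>i x y. \<bar>partial_deriv i f x - partial_deriv i f y\<bar> \<le> L i * norm (x - y)" by metis
  let ?f' = "\<lambda>x h. \<Sum>i\<in>UNIV. h $ i * partial_deriv i f x"
  show thesis
  proof
    show "0 \<le> (\<Sum>i\<in>UNIV. L i)" using L by (intro sum_nonneg) auto
    fix x v
    have "norm (f (x + v) - f x - ?f' x ((x + v) - x)) \<le> norm ((x + v) - x) * ((\<Sum>i\<in>UNIV. L i) * norm v)"
    proof (rule differentiable_bound_linearization[of _ _ "cball x (norm v)"])
      show "x + t *\<^sub>R (x + v - x) \<in> cball x (norm v)" if "t \<in> {0..1}" for t
        using that by (auto simp: dist_norm mult_left_le_one_le)
      show "(f has_derivative ?f' y) (at y within cball x (norm v))" for y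
        by (rule has_derivative_at_withinI, rule smooth_on_has_derivative[OF test_function_smooth[OF assms]]) auto
      fix y assume y: "y \<in> cball x (norm v)"
      show "onorm (?f' y - ?f' x) \<le> (\<Sum>i\<in>UNIV. L i) * norm v"
      proof (rule onorm_le)
        fix h :: "real^'a"
        have "(?f' y - ?f' x) h = (\<Sum>i\<in>UNIV. h $ i * (partial_deriv i f y - partial_deriv i f x))"
          by (simp add: sum_subtractf algebra_simps)
        also have "norm \<dots> \<le> (\<Sum>i\<in>UNIV. norm h * (L i * norm v))"
        proof (rule sum_norm_le)
          fix i
          have "L i * norm (y - x) \<le> L i * norm v"
            using y L by (intro mult_left_mono) (auto simp: dist_norm norm_minus_commute)
          then have "\<bar>partial_deriv i f y - partial_deriv i f x\<bar> \<le> L i * norm v"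
            using L(2)[of i y x] by linarith
          then show "norm (h $ i * (partial_deriv i f y - partial_deriv i f x)) \<le> norm h * (L i * norm v)"
            by (simp add: abs_mult) (intro mult_mono component_le_norm_cart, auto)
        qed
        finally show "norm ((?f' y - ?f' x) h) \<le> (\<Sum>i\<in>UNIV. L i) * norm v * norm h"
          by (simp add: sum_distrib_left sum_distrib_right mult_ac)
      qed
    qed simp
    then show "\<bar>f (x + v) - f x - ?f' x v\<bar> \<le> (\<Sum>i\<in>UNIV. L i) * (norm v)\<^sup>2"
      by (simp add: power2_eq_square mult_ac)
  qed
qed

text \<open>The integral is over \<open>lebesgue\<close> because \<open>h\<close> is in general not
  Borel measurable.\<close>

definition conv :: "(real^'n::finite \<Rightarrow> real) \<Rightarrow> (real^'n \<Rightarrow> real) \<Rightarrow> real^'n \<Rightarrow> real" where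
  "conv h \<psi> x = (LINT z|lebesgue. h z * \<psi> (x - z))"

lemma measurable_lebesgue_reflect:
  fixes \<psi> :: "real^'n::finite \<Rightarrow> real"
  assumes [measurable]: "\<psi> \<in> borel_measurable borel"
  shows "(\<lambda>z. \<psi> (x - z)) \<in> borel_measurable lebesgue"
  by (rule borel_imp_lebesgue_measurable) measurable

lemma integrable_mult_bounded:
  fixes h g :: "'a \<Rightarrow> real"
  assumes h: "integrable M h" and [measurable]: "g \<in> borel_measurable M" and g: "\<And>z. \<bar>g z\<bar> \<le> B"
  shows "integrable M (\<lambda>z. h z * g z)"
proof (rule Bochner_Integration.integrable_bound)
  show "integrable M (\<lambda>z. B * h z)" using h by simp
  have [measurable]: "h \<in> borel_measurable M" using h by auto
  show "(\<lambda>z. h z * g z) \<in> borel_measurable M" by measurable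
  show "AE x in M. norm (h x * g x) \<le> norm (B * h x)"
    using g by (auto simp: abs_mult mult.commute intro!: mult_right_mono order_trans[OF g abs_ge_self])
qed

lemma conv_integrable:
  assumes "integrable lebesgue h" "test_function D \<psi>"
  shows "integrable lebesgue (\<lambda>z. h z * \<psi> (x - z))"
proof -
  obtain M where M: "M > 0" "\<And>x. \<bar>\<psi> x\<bar> \<le> M" using assms(2) by (rule test_function_bounded) blast
  show ?thesis
    by (rule integrable_mult_bounded[OF assms(1) measurable_lebesgue_reflect[OF test_function_measurable[OF assms(2)]]])
      (rule M)
qed

text \<open>Integrating the uniform Taylor remainder of \<psi> against \<open>h\<close> leaves at
  most the L1 norm of \<open>h\<close> times C |v|^2, which is o(|v|). So integrability of
  \<open>h\<close> alone justifies differentiation under the integral.\<close>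

lemma conv_has_derivative:
  assumes h: "integrable lebesgue h" and \<psi>: "test_function D \<psi>"
  shows "(conv h \<psi> has_derivative (\<lambda>v. \<Sum>i\<in>UNIV. v $ i * conv h (partial_deriv i \<psi>) x)) (at x)"
proof -
  obtain C where C: "C \<ge> 0"
    "\<And>x v. \<bar>\<psi> (x + v) - \<psi> x - (\<Sum>i\<in>UNIV. v $ i * partial_deriv i \<psi> x)\<bar> \<le> C * (norm v)\<^sup>2"
    using \<psi> by (rule test_function_taylor) blast
  define H where "H = (LINT z|lebesgue. \<bar>h z\<bar>)"
  note int = conv_integrable[OF h]
  have int': "integrable lebesgue (\<lambda>z. h z * partial_deriv i \<psi> (x - z))" for i x
    using int[OF test_function_list[OF \<psi>, of "[i]"]] by simp
  have bnd: "\<bar>conv h \<psi> (x + v) - conv h \<psi> x - (\<Sum>i\<in>UNIV. v $ i * conv h (partial_deriv i \<psi>) x)\<bar>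
      \<le> H * C * (norm v)\<^sup>2" for v
  proof -
    let ?r = "\<lambda>z. h z * (\<psi> ((x - z) + v) - \<psi> (x - z) - (\<Sum>i\<in>UNIV. v $ i * partial_deriv i \<psi> (x - z)))"
    have e: "?r z = h z * \<psi> (x + v - z) - h z * \<psi> (x - z) - (\<Sum>i\<in>UNIV. v $ i * (h z * partial_deriv i \<psi> (x - z)))" for z
      by (simp add: algebra_simps sum_distrib_left)
    have ir: "integrable lebesgue ?r"
      unfolding e using int[OF \<psi>] int'
      by (intro Bochner_Integration.integrable_diff Bochner_Integration.integrable_sum integrable_mult_right) auto
    have "conv h \<psi> (x + v) - conv h \<psi> x - (\<Sum>i\<in>UNIV. v $ i * conv h (partial_deriv i \<psi>) x) = integral\<^sup>L lebesgue ?r"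
    proof -
      have a: "integrable lebesgue (\<lambda>z. h z * \<psi> (x + v - z) - h z * \<psi> (x - z))"
        using int[OF \<psi>] by (intro Bochner_Integration.integrable_diff)
      have b: "integrable lebesgue (\<lambda>z. \<Sum>i\<in>UNIV. v $ i * (h z * partial_deriv i \<psi> (x - z)))"
        using int' by (intro Bochner_Integration.integrable_sum integrable_mult_right)
      have c: "(LINT z|lebesgue. (\<Sum>i\<in>UNIV. v $ i * (h z * partial_deriv i \<psi> (x - z)))) =
          (\<Sum>i\<in>UNIV. v $ i * conv h (partial_deriv i \<psi>) x)"
        unfolding conv_def using int'
        by (subst Bochner_Integration.integral_sum) (auto intro!: integrable_mult_right)
      show ?thesis unfolding e Bochner_Integration.integral_diff[OF a b] c
        using Bochner_Integration.integral_diff[OF int[OF \<psi>, of "x + v"] int[OF \<psi>, of x]]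
        by (simp add: conv_def)
    qed
    also have "\<bar>\<dots>\<bar> \<le> (LINT z|lebesgue. \<bar>h z\<bar> * (C * (norm v)\<^sup>2))"
    proof -
      have "\<bar>integral\<^sup>L lebesgue ?r\<bar> \<le> (LINT z|lebesgue. \<bar>?r z\<bar>)" by (rule integral_abs_bound)
      also have "\<dots> \<le> (LINT z|lebesgue. \<bar>h z\<bar> * (C * (norm v)\<^sup>2))"
      proof (rule integral_mono)
        show "\<bar>?r z\<bar> \<le> \<bar>h z\<bar> * (C * (norm v)\<^sup>2)" for z
          unfolding abs_mult by (intro mult_left_mono C) auto
      qed (use ir h in auto)
      finally show ?thesis .
    qed
    also have "\<dots> = H * C * (norm v)\<^sup>2" by (simp add: H_def)
    finally show ?thesis .
  qed
  show ?thesis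
    unfolding has_derivative_at
  proof
    show "bounded_linear (\<lambda>v. \<Sum>i\<in>UNIV. v $ i * conv h (partial_deriv i \<psi>) x)"
      by (intro bounded_linear_sum bounded_linear_mult_const[OF bounded_linear_vec_nth])
    show "(\<lambda>v. norm (conv h \<psi> (x + v) - conv h \<psi> x - (\<Sum>i\<in>UNIV. v $ i * conv h (partial_deriv i \<psi>) x)) / norm v) \<midarrow>0\<rightarrow> 0"
    proof (rule Lim_null_comparison)
      show "\<forall>\<^sub>F v in at 0. norm (norm (conv h \<psi> (x + v) - conv h \<psi> x - (\<Sum>i\<in>UNIV. v $ i * conv h (partial_deriv i \<psi>) x)) / norm v) \<le> H * C * norm v"
      proof (rule always_eventually, rule allI)
        fix v :: "real^'a"
        show "norm (norm (conv h \<psi> (x + v) - conv h \<psi> x - (\<Sum>i\<in>UNIV. v $ i * conv h (partial_deriv i \<psi>) x)) / norm v) \<le> H * C * norm v"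
        proof (cases "v = 0")
          case False
          have "\<bar>conv h \<psi> (x + v) - conv h \<psi> x - (\<Sum>i\<in>UNIV. v $ i * conv h (partial_deriv i \<psi>) x)\<bar> \<le> (H * C * norm v) * norm v"
            using bnd[of v] by (simp add: power2_eq_square mult_ac)
          then show ?thesis using False by (simp add: pos_divide_le_eq)
        qed simp
      qed
      have "((\<lambda>v::real^'a. H * C * norm v) \<longlongrightarrow> H * C * norm (0::real^'a)) (at 0)" by (intro tendsto_intros)
      then show "((\<lambda>v::real^'a. H * C * norm v) \<longlongrightarrow> 0) (at 0)" by simp
    qed
  qed
qed

lemma conv_partial:
  assumes h: "integrable lebesgue h" and \<psi>: "test_function D \<psi>"
  shows "partial_deriv i (conv h \<psi>) = conv h (partial_deriv i \<psi>)"
proof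
  fix x
  have "partial_deriv i (conv h \<psi>) x = (\<Sum>j\<in>UNIV. axis i 1 $ j * conv h (partial_deriv j \<psi>) x)"
    by (rule partial_deriv_eq[OF conv_has_derivative[OF assms]])
  also have "\<dots> = (\<Sum>j\<in>UNIV. if j = i then conv h (partial_deriv i \<psi>) x else 0)"
    by (rule sum.cong) (auto simp: axis_def)
  finally show "partial_deriv i (conv h \<psi>) x = conv h (partial_deriv i \<psi>) x" by simp
qed

lemma conv_list_deriv:
  assumes h: "integrable lebesgue h" and \<psi>: "test_function D \<psi>"
  shows "list_deriv xs (conv h \<psi>) = conv h (list_deriv xs \<psi>)"
  by (induction xs) (simp_all add: conv_partial[OF h test_function_list[OF \<psi>]])

lemma conv_smooth:
  assumes h: "integrable lebesgue h" and \<psi>: "test_function D \<psi>"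
  shows "smooth_on S (conv h \<psi>)"
proof (rule smooth_on_subset)
  show "smooth_on UNIV (conv h \<psi>)"
  proof (rule smooth_on_coinduct[where P="\<lambda>f. \<exists>\<psi>. test_function D \<psi> \<and> f = conv h \<psi>"])
    fix f assume "\<exists>\<psi>. test_function D \<psi> \<and> f = conv h \<psi>"
    then obtain \<psi> where \<psi>: "test_function D \<psi>" "f = conv h \<psi>" by blast
    have "test_function D (partial_deriv i \<psi>)" for i
      using test_function_list[OF \<psi>(1), of "[i]"] by simp
    then show "(\<forall>x\<in>UNIV. f differentiable at x) \<and>
         (\<forall>i. \<exists>g. (\<exists>\<psi>. test_function D \<psi> \<and> g = conv h \<psi>) \<and> (\<forall>x\<in>UNIV. partial_deriv i f x = g x))"
      unfolding \<psi>(2) conv_partial[OF h \<psi>(1)] using conv_has_derivative[OF h \<psi>(1)]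
      by (auto simp: differentiable_def)
  qed (use \<psi> in auto)
qed simp

lemma lborel_integral_affine:
  fixes f :: "'a::euclidean_space \<Rightarrow> real"
  assumes [measurable]: "f \<in> borel_measurable borel" and c: "c \<noteq> 0"
  shows "integral\<^sup>L lborel f = \<bar>c\<bar> ^ DIM('a) * (LINT x|lborel. f (t + c *\<^sub>R x))"
  by (subst lborel_affine[OF c, of t])
    (simp add: integral_density integral_distr)

lemma nn_integral_affine:
  fixes f :: "'a::euclidean_space \<Rightarrow> ennreal"
  assumes [measurable]: "f \<in> borel_measurable borel" and c: "c \<noteq> 0"
  shows "integral\<^sup>N lborel f = ennreal (\<bar>c\<bar> ^ DIM('a)) * (\<integral>\<^sup>+x. f (t + c *\<^sub>R x) \<partial>lborel)"
  by (subst lborel_affine[OF c, of t])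
    (simp add: nn_integral_density nn_integral_distr nn_integral_cmult)

lemma lborel_integral_reflect:
  fixes f :: "'a::euclidean_space \<Rightarrow> real"
  assumes "f \<in> borel_measurable borel"
  shows "(LINT x|lborel. f (a - x)) = integral\<^sup>L lborel f"
  using lborel_integral_affine[OF assms, of "-1" a] by simp

text \<open>The convolution of \<open>h\<close> with the indicator of a large ball is constant near the origin.\<close>

lemma integral_partial_deriv_zero:
  assumes h: "test_function D h"
  shows "integral\<^sup>L lborel (partial_deriv i h) = 0"
proof -
  obtain K where K: "compact K" "\<And>x. x \<notin> K \<Longrightarrow> h x = 0" "\<And>x xs. x \<notin> K \<Longrightarrow> list_deriv xs h x = 0"
    using h by (rule test_functionE) blast
  obtain R where R: "R > 0" "\<And>x. x \<in> K \<Longrightarrow> norm x \<le> R"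
    using compact_imp_bounded[OF K(1)] by (auto simp: bounded_pos)
  \<comment> \<open>\<open>R\<close> bounds the support of \<open>h\<close>; the extra 1 lets the
    point \<open>x\<close> move in the open unit ball while \<open>x - z\<close> in the support
    still forces \<open>z\<close> into the ball.\<close>
  define B :: "real^'a \<Rightarrow> real" where "B = indicator (cball 0 (R + 1))"
  have B: "integrable lebesgue B"
    unfolding B_def by (intro integrable_real_indicator) (auto intro!: emeasure_bounded_finite simp flip: infinity_ennreal_def)
  have eq: "conv B g x = integral\<^sup>L lborel g"
    if x: "norm x < 1" and g: "g \<in> borel_measurable borel" "\<And>x. x \<notin> K \<Longrightarrow> g x = 0" for x g
  proof -
    note [measurable] = g(1)
    have "(\<lambda>z. B z * g (x - z)) = (\<lambda>z. g (x - z))"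
    proof
      fix z show "B z * g (x - z) = g (x - z)"
      proof (cases "x - z \<in> K")
        case True
        then have "norm (x - z) \<le> R" by (rule R)
        then have "norm z \<le> R + 1" using x norm_triangle_ineq2[of z x] by (simp add: norm_minus_commute)
        then show ?thesis by (simp add: B_def)
      qed (simp add: g)
    qed
    then have "conv B g x = (LINT z|lborel. g (x - z))"
      unfolding conv_def by (simp add: lebesgue_integral_eq_lborel)
    then show ?thesis by (simp add: lborel_integral_reflect g)
  qed
  have "partial_deriv i (conv B h) 0 = partial_deriv i (\<lambda>_. integral\<^sup>L lborel h) 0"
    by (rule partial_deriv_cong[of "ball 0 1"])
      (use eq[OF _ test_function_measurable[OF h] K(2)] in auto)
  moreover have "partial_deriv i (conv B h) 0 = integral\<^sup>L lborel (partial_deriv i h)"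
    unfolding conv_partial[OF B h]
    by (rule eq) (use K(3)[of _ "[i]"] test_function_measurable[OF test_function_list[OF h, of "[i]"]] in auto)
  ultimately show ?thesis by simp
qed

lemma test_function_set_integral:
  fixes g :: "'a::euclidean_space \<Rightarrow> real"
  assumes g: "\<And>x. x \<notin> D \<Longrightarrow> g x = 0" "g \<in> borel_measurable borel"
  shows "(LINT x:D|lebesgue. g x) = integral\<^sup>L lborel g"
proof -
  have "(\<lambda>x. indicator D x *\<^sub>R g x) = g"
    using g by (intro ext) (auto simp: indicator_def)
  then show ?thesis unfolding set_lebesgue_integral_def
    using lebesgue_integral_eq_lborel[OF g(2)] by simp
qed

lemma test_function_zero_outside:
  "test_function D \<phi> \<Longrightarrow> x \<notin> D \<Longrightarrow> \<phi> x = 0"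
  by (elim test_functionE) blast

text \<open>The product of \<phi> and \<open>f\<close> is a test function although \<open>f\<close>
  is smooth on \<open>D\<close> only; the integral of its derivative vanishes, and the product rule
  splits it.\<close>

lemma integration_by_parts:
  assumes D: "open D" and f: "smooth_on D f" and \<phi>: "test_function D \<phi>"
  shows "(LINT x:D|lebesgue. f x * partial_deriv i \<phi> x) = - (LINT x:D|lebesgue. partial_deriv i f x * \<phi> x)"
proof -
  have p: "test_function D (partial_deriv i \<phi>)" using test_function_list[OF \<phi>, of "[i]"] by simp
  have t1: "test_function D (\<lambda>x. \<phi> x * f x)" by (rule test_function_mult[OF D \<phi> f])
  have t2: "test_function D (\<lambda>x. partial_deriv i \<phi> x * f x)" by (rule test_function_mult[OF D p f])
  have t3: "test_function D (\<lambda>x. \<phi> x * partial_deriv i f x)"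
    by (rule test_function_mult[OF D \<phi> smooth_on_partial[OF f]])
  have t4: "test_function D (partial_deriv i (\<lambda>x. \<phi> x * f x))"
    using test_function_list[OF t1, of "[i]"] by simp
  \<comment> \<open>The product rule holds on the whole space: off \<open>D\<close>, where
    \<open>f\<close> need not be differentiable, all terms are zero.\<close>
  have eq: "partial_deriv i (\<lambda>x. \<phi> x * f x) x = \<phi> x * partial_deriv i f x + partial_deriv i \<phi> x * f x" for x
  proof (cases "x \<in> D")
    case True
    then show ?thesis
      by (intro partial_deriv_mult smooth_on_differentiable[OF f]
          smooth_on_differentiable[OF test_function_smooth[OF \<phi>]])
  qed (use \<phi> p t4 in \<open>auto simp: test_function_zero_outside\<close>)
  have "(LINT x|lborel. \<phi> x * partial_deriv i f x + partial_deriv i \<phi> x * f x) = 0"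
    using integral_partial_deriv_zero[OF t1, of i] unfolding ext[of "partial_deriv i (\<lambda>x. \<phi> x * f x)", OF eq] .
  then have "(LINT x|lborel. \<phi> x * partial_deriv i f x) + (LINT x|lborel. partial_deriv i \<phi> x * f x) = 0"
    by (subst (asm) Bochner_Integration.integral_add) (use test_function_integrable t2 t3 in auto)
  moreover have "(LINT x:D|lebesgue. partial_deriv i f x * \<phi> x) = (LINT x|lborel. \<phi> x * partial_deriv i f x)"
    using test_function_set_integral[of D "\<lambda>x. \<phi> x * partial_deriv i f x"]
      test_function_zero_outside[OF t3] test_function_measurable[OF t3] by (simp add: mult.commute)
  moreover have "(LINT x:D|lebesgue. f x * partial_deriv i \<phi> x) = (LINT x|lborel. partial_deriv i \<phi> x * f x)"
    using test_function_set_integral[of D "\<lambda>x. partial_deriv i \<phi> x * f x"]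
      test_function_zero_outside[OF t2] test_function_measurable[OF t2] by (simp add: mult.commute)
  ultimately show ?thesis by linarith
qed

text \<open>The head of the list is the outermost derivative of \<phi>. It is moved first and so
  becomes the innermost derivative of \<open>f\<close>, whence the reversal.\<close>

lemma integration_by_parts_list:
  assumes D: "open D" and f: "smooth_on D f" and \<phi>: "test_function D \<phi>"
  shows "(LINT x:D|lebesgue. f x * list_deriv xs \<phi> x) =
    (-1) ^ length xs * (LINT x:D|lebesgue. list_deriv (rev xs) f x * \<phi> x)"
  using f
proof (induction xs arbitrary: f)
  case (Cons i xs)
  have "(LINT x:D|lebesgue. f x * list_deriv (i # xs) \<phi> x) =
      - (LINT x:D|lebesgue. partial_deriv i f x * list_deriv xs \<phi> x)"
    using integration_by_parts[OF D Cons.prems test_function_list[OF \<phi>]] by simp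
  also have "\<dots> = - ((-1) ^ length xs * (LINT x:D|lebesgue. list_deriv (rev xs) (partial_deriv i f) x * \<phi> x))"
    using Cons.IH[OF smooth_on_partial[OF Cons.prems]] by simp
  finally show ?case by simp
qed simp

section \<open>Mollification and the fundamental lemma\<close>

text \<open>The usual rescaling of total mass 1. The summand 0 brings the argument into the form
  \<open>c + a *\<^sub>R y\<close> of the affine lemmas.\<close>

definition moll :: "real \<Rightarrow> real^'n::finite \<Rightarrow> real" where
  "moll \<epsilon> z = inverse (\<epsilon> ^ CARD('n)) * mollifier (0 + inverse \<epsilon> *\<^sub>R z)"

definition mollify :: "real \<Rightarrow> (real^'n::finite \<Rightarrow> real) \<Rightarrow> real^'n \<Rightarrow> real" where
  "mollify \<epsilon> f = conv f (moll \<epsilon>)"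

lemma moll_test:
  assumes "0 < \<epsilon>"
  shows "test_function UNIV (moll \<epsilon> :: real^'n::finite \<Rightarrow> real)"
  unfolding moll_def[abs_def] using assms
  by (intro test_function_cmult test_function_affine mollifier_test) auto

lemma moll_measurable: "0 < \<epsilon> \<Longrightarrow> (moll \<epsilon> :: real^'n::finite \<Rightarrow> real) \<in> borel_measurable borel"
  by (rule test_function_measurable[OF moll_test])

lemma moll_zero: "0 < \<epsilon> \<Longrightarrow> \<epsilon> \<le> norm z \<Longrightarrow> moll \<epsilon> z = 0"
  by (auto simp: moll_def mollifier_zero field_simps)

lemma moll_nonneg: "0 < \<epsilon> \<Longrightarrow> 0 \<le> moll \<epsilon> z"
  by (auto simp: moll_def mollifier_nonneg)

lemma moll_integral:
  assumes "0 < \<epsilon>"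
  shows "(LINT z|lborel. moll \<epsilon> (x - z :: real^'n::finite)) = 1"
proof -
  have "1 = \<bar>inverse \<epsilon>\<bar> ^ CARD('n) * (LINT x::real^'n|lborel. mollifier (0 + inverse \<epsilon> *\<^sub>R x))"
    using lborel_integral_affine[OF test_function_measurable[OF mollifier_test], of "inverse \<epsilon>" 0] assms
    by (simp add: mollifier_integral)
  also have "\<dots> = (LINT z::real^'n|lborel. moll \<epsilon> z)"
    using assms by (simp add: moll_def power_inverse)
  finally show ?thesis using lborel_integral_reflect[OF moll_measurable[OF assms], of x] by simp
qed

lemma count_list_length_eq:
  fixes xs ys :: "'a::finite list"
  assumes "\<And>i. count_list xs i = count_list ys i"
  shows "length xs = length ys"
proof -
  have "count_list xs = count_list ys" using assms by (rule ext)
  then show ?thesis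
    using sum_count_set[of xs UNIV] sum_count_set[of ys UNIV] by simp
qed

lemma moll_list_deriv:
  fixes xs ys :: "'n::finite list"
  assumes "0 < \<epsilon>" and eq: "\<And>i. count_list xs i = count_list ys i"
  shows "list_deriv xs (moll \<epsilon>) = list_deriv ys (moll \<epsilon>)"
proof
  fix z :: "real^'n"
  have sm: "smooth_on UNIV (mollifier :: real^'n \<Rightarrow> real)" by (rule test_function_smooth[OF mollifier_test])
  have "list_deriv xs (moll \<epsilon>) z = inverse (\<epsilon> ^ CARD('n)) *
      (inverse \<epsilon> ^ length xs * list_deriv xs mollifier (0 + inverse \<epsilon> *\<^sub>R z))" for xs :: "'n list"
    unfolding moll_def[abs_def]
    using smooth_on_affine[OF open_UNIV sm, of 0 "inverse \<epsilon>"]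
    by (subst list_deriv_cmult[of UNIV]) (simp_all add: list_deriv_affine[OF open_UNIV sm, of 0, simplified])
  then show "list_deriv xs (moll \<epsilon>) z = list_deriv ys (moll \<epsilon>) z"
    using count_list_length_eq[OF eq] mollifier_list_deriv[OF eq] by simp
qed

text \<open>Substitution of x - \<epsilon> y for the variable of integration. In this form the
  mollification is a kernel average over the unit ball with step -\<epsilon>, to which
  \<open>E_kernel_bound\<close> applies.\<close>

lemma mollify_eq:
  fixes f :: "real^'n::finite \<Rightarrow> real"
  assumes [measurable]: "f \<in> borel_measurable borel" and e: "0 < \<epsilon>"
  shows "mollify \<epsilon> f x = (LINT y|lborel. mollifier y * f (x - \<epsilon> *\<^sub>R y))"
proof -
  note [measurable] = moll_measurable[OF e]
  let ?F = "\<lambda>z. f z * moll \<epsilon> (x - z)"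
  have [measurable]: "?F \<in> borel_measurable borel" by measurable
  have "mollify \<epsilon> f x = integral\<^sup>L lborel ?F"
    by (simp add: mollify_def conv_def lebesgue_integral_eq_lborel)
  also have "\<dots> = \<bar>-\<epsilon>\<bar> ^ CARD('n) * (LINT y|lborel. ?F (x + (-\<epsilon>) *\<^sub>R y))"
    using lborel_integral_affine[of ?F "-\<epsilon>" x] e by simp
  also have "\<dots> = (LINT y|lborel. \<epsilon> ^ CARD('n) * ?F (x + (-\<epsilon>) *\<^sub>R y))" using e by simp
  also have "(\<lambda>y. \<epsilon> ^ CARD('n) * ?F (x + (-\<epsilon>) *\<^sub>R y)) = (\<lambda>y. mollifier y * f (x - \<epsilon> *\<^sub>R y))"
    using e by (auto simp: moll_def)
  finally show ?thesis .
qed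

lemma mollify_integrable:
  assumes "integrable lebesgue f" "0 < \<epsilon>"
  shows "integrable lebesgue (\<lambda>z. f z * moll \<epsilon> (x - z))"
  by (rule conv_integrable[OF assms(1) moll_test[OF assms(2)]])

lemma mollify_smooth: "integrable lebesgue f \<Longrightarrow> 0 < \<epsilon> \<Longrightarrow> smooth_on S (mollify \<epsilon> f)"
  unfolding mollify_def by (rule conv_smooth[OF _ moll_test])

text \<open>The mollification is a mean, with nonnegative weights of total mass 1, of values from
  the ball of radius \<epsilon>. With \<open>e = 0\<close> this gives exact values of cutoffs, with
  \<open>e > 0\<close> uniform convergence.\<close>

lemma mollify_near:
  assumes f: "integrable lebesgue f" and e: "0 < \<epsilon>" and near: "\<And>z. dist x z < \<epsilon> \<Longrightarrow> \<bar>f z - c\<bar> \<le> e"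
  shows "\<bar>mollify \<epsilon> f x - c\<bar> \<le> e"
proof -
  note [measurable] = moll_measurable[OF e]
  have mm: "(\<lambda>z. moll \<epsilon> (x - z)) \<in> borel_measurable borel" by measurable
  have i1: "integrable lebesgue (\<lambda>z. moll \<epsilon> (x - z))"
  proof -
    have "integrable lborel (\<lambda>z. moll \<epsilon> (x + (-1) *\<^sub>R z))"
      by (rule test_function_integrable[OF test_function_affine[OF moll_test[OF e]]]) simp
    then show ?thesis using mm by (subst integrable_completion) auto
  qed
  have int1: "(LINT z|lebesgue. moll \<epsilon> (x - z)) = 1"
    using moll_integral[OF e, of x] mm by (subst lebesgue_integral_eq_lborel) auto
  have d: "integrable lebesgue (\<lambda>z. (f z - c) * moll \<epsilon> (x - z))"
    using Bochner_Integration.integrable_diff[OF mollify_integrable[OF f e, of x] integrable_mult_right[OF i1, of c]]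
    by (simp add: algebra_simps)
  have "mollify \<epsilon> f x - c = (LINT z|lebesgue. f z * moll \<epsilon> (x - z)) - (LINT z|lebesgue. c * moll \<epsilon> (x - z))"
    by (simp add: mollify_def conv_def int1)
  also have "\<dots> = (LINT z|lebesgue. (f z - c) * moll \<epsilon> (x - z))"
    by (subst Bochner_Integration.integral_diff[symmetric])
      (use mollify_integrable[OF f e] i1 in \<open>auto simp: algebra_simps\<close>)
  also have "\<bar>\<dots>\<bar> \<le> (LINT z|lebesgue. e * moll \<epsilon> (x - z))"
  proof (rule order_trans[OF integral_abs_bound], rule integral_mono)
    show "\<bar>(f z - c) * moll \<epsilon> (x - z)\<bar> \<le> e * moll \<epsilon> (x - z)" for z
    proof (cases "dist x z < \<epsilon>")
      case True
      then show ?thesis using near[OF True] moll_nonneg[OF e, of "x - z"]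
        by (simp add: abs_mult mult_right_mono)
    qed (use moll_zero[OF e, of "x - z"] in \<open>simp add: dist_norm\<close>)
  qed (use d i1 in auto)
  also have "\<dots> = e" by (simp add: int1)
  finally show ?thesis .
qed

lemma compact_neighbourhood:
  fixes K :: "'a::heine_borel set"
  assumes "compact K" "open U" "K \<subseteq> U"
  obtains r where "r > 0" "compact (\<Union>x\<in>K. cball x r)" "(\<Union>x\<in>K. cball x r) \<subseteq> U"
proof -
  obtain \<epsilon> where \<epsilon>: "\<epsilon> > 0"  "(\<Union>x\<in>K. ball x \<epsilon>) \<subseteq> U"
    by (rule compact_subset_open_imp_ball_epsilon_subset[OF assms]) blast
  show thesis
  proof
    show "\<epsilon> / 2 > 0" using \<epsilon> by simp
    show "compact (\<Union>x\<in>K. cball x (\<epsilon> / 2))" by (rule compact_minkowski_sum_cball) fact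
    have "cball x (\<epsilon> / 2) \<subseteq> ball x \<epsilon>" for x using \<epsilon> by auto
    then show "(\<Union>x\<in>K. cball x (\<epsilon> / 2)) \<subseteq> U" using \<epsilon>(2) by blast
  qed
qed

lemma integrable_indicator_compact:
  "compact K \<Longrightarrow> integrable lebesgue (indicator K :: real^'n::finite \<Rightarrow> real)"
  using lmeasurable_compact[of K]
  by (intro integrable_real_indicator) (auto simp: fmeasurable_def)

text \<open>The indicator of the neighbourhood of \<open>K\<close> of radius r/2 is mollified at
  scale r/4: the result is 1 within distance r/4 of \<open>K\<close> and 0 beyond distance 3r/4,
  while the neighbourhood of radius \<open>r\<close> still lies in \<open>U\<close>.\<close>

lemma cutoff_exists:
  fixes K :: "(real^'n::finite) set"
  assumes K: "compact K" and U: "open U" and KU: "K \<subseteq> U"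
  obtains \<eta> V where "test_function U \<eta>" "open V" "K \<subseteq> V" "\<And>x. x \<in> V \<Longrightarrow> \<eta> x = 1"
    "\<And>x. 0 \<le> \<eta> x" "\<And>x. \<eta> x \<le> 1"
proof -
  obtain r where r: "r > 0" "compact (\<Union>x\<in>K. cball x r)" "(\<Union>x\<in>K. cball x r) \<subseteq> U"
    by (rule compact_neighbourhood[OF assms]) blast
  define S where "S = (\<Union>x\<in>K. cball x (r / 2))"
  have S: "compact S" unfolding S_def by (rule compact_minkowski_sum_cball[OF K])
  define \<eta> where "\<eta> = mollify (r / 4) (indicator S)"
  note near = mollify_near[OF integrable_indicator_compact[OF S], of "r / 4"]
  show thesis
  proof
    show "open (\<Union>x\<in>K. ball x (r / 4))" by auto
    show "K \<subseteq> (\<Union>x\<in>K. ball x (r / 4))" using r(1) by auto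
    show "\<eta> x = 1" if x: "x \<in> (\<Union>x\<in>K. ball x (r / 4))" for x
    proof -
      obtain k where k: "k \<in> K" "dist k x < r / 4" using x by auto
      have "z \<in> S" if "dist x z < r / 4" for z
        unfolding S_def using k that dist_triangle[of k z x] by (auto intro!: bexI[of _ k])
      then have "\<bar>\<eta> x - 1\<bar> \<le> 0" unfolding \<eta>_def using r(1) by (intro near) auto
      then show ?thesis by simp
    qed
    \<comment> \<open>Both values of an indicator have distance 1/2 from 1/2, so one application of
      \<open>mollify_near\<close> gives the lower and the upper bound.\<close>
    have *: "\<bar>\<eta> x - 1 / 2\<bar> \<le> 1 / 2" for x
      unfolding \<eta>_def using r(1) by (intro near) (auto simp: indicator_def)
    show "0 \<le> \<eta> x" for x using *[of x] unfolding abs_le_iff by linarith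
    show "\<eta> x \<le> 1" for x using *[of x] unfolding abs_le_iff by linarith
    show "test_function U \<eta>"
    proof (rule test_functionI[OF _ r(2,3)])
      show "smooth_on UNIV \<eta>" unfolding \<eta>_def
        using r(1) by (intro mollify_smooth integrable_indicator_compact S) auto
      fix x assume x: "x \<notin> (\<Union>x\<in>K. cball x r)"
      have "z \<notin> S" if z: "dist x z < r / 4" for z
      proof
        assume "z \<in> S"
        then obtain k where "k \<in> K" "dist k z \<le> r / 2" by (auto simp: S_def)
        then show False using x z dist_triangle[of k x z] r(1) by (auto simp: dist_commute)
      qed
      then have "\<bar>\<eta> x - 0\<bar> \<le> 0" unfolding \<eta>_def using r(1) by (intro near) auto
      then show "\<eta> x = 0" by simp
    qed
  qed
qed

lemma uniform_continuity_compact_support: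
  fixes g :: "'a::heine_borel \<Rightarrow> real"
  assumes g: "continuous_on UNIV g" and K: "compact K" "\<And>x. x \<notin> K \<Longrightarrow> g x = 0" and e: "0 < e"
  obtains \<delta> where "0 < \<delta>" "\<And>x z. dist x z < \<delta> \<Longrightarrow> \<bar>g x - g z\<bar> < e"
proof -
  define L where "L = (\<Union>x\<in>K. cball x 1)"
  have "compact L" unfolding L_def by (rule compact_minkowski_sum_cball[OF K(1)])
  then have "uniformly_continuous_on L g"
    using g by (intro compact_uniformly_continuous) (auto intro: continuous_on_subset)
  then obtain d where d: "d > 0" "\<And>x z. x \<in> L \<Longrightarrow> z \<in> L \<Longrightarrow> dist z x < d \<Longrightarrow> \<bar>g z - g x\<bar> < e"
    using e unfolding uniformly_continuous_on_def dist_real_def by metis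
  show thesis
  proof
    show "0 < min d 1" using d by simp
    fix x z :: 'a assume xz: "dist x z < min d 1"
    show "\<bar>g x - g z\<bar> < e"
    proof (cases "x \<in> K \<or> z \<in> K")
      case True
      then have "x \<in> L \<and> z \<in> L" using xz unfolding L_def
        by (auto intro: bexI[of _ x] bexI[of _ z] simp: dist_commute less_imp_le)
      then show ?thesis using d(2)[of z x] xz by simp
    qed (use K(2) e in auto)
  qed
qed

lemma continuous_compact_support_integrable:
  fixes g :: "real^'n::finite \<Rightarrow> real"
  assumes g: "continuous_on UNIV g" and K: "compact K" "\<And>x. x \<notin> K \<Longrightarrow> g x = 0"
  shows "integrable lebesgue g"
proof -
  have "integrable lborel (\<lambda>x. indicator K x *\<^sub>R g x)"
    using g by (intro borel_integrable_compact K continuous_on_subset[OF g]) auto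
  moreover have "(\<lambda>x. indicator K x *\<^sub>R g x) = g" using K(2) by (intro ext) (auto simp: indicator_def)
  ultimately show ?thesis
    using borel_measurable_continuous_onI[OF g] by (subst integrable_completion) auto
qed

text \<open>A Lebesgue measurable function is an almost everywhere limit of continuous ones.
  Clipping them to [-M, M] and multiplying by a cutoff that is 1 on \<open>K\<close> keeps the limit
  and adds a common bound and a common compact support, ready for dominated convergence.\<close>

lemma approx_continuous:
  fixes s :: "real^'n::finite \<Rightarrow> real"
  assumes s: "s \<in> borel_measurable lebesgue" and M: "\<And>x. \<bar>s x\<bar> \<le> M"
    and K: "compact K" "\<And>x. x \<notin> K \<Longrightarrow> s x = 0" and U: "open U" "K \<subseteq> U"
  obtains g :: "nat \<Rightarrow> real^'n \<Rightarrow> real" and L where "\<And>n. continuous_on UNIV (g n)" "\<And>n x. \<bar>g n x\<bar> \<le> M"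
    "compact L" "L \<subseteq> U" "\<And>n x. x \<notin> L \<Longrightarrow> g n x = 0" "AE x in lebesgue. (\<lambda>n. g n x) \<longlonglongrightarrow> s x"
proof -
  obtain \<eta> V where \<eta>: "test_function U \<eta>" "K \<subseteq> V" "\<And>x. x \<in> V \<Longrightarrow> \<eta> x = 1"
    "\<And>x. 0 \<le> \<eta> x" "\<And>x. \<eta> x \<le> 1"
    by (rule cutoff_exists[OF K(1) U]) blast
  obtain L where L: "smooth_on UNIV \<eta>" "compact L" "L \<subseteq> U" "\<And>x. x \<notin> L \<Longrightarrow> \<eta> x = 0"
    using \<eta>(1) by (rule test_functionE) blast
  have "s measurable_on UNIV" using s by (rule lebesgue_measurable_imp_measurable_on) simp
  then obtain N g0 where g0: "negligible N" "\<And>n. continuous_on UNIV (g0 n)"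
    "\<And>x. x \<notin> N \<Longrightarrow> (\<lambda>n::nat. g0 n x) \<longlonglongrightarrow> s x"
    unfolding measurable_on_def by auto
  have M0: "0 \<le> M" using M[of undefined] by linarith
  define g where "g n x = max (-M) (min M (g0 n x)) * \<eta> x" for n x
  show thesis
  proof
    show "continuous_on UNIV (g n)" for n
      unfolding g_def by (intro continuous_intros g0 smooth_on_continuous L)
    show "\<bar>g n x\<bar> \<le> M" for n x
    proof -
      have "\<bar>max (-M) (min M (g0 n x))\<bar> * \<bar>\<eta> x\<bar> \<le> M * 1"
        using M0 \<eta>(4,5)[of x] by (intro mult_mono) auto
      then show ?thesis by (simp add: g_def abs_mult)
    qed
    show "g n x = 0" if "x \<notin> L" for n x using L(4)[OF that] by (simp add: g_def)
    have "(\<lambda>n. g n x) \<longlonglongrightarrow> s x" if "x \<notin> N" for x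
    proof -
      have "(\<lambda>n. g n x) \<longlonglongrightarrow> max (-M) (min M (s x)) * \<eta> x"
        unfolding g_def by (intro tendsto_intros g0(3)[OF that])
      moreover have "max (-M) (min M (s x)) = s x" using M[of x] by (auto simp: abs_le_iff)
      moreover have "s x * \<eta> x = s x" using K(2) \<eta>(2,3) by (cases "x \<in> K") auto
      ultimately show ?thesis by simp
    qed
    moreover have "AE x in lebesgue. x \<notin> N"
      using g0(1) by (intro AE_not_in) (simp add: negligible_iff_null_sets)
    ultimately show "AE x in lebesgue. (\<lambda>n. g n x) \<longlonglongrightarrow> s x" by auto
  qed (use L in auto)
qed

text \<open>The n-th continuous approximant is mollified at a scale given by its uniform continuity,
  with error at most 1 / (n + 1); this error accounts for the bound \<open>M + 1\<close>.\<close>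

lemma approx_test_function:
  fixes s :: "real^'n::finite \<Rightarrow> real"
  assumes s: "s \<in> borel_measurable lebesgue" and M: "\<And>x. \<bar>s x\<bar> \<le> M"
    and K: "compact K" "\<And>x. x \<notin> K \<Longrightarrow> s x = 0" and U: "open U" "K \<subseteq> U"
  obtains \<phi> :: "nat \<Rightarrow> real^'n \<Rightarrow> real" and L where "\<And>n. test_function U (\<phi> n)" "\<And>n x. \<bar>\<phi> n x\<bar> \<le> M + 1"
    "compact L" "L \<subseteq> U" "\<And>n x. x \<notin> L \<Longrightarrow> \<phi> n x = 0" "AE x in lebesgue. (\<lambda>n. \<phi> n x) \<longlonglongrightarrow> s x"
proof -
  obtain g :: "nat \<Rightarrow> real^'n \<Rightarrow> real" and L where g: "\<And>n. continuous_on UNIV (g n)" "\<And>n x. \<bar>g n x\<bar> \<le> M"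
    "compact L" "L \<subseteq> U" "\<And>n x. x \<notin> L \<Longrightarrow> g n x = 0" "AE x in lebesgue. (\<lambda>n. g n x) \<longlonglongrightarrow> s x"
    by (rule approx_continuous[OF s M K(1) _ U], erule K(2), rule that)
  obtain r where r: "r > 0" "compact (\<Union>x\<in>L. cball x r)" "(\<Union>x\<in>L. cball x r) \<subseteq> U"
    by (rule compact_neighbourhood[OF g(3) U(1) g(4)]) blast
  have "\<exists>\<delta>>0. \<forall>x z. dist x z < \<delta> \<longrightarrow> \<bar>g n x - g n z\<bar> < inverse (Suc n)" for n
    by (rule uniform_continuity_compact_support[OF g(1,3,5), of "inverse (Suc n)" n]) auto
  then obtain \<delta> where \<delta>: "\<And>n. \<delta> n > 0" "\<And>n x z. dist x z < \<delta> n \<Longrightarrow> \<bar>g n x - g n z\<bar> < inverse (Suc n)"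
    by metis
  \<comment> \<open>The minimum with \<open>r\<close> keeps all supports in one compact
    neighbourhood of \<open>L\<close> inside \<open>U\<close>.\<close>
  define \<epsilon> where "\<epsilon> n = min (\<delta> n) r" for n
  have \<epsilon>: "\<epsilon> n > 0" for n using \<delta>(1) r(1) by (simp add: \<epsilon>_def)
  note int = continuous_compact_support_integrable[OF g(1,3,5)]
  define \<phi> where "\<phi> n = mollify (\<epsilon> n) (g n)" for n
  have close: "\<bar>\<phi> n x - g n x\<bar> \<le> inverse (Suc n)" for n x
    unfolding \<phi>_def
  proof (rule mollify_near[OF int \<epsilon>])
    show "\<bar>g n z - g n x\<bar> \<le> inverse (Suc n)" if "dist x z < \<epsilon> n" for z
      using \<delta>(2)[of z x n] that by (simp add: \<epsilon>_def dist_commute)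
  qed
  have zero: "\<phi> n x = 0" if "x \<notin> (\<Union>x\<in>L. cball x r)" for n x
  proof -
    have "\<bar>\<phi> n x - 0\<bar> \<le> 0" unfolding \<phi>_def
    proof (rule mollify_near[OF int \<epsilon>])
      fix z assume z: "dist x z < \<epsilon> n"
      then have "z \<notin> L" using that by (auto simp: \<epsilon>_def dist_commute)
      then show "\<bar>g n z - 0\<bar> \<le> 0" using g(5) by simp
    qed
    then show ?thesis by simp
  qed
  show thesis
  proof
    show "test_function U (\<phi> n)" for n
      by (rule test_functionI[OF _ r(2,3) zero]) (auto simp: \<phi>_def intro: mollify_smooth int \<epsilon>)
    have "inverse (real (Suc n)) \<le> 1" for n by (simp add: field_simps)
    then show "\<bar>\<phi> n x\<bar> \<le> M + 1" for n x
      using close[of n x] g(2)[of n x] by (smt (verit))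
    have "(\<lambda>n. \<phi> n x - g n x) \<longlonglongrightarrow> 0" for x
      by (rule Lim_null_comparison[OF _ LIMSEQ_inverse_real_of_nat]) (use close in auto)
    then have "(\<lambda>n. \<phi> n x) \<longlonglongrightarrow> s x" if "(\<lambda>n. g n x) \<longlonglongrightarrow> s x" for x
      using tendsto_add[OF _ that, of "\<lambda>n. \<phi> n x - g n x" 0] by simp
    then show "AE x in lebesgue. (\<lambda>n. \<phi> n x) \<longlonglongrightarrow> s x" using g(6) by auto
  qed (use r zero in auto)
qed

lemma locally_summable_integrable:
  "locally_summable D h \<Longrightarrow> compact K \<Longrightarrow> K \<subseteq> D \<Longrightarrow> integrable lebesgue (\<lambda>x. indicator K x * h x)"
  by (auto simp: locally_summable_def set_integrable_def)

text \<open>On a compact set \<open>h\<close> is tested against bounded test functions that converge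
  almost everywhere to its sign there; in the limit the integral of the absolute value vanishes.
  Countably many compact sets exhaust \<open>U\<close>.\<close>

theorem fundamental_lemma:
  fixes h :: "real^'n::finite \<Rightarrow> real"
  assumes U: "open U" and h: "locally_summable U h"
    and zero: "\<And>\<phi>. test_function U \<phi> \<Longrightarrow> (LINT x:U|lebesgue. h x * \<phi> x) = 0"
  shows "AE x in lebesgue. x \<in> U \<longrightarrow> h x = 0"
proof -
  have K: "AE x in lebesgue. x \<in> K \<longrightarrow> h x = 0" if K: "compact K" "K \<subseteq> U" for K
  proof -
    have hK: "integrable lebesgue (\<lambda>x. indicator K x * h x)"
      by (rule locally_summable_integrable[OF h K])
    define s where "s x = sgn (indicator K x * h x)" for x
    have s_meas: "s \<in> borel_measurable lebesgue" unfolding s_def using hK by auto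
    have s_bnd: "\<bar>s x\<bar> \<le> 1" for x by (simp add: s_def sgn_real_def)
    have s_zero: "s x = 0" if "x \<notin> K" for x using that by (simp add: s_def)
    obtain \<phi> :: "nat \<Rightarrow> real^'n \<Rightarrow> real" and L where \<phi>: "\<And>n. test_function U (\<phi> n)" "\<And>n x. \<bar>\<phi> n x\<bar> \<le> 1 + 1"
      "compact L" "L \<subseteq> U" "\<And>n x. x \<notin> L \<Longrightarrow> \<phi> n x = 0" "AE x in lebesgue. (\<lambda>n. \<phi> n x) \<longlonglongrightarrow> s x"
      by (rule approx_test_function[OF s_meas s_bnd K(1) _ U K(2)], erule s_zero, rule that)
    \<comment> \<open>\<open>L\<close> carries the test functions and \<open>K\<close> the sign; on
      the union \<open>h\<close> is integrable, and twice its absolute value dominates.\<close>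
    define L' where "L' = L \<union> K"
    have L': "compact L'" "L' \<subseteq> U" using \<phi>(3,4) K by (auto simp: L'_def)
    have hL: "integrable lebesgue (\<lambda>x. indicator L' x * h x)"
      by (rule locally_summable_integrable[OF h L'])
    then have hL_meas: "(\<lambda>x. indicator L' x * h x) \<in> borel_measurable lebesgue" by auto
    have "(\<lambda>n. LINT x|lebesgue. indicator L' x * h x * \<phi> n x) \<longlonglongrightarrow> (LINT x|lebesgue. indicator L' x * h x * s x)"
    proof (rule integral_dominated_convergence)
      show "integrable lebesgue (\<lambda>x. 2 * \<bar>indicator L' x * h x\<bar>)" using hL by auto
      show "(\<lambda>x. indicator L' x * h x * s x) \<in> borel_measurable lebesgue"
        using hL_meas s_meas by measurable
      show "(\<lambda>x. indicator L' x * h x * \<phi> n x) \<in> borel_measurable lebesgue" for n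
        using hL_meas borel_imp_lebesgue_measurable[OF test_function_measurable[OF \<phi>(1)], of n] by measurable
      show "AE x in lebesgue. norm (indicator L' x * h x * \<phi> n x) \<le> 2 * \<bar>indicator L' x * h x\<bar>" for n
      proof (rule AE_I2)
        fix x
        have "\<bar>indicator L' x * h x\<bar> * \<bar>\<phi> n x\<bar> \<le> \<bar>indicator L' x * h x\<bar> * 2"
          using \<phi>(2)[of n x] by (intro mult_left_mono) auto
        then show "norm (indicator L' x * h x * \<phi> n x) \<le> 2 * \<bar>indicator L' x * h x\<bar>"
          by (simp add: abs_mult)
      qed
      show "AE x in lebesgue. (\<lambda>n. indicator L' x * h x * \<phi> n x) \<longlonglongrightarrow> indicator L' x * h x * s x"
        using \<phi>(6) by eventually_elim (intro tendsto_intros)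
    qed
    moreover have "(LINT x|lebesgue. indicator L' x * h x * \<phi> n x) = 0" for n
    proof -
      have "(\<lambda>x. indicator L' x * h x * \<phi> n x) = (\<lambda>x. indicator U x *\<^sub>R (h x * \<phi> n x))"
      proof
        fix x show "indicator L' x * h x * \<phi> n x = indicator U x *\<^sub>R (h x * \<phi> n x)"
          using \<phi>(5)[of x n] L'(2) by (auto simp: indicator_def L'_def)
      qed
      then show ?thesis using zero[OF \<phi>(1)[of n]] by (simp only: set_lebesgue_integral_def)
    qed
    ultimately have "(LINT x|lebesgue. indicator L' x * h x * s x) = 0"
      by (simp add: LIMSEQ_const_iff)
    moreover have "indicator L' x * h x * s x = \<bar>indicator K x * h x\<bar>" for x
      by (auto simp: s_def L'_def indicator_def sgn_real_def)
    ultimately have "(LINT x|lebesgue. \<bar>indicator K x * h x\<bar>) = 0" by simp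
    then have "AE x in lebesgue. \<bar>indicator K x * h x\<bar> = 0"
      using integral_nonneg_eq_0_iff_AE[of lebesgue "\<lambda>x. \<bar>indicator K x * h x\<bar>"] hK by auto
    then show ?thesis by eventually_elim (auto simp: indicator_def)
  qed
  obtain C where C: "\<And>n::nat. compact (C n)" "\<And>n. C n \<subseteq> U" "\<Union>(range C) = U"
    by (rule open_Union_compact_subsets[OF U]) blast
  have "AE x in lebesgue. \<forall>n. x \<in> C n \<longrightarrow> h x = 0"
    unfolding AE_all_countable using K[OF C(1,2)] by blast
  then show ?thesis by eventually_elim (use C(3) in blast)
qed

section \<open>Multi-indices as lists, and uniqueness of weak derivatives\<close>

definition mi_list :: "('n::finite \<Rightarrow> nat) \<Rightarrow> 'n list" where
  "mi_list \<alpha> = (SOME xs. \<forall>i. count_list xs i = \<alpha> i)"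

lemma count_mi_list: "count_list (mi_list \<alpha>) i = \<alpha> i"
  unfolding mi_list_def using someI_ex[OF multiindex_list_exists[of \<alpha>]] by blast

lemma length_mi_list: "length (mi_list \<alpha>) = multiindex_order \<alpha>"
  using sum_count_set[of "mi_list \<alpha>" UNIV] count_mi_list[of \<alpha>]
  by (simp add: multiindex_order_def)

lemma multi_deriv_eq: "multi_deriv \<alpha> f = list_deriv (mi_list \<alpha>) f"
  by (simp add: multi_deriv_def mi_list_def)

lemma locally_summable_diff:
  "locally_summable D f \<Longrightarrow> locally_summable D g \<Longrightarrow> locally_summable D (\<lambda>x. f x - g x)"
  unfolding locally_summable_def by (auto intro: set_integral_diff)

lemma locally_summable_mult_test:
  assumes f: "locally_summable D f" and \<phi>: "test_function D \<phi>"
  shows "set_integrable lebesgue D (\<lambda>x. f x * \<phi> x)"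
proof -
  obtain K where K: "compact K" "K \<subseteq> D" "\<And>x. x \<notin> K \<Longrightarrow> \<phi> x = 0"
    using \<phi> by (rule test_functionE) blast
  obtain M where M: "\<And>x. \<bar>\<phi> x\<bar> \<le> M" using \<phi> by (rule test_function_bounded) blast
  have "integrable lebesgue (\<lambda>x. indicator K x * f x * \<phi> x)"
    by (rule integrable_mult_bounded[OF locally_summable_integrable[OF f K(1,2)] _ M])
      (rule borel_imp_lebesgue_measurable[OF test_function_measurable[OF \<phi>]])
  moreover have "indicator K x * f x * \<phi> x = indicator D x *\<^sub>R (f x * \<phi> x)" for x
    using K(2) K(3)[of x] by (auto simp: indicator_def)
  ultimately show ?thesis by (simp add: set_integrable_def)
qed

lemma has_weak_deriv_unique:
  assumes D: "open D" and g: "has_weak_deriv D \<alpha> f g" and g': "has_weak_deriv D \<alpha> f g'"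
  shows "AE x in lebesgue. x \<in> D \<longrightarrow> g x = g' x"
proof -
  have "AE x in lebesgue. x \<in> D \<longrightarrow> g x - g' x = 0"
  proof (rule fundamental_lemma[OF D])
    show "locally_summable D (\<lambda>x. g x - g' x)"
      using g g' by (auto simp: has_weak_deriv_def intro: locally_summable_diff)
    fix \<phi> assume \<phi>: "test_function D \<phi>"
    have "(LINT x:D|lebesgue. (g x - g' x) * \<phi> x) = (LINT x:D|lebesgue. g x * \<phi> x - g' x * \<phi> x)"
      by (simp add: algebra_simps)
    also have "\<dots> = (LINT x:D|lebesgue. g x * \<phi> x) - (LINT x:D|lebesgue. g' x * \<phi> x)"
      using g g' \<phi> by (intro set_integral_diff locally_summable_mult_test) (auto simp: has_weak_deriv_def)
    also have "\<dots> = 0"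
    proof -
      have "(-1) ^ multiindex_order \<alpha> * (LINT x:D|lebesgue. g x * \<phi> x) =
          (-1::real) ^ multiindex_order \<alpha> * (LINT x:D|lebesgue. g' x * \<phi> x)"
        using g g' \<phi> by (auto simp: has_weak_deriv_def)
      then show ?thesis by simp
    qed
    finally show "(LINT x:D|lebesgue. (g x - g' x) * \<phi> x) = 0" .
  qed
  then show ?thesis by eventually_elim auto
qed

section \<open>Elements of Lp theory\<close>

text \<open>The p-th power of the norm of L^p with values in \<open>ennreal\<close>, so that no
  integrability has to be carried along. Its triangle inequality \<open>Ep_add\<close> has the
  factor \<open>2 powr p\<close>, which is harmless for convergence.\<close>

definition Ep :: "real \<Rightarrow> 'a measure \<Rightarrow> ('a \<Rightarrow> real) \<Rightarrow> ennreal" where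
  "Ep p M f = (\<integral>\<^sup>+x. ennreal (\<bar>f x\<bar> powr p) \<partial>M)"

lemma powr_abs_add_le:
  fixes x y :: real
  assumes "0 < p"
  shows "\<bar>x + y\<bar> powr p \<le> 2 powr p * (\<bar>x\<bar> powr p + \<bar>y\<bar> powr p)"
proof -
  have "\<bar>x + y\<bar> powr p \<le> (2 * max \<bar>x\<bar> \<bar>y\<bar>) powr p"
    using assms by (intro powr_mono2) auto
  also have "\<dots> = 2 powr p * max \<bar>x\<bar> \<bar>y\<bar> powr p" by (simp add: powr_mult)
  also have "max \<bar>x\<bar> \<bar>y\<bar> powr p \<le> \<bar>x\<bar> powr p + \<bar>y\<bar> powr p" by (simp add: max_def)
  finally show ?thesis by simp
qed

lemma Ep_add:
  assumes [measurable]: "f \<in> borel_measurable M" "g \<in> borel_measurable M" and "0 < p"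
  shows "Ep p M (\<lambda>x. f x + g x) \<le> ennreal (2 powr p) * (Ep p M f + Ep p M g)"
proof -
  have "Ep p M (\<lambda>x. f x + g x) \<le>
      (\<integral>\<^sup>+x. ennreal (2 powr p) * (ennreal (\<bar>f x\<bar> powr p) + ennreal (\<bar>g x\<bar> powr p)) \<partial>M)"
    unfolding Ep_def
    by (intro nn_integral_mono)
      (use powr_abs_add_le[OF assms(3)] in \<open>auto simp flip: ennreal_plus ennreal_mult' intro!: ennreal_leI\<close>)
  also have "\<dots> = ennreal (2 powr p) * (Ep p M f + Ep p M g)"
    unfolding Ep_def by (simp add: nn_integral_cmult nn_integral_add)
  finally show ?thesis .
qed

lemma Ep_mono:
  "0 < p \<Longrightarrow> AE x in M. \<bar>f x\<bar> \<le> \<bar>g x\<bar> \<Longrightarrow> Ep p M f \<le> Ep p M g"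
  unfolding Ep_def by (intro nn_integral_mono_AE) (auto elim!: eventually_mono intro!: ennreal_leI powr_mono2)

lemma Ep_cong: "AE x in M. \<bar>f x\<bar> = \<bar>g x\<bar> \<Longrightarrow> Ep p M f = Ep p M g"
  unfolding Ep_def by (intro nn_integral_cong_AE) (auto elim!: eventually_mono)

lemma Ep_cmult:
  assumes [measurable]: "f \<in> borel_measurable M"
  shows "Ep p M (\<lambda>x. c * f x) = ennreal (\<bar>c\<bar> powr p) * Ep p M f"
  unfolding Ep_def by (simp add: abs_mult powr_mult ennreal_mult nn_integral_cmult)

lemma Ep_zero_iff:
  assumes [measurable]: "f \<in> borel_measurable M"
  shows "Ep p M f = 0 \<longleftrightarrow> (AE x in M. f x = 0)"
  unfolding Ep_def
  by (subst nn_integral_0_iff_AE) (auto simp: powr_eq_0_iff)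

lemma Ep_dominated:
  assumes [measurable]: "\<And>n::nat. f n \<in> borel_measurable M" "g \<in> borel_measurable M" and p: "0 < p"
    and le: "\<And>n. AE x in M. \<bar>f n x\<bar> \<le> g x" and fin: "Ep p M g < \<infinity>"
    and lim: "AE x in M. (\<lambda>n. f n x) \<longlonglongrightarrow> 0"
  shows "(\<lambda>n. Ep p M (f n)) \<longlonglongrightarrow> 0"
proof -
  have "(\<lambda>n. Ep p M (f n)) \<longlonglongrightarrow> (\<integral>\<^sup>+x. 0 \<partial>M)"
    unfolding Ep_def
  proof (rule nn_integral_dominated_convergence)
    show "AE x in M. ennreal (\<bar>f n x\<bar> powr p) \<le> ennreal (\<bar>g x\<bar> powr p)" for n
      using le[of n] by eventually_elim (use p in \<open>auto intro!: ennreal_leI powr_mono2\<close>)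
    show "(\<integral>\<^sup>+x. ennreal (\<bar>g x\<bar> powr p) \<partial>M) < \<infinity>" using fin by (simp add: Ep_def)
    show "AE x in M. (\<lambda>n. ennreal (\<bar>f n x\<bar> powr p)) \<longlonglongrightarrow> 0"
      using lim
    proof eventually_elim
      case (elim x)
      have "(\<lambda>n. \<bar>f n x\<bar> powr p) \<longlonglongrightarrow> \<bar>0\<bar> powr p"
        using p by (intro tendsto_powr' tendsto_rabs elim tendsto_const) auto
      then have "(\<lambda>n. ennreal (\<bar>f n x\<bar> powr p)) \<longlonglongrightarrow> ennreal (\<bar>0\<bar> powr p)" by (rule tendsto_ennrealI)
      then show ?case by simp
    qed
  qed auto
  then show ?thesis by simp
qed

text \<open>The Hoelder inequality for F = (F W^(1/p)) W^(-1/p); for the dual exponent q = p / (p -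
  1) one has -q/p = 1 / (1 - p), the exponent in the A_p condition. Real bounds \<open>a\<close> and
  \<open>b\<close> make the finiteness of the left-hand side part of the conclusion.\<close>

lemma nn_integral_holder:
  fixes F W :: "'a \<Rightarrow> real"
  assumes [measurable]: "F \<in> borel_measurable M" "W \<in> borel_measurable M"
    and F: "\<And>x. 0 \<le> F x" and W: "\<And>x. 0 < W x" and p: "1 < p"
    and a: "(\<integral>\<^sup>+x. ennreal (F x powr p * W x) \<partial>M) \<le> ennreal a" "0 \<le> a"
    and b: "(\<integral>\<^sup>+x. ennreal (W x powr (1 / (1 - p))) \<partial>M) \<le> ennreal b" "0 \<le> b"
  shows "(\<integral>\<^sup>+x. ennreal (F x) \<partial>M) \<le> ennreal (a powr (1 / p) * b powr (1 - 1 / p))"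
\<comment> \<open>Normalisation by \<open>a\<close> and \<open>b\<close> is impossible here, but
  \<open>F\<close> vanishes almost everywhere: for \<open>a = 0\<close> because \<open>W\<close> is
  positive, for \<open>b = 0\<close> because a positive function with zero integral forces a null
  measure.\<close>
proof (cases "a = 0 \<or> b = 0")
  case True
  have "AE x in M. F x = 0"
  proof (cases "a = 0")
    case True
    then have "(\<integral>\<^sup>+x. ennreal (F x powr p * W x) \<partial>M) = 0" using a by simp
    then have "AE x in M. ennreal (F x powr p * W x) = 0"
      by (subst (asm) nn_integral_0_iff_AE) auto
    then show ?thesis
    proof eventually_elim
      case (elim x)
      then have "F x powr p * W x \<le> 0" by (simp add: ennreal_eq_0_iff)
      then have "F x powr p \<le> 0" using W[of x] by (simp add: mult_le_0_iff not_less)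
      then have "F x powr p = 0" by (simp add: antisym)
      then show ?case by simp
    qed
  next
    case False
    then have "b = 0" using True by simp
    then have "(\<integral>\<^sup>+x. ennreal (W x powr (1 / (1 - p))) \<partial>M) = 0" using b by simp
    then have "AE x in M. ennreal (W x powr (1 / (1 - p))) = 0"
      by (subst (asm) nn_integral_0_iff_AE) auto
    then show ?thesis
    proof eventually_elim
      case (elim x)
      have "W x powr (1 / (1 - p)) > 0" using W[of x] by simp
      then show ?case using elim by (simp add: ennreal_eq_0_iff)
    qed
  qed
  then have "(\<integral>\<^sup>+x. ennreal (F x) \<partial>M) = 0"
    by (subst nn_integral_0_iff_AE) auto
  then show ?thesis by simp
next
  case False
  then have ab: "a > 0" "b > 0" using a b by auto
  define q where "q = p / (p - 1)"
  have q: "1 < q" "1 / p + 1 / q = 1" "1 - 1 / p = 1 / q"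
    using p by (auto simp: q_def field_simps)
  define A where "A = a powr (1 / p)"
  define B where "B = b powr (1 / q)"
  have AB: "A > 0" "B > 0" "A powr p = a" "B powr q = b"
    using ab p q(1) by (auto simp: A_def B_def powr_powr)
  \<comment> \<open>The Young inequality for F W^(1/p) / A and W^(-1/p) / B.\<close>
  have pw: "F x \<le> A * B * (F x powr p * W x / (a * p) + W x powr (1 / (1 - p)) / (b * q))" for x
  proof -
    have y: "(F x * W x powr (1 / p) / A) * (W x powr (- (1 / p)) / B) \<le>
        (F x * W x powr (1 / p) / A) powr p / p + (W x powr (- (1 / p)) / B) powr q / q"
      using F AB by (intro Youngs_inequality p q) auto
    have e1: "(F x * W x powr (1 / p) / A) * (W x powr (- (1 / p)) / B) = F x / (A * B)"
      using W[of x] by (simp add: powr_minus)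
    have e2: "(F x * W x powr (1 / p) / A) powr p = F x powr p * W x / a"
      using F[of x] W[of x] AB p by (simp add: powr_divide powr_mult powr_powr)
    have e3: "(W x powr (- (1 / p)) / B) powr q = W x powr (1 / (1 - p)) / b"
    proof -
      have "- (1 / p) * q = 1 / (1 - p)" using p by (simp add: q_def divide_simps)
      then show ?thesis using W[of x] AB p by (simp add: powr_divide powr_powr)
    qed
    have "F x / (A * B) \<le> F x powr p * W x / (a * p) + W x powr (1 / (1 - p)) / (b * q)"
      using y unfolding e1 e2 e3 by simp
    then show ?thesis using AB by (simp add: field_simps)
  qed
  have "(\<integral>\<^sup>+x. ennreal (F x) \<partial>M) \<le> (\<integral>\<^sup>+x. ennreal (A * B / (a * p)) * ennreal (F x powr p * W x) +
      ennreal (A * B / (b * q)) * ennreal (W x powr (1 / (1 - p))) \<partial>M)"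
  proof (rule nn_integral_mono)
    fix x
    have "F x \<le> A * B / (a * p) * (F x powr p * W x) + A * B / (b * q) * W x powr (1 / (1 - p))"
      using pw[of x] by (simp add: algebra_simps)
    then show "ennreal (F x) \<le> ennreal (A * B / (a * p)) * ennreal (F x powr p * W x) +
      ennreal (A * B / (b * q)) * ennreal (W x powr (1 / (1 - p)))"
      using AB ab p q W[of x] by (simp flip: ennreal_mult' ennreal_plus add: less_imp_le)
  qed
  also have "\<dots> = ennreal (A * B / (a * p)) * (\<integral>\<^sup>+x. ennreal (F x powr p * W x) \<partial>M) +
      ennreal (A * B / (b * q)) * (\<integral>\<^sup>+x. ennreal (W x powr (1 / (1 - p))) \<partial>M)"
    by (simp add: nn_integral_add nn_integral_cmult)
  also have "\<dots> \<le> ennreal (A * B / (a * p)) * ennreal a + ennreal (A * B / (b * q)) * ennreal b"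
    by (intro add_mono mult_left_mono a b) auto
  also have "\<dots> = ennreal (A * B * (1 / p + 1 / q))"
    using AB ab p q by (simp flip: ennreal_mult' ennreal_plus add: field_simps)
  finally show ?thesis by (simp add: q A_def B_def)
qed

lemma powr_convex_nonneg:
  fixes x y :: real
  assumes "1 \<le> p" "0 \<le> x" "0 \<le> y" "0 \<le> l" "l \<le> 1"
  shows "(l * x + (1 - l) * y) powr p \<le> l * x powr p + (1 - l) * y powr p"
proof -
  have *: "(l * z) powr p \<le> l * z powr p" if "0 \<le> l" "l \<le> 1" "0 \<le> z" for l z :: real
  proof (cases "l = 0")
    case False
    have "l powr p \<le> l powr 1" using that False assms by (intro powr_mono') auto
    then show ?thesis using that by (simp add: powr_mult mult_right_mono)
  qed simp
  consider "x = 0" | "y = 0" | "0 < x" "0 < y" using assms by force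
  then show ?thesis
  proof cases
    case 1 then show ?thesis using *[of "1 - l" y] assms by simp
  next
    case 2 then show ?thesis using *[of l x] assms by simp
  next
    case 3
    then show ?thesis
      using convex_onD[OF powr_convex[OF assms(1)], of "1 - l" x y] assms by simp
  qed
qed

definition lpn :: "real \<Rightarrow> 'a measure \<Rightarrow> ('a \<Rightarrow> real) \<Rightarrow> real" where
  "lpn p M f = (LINT x|M. \<bar>f x\<bar> powr p) powr (1 / p)"

lemma lpn_nonneg: "0 \<le> lpn p M f"
  by (simp add: lpn_def)

lemma lp_add_integrable:
  fixes f g :: "'a \<Rightarrow> real"
  assumes [measurable]: "f \<in> borel_measurable M" "g \<in> borel_measurable M" and p: "0 < p"
    and "integrable M (\<lambda>x. \<bar>f x\<bar> powr p)" "integrable M (\<lambda>x. \<bar>g x\<bar> powr p)"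
  shows "integrable M (\<lambda>x. \<bar>f x + g x\<bar> powr p)"
proof (rule Bochner_Integration.integrable_bound)
  show "integrable M (\<lambda>x. 2 powr p * (\<bar>f x\<bar> powr p + \<bar>g x\<bar> powr p))" using assms by simp
  show "AE x in M. norm (\<bar>f x + g x\<bar> powr p) \<le> norm (2 powr p * (\<bar>f x\<bar> powr p + \<bar>g x\<bar> powr p))"
    using powr_abs_add_le[OF p] by (auto simp: abs_of_nonneg)
qed measurable

lemma lpn_eq_0_iff:
  assumes [measurable]: "f \<in> borel_measurable M" and p: "0 < p"
    and f: "integrable M (\<lambda>x. \<bar>f x\<bar> powr p)"
  shows "lpn p M f = 0 \<longleftrightarrow> (AE x in M. f x = 0)"
proof -
  have "lpn p M f = 0 \<longleftrightarrow> (LINT x|M. \<bar>f x\<bar> powr p) = 0"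
    using p by (simp add: lpn_def powr_eq_0_iff)
  also have "\<dots> \<longleftrightarrow> (AE x in M. \<bar>f x\<bar> powr p = 0)"
    by (rule integral_nonneg_eq_0_iff_AE[OF f]) simp
  finally show ?thesis by (simp add: powr_eq_0_iff)
qed

lemma lpn_cong_AE:
  assumes [measurable]: "f \<in> borel_measurable M" "g \<in> borel_measurable M" and "AE x in M. f x = g x"
  shows "lpn p M f = lpn p M g"
proof -
  have "(LINT x|M. \<bar>f x\<bar> powr p) = (LINT x|M. \<bar>g x\<bar> powr p)"
    by (rule integral_cong_AE) (use assms(3) in \<open>auto elim: eventually_mono\<close>)
  then show ?thesis by (simp add: lpn_def)
qed

text \<open>Convexity of the p-th power, applied to |f| / a and |g| / b with the weights a / (a + b)
  and b / (a + b), where \<open>a\<close> and \<open>b\<close> are the two norms. A vanishing norm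
  is treated separately, as it cannot be divided by.\<close>

lemma minkowski:
  assumes [measurable]: "f \<in> borel_measurable M" "g \<in> borel_measurable M" and p: "1 \<le> p"
    and f: "integrable M (\<lambda>x. \<bar>f x\<bar> powr p)" and g: "integrable M (\<lambda>x. \<bar>g x\<bar> powr p)"
  shows "lpn p M (\<lambda>x. f x + g x) \<le> lpn p M f + lpn p M g"
proof -
  have p0: "0 < p" using p by simp
  consider "lpn p M f = 0" | "lpn p M g = 0" | "lpn p M f > 0" "lpn p M g > 0"
    using lpn_nonneg[of p M] by (metis less_eq_real_def)
  then show ?thesis
  proof cases
    case 1
    then have "AE x in M. f x = 0" using lpn_eq_0_iff[OF _ p0 f] by simp
    then have "lpn p M (\<lambda>x. f x + g x) = lpn p M g"
      by (intro lpn_cong_AE) (auto elim: eventually_mono)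
    then show ?thesis using 1 by simp
  next
    case 2
    then have "AE x in M. g x = 0" using lpn_eq_0_iff[OF _ p0 g] by simp
    then have "lpn p M (\<lambda>x. f x + g x) = lpn p M f"
      by (intro lpn_cong_AE) (auto elim: eventually_mono)
    then show ?thesis using 2 by simp
  next
    case 3
    define a where "a = lpn p M f"
    define b where "b = lpn p M g"
    have ab: "a > 0" "b > 0" using 3 by (auto simp: a_def b_def)
    have Ia: "(LINT x|M. \<bar>f x\<bar> powr p) = a powr p" and Ib: "(LINT x|M. \<bar>g x\<bar> powr p) = b powr p"
      using p by (auto simp: a_def b_def lpn_def powr_powr integral_nonneg)
    define l where "l = a / (a + b)"
    have l: "0 \<le> l" "l \<le> 1" "1 - l = b / (a + b)" using ab by (auto simp: l_def field_simps)
    have pw: "\<bar>f x + g x\<bar> powr p \<le>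
        (a + b) powr p * (l * (\<bar>f x\<bar> powr p / a powr p) + (1 - l) * (\<bar>g x\<bar> powr p / b powr p))" for x
    proof -
      have "\<bar>f x + g x\<bar> powr p \<le> (\<bar>f x\<bar> + \<bar>g x\<bar>) powr p" using p by (intro powr_mono2) auto
      also have "\<bar>f x\<bar> + \<bar>g x\<bar> = (a + b) * (l * (\<bar>f x\<bar> / a) + (1 - l) * (\<bar>g x\<bar> / b))"
      proof -
        have "l * (\<bar>f x\<bar> / a) = \<bar>f x\<bar> / (a + b)" "(1 - l) * (\<bar>g x\<bar> / b) = \<bar>g x\<bar> / (a + b)"
          using ab unfolding l(3) by (simp_all add: l_def)
        then show ?thesis using ab by (simp add: distrib_left)
      qed
      also have "\<dots> powr p = (a + b) powr p * (l * (\<bar>f x\<bar> / a) + (1 - l) * (\<bar>g x\<bar> / b)) powr p"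
        using ab l by (simp add: powr_mult)
      also have "\<dots> \<le> (a + b) powr p * (l * (\<bar>f x\<bar> / a) powr p + (1 - l) * (\<bar>g x\<bar> / b) powr p)"
        using ab l p by (intro mult_left_mono powr_convex_nonneg) auto
      finally show ?thesis using ab by (simp add: powr_divide)
    qed
    have "(LINT x|M. \<bar>f x + g x\<bar> powr p) \<le>
        (LINT x|M. (a + b) powr p * (l * (\<bar>f x\<bar> powr p / a powr p) + (1 - l) * (\<bar>g x\<bar> powr p / b powr p)))"
      by (intro integral_mono pw lp_add_integrable p0 f g Bochner_Integration.integrable_add integrable_mult_right Bochner_Integration.integrable_divide assms)
    also have "\<dots> = (a + b) powr p * (l * ((LINT x|M. \<bar>f x\<bar> powr p) / a powr p) + (1 - l) * ((LINT x|M. \<bar>g x\<bar> powr p) / b powr p))"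
      using f g by simp
    also have "\<dots> = (a + b) powr p" unfolding Ia Ib using ab by simp
    finally have "(LINT x|M. \<bar>f x + g x\<bar> powr p) powr (1 / p) \<le> ((a + b) powr p) powr (1 / p)"
      using p by (intro powr_mono2) (auto intro: integral_nonneg)
    also have "\<dots> = a + b" using ab p by (simp add: powr_powr)
    finally show ?thesis by (simp add: lpn_def a_def b_def)
  qed
qed

lemma ennreal_tendsto_0I:
  fixes X :: "'a \<Rightarrow> ennreal"
  assumes "\<And>e. e > 0 \<Longrightarrow> \<forall>\<^sub>F n in F. X n \<le> ennreal e"
  shows "(X \<longlongrightarrow> 0) F"
proof (rule order_tendstoI)
  fix a :: ennreal assume "0 < a"
  then obtain y where y: "0 < y" "y < a" using dense by blast
  then obtain e where e: "y = ennreal e" "0 \<le> e" by (cases y) (auto simp: top_unique)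
  then have "e > 0" using y by (simp add: ennreal_less_zero_iff less_le)
  from assms[OF this] show "\<forall>\<^sub>F n in F. X n < a"
    by eventually_elim (use y e in auto)
qed simp

lemma ennreal_tendsto_0D:
  fixes X :: "'a \<Rightarrow> ennreal"
  assumes "(X \<longlongrightarrow> 0) F" "e > 0"
  shows "\<forall>\<^sub>F n in F. X n \<le> ennreal e"
  using order_tendstoD(2)[OF assms(1), of "ennreal e"] assms(2)
  by (auto elim!: eventually_mono)

text \<open>A rapidly converging subsequence converges almost everywhere, and the Fatou lemma along
  it turns the Cauchy condition into convergence of the whole sequence.\<close>

theorem riesz_fischer:
  fixes f :: "nat \<Rightarrow> 'a \<Rightarrow> real"
  assumes meas [measurable]: "\<And>n. f n \<in> borel_measurable M" and p: "0 < p"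
    and Cauchy: "\<And>e. e > 0 \<Longrightarrow> \<exists>N. \<forall>m\<ge>N. \<forall>n\<ge>N. Ep p M (\<lambda>x. f m x - f n x) \<le> ennreal e"
  obtains g where "g \<in> borel_measurable M" "(\<lambda>n. Ep p M (\<lambda>x. f n x - g x)) \<longlonglongrightarrow> 0"
proof -
  \<comment> \<open>The rate makes the sum of the functions 2^(k p) |d_k|^p, for the increments d_k
    of the subsequence, integrable. Where this sum has a finite value S, each increment is at most
    S^(1/p) 2^(-k), so the increments are summable.\<close>
  define c where "c k = 2 powr (- (real k * p)) * (1/2) ^ k" for k :: nat
  have c: "c k > 0" for k by (simp add: c_def)
  obtain N where N: "\<And>k m n. m \<ge> N k \<Longrightarrow> n \<ge> N k \<Longrightarrow> Ep p M (\<lambda>x. f m x - f n x) \<le> ennreal (c k)"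
    using Cauchy[OF c] by metis
  define r where "r = rec_nat (N 0) (\<lambda>k rk. max (Suc rk) (N (Suc k)))"
  have r_Suc: "r (Suc k) = max (Suc (r k)) (N (Suc k))" for k by (simp add: r_def)
  have r_N: "r k \<ge> N k" for k by (cases k) (simp_all add: r_def)
  have r_mono: "r k \<le> r (Suc k)" for k by (simp add: r_Suc)
  define d where "d k x = f (r (Suc k)) x - f (r k) x" for k x
  have [measurable]: "d k \<in> borel_measurable M" for k unfolding d_def by measurable
  have dE: "Ep p M (d k) \<le> ennreal (c k)" for k
    unfolding d_def using r_N[of k] r_mono[of k] by (intro N) auto
  have "(\<integral>\<^sup>+x. (\<Sum>k. ennreal (2 powr (real k * p) * \<bar>d k x\<bar> powr p)) \<partial>M) =
      (\<Sum>k. ennreal (2 powr (real k * p)) * Ep p M (d k))"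
    by (simp add: nn_integral_suminf ennreal_mult nn_integral_cmult Ep_def)
  also have "\<dots> \<le> (\<Sum>k. ennreal ((1/2) ^ k))"
  proof (intro suminf_le summableI)
    fix k
    have "ennreal (2 powr (real k * p)) * Ep p M (d k) \<le> ennreal (2 powr (real k * p)) * ennreal (c k)"
      by (intro mult_left_mono dE) auto
    also have "\<dots> = ennreal ((1/2) ^ k)"
      by (simp add: c_def powr_minus flip: ennreal_mult')
    finally show "ennreal (2 powr (real k * p)) * Ep p M (d k) \<le> ennreal ((1/2) ^ k)" .
  qed
  also have "\<dots> < \<infinity>"
    by (subst suminf_ennreal2) (auto simp: summable_geometric)
  finally have "AE x in M. (\<Sum>k. ennreal (2 powr (real k * p) * \<bar>d k x\<bar> powr p)) \<noteq> \<infinity>"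
    by (intro nn_integral_PInf_AE) auto
  then have conv: "AE x in M. convergent (\<lambda>k. f (r k) x)"
  proof eventually_elim
    case (elim x)
    have real_valued: "\<exists>S. T = ennreal S \<and> S \<ge> 0" if "T \<noteq> \<infinity>" for T :: ennreal
      using that by (cases T) auto
    obtain S where S: "(\<Sum>k. ennreal (2 powr (real k * p) * \<bar>d k x\<bar> powr p)) = ennreal S" "S \<ge> 0"
      using real_valued[OF elim] by blast
    have bound: "\<bar>d k x\<bar> \<le> S powr (1 / p) * (1/2) ^ k" for k
    proof -
      have "(\<Sum>i\<in>{k}. ennreal (2 powr (real i * p) * \<bar>d i x\<bar> powr p)) \<le> ennreal S"
        unfolding S(1)[symmetric] by (rule sum_le_suminf[OF summableI]) auto
      then have "2 powr (real k * p) * \<bar>d k x\<bar> powr p \<le> S" using S(2) by (simp add: ennreal_le_iff)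
      then have "(2 powr (real k * p) * \<bar>d k x\<bar> powr p) powr (1 / p) \<le> S powr (1 / p)"
        using p by (intro powr_mono2) auto
      moreover have "(2 powr (real k * p) * \<bar>d k x\<bar> powr p) powr (1 / p) = 2 ^ k * \<bar>d k x\<bar>"
        using p by (simp add: powr_mult powr_powr powr_realpow)
      ultimately show ?thesis by (simp add: field_simps power_divide)
    qed
    have "summable (\<lambda>k. d k x)"
      by (rule summable_comparison_test[of _ "\<lambda>k. S powr (1 / p) * (1/2) ^ k"])
        (use bound in \<open>auto intro!: summable_mult summable_geometric\<close>)
    then have "convergent (\<lambda>n. \<Sum>k<n. d k x)" by (simp add: summable_iff_convergent)
    moreover have "(\<Sum>k<n. d k x) = f (r n) x - f (r 0) x" for n
      unfolding d_def by (rule sum_lessThan_telescope)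
    ultimately have "convergent (\<lambda>n. (f (r n) x - f (r 0) x) + f (r 0) x)"
      by (intro convergent_add convergent_const) simp
    then show ?case by simp
  qed
  define g where "g x = lim (\<lambda>k. f (r k) x)" for x
  have g_meas [measurable]: "g \<in> borel_measurable M" unfolding g_def by measurable
  have lim: "AE x in M. (\<lambda>k. f (r k) x) \<longlonglongrightarrow> g x"
    using conv by eventually_elim (simp add: g_def convergent_LIMSEQ_iff)
  have r_ge: "k \<le> r k" for k by (induction k) (simp_all add: r_Suc)
  show thesis
  proof (rule that[OF g_meas])
    show "(\<lambda>n. Ep p M (\<lambda>x. f n x - g x)) \<longlonglongrightarrow> 0"
    proof (rule ennreal_tendsto_0I)
      fix e :: real assume "e > 0"
      then obtain N0 where N0: "\<And>m n. m \<ge> N0 \<Longrightarrow> n \<ge> N0 \<Longrightarrow> Ep p M (\<lambda>x. f m x - f n x) \<le> ennreal e"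
        using Cauchy by blast
      have "Ep p M (\<lambda>x. f n x - g x) \<le> ennreal e" if n: "n \<ge> N0" for n
      proof -
        \<comment> \<open>The limit is written as a lower limit, which is the form the Fatou lemma
          takes.\<close>
        have "Ep p M (\<lambda>x. f n x - g x) =
            (\<integral>\<^sup>+x. liminf (\<lambda>k. ennreal (\<bar>f n x - f (r k) x\<bar> powr p)) \<partial>M)"
          unfolding Ep_def
        proof (rule nn_integral_cong_AE, use lim in eventually_elim)
          case (elim x)
          have "(\<lambda>k. \<bar>f n x - f (r k) x\<bar> powr p) \<longlonglongrightarrow> \<bar>f n x - g x\<bar> powr p"
            using p by (intro tendsto_powr' tendsto_rabs tendsto_diff elim tendsto_const) auto
          then have "(\<lambda>k. ennreal (\<bar>f n x - f (r k) x\<bar> powr p)) \<longlonglongrightarrow> ennreal (\<bar>f n x - g x\<bar> powr p)"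
            by (rule tendsto_ennrealI)
          then show ?case by (metis lim_imp_Liminf sequentially_bot)
        qed
        also have "\<dots> \<le> liminf (\<lambda>k. Ep p M (\<lambda>x. f n x - f (r k) x))"
          unfolding Ep_def by (rule nn_integral_liminf) measurable
        also have "\<dots> \<le> limsup (\<lambda>k. Ep p M (\<lambda>x. f n x - f (r k) x))"
          by (rule Liminf_le_Limsup) simp
        also have "\<dots> \<le> ennreal e"
        proof (rule Limsup_bounded)
          show "\<forall>\<^sub>F k in sequentially. Ep p M (\<lambda>x. f n x - f (r k) x) \<le> ennreal e"
            using eventually_ge_at_top[of N0]
            by eventually_elim (use N0[OF n] r_ge order_trans in blast)
        qed
        finally show ?thesis .
      qed
      then show "\<forall>\<^sub>F n in sequentially. Ep p M (\<lambda>x. f n x - g x) \<le> ennreal e"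
        unfolding eventually_sequentially by blast
    qed
  qed
qed

section \<open>Averages over balls for Muckenhoupt weights\<close>

text \<open>A positive Borel representative of an A_p weight. The two averages are multiplied out:
  the powers 1 and p - 1 of the volume combine to the p-th power, and the volume of the unit ball is
  absorbed into \<open>A\<close>. Balls appear as conditions on \<open>dist\<close>, which leaves
  the integrands jointly measurable in centre and variable.\<close>

locale ap_weight =
  fixes v :: "real^'n::finite \<Rightarrow> real" and p A :: real
  assumes p_gt_1: "1 < p" and v_pos: "\<And>x. 0 < v x" and v_meas [measurable]: "v \<in> borel_measurable borel"
    and A_nonneg: "0 \<le> A"
    and v_ball: "\<And>c r. 0 < r \<Longrightarrow> (\<integral>\<^sup>+z. (if dist c z < r then ennreal (v z) else 0) \<partial>lborel) < \<infinity>"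
    and dual_ball: "\<And>c r. 0 < r \<Longrightarrow>
      (\<integral>\<^sup>+z. (if dist c z < r then ennreal (v z powr (1 / (1 - p))) else 0) \<partial>lborel) < \<infinity>"
    and ap: "\<And>c r. 0 < r \<Longrightarrow>
      enn2real (\<integral>\<^sup>+z. (if dist c z < r then ennreal (v z) else 0) \<partial>lborel) *
      enn2real (\<integral>\<^sup>+z. (if dist c z < r then ennreal (v z powr (1 / (1 - p))) else 0) \<partial>lborel) powr (p - 1)
        \<le> A * (r ^ CARD('n)) powr p"
begin

definition mass :: "real^'n \<Rightarrow> real \<Rightarrow> real" where
  "mass c r = enn2real (\<integral>\<^sup>+z. (if dist c z < r then ennreal (v z) else 0) \<partial>lborel)"

definition dual_mass :: "real^'n \<Rightarrow> real \<Rightarrow> real" where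
  "dual_mass c r = enn2real (\<integral>\<^sup>+z. (if dist c z < r then ennreal (v z powr (1 / (1 - p))) else 0) \<partial>lborel)"

lemma p_pos: "0 < p" using p_gt_1 by simp

lemma mass_eq: "0 < r \<Longrightarrow> (\<integral>\<^sup>+z. (if dist c z < r then ennreal (v z) else 0) \<partial>lborel) = ennreal (mass c r)"
  unfolding mass_def using v_ball[of r c] by (intro ennreal_enn2real[symmetric]) (auto simp: less_top)

lemma dual_mass_eq: "0 < r \<Longrightarrow>
    (\<integral>\<^sup>+z. (if dist c z < r then ennreal (v z powr (1 / (1 - p))) else 0) \<partial>lborel) = ennreal (dual_mass c r)"
  unfolding dual_mass_def using dual_ball[of r c] by (intro ennreal_enn2real[symmetric]) (auto simp: less_top)

lemma mass_nonneg: "0 \<le> mass c r" "0 \<le> dual_mass c r"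
  by (auto simp: mass_def dual_mass_def)

lemma dual_mass_mono:
  assumes "0 < r" "dist x z < r" shows "dual_mass x r \<le> dual_mass z (2 * r)"
proof -
  have "(\<integral>\<^sup>+y. (if dist x y < r then ennreal (v y powr (1 / (1 - p))) else 0) \<partial>lborel)
      \<le> (\<integral>\<^sup>+y. (if dist z y < 2 * r then ennreal (v y powr (1 / (1 - p))) else 0) \<partial>lborel)"
  proof (rule nn_integral_mono)
    fix y
    have "dist z y < 2 * r" if "dist x y < r"
      using that assms dist_triangle[of z y x] by (simp add: dist_commute)
    then show "(if dist x y < r then ennreal (v y powr (1 / (1 - p))) else 0) \<le>
        (if dist z y < 2 * r then ennreal (v y powr (1 / (1 - p))) else 0)" by auto
  qed
  then show ?thesis
    using assms(1) dual_mass_eq[of r x] dual_mass_eq[of "2 * r" z] by (simp add: ennreal_le_iff mass_nonneg)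
qed

lemma mass_mono:
  assumes "0 < r" "r \<le> s" shows "mass z r \<le> mass z s"
proof -
  have "(\<integral>\<^sup>+y. (if dist z y < r then ennreal (v y) else 0) \<partial>lborel)
      \<le> (\<integral>\<^sup>+y. (if dist z y < s then ennreal (v y) else 0) \<partial>lborel)"
    by (rule nn_integral_mono) (use assms in auto)
  then show ?thesis
    using assms mass_eq[of r z] mass_eq[of s z] by (simp add: ennreal_le_iff mass_nonneg)
qed

lemma dual_mass_measurable [measurable]: "(\<lambda>x. dual_mass x r) \<in> borel_measurable borel"
  unfolding dual_mass_def by measurable

definition avg :: "(real^'n \<Rightarrow> real) \<Rightarrow> real \<Rightarrow> real^'n \<Rightarrow> ennreal" where
  "avg g \<rho> x = (\<integral>\<^sup>+y. (if norm y < 1 then ennreal (g (x + \<rho> *\<^sub>R y)) else 0) \<partial>lborel)"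

lemma avg_measurable [measurable]:
  assumes [measurable]: "g \<in> borel_measurable borel"
  shows "avg g \<rho> \<in> borel_measurable borel"
  unfolding avg_def by measurable

text \<open>The dual mass of \<open>ball x r\<close> is at most that of \<open>ball z (2 r)\<close> for \<open>z \<in> ball x r\<close>;
  hence Fubini and one application of the \<open>A_p\<close> condition on \<open>ball z (2 r)\<close> suffice, and no maximal
  function is needed.\<close>

definition avg_const :: real where "avg_const = A * (2 ^ CARD('n)) powr p"

lemma avg_const_nonneg: "0 \<le> avg_const"
  by (simp add: avg_const_def A_nonneg)

text \<open>The Hoelder inequality with \<open>W = v\<close> on the ball about \<open>x\<close>,
  after the substitution that maps it to the unit ball. In the p-th power the dual mass gets the
  exponent (1 - 1/p) p = p - 1, as in the A_p condition.\<close>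

lemma avg_pointwise:
  assumes [measurable]: "g \<in> borel_measurable borel" and g: "\<And>x. 0 \<le> g x" and \<rho>: "\<rho> \<noteq> 0"
    and fin: "(\<integral>\<^sup>+x. ennreal (g x powr p * v x) \<partial>lborel) < \<infinity>"
  shows "avg g \<rho> x < \<infinity>"
    and "ennreal (enn2real (avg g \<rho> x) powr p) \<le>
      ennreal (inverse (\<bar>\<rho>\<bar> ^ CARD('n)) powr p * dual_mass x \<bar>\<rho>\<bar> powr (p - 1)) *
        (\<integral>\<^sup>+z. (if dist x z < \<bar>\<rho>\<bar> then ennreal (g z powr p * v z) else 0) \<partial>lborel)"
proof -
  define r where "r = \<bar>\<rho>\<bar>"
  have r: "r > 0" using \<rho> by (simp add: r_def)
  define G where "G = (\<integral>\<^sup>+z. (if dist x z < r then ennreal (g z powr p * v z) else 0) \<partial>lborel)"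
  have "G \<le> (\<integral>\<^sup>+x. ennreal (g x powr p * v x) \<partial>lborel)"
    unfolding G_def by (rule nn_integral_mono) auto
  then have "G < \<infinity>" using fin by simp
  then obtain a where a: "G = ennreal a" "0 \<le> a" by (cases G) auto
  let ?M = "restrict_space lborel {z. dist x z < r}"
  have ms: "{z. dist x z < r} \<inter> space lborel \<in> sets lborel" by measurable
  have restr: "(\<integral>\<^sup>+z. ennreal (f z) \<partial>?M) = (\<integral>\<^sup>+z. (if dist x z < r then ennreal (f z) else 0) \<partial>lborel)" for f
    using ms by (subst nn_integral_restrict_space) (auto intro!: nn_integral_cong simp: indicator_def)
  have hol: "(\<integral>\<^sup>+z. ennreal (g z) \<partial>?M) \<le> ennreal (a powr (1 / p) * dual_mass x r powr (1 - 1 / p))"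
  proof (rule nn_integral_holder[where W=v and p=p])
    show "(\<integral>\<^sup>+z. ennreal (g z powr p * v z) \<partial>?M) \<le> ennreal a"
      unfolding restr using a by (simp add: G_def)
    show "(\<integral>\<^sup>+z. ennreal (v z powr (1 / (1 - p))) \<partial>?M) \<le> ennreal (dual_mass x r)"
      unfolding restr using dual_mass_eq[OF r] by simp
  qed (use g v_pos p_gt_1 a mass_nonneg in \<open>auto intro: measurable_restrict_space1\<close>)
  have cv: "(\<integral>\<^sup>+z. (if dist x z < r then ennreal (g z) else 0) \<partial>lborel) = ennreal (r ^ CARD('n)) * avg g \<rho> x"
  proof -
    have "(\<integral>\<^sup>+z. (if dist x z < r then ennreal (g z) else 0) \<partial>lborel) = ennreal (\<bar>\<rho>\<bar> ^ DIM(real^'n)) *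
        (\<integral>\<^sup>+y. (if dist x (x + \<rho> *\<^sub>R y) < r then ennreal (g (x + \<rho> *\<^sub>R y)) else 0) \<partial>lborel)"
      by (rule nn_integral_affine) (use \<rho> in measurable)
    moreover have "dist x (x + \<rho> *\<^sub>R y) < r \<longleftrightarrow> norm y < 1" for y :: "real^'n"
      using r by (simp add: dist_norm r_def)
    ultimately show ?thesis by (simp add: avg_def r_def)
  qed
  have "ennreal (r ^ CARD('n)) * avg g \<rho> x \<le> ennreal (a powr (1 / p) * dual_mass x r powr (1 - 1 / p))"
    using hol unfolding restr cv .
  then have "ennreal (inverse (r ^ CARD('n))) * (ennreal (r ^ CARD('n)) * avg g \<rho> x) \<le>
      ennreal (inverse (r ^ CARD('n))) * ennreal (a powr (1 / p) * dual_mass x r powr (1 - 1 / p))"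
    by (rule mult_left_mono) simp
  moreover have "ennreal (inverse (r ^ CARD('n))) * (ennreal (r ^ CARD('n)) * avg g \<rho> x) = avg g \<rho> x"
    using r by (simp add: mult.assoc[symmetric] ennreal_mult[symmetric])
  ultimately have le: "avg g \<rho> x \<le> ennreal (inverse (r ^ CARD('n)) * (a powr (1 / p) * dual_mass x r powr (1 - 1 / p)))"
    using r by (simp add: ennreal_mult)
  then show fin': "avg g \<rho> x < \<infinity>" by (metis ennreal_less_top infinity_ennreal_def order_le_less_trans)
  have "enn2real (avg g \<rho> x) \<le> inverse (r ^ CARD('n)) * (a powr (1 / p) * dual_mass x r powr (1 - 1 / p))"
    using enn2real_mono[OF le] r by simp
  then have "enn2real (avg g \<rho> x) powr p \<le> (inverse (r ^ CARD('n)) * (a powr (1 / p) * dual_mass x r powr (1 - 1 / p))) powr p"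
    using p_pos by (intro powr_mono2) auto
  also have "\<dots> = inverse (r ^ CARD('n)) powr p * (a * dual_mass x r powr (p - 1))"
  proof -
    have "(1 - 1 / p) * p = p - 1" using p_pos by (simp add: field_simps)
    then show ?thesis using a p_pos by (simp add: powr_mult powr_powr)
  qed
  finally have "enn2real (avg g \<rho> x) powr p \<le> (inverse (r ^ CARD('n)) powr p * dual_mass x r powr (p - 1)) * a"
    by (simp add: mult_ac)
  then have "ennreal (enn2real (avg g \<rho> x) powr p) \<le> ennreal ((inverse (r ^ CARD('n)) powr p * dual_mass x r powr (p - 1)) * a)"
    by (rule ennreal_leI)
  also have "\<dots> = ennreal (inverse (r ^ CARD('n)) powr p * dual_mass x r powr (p - 1)) * G"
    using a by (simp add: ennreal_mult)
  finally show "ennreal (enn2real (avg g \<rho> x) powr p) \<le>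
      ennreal (inverse (\<bar>\<rho>\<bar> ^ CARD('n)) powr p * dual_mass x \<bar>\<rho>\<bar> powr (p - 1)) *
        (\<integral>\<^sup>+z. (if dist x z < \<bar>\<rho>\<bar> then ennreal (g z powr p * v z) else 0) \<partial>lborel)"
    by (simp add: G_def r_def)
qed

lemma avg_bound:
  assumes [measurable]: "g \<in> borel_measurable borel" and g: "\<And>x. 0 \<le> g x" and \<rho>: "\<rho> \<noteq> 0"
    and fin: "(\<integral>\<^sup>+x. ennreal (g x powr p * v x) \<partial>lborel) < \<infinity>"
  shows "(\<integral>\<^sup>+x. ennreal (enn2real (avg g \<rho> x) powr p * v x) \<partial>lborel)
      \<le> ennreal avg_const * (\<integral>\<^sup>+x. ennreal (g x powr p * v x) \<partial>lborel)"
proof -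
  define r where "r = \<bar>\<rho>\<bar>"
  have r: "r > 0" using \<rho> by (simp add: r_def)
  define k where "k = inverse (r ^ CARD('n)) powr p"
  have k: "k \<ge> 0" by (simp add: k_def)
  define S where "S x = dual_mass x r powr (p - 1)" for x
  have S: "S x \<ge> 0" for x by (simp add: S_def)
  have [measurable]: "S \<in> borel_measurable borel" unfolding S_def by measurable
  have "(\<integral>\<^sup>+x. ennreal (enn2real (avg g \<rho> x) powr p * v x) \<partial>lborel) \<le>
     (\<integral>\<^sup>+x. ennreal (k * S x * v x) * (\<integral>\<^sup>+z. (if dist x z < r then ennreal (g z powr p * v z) else 0) \<partial>lborel) \<partial>lborel)"
  proof (rule nn_integral_mono)
    fix x
    have "ennreal (enn2real (avg g \<rho> x) powr p) * ennreal (v x) \<le> (ennreal (k * S x) *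
        (\<integral>\<^sup>+z. (if dist x z < r then ennreal (g z powr p * v z) else 0) \<partial>lborel)) * ennreal (v x)"
      using avg_pointwise(2)[OF assms(1) g \<rho> fin, of x] by (intro mult_right_mono) (simp_all add: k_def r_def S_def)
    then show "ennreal (enn2real (avg g \<rho> x) powr p * v x) \<le> ennreal (k * S x * v x) *
        (\<integral>\<^sup>+z. (if dist x z < r then ennreal (g z powr p * v z) else 0) \<partial>lborel)"
      using k S[of x] v_pos[of x] by (simp add: ennreal_mult mult_ac)
  qed
  also have "\<dots> = (\<integral>\<^sup>+x. (\<integral>\<^sup>+z. ennreal (k * S x * v x) * (if dist x z < r then ennreal (g z powr p * v z) else 0) \<partial>lborel) \<partial>lborel)"
    by (subst nn_integral_cmult) auto
  \<comment> \<open>With \<open>z\<close> fixed and the integration over \<open>x\<close> innermost,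
    the dual mass about \<open>x\<close> can be replaced by one about \<open>z\<close> and leaves
    only the mass of \<open>v\<close> on a ball about \<open>z\<close>.\<close>
  also have "\<dots> = (\<integral>\<^sup>+z. (\<integral>\<^sup>+x. ennreal (k * S x * v x) * (if dist x z < r then ennreal (g z powr p * v z) else 0) \<partial>lborel) \<partial>lborel)"
    by (rule lborel_pair.Fubini') measurable
  also have "\<dots> \<le> (\<integral>\<^sup>+z. ennreal avg_const * ennreal (g z powr p * v z) \<partial>lborel)"
  proof (rule nn_integral_mono)
    fix z
    have "(\<integral>\<^sup>+x. ennreal (k * S x * v x) * (if dist x z < r then ennreal (g z powr p * v z) else 0) \<partial>lborel)
      \<le> (\<integral>\<^sup>+x. ennreal (k * dual_mass z (2 * r) powr (p - 1)) * ennreal (g z powr p * v z) * (if dist z x < r then ennreal (v x) else 0) \<partial>lborel)"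
    proof (rule nn_integral_mono)
      fix x
      show "ennreal (k * S x * v x) * (if dist x z < r then ennreal (g z powr p * v z) else 0) \<le>
        ennreal (k * dual_mass z (2 * r) powr (p - 1)) * ennreal (g z powr p * v z) * (if dist z x < r then ennreal (v x) else 0)"
      proof (cases "dist x z < r")
        case True
        have "S x \<le> dual_mass z (2 * r) powr (p - 1)"
          unfolding S_def using dual_mass_mono[OF r True] p_gt_1 mass_nonneg by (intro powr_mono2) auto
        then have "ennreal (k * S x * v x) \<le> ennreal (k * dual_mass z (2 * r) powr (p - 1) * v x)"
          using k v_pos[of x] by (intro ennreal_leI mult_right_mono mult_left_mono) auto
        then have "ennreal (k * S x * v x) * ennreal (g z powr p * v z) \<le>
            ennreal (k * dual_mass z (2 * r) powr (p - 1) * v x) * ennreal (g z powr p * v z)"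
          by (rule mult_right_mono) simp
        also have "\<dots> = ennreal (k * dual_mass z (2 * r) powr (p - 1)) * ennreal (g z powr p * v z) * ennreal (v x)"
          using k v_pos[of x] by (simp add: ennreal_mult mult_ac)
        finally show ?thesis using True by (simp add: dist_commute)
      qed simp
    qed
    also have "\<dots> = ennreal (k * dual_mass z (2 * r) powr (p - 1)) * ennreal (g z powr p * v z) * ennreal (mass z r)"
      using mass_eq[OF r, of z] by (subst nn_integral_cmult) auto
    also have "\<dots> = ennreal (k * (mass z r * dual_mass z (2 * r) powr (p - 1))) * ennreal (g z powr p * v z)"
      using k mass_nonneg by (simp add: ennreal_mult mult_ac)
    also have "\<dots> \<le> ennreal avg_const * ennreal (g z powr p * v z)"
    proof (intro mult_right_mono ennreal_leI)
      \<comment> \<open>The mass is enlarged as well, so that both factors refer to the same ball;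
        this is where the factor 2^n in \<open>avg_const\<close> comes from.\<close>
      have "mass z r * dual_mass z (2 * r) powr (p - 1) \<le> mass z (2 * r) * dual_mass z (2 * r) powr (p - 1)"
        using r by (intro mult_right_mono mass_mono) auto
      also have "\<dots> \<le> A * ((2 * r) ^ CARD('n)) powr p"
        unfolding mass_def dual_mass_def using r by (intro ap) auto
      finally have "k * (mass z r * dual_mass z (2 * r) powr (p - 1)) \<le> k * (A * ((2 * r) ^ CARD('n)) powr p)"
        using k by (rule mult_left_mono)
      also have "\<dots> = A * (inverse (r ^ CARD('n)) * (2 * r) ^ CARD('n)) powr p"
        using r by (simp add: k_def powr_mult mult_ac)
      also have "inverse (r ^ CARD('n)) * (2 * r) ^ CARD('n) = 2 ^ CARD('n)"
        using r by (simp add: power_mult_distrib)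
      finally show "k * (mass z r * dual_mass z (2 * r) powr (p - 1)) \<le> avg_const" by (simp add: avg_const_def)
    qed simp
    finally show "(\<integral>\<^sup>+x. ennreal (k * S x * v x) * (if dist x z < r then ennreal (g z powr p * v z) else 0) \<partial>lborel)
      \<le> ennreal avg_const * ennreal (g z powr p * v z)" .
  qed
  also have "\<dots> = ennreal avg_const * (\<integral>\<^sup>+x. ennreal (g x powr p * v x) \<partial>lborel)"
    by (rule nn_integral_cmult) measurable
  finally show ?thesis .
qed

lemma nn_integral_finite_AE:
  fixes H :: "real^'n \<Rightarrow> ennreal"
  assumes [measurable]: "H \<in> borel_measurable borel" and "(\<integral>\<^sup>+x. ennreal (v x) * H x \<partial>lborel) < \<infinity>"
  shows "AE x in lborel. H x < \<infinity>"
proof -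
  have "AE x in lborel. ennreal (v x) * H x \<noteq> \<infinity>"
    using assms(2) by (intro nn_integral_PInf_AE) auto
  then show ?thesis
  proof eventually_elim
    case (elim x)
    then show ?case using v_pos[of x] by (auto simp: ennreal_mult_eq_top_iff less_top ennreal_eq_0_iff)
  qed
qed

text \<open>The difference V (x + r y) - V x is an integral of the gradient along a segment.
  Averaging over \<open>y\<close> and exchanging the integrals produces averages at all scales
  \<open>t * r\<close> with t in (0, 1), which are collected here.\<close>

definition line_avg :: "(real^'n \<Rightarrow> real) \<Rightarrow> real \<Rightarrow> real^'n \<Rightarrow> ennreal" where
  "line_avg g r x = (\<integral>\<^sup>+t. (if 0 < t \<and> t < 1 then avg g (t * r) x else 0) \<partial>lborel)"

text \<open>\<open>avg_bound\<close> is uniform in the radius, so integration over the scale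
  \<open>t\<close> keeps the constant: the Hoelder inequality on (0, 1) with weight 1 moves the p-th
  power inside, and Fubini reduces to a single scale.\<close>

lemma line_avg_bound:
  assumes [measurable]: "g \<in> borel_measurable borel" and g: "\<And>x. 0 \<le> g x" and r: "0 < r"
    and fin: "(\<integral>\<^sup>+x. ennreal (g x powr p * v x) \<partial>lborel) < \<infinity>"
  shows "AE x in lborel. line_avg g r x < \<infinity>"
    and "(\<integral>\<^sup>+x. ennreal (enn2real (line_avg g r x) powr p * v x) \<partial>lborel)
      \<le> ennreal avg_const * (\<integral>\<^sup>+x. ennreal (g x powr p * v x) \<partial>lborel)"
proof -
  let ?G = "\<integral>\<^sup>+x. ennreal (g x powr p * v x) \<partial>lborel"
  define F where "F t x = enn2real (avg g (t * r) x)" for t x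
  have [measurable]: "(\<lambda>q. avg g (fst q * r) (snd q)) \<in> borel_measurable (borel \<Otimes>\<^sub>M borel)"
    unfolding avg_def by measurable
  have F_meas2 [measurable]: "(\<lambda>q. F (fst q) (snd q)) \<in> borel_measurable (borel \<Otimes>\<^sub>M borel)"
    unfolding F_def by measurable
  have [measurable]: "(\<lambda>q. avg g (snd q * r) (fst q)) \<in> borel_measurable (borel \<Otimes>\<^sub>M borel)"
    unfolding avg_def by measurable
  have [measurable]: "(\<lambda>q. F (snd q) (fst q)) \<in> borel_measurable (borel \<Otimes>\<^sub>M borel)"
    unfolding F_def by measurable
  have [measurable]: "(\<lambda>t. F t x) \<in> borel_measurable borel" for x
    using measurable_compose[OF measurable_Pair2'[of x borel borel] F_meas2] by simp
  have [measurable]: "F t \<in> borel_measurable borel" for t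
    unfolding F_def by measurable
  have FF: "avg g (t * r) x = ennreal (F t x)" if "0 < t" for t x
    unfolding F_def using that r
    by (intro ennreal_enn2real[symmetric] avg_pointwise(1)[OF assms(1) g _ fin, unfolded infinity_ennreal_def]) auto
  \<comment> \<open>The integral over \<open>t\<close> of the p-th powers. Its weighted integral is
    finite, so it is finite almost everywhere, and it dominates the p-th power of
    \<open>line_avg\<close> there.\<close>
  define H where "H x = (\<integral>\<^sup>+t. (if 0 < t \<and> t < 1 then ennreal (F t x powr p) else 0) \<partial>lborel)" for x
  have [measurable]: "H \<in> borel_measurable borel" unfolding H_def by measurable
  have H: "(\<integral>\<^sup>+x. ennreal (v x) * H x \<partial>lborel) \<le> ennreal avg_const * ?G"
  proof -
    have "(\<integral>\<^sup>+x. ennreal (v x) * H x \<partial>lborel) =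
        (\<integral>\<^sup>+x. (\<integral>\<^sup>+t. ennreal (v x) * (if 0 < t \<and> t < 1 then ennreal (F t x powr p) else 0) \<partial>lborel) \<partial>lborel)"
      unfolding H_def by (subst nn_integral_cmult) auto
    also have "\<dots> = (\<integral>\<^sup>+t. (\<integral>\<^sup>+x. ennreal (v x) * (if 0 < t \<and> t < 1 then ennreal (F t x powr p) else 0) \<partial>lborel) \<partial>lborel)"
      by (rule lborel_pair.Fubini') measurable
    also have "\<dots> \<le> (\<integral>\<^sup>+t. (ennreal avg_const * ?G) * indicator {0<..<1::real} t \<partial>lborel)"
    proof (rule nn_integral_mono)
      fix t :: real
      show "(\<integral>\<^sup>+x. ennreal (v x) * (if 0 < t \<and> t < 1 then ennreal (F t x powr p) else 0) \<partial>lborel)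
        \<le> (ennreal avg_const * ?G) * indicator {0<..<1} t"
      proof (cases "0 < t \<and> t < 1")
        case True
        have "(\<integral>\<^sup>+x. ennreal (F t x powr p * v x) \<partial>lborel) \<le> ennreal avg_const * ?G"
          unfolding F_def using True r by (intro avg_bound[OF assms(1) g _ fin]) auto
        moreover have "ennreal (v x) * ennreal (F t x powr p) = ennreal (F t x powr p * v x)" for x
          using v_pos[of x] by (simp add: ennreal_mult mult.commute)
        ultimately show ?thesis using True by simp
      qed auto
    qed
    also have "\<dots> = ennreal avg_const * ?G"
      by (subst nn_integral_cmult) auto
    finally show ?thesis .
  qed
  then have Hfin: "AE x in lborel. H x < \<infinity>"
  proof (intro nn_integral_finite_AE)
    have "ennreal avg_const * ?G < \<infinity>" using fin by (simp add: ennreal_mult_less_top)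
    with H show "(\<integral>\<^sup>+x. ennreal (v x) * H x \<partial>lborel) < \<infinity>" by (rule order_le_less_trans)
  qed measurable
  have key: "line_avg g r x < \<infinity> \<and> ennreal (enn2real (line_avg g r x) powr p) \<le> H x" if Hx: "H x < \<infinity>" for x
  proof -
    obtain a where a: "H x = ennreal a" "0 \<le> a" using Hx by (cases "H x") auto
    let ?M = "restrict_space lborel {t::real. 0 < t \<and> t < 1}"
    have ms: "{t::real. 0 < t \<and> t < 1} \<inter> space lborel \<in> sets lborel" by measurable
    have restr: "(\<integral>\<^sup>+t. ennreal (f t) \<partial>?M) = (\<integral>\<^sup>+t. (if 0 < t \<and> t < 1 then ennreal (f t) else 0) \<partial>lborel)" for f
      using ms by (subst nn_integral_restrict_space) (auto intro!: nn_integral_cong simp: indicator_def)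
    have "(\<integral>\<^sup>+t. ennreal (F t x) \<partial>?M) \<le> ennreal (a powr (1 / p) * 1 powr (1 - 1 / p))"
    proof (rule nn_integral_holder[where W="\<lambda>_. 1" and p=p])
      show "(\<integral>\<^sup>+t. ennreal (F t x powr p * 1) \<partial>?M) \<le> ennreal a"
        unfolding restr mult_1_right using a by (simp add: H_def)
      have "(\<integral>\<^sup>+t. (if 0 < t \<and> t < (1::real) then ennreal 1 else 0) \<partial>lborel) = (\<integral>\<^sup>+t. indicator {0<..<1::real} t \<partial>lborel)"
        by (rule nn_integral_cong) (auto simp: indicator_def)
      then show "(\<integral>\<^sup>+t. ennreal (1 powr (1 / (1 - p))) \<partial>?M) \<le> ennreal 1"
        unfolding restr powr_one_eq_one by simp
      show "(\<lambda>t. F t x) \<in> borel_measurable ?M" by (rule measurable_restrict_space1) measurable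
      show "0 \<le> F t x" for t by (simp add: F_def)
    qed (use p_gt_1 a in auto)
    moreover have "(\<integral>\<^sup>+t. ennreal (F t x) \<partial>?M) = line_avg g r x"
      unfolding restr line_avg_def by (rule nn_integral_cong) (auto simp: FF)
    ultimately have le: "line_avg g r x \<le> ennreal (a powr (1 / p))" by simp
    then have "line_avg g r x < \<infinity>" by (metis ennreal_less_top infinity_ennreal_def order_le_less_trans)
    moreover have "enn2real (line_avg g r x) powr p \<le> (a powr (1 / p)) powr p"
      using enn2real_mono[OF le] p_pos by (intro powr_mono2) auto
    ultimately show ?thesis using a p_pos by (simp add: powr_powr ennreal_leI)
  qed
  show "AE x in lborel. line_avg g r x < \<infinity>" using Hfin by eventually_elim (use key in blast)
  have "(\<integral>\<^sup>+x. ennreal (enn2real (line_avg g r x) powr p * v x) \<partial>lborel) \<le> (\<integral>\<^sup>+x. ennreal (v x) * H x \<partial>lborel)"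
  proof (rule nn_integral_mono_AE, use Hfin in eventually_elim)
    case (elim x)
    have "ennreal (enn2real (line_avg g r x) powr p) * ennreal (v x) \<le> H x * ennreal (v x)"
      using key[OF elim] by (intro mult_right_mono) auto
    then show ?case using v_pos[of x] by (simp add: ennreal_mult mult.commute)
  qed
  with H show "(\<integral>\<^sup>+x. ennreal (enn2real (line_avg g r x) powr p * v x) \<partial>lborel) \<le> ennreal avg_const * ?G"
    by (rule order_trans[rotated])
qed

end

section \<open>Weighted Lp convergence of mollifications\<close>

text \<open>Functions in the space matter on \<open>D\<close> only and are arbitrary elsewhere, so
  measurability is asked of the truncated function.\<close>

definition meas_on :: "'a::euclidean_space set \<Rightarrow> ('a \<Rightarrow> real) \<Rightarrow> bool" where
  "meas_on K f \<longleftrightarrow> (\<lambda>x. indicator K x * f x) \<in> borel_measurable lebesgue"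

lemma meas_on_diff: "meas_on K f \<Longrightarrow> meas_on K g \<Longrightarrow> meas_on K (\<lambda>x. f x - g x)"
  unfolding meas_on_def by (simp add: right_diff_distrib)

lemma meas_on_cmult: "meas_on K f \<Longrightarrow> meas_on K (\<lambda>x. c * f x)"
  unfolding meas_on_def by (simp add: mult.left_commute)

lemma meas_on_borel: "f \<in> borel_measurable borel \<Longrightarrow> K \<in> sets lebesgue \<Longrightarrow> meas_on K f"
  unfolding meas_on_def
  by (intro borel_measurable_times borel_imp_lebesgue_measurable[of f] borel_measurable_indicator)

lemma meas_on_subset:
  assumes "meas_on L f" "K \<subseteq> L" "K \<in> sets lebesgue"
  shows "meas_on K f"
proof -
  have "(\<lambda>x. indicator K x * (indicator L x * f x)) \<in> borel_measurable lebesgue"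
    using assms(3) by (intro borel_measurable_times[OF _ assms(1)[unfolded meas_on_def]]) auto
  moreover have "(\<lambda>x. indicator K x * (indicator L x * f x)) = (\<lambda>x. indicator K x * f x)"
    using assms(2) by (intro ext) (auto simp: indicator_def)
  ultimately show ?thesis by (simp add: meas_on_def)
qed

context ap_weight
begin

text \<open>The p-th power of the weighted norm over \<open>K\<close>. Integration over
  \<open>lborel\<close> connects it with the Borel estimates above; by \<open>E_eq\<close> the value
  is the same over \<open>lebesgue\<close>.\<close>

definition E :: "(real^'n) set \<Rightarrow> (real^'n \<Rightarrow> real) \<Rightarrow> ennreal" where
  "E K f = (\<integral>\<^sup>+x. ennreal (indicator K x * (\<bar>f x\<bar> powr p * v x)) \<partial>lborel)"

text \<open>Multiplication by v^(1/p) maps the weighted space isometrically into the unweighted one;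
  the facts about \<open>Ep\<close> are transferred along it.\<close>

definition wt :: "(real^'n) set \<Rightarrow> (real^'n \<Rightarrow> real) \<Rightarrow> real^'n \<Rightarrow> real" where
  "wt K f x = indicator K x * f x * v x powr (1 / p)"

lemma v_lebesgue [measurable]: "v \<in> borel_measurable lebesgue"
  by (rule borel_imp_lebesgue_measurable) measurable

lemma wt_powr: "\<bar>wt K f x\<bar> powr p = indicator K x * (\<bar>f x\<bar> powr p * v x)"
  using v_pos[of x] p_pos by (simp add: wt_def abs_mult powr_mult powr_powr indicator_def)

lemma E_eq: "E K f = Ep p lebesgue (wt K f)"
  unfolding E_def Ep_def wt_powr by (simp add: nn_integral_completion)

lemma wt_measurable:
  assumes "meas_on K f" shows "wt K f \<in> borel_measurable lebesgue"
proof -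
  have "(\<lambda>x. v x powr (1 / p)) \<in> borel_measurable lebesgue" by measurable
  from borel_measurable_times[OF assms[unfolded meas_on_def] this] show ?thesis
    by (simp add: wt_def[abs_def])
qed

lemma E_add: "meas_on K f \<Longrightarrow> meas_on K g \<Longrightarrow>
    E K (\<lambda>x. f x + g x) \<le> ennreal (2 powr p) * (E K f + E K g)"
  using Ep_add[OF wt_measurable wt_measurable p_pos, of K f K g]
  by (simp add: E_eq wt_def[abs_def] algebra_simps)

lemma E_cmult: "meas_on K f \<Longrightarrow> E K (\<lambda>x. c * f x) = ennreal (\<bar>c\<bar> powr p) * E K f"
  using Ep_cmult[OF wt_measurable, of K f p c]
  by (simp add: E_eq wt_def[abs_def] algebra_simps)

lemma E_minus: "E K (\<lambda>x. - f x) = E K f"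
  by (simp add: E_def)

lemma E_commute: "E K (\<lambda>x. f x - g x) = E K (\<lambda>x. g x - f x)"
  by (simp add: E_def abs_minus_commute)

lemma E_triangle:
  assumes "meas_on K f" "meas_on K g" "meas_on K h"
  shows "E K (\<lambda>x. f x - h x) \<le> ennreal (2 powr p) * (E K (\<lambda>x. f x - g x) + E K (\<lambda>x. g x - h x))"
  using E_add[OF meas_on_diff[OF assms(1,2)] meas_on_diff[OF assms(2,3)]] by simp

lemma E_mono: "(\<And>x. x \<in> K \<Longrightarrow> \<bar>f x\<bar> \<le> \<bar>g x\<bar>) \<Longrightarrow> E K f \<le> E K g"
  unfolding E_def using v_pos p_pos
  by (intro nn_integral_mono ennreal_leI) (auto simp: indicator_def less_imp_le intro!: mult_right_mono powr_mono2)

lemma E_mono_set: "K \<subseteq> L \<Longrightarrow> E K f \<le> E L f"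
  unfolding E_def using v_pos
  by (intro nn_integral_mono ennreal_leI) (auto simp: indicator_def less_imp_le)

lemma E_cong_AE: "AE x in lebesgue. x \<in> K \<longrightarrow> f x = g x \<Longrightarrow> E K f = E K g"
  unfolding E_eq by (rule Ep_cong) (auto elim!: eventually_mono simp: wt_def indicator_def)

lemma E_cong: "(\<And>x. x \<in> K \<Longrightarrow> f x = g x) \<Longrightarrow> E K f = E K g"
  by (rule E_cong_AE) auto

lemma E_indicator: "K \<subseteq> L \<Longrightarrow> E L (\<lambda>x. indicator K x * f x) = E K f"
  unfolding E_def by (rule nn_integral_cong) (auto simp: indicator_def)

lemma E_zero_iff: "meas_on K f \<Longrightarrow> E K f = 0 \<longleftrightarrow> (AE x in lebesgue. x \<in> K \<longrightarrow> f x = 0)"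
  using Ep_zero_iff[OF wt_measurable, of K f p] v_pos
  by (auto simp: E_eq wt_def indicator_def elim!: eventually_mono) (metis less_irrefl)+

lemma powr_sum_le:
  fixes a :: "'i \<Rightarrow> real"
  assumes "finite I"
  shows "(\<Sum>i\<in>I. \<bar>a i\<bar>) powr p \<le> real (card I) powr p * (\<Sum>i\<in>I. \<bar>a i\<bar> powr p)"
proof (cases "I = {}")
  case False
  define m where "m = Max ((\<lambda>i. \<bar>a i\<bar>) ` I)"
  have "m \<in> (\<lambda>i. \<bar>a i\<bar>) ` I" unfolding m_def using assms False by (intro Max_in) auto
  then obtain j where j: "j \<in> I" "m = \<bar>a j\<bar>" by blast
  have "(\<Sum>i\<in>I. \<bar>a i\<bar>) \<le> real (card I) * m"
    using assms by (intro sum_bounded_above) (auto simp: m_def)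
  then have "(\<Sum>i\<in>I. \<bar>a i\<bar>) powr p \<le> (real (card I) * m) powr p"
    using p_pos by (intro powr_mono2 sum_nonneg) auto
  also have "\<dots> = real (card I) powr p * \<bar>a j\<bar> powr p" by (simp add: powr_mult j(2))
  also have "\<bar>a j\<bar> powr p \<le> (\<Sum>i\<in>I. \<bar>a i\<bar> powr p)"
    using assms j by (intro member_le_sum) auto
  finally show ?thesis by (simp add: mult_left_mono)
qed simp

lemma E_sum_le:
  assumes I: "finite I" and f: "\<And>i. i \<in> I \<Longrightarrow> meas_on K (f i)"
  shows "E K (\<lambda>x. \<Sum>i\<in>I. \<bar>f i x\<bar>) \<le> ennreal (real (card I) powr p) * (\<Sum>i\<in>I. E K (f i))"
proof -
  have m: "(\<lambda>x. ennreal (\<bar>wt K (f i) x\<bar> powr p)) \<in> borel_measurable lebesgue" if "i \<in> I" for i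
    using wt_measurable[OF f[OF that]] by measurable
  have "E K (\<lambda>x. \<Sum>i\<in>I. \<bar>f i x\<bar>) \<le>
      (\<integral>\<^sup>+x. ennreal (real (card I) powr p) * (\<Sum>i\<in>I. ennreal (\<bar>wt K (f i) x\<bar> powr p)) \<partial>lebesgue)"
    unfolding E_eq Ep_def
  proof (rule nn_integral_mono)
    fix x
    have "(\<Sum>i\<in>I. \<bar>f i x\<bar>) powr p * v x \<le> real (card I) powr p * (\<Sum>i\<in>I. \<bar>f i x\<bar> powr p) * v x"
      using powr_sum_le[OF I] v_pos[of x] by (intro mult_right_mono) auto
    then have "\<bar>wt K (\<lambda>x. \<Sum>i\<in>I. \<bar>f i x\<bar>) x\<bar> powr p \<le> real (card I) powr p * (\<Sum>i\<in>I. \<bar>wt K (f i) x\<bar> powr p)"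
      unfolding wt_powr by (auto simp: indicator_def sum_nonneg sum_distrib_right sum_distrib_left mult.assoc)
    then show "ennreal (\<bar>wt K (\<lambda>x. \<Sum>i\<in>I. \<bar>f i x\<bar>) x\<bar> powr p) \<le>
        ennreal (real (card I) powr p) * (\<Sum>i\<in>I. ennreal (\<bar>wt K (f i) x\<bar> powr p))"
      by (simp add: ennreal_leI sum_nonneg flip: ennreal_mult')
  qed
  also have "\<dots> = ennreal (real (card I) powr p) * (\<Sum>i\<in>I. E K (f i))"
  proof -
    have m2: "(\<lambda>x. \<Sum>i\<in>I. ennreal (\<bar>wt K (f i) x\<bar> powr p)) \<in> borel_measurable lebesgue"
      by (intro borel_measurable_sum m)
    show ?thesis by (simp only: nn_integral_cmult[OF m2] nn_integral_sum[OF m] E_eq Ep_def)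
  qed
  finally show ?thesis .
qed

lemma E_compact_finite:
  assumes K: "compact K" and f: "\<And>x. x \<in> K \<Longrightarrow> \<bar>f x\<bar> \<le> M"
  shows "E K f < \<infinity>"
proof -
  obtain R where R: "R > 0" "\<And>x. x \<in> K \<Longrightarrow> norm x < R"
    using compact_imp_bounded[OF K] by (metis bounded_pos_less)
  have "E K f \<le> (\<integral>\<^sup>+x. ennreal (M powr p) * (if dist 0 x < R then ennreal (v x) else 0) \<partial>lborel)"
    unfolding E_def
  proof (rule nn_integral_mono)
    fix x
    show "ennreal (indicator K x * (\<bar>f x\<bar> powr p * v x)) \<le> ennreal (M powr p) * (if dist 0 x < R then ennreal (v x) else 0)"
    proof (cases "x \<in> K")
      case True
      have "\<bar>f x\<bar> powr p * v x \<le> M powr p * v x"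
        using f[OF True] v_pos[of x] p_pos by (intro mult_right_mono powr_mono2) auto
      then show ?thesis using True R(2)[OF True] v_pos[of x] by (simp flip: ennreal_mult' add: ennreal_leI)
    qed simp
  qed
  also have "\<dots> = ennreal (M powr p) * ennreal (mass 0 R)"
    using mass_eq[OF R(1), of 0] by (subst nn_integral_cmult) auto
  also have "\<dots> < \<infinity>" by (simp flip: ennreal_mult')
  finally show ?thesis .
qed

lemma E_continuous_finite:
  assumes K: "compact K" and f: "continuous_on K f"
  shows "E K f < \<infinity>"
proof -
  have "bounded (f ` K)" using assms by (intro compact_imp_bounded compact_continuous_image)
  then obtain M where "\<forall>x\<in>K. \<bar>f x\<bar> \<le> M" by (auto simp: bounded_iff)
  then show ?thesis by (intro E_compact_finite[OF K]) auto
qed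

text \<open>The dual weight has finite integral over balls, so on a compact set the weighted energy
  controls the L1 norm. This gives local summability and the convergence of pairings with test
  functions.\<close>

lemma holder_compact:
  assumes K: "compact K"
  obtains C where "C \<ge> 0" "\<And>f e. meas_on K f \<Longrightarrow> 0 \<le> e \<Longrightarrow> E K f \<le> ennreal e \<Longrightarrow>
    (\<integral>\<^sup>+x. ennreal \<bar>indicator K x * f x\<bar> \<partial>lebesgue) \<le> ennreal (C * e powr (1 / p))"
proof -
  obtain R where R: "R > 0" "\<And>x. x \<in> K \<Longrightarrow> norm x < R"
    using compact_imp_bounded[OF K] by (metis bounded_pos_less)
  let ?M = "restrict_space lebesgue {z. dist 0 z < R}"
  have ms: "{z::real^'n. dist 0 z < R} \<inter> space lebesgue \<in> sets lebesgue"
    using lmeasurable_ball[of "0::real^'n" R] by (simp add: ball_def fmeasurable_def)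
  have restr: "(\<integral>\<^sup>+z. ennreal (f z) \<partial>?M) = (\<integral>\<^sup>+z. (if dist 0 z < R then ennreal (f z) else 0) \<partial>lebesgue)" for f
    using ms by (subst nn_integral_restrict_space) (auto intro!: nn_integral_cong simp: indicator_def)
  show thesis
  proof
    show "dual_mass 0 R powr (1 - 1 / p) \<ge> 0" by simp
    fix f e assume f: "meas_on K f" and e: "0 \<le> e" "E K f \<le> ennreal e"
    have "(\<integral>\<^sup>+z. ennreal \<bar>indicator K z * f z\<bar> \<partial>?M) \<le> ennreal (e powr (1 / p) * dual_mass 0 R powr (1 - 1 / p))"
    proof (rule nn_integral_holder[where W=v and p=p])
      have "(\<integral>\<^sup>+z. ennreal (\<bar>indicator K z * f z\<bar> powr p * v z) \<partial>?M) \<le> E K f"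
        unfolding restr E_def nn_integral_completion
        by (rule nn_integral_mono) (use v_pos in \<open>auto simp: indicator_def\<close>)
      then show "(\<integral>\<^sup>+z. ennreal (\<bar>indicator K z * f z\<bar> powr p * v z) \<partial>?M) \<le> ennreal e"
        using e by simp
      show "(\<integral>\<^sup>+z. ennreal (v z powr (1 / (1 - p))) \<partial>?M) \<le> ennreal (dual_mass 0 R)"
        unfolding restr nn_integral_completion using dual_mass_eq[OF R(1), of 0] by simp
    qed (use v_pos p_gt_1 e mass_nonneg f in \<open>auto simp: meas_on_def intro!: measurable_restrict_space1\<close>)
    moreover have "(\<integral>\<^sup>+z. ennreal \<bar>indicator K z * f z\<bar> \<partial>?M) = (\<integral>\<^sup>+x. ennreal \<bar>indicator K x * f x\<bar> \<partial>lebesgue)"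
      unfolding restr by (rule nn_integral_cong) (use R(2) in \<open>auto simp: indicator_def\<close>)
    ultimately show "(\<integral>\<^sup>+x. ennreal \<bar>indicator K x * f x\<bar> \<partial>lebesgue)
        \<le> ennreal (dual_mass 0 R powr (1 - 1 / p) * e powr (1 / p))" by (simp add: mult.commute)
  qed
qed

lemma E_imp_integrable:
  assumes K: "compact K" and f: "meas_on K f" "E K f < \<infinity>"
  shows "integrable lebesgue (\<lambda>x. indicator K x * f x)"
proof (rule integrableI_bounded)
  obtain C where C: "C \<ge> 0" "\<And>f e. meas_on K f \<Longrightarrow> 0 \<le> e \<Longrightarrow> E K f \<le> ennreal e \<Longrightarrow>
    (\<integral>\<^sup>+x. ennreal \<bar>indicator K x * f x\<bar> \<partial>lebesgue) \<le> ennreal (C * e powr (1 / p))"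
    by (rule holder_compact[OF K]) (rule that)
  obtain e where e: "E K f = ennreal e" "0 \<le> e" using f(2) by (cases "E K f") auto
  have "(\<integral>\<^sup>+x. ennreal \<bar>indicator K x * f x\<bar> \<partial>lebesgue) \<le> ennreal (C * e powr (1 / p))"
    using e by (intro C(2) f) auto
  then show "(\<integral>\<^sup>+x. ennreal (norm (indicator K x * f x)) \<partial>lebesgue) < \<infinity>"
    by (simp add: order_le_less_trans)
  show "(\<lambda>x. indicator K x * f x) \<in> borel_measurable lebesgue" using f(1) by (simp add: meas_on_def)
qed

lemma E_tendsto_L1:
  assumes K: "compact K" and f: "\<And>n. meas_on K (f n)" and lim: "((\<lambda>n. E K (f n)) \<longlongrightarrow> 0) F"
  shows "((\<lambda>n. \<integral>\<^sup>+x. ennreal \<bar>indicator K x * f n x\<bar> \<partial>lebesgue) \<longlongrightarrow> 0) F"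
proof (rule ennreal_tendsto_0I)
  fix e :: real assume e: "e > 0"
  obtain C where C: "C \<ge> 0" "\<And>f e. meas_on K f \<Longrightarrow> 0 \<le> e \<Longrightarrow> E K f \<le> ennreal e \<Longrightarrow>
    (\<integral>\<^sup>+x. ennreal \<bar>indicator K x * f x\<bar> \<partial>lebesgue) \<le> ennreal (C * e powr (1 / p))"
    by (rule holder_compact[OF K]) (rule that)
  define d where "d = (e / (C + 1)) powr p"
  have d: "d > 0" using e C(1) by (simp add: d_def)
  have Cd: "C * d powr (1 / p) \<le> e"
    using e C(1) p_pos by (simp add: d_def powr_powr field_simps)
  show "\<forall>\<^sub>F n in F. (\<integral>\<^sup>+x. ennreal \<bar>indicator K x * f n x\<bar> \<partial>lebesgue) \<le> ennreal e"
  proof (rule eventually_mono[OF ennreal_tendsto_0D[OF lim d]])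
    fix n assume n: "E K (f n) \<le> ennreal d"
    have "(\<integral>\<^sup>+x. ennreal \<bar>indicator K x * f n x\<bar> \<partial>lebesgue) \<le> ennreal (C * d powr (1 / p))"
      using d n by (intro C(2) f) auto
    also have "\<dots> \<le> ennreal e" by (rule ennreal_leI[OF Cd])
    finally show "(\<integral>\<^sup>+x. ennreal \<bar>indicator K x * f n x\<bar> \<partial>lebesgue) \<le> ennreal e" .
  qed
qed

section \<open>Kernel averages and convergence of mollifications\<close>

definition moll_const :: real where
  "moll_const = (SOME M. M > 0 \<and> (\<forall>x::real^'n. \<bar>mollifier x\<bar> \<le> M))"

lemma moll_const: "moll_const > 0" "\<bar>mollifier (x::real^'n)\<bar> \<le> moll_const"
proof -
  have "\<exists>M. M > 0 \<and> (\<forall>x::real^'n. \<bar>mollifier x\<bar> \<le> M)"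
    by (rule test_function_bounded[OF mollifier_test]) blast
  from someI_ex[OF this] show "moll_const > 0" "\<bar>mollifier (x::real^'n)\<bar> \<le> moll_const"
    by (auto simp: moll_const_def)
qed

lemma integral_kernel_le_avg:
  assumes [measurable]: "f \<in> borel_measurable borel" and \<rho>: "\<rho> \<noteq> 0" and fin: "E UNIV f < \<infinity>"
    and [measurable]: "\<phi> \<in> borel_measurable borel" and \<phi>: "\<And>y. \<bar>\<phi> y\<bar> \<le> M" "\<And>y. 1 \<le> norm y \<Longrightarrow> \<phi> y = 0" and M: "0 \<le> M"
  shows "\<bar>LINT y|lborel. \<phi> y * f (x + \<rho> *\<^sub>R y)\<bar> \<le> M * enn2real (avg (\<lambda>x. \<bar>f x\<bar>) \<rho> x)"
\<comment> \<open>Where the integrand is not integrable, the integral is 0 by convention and the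
  bound is trivial.\<close>
proof (cases "integrable lborel (\<lambda>y. \<phi> y * f (x + \<rho> *\<^sub>R y))")
  case True
  have "avg (\<lambda>x. \<bar>f x\<bar>) \<rho> x < \<infinity>"
    using fin by (intro avg_pointwise(1) \<rho>) (auto simp: E_def)
  then obtain a where a: "avg (\<lambda>x. \<bar>f x\<bar>) \<rho> x = ennreal a" "0 \<le> a" by (cases "avg (\<lambda>x. \<bar>f x\<bar>) \<rho> x") auto
  have "ennreal \<bar>LINT y|lborel. \<phi> y * f (x + \<rho> *\<^sub>R y)\<bar> \<le> (\<integral>\<^sup>+y. ennreal \<bar>\<phi> y * f (x + \<rho> *\<^sub>R y)\<bar> \<partial>lborel)"
    using integral_norm_bound_ennreal[OF True] by simp
  also have "\<dots> \<le> (\<integral>\<^sup>+y. ennreal M * (if norm y < 1 then ennreal \<bar>f (x + \<rho> *\<^sub>R y)\<bar> else 0) \<partial>lborel)"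
  proof (rule nn_integral_mono)
    fix y
    show "ennreal \<bar>\<phi> y * f (x + \<rho> *\<^sub>R y)\<bar> \<le> ennreal M * (if norm y < 1 then ennreal \<bar>f (x + \<rho> *\<^sub>R y)\<bar> else 0)"
    proof (cases "norm y < 1")
      case True
      then show ?thesis using M \<phi>(1)[of y]
        by (simp flip: ennreal_mult' add: abs_mult ennreal_leI mult_right_mono)
    qed (use \<phi>(2) in auto)
  qed
  also have "\<dots> = ennreal M * avg (\<lambda>x. \<bar>f x\<bar>) \<rho> x"
    unfolding avg_def by (rule nn_integral_cmult) measurable
  also have "\<dots> = ennreal (M * a)" using M a by (simp add: ennreal_mult)
  finally show ?thesis using M a by (simp add: ennreal_le_iff)
qed (use M in \<open>simp add: not_integrable_integral_eq\<close>)

lemma E_kernel_bound: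
  assumes [measurable]: "f \<in> borel_measurable borel" and \<rho>: "\<rho> \<noteq> 0"
    and [measurable]: "\<phi> \<in> borel_measurable borel" and \<phi>: "\<And>y. \<bar>\<phi> y\<bar> \<le> M" "\<And>y. 1 \<le> norm y \<Longrightarrow> \<phi> y = 0" and M: "0 < M"
  shows "E UNIV (\<lambda>x. LINT y|lborel. \<phi> y * f (x + \<rho> *\<^sub>R y)) \<le> ennreal (M powr p * (avg_const + 1)) * E UNIV f"
\<comment> \<open>For infinite energy the right-hand side must be infinite too, hence a positive
  factor: \<open>avg_const\<close> may be 0, and the added 1 together with \<open>0 < M\<close>
  excludes a product of 0 and infinity.\<close>
proof (cases "E UNIV f < \<infinity>")
  case False
  then show ?thesis using M avg_const_nonneg by (simp add: less_top[symmetric] ennreal_mult_top not_less top_unique ennreal_top_mult ennreal_mult_eq_top_iff)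
next
  case fin: True
  have g: "(\<integral>\<^sup>+x. ennreal (\<bar>f x\<bar> powr p * v x) \<partial>lborel) = E UNIV f" by (simp add: E_def)
  have "E UNIV (\<lambda>x. LINT y|lborel. \<phi> y * f (x + \<rho> *\<^sub>R y)) \<le>
      (\<integral>\<^sup>+x. ennreal (M powr p) * ennreal (enn2real (avg (\<lambda>x. \<bar>f x\<bar>) \<rho> x) powr p * v x) \<partial>lborel)"
    unfolding E_def
  proof (rule nn_integral_mono)
    fix x
    have "\<bar>LINT y|lborel. \<phi> y * f (x + \<rho> *\<^sub>R y)\<bar> powr p \<le> (M * enn2real (avg (\<lambda>x. \<bar>f x\<bar>) \<rho> x)) powr p"
      using integral_kernel_le_avg[OF assms(1,2) fin assms(3) \<phi>, of x] M p_pos by (intro powr_mono2) auto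
    also have "\<dots> = M powr p * enn2real (avg (\<lambda>x. \<bar>f x\<bar>) \<rho> x) powr p"
      using M by (simp add: powr_mult)
    finally have "\<bar>LINT y|lborel. \<phi> y * f (x + \<rho> *\<^sub>R y)\<bar> powr p * v x \<le>
        M powr p * enn2real (avg (\<lambda>x. \<bar>f x\<bar>) \<rho> x) powr p * v x"
      using v_pos[of x] by (intro mult_right_mono) auto
    then show "ennreal (indicator UNIV x * (\<bar>LINT y|lborel. \<phi> y * f (x + \<rho> *\<^sub>R y)\<bar> powr p * v x)) \<le>
        ennreal (M powr p) * ennreal (enn2real (avg (\<lambda>x. \<bar>f x\<bar>) \<rho> x) powr p * v x)"
      by (simp flip: ennreal_mult' add: ennreal_leI mult.assoc)
  qed
  also have "\<dots> = ennreal (M powr p) * (\<integral>\<^sup>+x. ennreal (enn2real (avg (\<lambda>x. \<bar>f x\<bar>) \<rho> x) powr p * v x) \<partial>lborel)"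
    by (rule nn_integral_cmult) measurable
  also have "\<dots> \<le> ennreal (M powr p) * (ennreal avg_const * E UNIV f)"
    unfolding g[symmetric] using fin by (intro mult_left_mono avg_bound \<rho>) (auto simp: E_def)
  also have "\<dots> \<le> ennreal (M powr p) * (ennreal (avg_const + 1) * E UNIV f)"
    by (intro mult_left_mono mult_right_mono ennreal_leI) auto
  also have "\<dots> = ennreal (M powr p * (avg_const + 1)) * E UNIV f"
    using avg_const_nonneg by (simp add: ennreal_mult mult.assoc)
  finally show ?thesis .
qed

lemma E_mollify_bound:
  assumes "f \<in> borel_measurable borel" "0 < \<epsilon>"
  shows "E UNIV (mollify \<epsilon> f) \<le> ennreal (moll_const powr p * (avg_const + 1)) * E UNIV f"
proof -
  have "mollify \<epsilon> f = (\<lambda>x. LINT y|lborel. mollifier y * f (x + (-\<epsilon>) *\<^sub>R y))"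
    using mollify_eq[OF assms] by auto
  then show ?thesis
    using E_kernel_bound[OF assms(1) _ test_function_measurable[OF mollifier_test] moll_const(2)
        mollifier_zero moll_const(1), of "-\<epsilon>"] assms(2) by simp
qed

lemma mollify_diff:
  assumes "integrable lebesgue f" "integrable lebesgue g" "0 < \<epsilon>"
  shows "mollify \<epsilon> (\<lambda>x. f x - g x) x = mollify \<epsilon> f x - mollify \<epsilon> g x"
  unfolding mollify_def conv_def
  using mollify_integrable[OF assms(1,3), of x] mollify_integrable[OF assms(2,3), of x]
  by (simp add: left_diff_distrib)

text \<open>Truncation of the values of \<open>f\<close>, followed by
  \<open>approx_continuous\<close>; both limits are dominated. In the second the dominating function
  is a constant on a compact set, whose energy is finite since \<open>v\<close> is locally
  integrable.\<close>

lemma approx_continuous_E: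
  assumes f: "f \<in> borel_measurable lebesgue" and K: "compact K" "\<And>x. x \<notin> K \<Longrightarrow> f x = 0"
    and fin: "E UNIV f < \<infinity>" and e: "0 < e"
  obtains g L where "continuous_on UNIV g" "compact L" "\<And>x. x \<notin> L \<Longrightarrow> g x = 0"
    "E UNIV (\<lambda>x. f x - g x) \<le> ennreal e"
proof -
  note [measurable] = f
  have mUNIV: "meas_on UNIV h \<longleftrightarrow> h \<in> borel_measurable lebesgue" for h :: "real^'n \<Rightarrow> real"
    by (simp add: meas_on_def)
  define d where "d = e / (2 * 2 powr p)"
  have d: "d > 0" using e by (simp add: d_def)
  define s where "s n x = (if \<bar>f x\<bar> \<le> real n then f x else 0)" for n :: nat and x
  have s_meas [measurable]: "s n \<in> borel_measurable lebesgue" for n unfolding s_def by measurable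
  have "(\<lambda>n. E UNIV (\<lambda>x. f x - s n x)) \<longlonglongrightarrow> 0"
    unfolding E_eq
  proof (rule Ep_dominated[where g="\<lambda>x. \<bar>wt UNIV f x\<bar>"])
    show "wt UNIV (\<lambda>x. f x - s n x) \<in> borel_measurable lebesgue" for n
      by (rule wt_measurable) (simp add: mUNIV)
    have "wt UNIV f \<in> borel_measurable lebesgue" by (rule wt_measurable) (simp add: mUNIV f)
    then show "(\<lambda>x. \<bar>wt UNIV f x\<bar>) \<in> borel_measurable lebesgue" by measurable
    show "AE x in lebesgue. \<bar>wt UNIV (\<lambda>x. f x - s n x) x\<bar> \<le> \<bar>wt UNIV f x\<bar>" for n
      by (rule AE_I2) (auto simp: wt_def s_def abs_mult)
    show "Ep p lebesgue (\<lambda>x. \<bar>wt UNIV f x\<bar>) < \<infinity>"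
      using fin by (simp add: E_eq Ep_def)
    show "AE x in lebesgue. (\<lambda>n. wt UNIV (\<lambda>x. f x - s n x) x) \<longlonglongrightarrow> 0"
    proof (rule AE_I2)
      fix x
      have "\<forall>\<^sub>F n in sequentially. \<bar>f x\<bar> \<le> real n"
        using real_arch_simple[of "\<bar>f x\<bar>"] unfolding eventually_sequentially
        by (meson of_nat_le_iff order_trans)
      then have "\<forall>\<^sub>F n in sequentially. wt UNIV (\<lambda>x. f x - s n x) x = 0"
        by eventually_elim (simp add: wt_def s_def)
      then show "(\<lambda>n. wt UNIV (\<lambda>x. f x - s n x) x) \<longlonglongrightarrow> 0" by (rule tendsto_eventually)
    qed
  qed (use p_pos in auto)
  from ennreal_tendsto_0D[OF this d] obtain N where N: "E UNIV (\<lambda>x. f x - s N x) \<le> ennreal d"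
    by (auto simp: eventually_sequentially)
  have sb: "\<bar>s N x\<bar> \<le> real N" and s0: "x \<notin> K \<Longrightarrow> s N x = 0" for x
    using K(2)[of x] by (auto simp: s_def)
  obtain g :: "nat \<Rightarrow> real^'n \<Rightarrow> real" and L where g: "\<And>n. continuous_on UNIV (g n)" "\<And>n x. \<bar>g n x\<bar> \<le> real N"
    "compact L" "L \<subseteq> UNIV" "\<And>n x. x \<notin> L \<Longrightarrow> g n x = 0" "AE x in lebesgue. (\<lambda>n. g n x) \<longlonglongrightarrow> s N x"
    by (rule approx_continuous[OF s_meas sb K(1) _ open_UNIV subset_UNIV], erule s0, rule that)
  have g_meas [measurable]: "g n \<in> borel_measurable lebesgue" for n
    by (rule borel_imp_lebesgue_measurable, rule borel_measurable_continuous_onI, rule g)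
  have LK: "compact (L \<union> K)" using g(3) K(1) by auto
  have LKs: "L \<union> K \<in> sets lebesgue" using lmeasurable_compact[OF LK] by (simp add: fmeasurable_def)
  have "(\<lambda>n. E UNIV (\<lambda>x. s N x - g n x)) \<longlonglongrightarrow> 0"
    unfolding E_eq
  proof (rule Ep_dominated[where g="wt (L \<union> K) (\<lambda>_. 2 * real N)"])
    show "wt UNIV (\<lambda>x. s N x - g n x) \<in> borel_measurable lebesgue" for n
      by (rule wt_measurable) (simp add: mUNIV)
    show "wt (L \<union> K) (\<lambda>_. 2 * real N) \<in> borel_measurable lebesgue"
      by (rule wt_measurable) (use LKs in \<open>simp add: meas_on_def\<close>)
    show "AE x in lebesgue. \<bar>wt UNIV (\<lambda>x. s N x - g n x) x\<bar> \<le> wt (L \<union> K) (\<lambda>_. 2 * real N) x" for n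
    proof (rule AE_I2)
      fix x
      have "\<bar>s N x - g n x\<bar> \<le> indicator (L \<union> K) x * (2 * real N)"
        using sb[of x] g(2)[of n x] s0[of x] g(5)[of x n] by (auto simp: indicator_def)
      then show "\<bar>wt UNIV (\<lambda>x. s N x - g n x) x\<bar> \<le> wt (L \<union> K) (\<lambda>_. 2 * real N) x"
        unfolding wt_def by (simp add: abs_mult mult_right_mono)
    qed
    show "Ep p lebesgue (wt (L \<union> K) (\<lambda>_. 2 * real N)) < \<infinity>"
      unfolding E_eq[symmetric] by (rule E_compact_finite[OF LK, of _ "2 * real N"]) simp
    show "AE x in lebesgue. (\<lambda>n. wt UNIV (\<lambda>x. s N x - g n x) x) \<longlonglongrightarrow> 0"
      using g(6)
    proof eventually_elim
      case (elim x)
      have "(\<lambda>n. indicator UNIV x * (s N x - g n x) * v x powr (1 / p)) \<longlonglongrightarrow>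
          indicator UNIV x * (s N x - s N x) * v x powr (1 / p)"
        by (intro tendsto_intros elim)
      then show ?case by (simp add: wt_def)
    qed
  qed (use p_pos in auto)
  from ennreal_tendsto_0D[OF this d] obtain k where k: "E UNIV (\<lambda>x. s N x - g k x) \<le> ennreal d"
    by (auto simp: eventually_sequentially)
  show thesis
  proof (rule that[OF g(1,3), of k])
    show "g k x = 0" if "x \<notin> L" for x using g(5)[OF that] .
    have "E UNIV (\<lambda>x. f x - g k x) \<le> ennreal (2 powr p) * (E UNIV (\<lambda>x. f x - s N x) + E UNIV (\<lambda>x. s N x - g k x))"
      by (rule E_triangle) (simp_all add: mUNIV f)
    also have "\<dots> \<le> ennreal (2 powr p) * (ennreal d + ennreal d)"
      by (intro mult_left_mono add_mono N k) auto
    also have "\<dots> = ennreal e"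
      using d by (simp add: d_def flip: ennreal_mult' ennreal_plus)
    finally show "E UNIV (\<lambda>x. f x - g k x) \<le> ennreal e" .
  qed
qed

lemma E_mollify_continuous:
  assumes g: "continuous_on UNIV g" and L: "compact L" "\<And>x. x \<notin> L \<Longrightarrow> g x = 0" and e: "0 < e"
  obtains \<delta> where "0 < \<delta>" "\<And>\<epsilon>. 0 < \<epsilon> \<Longrightarrow> \<epsilon> < \<delta> \<Longrightarrow> E UNIV (\<lambda>x. mollify \<epsilon> g x - g x) \<le> ennreal e"
proof -
  define L' where "L' = (\<Union>x\<in>L. cball x 1)"
  have L': "compact L'" unfolding L'_def by (rule compact_minkowski_sum_cball[OF L(1)])
  have L's: "L' \<in> sets lebesgue" using lmeasurable_compact[OF L'] by (simp add: fmeasurable_def)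
  have "E L' (\<lambda>_. 1) < \<infinity>" by (rule E_compact_finite[OF L', of _ 1]) simp
  then obtain m where m: "E L' (\<lambda>_. 1) = ennreal m" "0 \<le> m" by (cases "E L' (\<lambda>_. 1)") auto
  \<comment> \<open>A uniform error \<open>d\<close> on the compact set \<open>L'\<close> has energy
    at most \<open>d powr p * m\<close>, which this choice keeps below \<open>e\<close>; the added 1
    avoids a division by zero.\<close>
  define d where "d = (e / (m + 1)) powr (1 / p)"
  have d: "d > 0" using e m by (simp add: d_def)
  obtain \<delta> where \<delta>: "0 < \<delta>" "\<And>x z. dist x z < \<delta> \<Longrightarrow> \<bar>g x - g z\<bar> < d"
    by (rule uniform_continuity_compact_support[OF g L(1) _ d], erule L(2), rule that)
  have int: "integrable lebesgue g" by (rule continuous_compact_support_integrable[OF g L(1)]) (rule L(2))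
  show thesis
  proof (rule that[of "min \<delta> 1"])
    fix \<epsilon> :: real assume \<epsilon>: "0 < \<epsilon>" "\<epsilon> < min \<delta> 1"
    have 1: "\<bar>mollify \<epsilon> g x - g x\<bar> \<le> d" for x
      by (rule mollify_near[OF int \<epsilon>(1)]) (use \<delta>(2)[of _ x] \<epsilon>(2) in \<open>force simp: dist_commute less_imp_le\<close>)
    have 2: "mollify \<epsilon> g x - g x = 0" if x: "x \<notin> L'" for x
    proof -
      have "z \<notin> L" if "dist x z \<le> 1" for z
        using x that unfolding L'_def by (auto simp: dist_commute)
      then have "g z = 0" if "dist x z \<le> 1" for z using that L(2) by blast
      moreover from this[of x] have "g x = 0" by simp
      moreover have "\<bar>mollify \<epsilon> g x - 0\<bar> \<le> 0"
        using \<epsilon> calculation(1) by (intro mollify_near[OF int \<epsilon>(1)]) auto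
      ultimately show ?thesis by simp
    qed
    have "E UNIV (\<lambda>x. mollify \<epsilon> g x - g x) = E UNIV (\<lambda>x. indicator L' x * (mollify \<epsilon> g x - g x))"
      using 2 by (intro E_cong) (auto simp: indicator_def)
    also have "\<dots> = E L' (\<lambda>x. mollify \<epsilon> g x - g x)" by (rule E_indicator) simp
    also have "\<dots> \<le> E L' (\<lambda>x. d * 1)" by (rule E_mono) (use 1 d in simp)
    also have "\<dots> = ennreal (d powr p * m)"
      using d m(2) by (subst E_cmult) (auto simp: meas_on_def m ennreal_mult intro!: borel_measurable_indicator L's)
    also have "\<dots> \<le> ennreal e"
      using e m(2) p_pos by (intro ennreal_leI) (simp add: d_def powr_powr field_simps)
    finally show "E UNIV (\<lambda>x. mollify \<epsilon> g x - g x) \<le> ennreal e" .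
  qed (use \<delta> in auto)
qed

lemma mollify_cong_AE:
  fixes f g :: "real^'n \<Rightarrow> real"
  assumes "AE x in lebesgue. f x = g x" "f \<in> borel_measurable lebesgue" "g \<in> borel_measurable lebesgue" "0 < \<epsilon>"
  shows "mollify \<epsilon> f x = mollify \<epsilon> g x"
  unfolding mollify_def conv_def
proof (rule integral_cong_AE)
  have m: "(\<lambda>z. moll \<epsilon> (x - z)) \<in> borel_measurable lebesgue"
    by (rule measurable_lebesgue_reflect[OF moll_measurable[OF assms(4)]])
  show "(\<lambda>z. f z * moll \<epsilon> (x - z)) \<in> borel_measurable lebesgue"
    "(\<lambda>z. g z * moll \<epsilon> (x - z)) \<in> borel_measurable lebesgue"
    using assms m by (auto intro!: borel_measurable_times)
  show "AE z in lebesgue. f z * moll \<epsilon> (x - z) = g z * moll \<epsilon> (x - z)"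
    using assms(1) by eventually_elim simp
qed

text \<open>The usual density argument: convergence is clear for a continuous \<open>g\<close> with
  compact support, and \<open>E_mollify_bound\<close>, uniform in \<epsilon>, transports the error
  from \<open>g\<close> to \<open>f\<close>.\<close>

theorem mollify_tendsto:
  assumes f: "f \<in> borel_measurable lebesgue" and K: "compact K" "\<And>x. x \<notin> K \<Longrightarrow> f x = 0"
    and fin: "E UNIV f < \<infinity>"
  shows "((\<lambda>\<epsilon>. E UNIV (\<lambda>x. mollify \<epsilon> f x - f x)) \<longlongrightarrow> 0) (at_right 0)"
proof (rule ennreal_tendsto_0I)
  fix e :: real assume e: "e > 0"
  have mUNIV: "meas_on UNIV h \<longleftrightarrow> h \<in> borel_measurable lebesgue" for h :: "real^'n \<Rightarrow> real"
    by (simp add: meas_on_def)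
  define C where "C = moll_const powr p * (avg_const + 1)"
  have C: "C > 0" using moll_const(1) avg_const_nonneg by (simp add: C_def)
  \<comment> \<open>Passing through \<open>mollify \<epsilon> g\<close> and \<open>g\<close> uses
    two triangle inequalities with factor \<open>2 powr p\<close>; the resulting bound
    \<open>2 powr p * (2 powr p * (C * d + d) + d)\<close> equals \<open>e\<close>.\<close>
  define d where "d = e / (2 powr p * (2 powr p * (C + 1) + 1))"
  have d: "d > 0" using e C by (simp add: d_def add_pos_pos)
  obtain g L where g: "continuous_on UNIV g" "compact L" "\<And>x. x \<notin> L \<Longrightarrow> g x = 0"
    "E UNIV (\<lambda>x. f x - g x) \<le> ennreal d"
    by (rule approx_continuous_E[OF f K(1) _ fin d], erule K(2), rule that)
  obtain \<delta> where \<delta>: "0 < \<delta>" "\<And>\<epsilon>. 0 < \<epsilon> \<Longrightarrow> \<epsilon> < \<delta> \<Longrightarrow> E UNIV (\<lambda>x. mollify \<epsilon> g x - g x) \<le> ennreal d"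
    by (rule E_mollify_continuous[OF g(1,2) _ d], erule g(3), rule that)
  have g_meas: "g \<in> borel_measurable borel" by (rule borel_measurable_continuous_onI[OF g(1)])
  have g_int: "integrable lebesgue g" by (rule continuous_compact_support_integrable[OF g(1,2)]) (rule g(3))
  have f_int: "integrable lebesgue f"
  proof -
    have "E K f < \<infinity>" using fin E_mono_set[of K UNIV f] by (simp add: order_le_less_trans)
    moreover have "meas_on K f" using lmeasurable_compact[OF K(1)]
      by (intro meas_on_subset[of UNIV f K]) (auto simp: mUNIV f fmeasurable_def)
    ultimately have "integrable lebesgue (\<lambda>x. indicator K x * f x)" by (rule E_imp_integrable[OF K(1), rotated])
    moreover have "(\<lambda>x. indicator K x * f x) = f" using K(2) by (intro ext) (auto simp: indicator_def)
    ultimately show ?thesis by simp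
  qed
  have sm: "mollify \<epsilon> h \<in> borel_measurable lebesgue" if "integrable lebesgue h" "0 < \<epsilon>" for h :: "real^'n \<Rightarrow> real" and \<epsilon>
    by (rule borel_imp_lebesgue_measurable, rule borel_measurable_continuous_onI,
        rule smooth_on_continuous, rule mollify_smooth[OF that])
  have key: "E UNIV (\<lambda>x. mollify \<epsilon> f x - f x) \<le> ennreal e" if \<epsilon>: "0 < \<epsilon>" "\<epsilon> < \<delta>" for \<epsilon>
  proof -
    \<comment> \<open>\<open>E_mollify_bound\<close> needs a Borel function, so the Lebesgue
      measurable difference is replaced by a Borel one that agrees with it almost
      everywhere.\<close>
    obtain h where h: "h \<in> borel_measurable borel" "AE x in lebesgue. f x - g x = h x"
    proof -
      have "(\<lambda>x. f x - g x) \<in> borel_measurable (completion lborel)"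
        using f borel_imp_lebesgue_measurable[OF g_meas] by (intro borel_measurable_diff)
      from completion_ex_borel_measurable_real[OF this] obtain h where
        "h \<in> borel_measurable lborel" "AE x in lborel. f x - g x = h x" by blast
      then show thesis by (intro that[of h] AE_completion) simp_all
    qed
    have "E UNIV (\<lambda>x. mollify \<epsilon> f x - mollify \<epsilon> g x) = E UNIV (mollify \<epsilon> h)"
    proof (rule E_cong)
      fix x
      have "mollify \<epsilon> f x - mollify \<epsilon> g x = mollify \<epsilon> (\<lambda>x. f x - g x) x"
        using mollify_diff[OF f_int g_int \<epsilon>(1)] by simp
      also have "\<dots> = mollify \<epsilon> h x"
        using h f borel_imp_lebesgue_measurable[OF g_meas] borel_imp_lebesgue_measurable[OF h(1)] \<epsilon>(1)
        by (intro mollify_cong_AE) auto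
      finally show "mollify \<epsilon> f x - mollify \<epsilon> g x = mollify \<epsilon> h x" .
    qed
    also have "\<dots> \<le> ennreal C * E UNIV h"
      unfolding C_def by (rule E_mollify_bound[OF h(1) \<epsilon>(1)])
    also have "E UNIV h = E UNIV (\<lambda>x. f x - g x)"
      by (rule E_cong_AE) (use h(2) in \<open>auto elim: eventually_mono\<close>)
    also have "ennreal C * \<dots> \<le> ennreal C * ennreal d" by (rule mult_left_mono[OF g(4)]) simp
    finally have 1: "E UNIV (\<lambda>x. mollify \<epsilon> f x - mollify \<epsilon> g x) \<le> ennreal (C * d)"
      using C by (simp add: ennreal_mult')
    have m: "meas_on UNIV (mollify \<epsilon> f)" "meas_on UNIV (mollify \<epsilon> g)" "meas_on UNIV g" "meas_on UNIV f"
      using sm[OF f_int \<epsilon>(1)] sm[OF g_int \<epsilon>(1)] f borel_imp_lebesgue_measurable[OF g_meas] by (simp_all add: mUNIV)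
    have "E UNIV (\<lambda>x. mollify \<epsilon> f x - g x) \<le> ennreal (2 powr p) *
        (E UNIV (\<lambda>x. mollify \<epsilon> f x - mollify \<epsilon> g x) + E UNIV (\<lambda>x. mollify \<epsilon> g x - g x))"
      by (rule E_triangle[OF m(1,2,3)])
    also have "\<dots> \<le> ennreal (2 powr p) * (ennreal (C * d) + ennreal d)"
      by (intro mult_left_mono add_mono 1 \<delta>(2) \<epsilon>) auto
    also have "\<dots> = ennreal (2 powr p * (C * d + d))"
      using C d by (simp flip: ennreal_mult' ennreal_plus)
    finally have 2: "E UNIV (\<lambda>x. mollify \<epsilon> f x - g x) \<le> ennreal (2 powr p * (C * d + d))" .
    have "E UNIV (\<lambda>x. mollify \<epsilon> f x - f x) \<le> ennreal (2 powr p) *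
        (E UNIV (\<lambda>x. mollify \<epsilon> f x - g x) + E UNIV (\<lambda>x. g x - f x))"
      by (rule E_triangle[OF m(1,3,4)])
    also have "\<dots> \<le> ennreal (2 powr p) * (ennreal (2 powr p * (C * d + d)) + ennreal d)"
      using g(4) by (intro mult_left_mono add_mono 2) (auto simp: E_commute[of _ g f])
    also have "\<dots> = ennreal (2 powr p * (2 powr p * (C * d + d) + d))"
      using C d by (simp flip: ennreal_mult' ennreal_plus)
    also have "2 powr p * (2 powr p * (C * d + d) + d) = d * (2 powr p * (2 powr p * (C + 1) + 1))"
      by (simp add: algebra_simps)
    also have "\<dots> = e"
    proof -
      have "2 powr p * (2 powr p * (C + 1) + 1) > 0" using C by (intro mult_pos_pos add_pos_pos) auto
      then show ?thesis by (metis d_def less_irrefl nonzero_eq_divide_eq)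
    qed
    finally show ?thesis .
  qed
  show "\<forall>\<^sub>F \<epsilon> in at_right 0. E UNIV (\<lambda>x. mollify \<epsilon> f x - f x) \<le> ennreal e"
    unfolding eventually_at_right_field using key \<delta>(1) by (intro exI[of _ \<delta>]) auto
qed

end

section \<open>Interpolation of intermediate derivatives\<close>

text \<open>The reflected kernel \<psi>, centred at \<open>x\<close>, is a test function on
  \<open>D\<close> as long as the ball lies in \<open>K\<close>, so the weak derivative may be
  tested with it. The sign from the reflection cancels the sign in the definition of the weak
  derivative.\<close>

lemma list_deriv_mollify:
  fixes f g :: "real^'n::finite \<Rightarrow> real"
  assumes wd: "has_weak_deriv D \<alpha> f g" and K: "compact K" "K \<subseteq> D"
    and e: "0 < \<epsilon>" and x: "cball x \<epsilon> \<subseteq> K" and xs: "\<And>i. count_list xs i = \<alpha> i"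
  shows "list_deriv xs (mollify \<epsilon> (\<lambda>z. indicator K z * f z)) x = mollify \<epsilon> (\<lambda>z. indicator K z * g z) x"
proof -
  have fl: "locally_summable D f" and gl: "locally_summable D g"
    using wd by (auto simp: has_weak_deriv_def)
  have len: "length xs = multiindex_order \<alpha>"
    using count_list_length_eq[of xs "mi_list \<alpha>"] xs count_mi_list[of \<alpha>] length_mi_list[of \<alpha>] by simp
  define m where "m = multiindex_order \<alpha>"
  define \<psi> where "\<psi> z = moll \<epsilon> (x + (-1) *\<^sub>R z)" for z
  have \<psi>_UNIV: "test_function UNIV \<psi>"
    unfolding \<psi>_def by (rule test_function_affine[OF moll_test[OF e]]) simp
  have \<psi>_zero: "\<psi> z = 0" if "z \<notin> cball x \<epsilon>" for z
    unfolding \<psi>_def using moll_zero[OF e, of "x - z"] that by (simp add: dist_norm)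
  have \<psi>: "test_function D \<psi>"
    by (rule test_functionI[OF _ compact_cball[of x \<epsilon>] _ \<psi>_zero])
      (use x K test_function_smooth[OF \<psi>_UNIV] in auto)
  have deriv_zero: "list_deriv ys \<psi> z = 0" if "z \<notin> cball x \<epsilon>" for ys z
  proof -
    have "list_deriv ys \<psi> z = list_deriv ys (\<lambda>_. 0) z"
      by (rule list_deriv_cong[of "- cball x \<epsilon>"]) (use \<psi>_zero that in auto)
    then show ?thesis by simp
  qed
  have md: "multi_deriv \<alpha> \<psi> z = (-1) ^ m * list_deriv xs (moll \<epsilon>) (x - z)" for z
  proof -
    have "multi_deriv \<alpha> \<psi> z = list_deriv (mi_list \<alpha>) (\<lambda>z. moll \<epsilon> (x + (-1) *\<^sub>R z)) z"
      by (simp add: multi_deriv_eq \<psi>_def[abs_def])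
    also have "\<dots> = (-1) ^ length (mi_list \<alpha>) * list_deriv (mi_list \<alpha>) (moll \<epsilon>) (x + (-1) *\<^sub>R z)"
      by (rule list_deriv_affine[OF open_UNIV test_function_smooth[OF moll_test[OF e]]]) simp
    \<comment> \<open>The list chosen by \<open>multi_deriv\<close> is exchanged for
      \<open>xs\<close>; the last clause of \<open>is_mollifier\<close> permits this.\<close>
    also have "list_deriv (mi_list \<alpha>) (moll \<epsilon>) = list_deriv xs (moll \<epsilon> :: real^'n \<Rightarrow> real)"
      by (rule moll_list_deriv[OF e]) (simp add: count_mi_list xs)
    finally show ?thesis by (simp add: length_mi_list m_def)
  qed
  have fK: "integrable lebesgue (\<lambda>z. indicator K z * f z)"
    by (rule locally_summable_integrable[OF fl K])
  have "list_deriv xs (mollify \<epsilon> (\<lambda>z. indicator K z * f z)) x =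
      (LINT z|lebesgue. indicator K z * f z * list_deriv xs (moll \<epsilon>) (x - z))"
    unfolding mollify_def conv_list_deriv[OF fK moll_test[OF e]] by (simp add: conv_def)
  also have "\<dots> = (LINT z|lebesgue. indicator D z *\<^sub>R (f z * ((-1) ^ m * multi_deriv \<alpha> \<psi> z)))"
  proof (rule Bochner_Integration.integral_cong[OF refl])
    fix z
    have "(-1) ^ m * multi_deriv \<alpha> \<psi> z = list_deriv xs (moll \<epsilon>) (x - z)"
      unfolding md by (simp add: mult.assoc[symmetric] power_add[symmetric])
    moreover have "multi_deriv \<alpha> \<psi> z = 0" if "z \<notin> K"
      unfolding multi_deriv_eq by (rule deriv_zero) (use x that in blast)
    ultimately show "indicator K z * f z * list_deriv xs (moll \<epsilon>) (x - z) =
        indicator D z *\<^sub>R (f z * ((-1) ^ m * multi_deriv \<alpha> \<psi> z))"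
      using K(2) by (auto simp: indicator_def)
  qed
  also have "\<dots> = (-1) ^ m * (LINT z:D|lebesgue. f z * multi_deriv \<alpha> \<psi> z)"
    unfolding set_lebesgue_integral_def
    by (subst integral_mult_right_zero[symmetric]) (simp add: mult_ac)
  also have "(LINT z:D|lebesgue. f z * multi_deriv \<alpha> \<psi> z) = (-1) ^ m * (LINT z:D|lebesgue. g z * \<psi> z)"
    using wd \<psi> by (simp add: has_weak_deriv_def m_def)
  also have "(-1) ^ m * ((-1) ^ m * (LINT z:D|lebesgue. g z * \<psi> z)) = (LINT z:D|lebesgue. g z * \<psi> z)"
    by (simp add: mult.assoc[symmetric] power_add[symmetric])
  also have "\<dots> = mollify \<epsilon> (\<lambda>z. indicator K z * g z) x"
    unfolding set_lebesgue_integral_def mollify_def conv_def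
  proof (rule Bochner_Integration.integral_cong[OF refl])
    fix z
    have "\<psi> z = 0" if "z \<notin> K" by (rule \<psi>_zero) (use x that in blast)
    then show "indicator D z *\<^sub>R (g z * \<psi> z) = indicator K z * g z * moll \<epsilon> (x - z)"
      using K(2) by (auto simp: indicator_def \<psi>_def)
  qed
  finally show ?thesis .
qed

lemma nn_integral_FTC_bound:
  fixes h h' :: "real \<Rightarrow> real"
  assumes h: "\<And>t. 0 \<le> t \<Longrightarrow> t \<le> 1 \<Longrightarrow> (h has_real_derivative h' t) (at t)"
    and c: "continuous_on {0..1} h'"
  shows "ennreal \<bar>h 1 - h 0\<bar> \<le> (\<integral>\<^sup>+t. (if 0 < t \<and> t < 1 then ennreal \<bar>h' t\<bar> else 0) \<partial>lborel)"
proof -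
  have i: "integrable lborel (\<lambda>t. indicator {0..1} t *\<^sub>R h' t)"
    by (rule borel_integrable_compact) (use c in auto)
  have "(LINT t|lborel. indicator {0..1} t *\<^sub>R h' t) = h 1 - h 0"
    by (rule integral_FTC_Icc)
      (use h c in \<open>auto simp: has_real_derivative_iff_has_vector_derivative[symmetric] intro: DERIV_subset\<close>)
  then have "ennreal \<bar>h 1 - h 0\<bar> \<le> (\<integral>\<^sup>+t. ennreal (norm (indicator {0..1} t *\<^sub>R h' t)) \<partial>lborel)"
    using integral_norm_bound_ennreal[OF i] by simp
  also have "\<dots> = (\<integral>\<^sup>+t. (if 0 < t \<and> t < 1 then ennreal \<bar>h' t\<bar> else 0) \<partial>lborel)"
  proof (rule nn_integral_cong_AE)
    have "AE t in lborel. t \<noteq> (0::real)" "AE t in lborel. t \<noteq> (1::real)" by (rule AE_lborel_singleton)+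
    then show "AE t in lborel. ennreal (norm (indicator {0..1} t *\<^sub>R h' t)) = (if 0 < t \<and> t < 1 then ennreal \<bar>h' t\<bar> else 0)"
      by eventually_elim (auto simp: indicator_def)
  qed
  finally show ?thesis .
qed

context ap_weight
begin

text \<open>The mean of \<open>list_deriv ys u\<close> against the mollifier is integrated by parts; the deviation
  from the mean is estimated along segments by the gradient.\<close>

lemma list_deriv_pointwise_bound:
  assumes D: "open D" and u: "smooth_on D u" and r: "0 < r"
    and K: "compact K" "K \<subseteq> D" "cball x r \<subseteq> K"
  shows "ennreal \<bar>list_deriv ys u x\<bar> \<le>
    ennreal (inverse (r ^ length ys) * \<bar>LINT y|lborel. list_deriv (rev ys) mollifier y * (indicator K (x + r *\<^sub>R y) * u (x + r *\<^sub>R y))\<bar>)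
    + ennreal (moll_const * r) * line_avg (\<lambda>z. \<Sum>i\<in>UNIV. \<bar>indicator K z * list_deriv (i # ys) u z\<bar>) r x"
proof -
  define V where "V = list_deriv ys u"
  have V: "smooth_on D V" unfolding V_def by (rule smooth_on_list[OF u])
  define G where "G z = (\<Sum>i\<in>UNIV. \<bar>indicator K z * partial_deriv i V z\<bar>)" for z
  have G0: "0 \<le> G z" for z unfolding G_def by (intro sum_nonneg) auto
  have G_meas [measurable]: "G \<in> borel_measurable borel"
  proof -
    have "(\<lambda>z. indicator K z *\<^sub>R partial_deriv i V z) \<in> borel_measurable borel" for i
      by (rule borel_measurable_continuous_on_indicator)
        (use K in \<open>auto intro: borel_compact continuous_on_subset smooth_on_continuous[OF smooth_on_partial[OF V]]\<close>)
    then have "(\<lambda>z. indicator K z * partial_deriv i V z) \<in> borel_measurable borel" for i by simp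
    then show ?thesis unfolding G_def by (intro borel_measurable_sum borel_measurable_abs)
  qed
  \<comment> \<open>The preimage of \<open>D\<close> under the change of variables. It contains the
    closed unit ball, so integrations by parts with the mollifier take place inside it.\<close>
  define T where "T = {y. x + r *\<^sub>R y \<in> D}"
  have T: "open T" unfolding T_def by (rule open_affine_preimage[OF D])
  have inK: "x + r *\<^sub>R y \<in> K" if "norm y \<le> 1" for y
    using that r K(3) by (auto simp: subset_iff dist_norm mult_left_le)
  then have cT: "cball 0 1 \<subseteq> T" using K(2) by (auto simp: T_def)
  have moll_T: "test_function T mollifier"
    by (rule test_functionI[OF test_function_smooth[OF mollifier_test] compact_cball cT])
      (auto intro: mollifier_zero)
  have wsm: "smooth_on T (\<lambda>y. u (x + r *\<^sub>R y))" unfolding T_def by (rule smooth_on_affine[OF D u])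
  have Vsm: "smooth_on T (\<lambda>y. V (x + r *\<^sub>R y))" unfolding T_def by (rule smooth_on_affine[OF D V])
  have t1: "test_function T (\<lambda>y. mollifier y * V (x + r *\<^sub>R y))"
    by (rule test_function_mult[OF T moll_T Vsm])
  have t2: "test_function T (\<lambda>y. list_deriv (rev ys) mollifier y * u (x + r *\<^sub>R y))"
    by (rule test_function_mult[OF T test_function_list[OF moll_T] wsm])
  define I1 where "I1 = (LINT y|lborel. mollifier y * V (x + r *\<^sub>R y))"
  define P where "P = (LINT y|lborel. list_deriv (rev ys) mollifier y * (indicator K (x + r *\<^sub>R y) * u (x + r *\<^sub>R y)))"
  \<comment> \<open>The chain rule yields one factor \<open>r\<close> for each derivative, and
    integration by parts moves all derivatives to the mollifier; this explains the factor
    \<open>inverse (r ^ length ys)\<close> in the bound.\<close>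
  have "r ^ length ys * I1 = (-1) ^ length ys * P"
  proof -
    have "(LINT y:T|lebesgue. u (x + r *\<^sub>R y) * list_deriv (rev ys) mollifier y) =
        (-1) ^ length (rev ys) * (LINT y:T|lebesgue. list_deriv (rev (rev ys)) (\<lambda>y. u (x + r *\<^sub>R y)) y * mollifier y)"
      by (rule integration_by_parts_list[OF T wsm moll_T])
    moreover have "(LINT y:T|lebesgue. u (x + r *\<^sub>R y) * list_deriv (rev ys) mollifier y) = P"
    proof -
      have "(LINT y:T|lebesgue. u (x + r *\<^sub>R y) * list_deriv (rev ys) mollifier y) =
          (LINT y|lborel. list_deriv (rev ys) mollifier y * u (x + r *\<^sub>R y))"
        using test_function_set_integral[OF test_function_zero_outside[OF t2] test_function_measurable[OF t2]]
        by (simp add: mult.commute)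
      also have "\<dots> = P"
        unfolding P_def
      proof (rule Bochner_Integration.integral_cong[OF refl])
        fix y
        show "list_deriv (rev ys) mollifier y * u (x + r *\<^sub>R y) =
            list_deriv (rev ys) mollifier y * (indicator K (x + r *\<^sub>R y) * u (x + r *\<^sub>R y))"
          using inK[of y] mollifier_list_zero[of y "rev ys"] by (cases "norm y \<le> 1") auto
      qed
      finally show ?thesis .
    qed
    moreover have "(LINT y:T|lebesgue. list_deriv (rev (rev ys)) (\<lambda>y. u (x + r *\<^sub>R y)) y * mollifier y) = r ^ length ys * I1"
    proof -
      have "(LINT y:T|lebesgue. list_deriv (rev (rev ys)) (\<lambda>y. u (x + r *\<^sub>R y)) y * mollifier y) =
          (LINT y:T|lebesgue. r ^ length ys * (mollifier y * V (x + r *\<^sub>R y)))"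
        unfolding set_lebesgue_integral_def
      proof (rule Bochner_Integration.integral_cong[OF refl])
        fix y
        show "indicator T y *\<^sub>R (list_deriv (rev (rev ys)) (\<lambda>y. u (x + r *\<^sub>R y)) y * mollifier y) =
            indicator T y *\<^sub>R (r ^ length ys * (mollifier y * V (x + r *\<^sub>R y)))"
          using list_deriv_affine[OF D u, of x r y ys] by (auto simp: indicator_def T_def V_def)
      qed
      also have "\<dots> = r ^ length ys * I1"
        using test_function_set_integral[OF test_function_zero_outside[OF t1] test_function_measurable[OF t1]]
        by (simp add: I1_def)
      finally show ?thesis .
    qed
    ultimately have "P = (-1) ^ length ys * (r ^ length ys * I1)" by simp
    then show ?thesis by (simp add: mult.assoc[symmetric] power_add[symmetric])
  qed
  then have I1: "\<bar>I1\<bar> = inverse (r ^ length ys) * \<bar>P\<bar>"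
    using r by (auto simp: field_simps abs_mult power_abs dest: arg_cong[of _ _ abs])
  have diff: "ennreal \<bar>V x - I1\<bar> \<le> ennreal (moll_const * r) * line_avg G r x"
  proof -
    have i1: "integrable lborel (\<lambda>y. mollifier y * V (x + r *\<^sub>R y))" by (rule test_function_integrable[OF t1])
    have i0: "integrable lborel (mollifier :: real^'n \<Rightarrow> real)" by (rule test_function_integrable[OF mollifier_test])
    \<comment> \<open>The mollifier has mass 1, so the deviation of \<open>V x\<close> from the mean
      is itself a mean of differences.\<close>
    have "V x = (LINT y|lborel. mollifier y * V x)"
      by (simp add: mollifier_integral)
    then have "V x - I1 = (LINT y|lborel. mollifier y * V x - mollifier y * V (x + r *\<^sub>R y))"
      unfolding I1_def using i0 i1 by (subst Bochner_Integration.integral_diff) auto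
    then have "ennreal \<bar>V x - I1\<bar> \<le> (\<integral>\<^sup>+y. ennreal \<bar>mollifier y * V x - mollifier y * V (x + r *\<^sub>R y)\<bar> \<partial>lborel)"
      using integral_norm_bound_ennreal[OF Bochner_Integration.integrable_diff[OF _ i1], of "\<lambda>y. mollifier y * V x"] i0 by simp
    also have "\<dots> \<le> (\<integral>\<^sup>+y. ennreal (moll_const * r) * (\<integral>\<^sup>+t. (if norm y < 1 \<and> 0 < t \<and> t < 1 then ennreal (G (x + (t * r) *\<^sub>R y)) else 0) \<partial>lborel) \<partial>lborel)"
    proof (rule nn_integral_mono)
      fix y :: "real^'n"
      show "ennreal \<bar>mollifier y * V x - mollifier y * V (x + r *\<^sub>R y)\<bar> \<le>
          ennreal (moll_const * r) * (\<integral>\<^sup>+t. (if norm y < 1 \<and> 0 < t \<and> t < 1 then ennreal (G (x + (t * r) *\<^sub>R y)) else 0) \<partial>lborel)"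
      proof (cases "norm y < 1")
        case True
        have inKt: "x + (t * r) *\<^sub>R y \<in> K" if "0 \<le> t" "t \<le> 1" for t
          using inK[of "t *\<^sub>R y"] True that by (simp add: mult.commute mult_le_one)
        have der: "((\<lambda>t. V (x + (t * r) *\<^sub>R y)) has_real_derivative
            (\<Sum>i\<in>UNIV. (r *\<^sub>R y) $ i * partial_deriv i V (x + (t * r) *\<^sub>R y))) (at t)" if t: "0 \<le> t" "t \<le> 1" for t
        proof -
          have "((\<lambda>t. x + (t * r) *\<^sub>R y) has_derivative (\<lambda>s. s *\<^sub>R (r *\<^sub>R y))) (at t)"
            by (auto intro!: derivative_eq_intros)
          from diff_chain_at[OF this smooth_on_has_derivative[OF V]]
          have "((\<lambda>t. V (x + (t * r) *\<^sub>R y)) has_derivative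
              (\<lambda>s. \<Sum>i\<in>UNIV. (s *\<^sub>R (r *\<^sub>R y)) $ i * partial_deriv i V (x + (t * r) *\<^sub>R y))) (at t)"
            using inKt[OF t] K(2) by (auto simp: o_def)
          then show ?thesis
            unfolding has_field_derivative_def
            by (rule has_derivative_eq_rhs) (auto simp: sum_distrib_left mult_ac intro!: ext sum.cong)
        qed
        have cont: "continuous_on {0..1} (\<lambda>t. \<Sum>i\<in>UNIV. (r *\<^sub>R y) $ i * partial_deriv i V (x + (t * r) *\<^sub>R y))"
        proof (intro continuous_on_sum continuous_on_mult continuous_on_const)
          fix i
          show "continuous_on {0..1} (\<lambda>t. partial_deriv i V (x + (t * r) *\<^sub>R y))"
            by (rule continuous_on_compose2[OF smooth_on_continuous[OF smooth_on_partial[OF V]]])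
              (use inKt K(2) in \<open>auto intro!: continuous_intros\<close>)
        qed
        \<comment> \<open>The fundamental theorem of calculus on the segment from \<open>x\<close>
          to \<open>x + r *\<^sub>R y\<close>, which stays in the ball and hence in
          \<open>K\<close>.\<close>
        have "ennreal \<bar>V (x + r *\<^sub>R y) - V x\<bar> \<le> (\<integral>\<^sup>+t. (if 0 < t \<and> t < 1 then
            ennreal \<bar>\<Sum>i\<in>UNIV. (r *\<^sub>R y) $ i * partial_deriv i V (x + (t * r) *\<^sub>R y)\<bar> else 0) \<partial>lborel)"
          using nn_integral_FTC_bound[OF der cont] by simp
        also have "\<dots> \<le> (\<integral>\<^sup>+t. ennreal r * (if norm y < 1 \<and> 0 < t \<and> t < 1 then ennreal (G (x + (t * r) *\<^sub>R y)) else 0) \<partial>lborel)"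
        proof (rule nn_integral_mono)
          fix t :: real
          show "(if 0 < t \<and> t < 1 then ennreal \<bar>\<Sum>i\<in>UNIV. (r *\<^sub>R y) $ i * partial_deriv i V (x + (t * r) *\<^sub>R y)\<bar> else 0)
              \<le> ennreal r * (if norm y < 1 \<and> 0 < t \<and> t < 1 then ennreal (G (x + (t * r) *\<^sub>R y)) else 0)"
          proof (cases "0 < t \<and> t < 1")
            case t: True
            have "\<bar>\<Sum>i\<in>UNIV. (r *\<^sub>R y) $ i * partial_deriv i V (x + (t * r) *\<^sub>R y)\<bar> \<le>
                (\<Sum>i\<in>UNIV. r * \<bar>indicator K (x + (t * r) *\<^sub>R y) * partial_deriv i V (x + (t * r) *\<^sub>R y)\<bar>)"
            proof (rule order_trans[OF sum_abs], rule sum_mono)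
              fix i
              have "\<bar>y $ i\<bar> \<le> 1" using component_le_norm_cart[of y i] True by linarith
              then have "r * \<bar>y $ i\<bar> * \<bar>partial_deriv i V (x + (t * r) *\<^sub>R y)\<bar> \<le> r * 1 * \<bar>partial_deriv i V (x + (t * r) *\<^sub>R y)\<bar>"
                using r by (intro mult_right_mono mult_left_mono) auto
              then show "\<bar>(r *\<^sub>R y) $ i * partial_deriv i V (x + (t * r) *\<^sub>R y)\<bar> \<le>
                  r * \<bar>indicator K (x + (t * r) *\<^sub>R y) * partial_deriv i V (x + (t * r) *\<^sub>R y)\<bar>"
                using inKt[of t] t r by (simp add: abs_mult)
            qed
            also have "\<dots> = r * G (x + (t * r) *\<^sub>R y)" by (simp add: G_def sum_distrib_left)
            finally show ?thesis using t True r by (simp flip: ennreal_mult' add: ennreal_leI)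
          next
            case False
            show ?thesis unfolding if_not_P[OF False] by simp
          qed
        qed
        also have "\<dots> = ennreal r * (\<integral>\<^sup>+t. (if norm y < 1 \<and> 0 < t \<and> t < 1 then ennreal (G (x + (t * r) *\<^sub>R y)) else 0) \<partial>lborel)"
          by (rule nn_integral_cmult) measurable
        finally have le: "ennreal \<bar>V (x + r *\<^sub>R y) - V x\<bar> \<le> ennreal r * (\<integral>\<^sup>+t. (if norm y < 1 \<and> 0 < t \<and> t < 1 then ennreal (G (x + (t * r) *\<^sub>R y)) else 0) \<partial>lborel)" .
        have "\<bar>mollifier y * V x - mollifier y * V (x + r *\<^sub>R y)\<bar> = \<bar>mollifier y\<bar> * \<bar>V (x + r *\<^sub>R y) - V x\<bar>"
          by (simp add: abs_mult[symmetric] right_diff_distrib abs_minus_commute)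
        also have "\<dots> \<le> moll_const * \<bar>V (x + r *\<^sub>R y) - V x\<bar>"
          by (rule mult_right_mono[OF moll_const(2)]) simp
        finally have "ennreal \<bar>mollifier y * V x - mollifier y * V (x + r *\<^sub>R y)\<bar> \<le> ennreal moll_const * ennreal \<bar>V (x + r *\<^sub>R y) - V x\<bar>"
          using moll_const(1) by (simp flip: ennreal_mult' add: ennreal_leI)
        also have "\<dots> \<le> ennreal moll_const * (ennreal r * (\<integral>\<^sup>+t. (if norm y < 1 \<and> 0 < t \<and> t < 1 then ennreal (G (x + (t * r) *\<^sub>R y)) else 0) \<partial>lborel))"
          by (rule mult_left_mono[OF le]) simp
        finally show ?thesis using moll_const(1) r by (simp add: ennreal_mult mult.assoc)
      qed (simp add: mollifier_zero)
    qed
    also have "\<dots> = ennreal (moll_const * r) * (\<integral>\<^sup>+y. (\<integral>\<^sup>+t. (if norm y < 1 \<and> 0 < t \<and> t < 1 then ennreal (G (x + (t * r) *\<^sub>R y)) else 0) \<partial>lborel) \<partial>lborel)"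
      by (rule nn_integral_cmult) measurable
    \<comment> \<open>After the exchange the inner integral over \<open>y\<close> is an average of
      \<open>G\<close> at scale \<open>t * r\<close>.\<close>
    also have "(\<integral>\<^sup>+y. (\<integral>\<^sup>+t. (if norm y < 1 \<and> 0 < t \<and> t < 1 then ennreal (G (x + (t * r) *\<^sub>R y)) else 0) \<partial>lborel) \<partial>lborel) =
        (\<integral>\<^sup>+t. (\<integral>\<^sup>+y. (if norm y < 1 \<and> 0 < t \<and> t < 1 then ennreal (G (x + (t * r) *\<^sub>R y)) else 0) \<partial>lborel) \<partial>lborel)"
      by (rule lborel_pair.Fubini') measurable
    also have "\<dots> = line_avg G r x"
      unfolding line_avg_def avg_def by (rule nn_integral_cong) (auto intro!: nn_integral_cong)
    finally show ?thesis .
  qed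
  have "ennreal \<bar>V x\<bar> \<le> ennreal (\<bar>I1\<bar> + \<bar>V x - I1\<bar>)" by (intro ennreal_leI) linarith
  also have "\<dots> = ennreal (inverse (r ^ length ys) * \<bar>P\<bar>) + ennreal \<bar>V x - I1\<bar>"
    using r by (simp add: I1 ennreal_plus)
  also have "\<dots> \<le> ennreal (inverse (r ^ length ys) * \<bar>P\<bar>) + ennreal (moll_const * r) * line_avg G r x"
    by (intro add_left_mono diff)
  finally show ?thesis by (simp add: V_def P_def G_def[abs_def])
qed

lemma E_mono_AE: "AE x in lborel. x \<in> K \<longrightarrow> \<bar>f x\<bar> \<le> \<bar>g x\<bar> \<Longrightarrow> E K f \<le> E K g"
  unfolding E_def using v_pos p_pos
  by (intro nn_integral_mono_AE)
    (auto elim!: eventually_mono simp: indicator_def less_imp_le intro!: ennreal_leI mult_right_mono powr_mono2)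

lemma sets_lebesgue_compact: "compact (K :: (real^'n) set) \<Longrightarrow> K \<in> sets lebesgue"
  using lmeasurable_compact[of K] by (simp add: fmeasurable_def)

text \<open>Integrates \<open>list_deriv_pointwise_bound\<close> with a radius \<open>r\<close> for
  which the neighbourhood \<open>K'\<close> of \<open>K\<close> lies in \<open>D\<close>. The term
  with a derivative of the mollifier as kernel is estimated by \<open>E_kernel_bound\<close>, the
  segment term by \<open>line_avg_bound\<close>. The set \<open>K'\<close> is the same for all
  \<open>ys\<close>; the constant depends on \<open>ys\<close> but not on \<open>u\<close>.\<close>

lemma interpolation_step:
  assumes D: "open D" and K: "compact K" "K \<subseteq> D"
  obtains K' where "compact K'" "K \<subseteq> K'" "K' \<subseteq> D"
    "\<And>ys. \<exists>C\<ge>0. \<forall>u. smooth_on D u \<longrightarrow>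
      E K (list_deriv ys u) \<le> ennreal C * (E K' u + (\<Sum>i\<in>UNIV. E K' (list_deriv (i # ys) u)))"
proof -
  obtain r where r: "r > 0" "compact (\<Union>x\<in>K. cball x r)" "(\<Union>x\<in>K. cball x r) \<subseteq> D"
    by (rule compact_neighbourhood[OF K(1) D K(2)]) (rule that)
  define K' where "K' = (\<Union>x\<in>K. cball x r)"
  have K': "compact K'" "K' \<subseteq> D" using r by (auto simp: K'_def)
  have KK': "K \<subseteq> K'" using r(1) by (force simp: K'_def)
  have Kl: "K \<in> sets lebesgue" by (rule sets_lebesgue_compact[OF K(1)])
  show thesis
  proof (rule that[OF K'(1) KK' K'(2)])
    fix ys :: "'n list"
    obtain M1 where M1: "M1 > 0" "\<And>y. \<bar>list_deriv (rev ys) (mollifier :: real^'n \<Rightarrow> real) y\<bar> \<le> M1"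
      by (rule test_function_bounded[OF test_function_list[OF mollifier_test], of "rev ys"]) (rule that)
    define c where "c = inverse (r ^ length ys)"
    define C1 where "C1 = M1 powr p * (avg_const + 1)"
    define m where "m = moll_const * r"
    define C2 where "C2 = avg_const * real CARD('n) powr p"
    define C where "C = 2 powr p * (c powr p * C1 + m powr p * C2)"
    have nn: "c > 0" "C1 \<ge> 0" "m > 0" "C2 \<ge> 0"
      using r(1) M1 moll_const(1) avg_const_nonneg by (auto simp: c_def C1_def m_def C2_def)
    show "\<exists>C\<ge>0. \<forall>u. smooth_on D u \<longrightarrow>
      E K (list_deriv ys u) \<le> ennreal C * (E K' u + (\<Sum>i\<in>UNIV. E K' (list_deriv (i # ys) u)))"
    proof (intro exI[of _ C] conjI allI impI)
      show "0 \<le> C" using nn by (simp add: C_def)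
      fix u assume u: "smooth_on D u"
      let ?D = "\<lambda>i. list_deriv (i # ys) u"
      have bm: "(\<lambda>z. indicator K' z * h z) \<in> borel_measurable borel" if "smooth_on D h" for h
      proof -
        have "(\<lambda>z. indicator K' z *\<^sub>R h z) \<in> borel_measurable borel"
          by (rule borel_measurable_continuous_on_indicator)
            (use K' that in \<open>auto intro: borel_compact continuous_on_subset smooth_on_continuous\<close>)
        then show ?thesis by simp
      qed
      define U1 where "U1 z = indicator K' z * u z" for z
      have [measurable]: "U1 \<in> borel_measurable borel" unfolding U1_def by (rule bm[OF u])
      define \<phi> where "\<phi> = list_deriv (rev ys) (mollifier :: real^'n \<Rightarrow> real)"
      have [measurable]: "\<phi> \<in> borel_measurable borel"
        unfolding \<phi>_def by (rule test_function_measurable[OF test_function_list[OF mollifier_test]])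
      define P where "P x = (LINT y|lborel. \<phi> y * U1 (x + r *\<^sub>R y))" for x
      have [measurable]: "P \<in> borel_measurable borel" unfolding P_def by measurable
      define G where "G z = (\<Sum>i\<in>UNIV. \<bar>indicator K' z * ?D i z\<bar>)" for z
      have DGi: "(\<lambda>z. indicator K' z * ?D i z) \<in> borel_measurable borel" for i
        by (rule bm[OF smooth_on_list[OF u]])
      then have G_meas [measurable]: "G \<in> borel_measurable borel"
        unfolding G_def by (intro borel_measurable_sum borel_measurable_abs)
      have G0: "0 \<le> G z" for z unfolding G_def by (intro sum_nonneg) auto
      define L where "L x = enn2real (line_avg G r x)" for x
      have [measurable]: "L \<in> borel_measurable borel" unfolding L_def line_avg_def avg_def by measurable
      have EG: "E UNIV G \<le> ennreal (real CARD('n) powr p) * (\<Sum>i\<in>UNIV. E K' (?D i))"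
      proof -
        have "E UNIV G \<le> ennreal (real CARD('n) powr p) * (\<Sum>i\<in>UNIV. E UNIV (\<lambda>z. indicator K' z * ?D i z))"
          unfolding G_def using DGi by (intro E_sum_le meas_on_borel) auto
        then show ?thesis by (simp add: E_indicator)
      qed
      \<comment> \<open>Smooth functions are bounded on the compact set \<open>K'\<close>; this
        provides the finite energy that \<open>line_avg_bound\<close> assumes.\<close>
      have "(\<Sum>i\<in>UNIV. E K' (?D i)) < \<infinity>"
        using E_continuous_finite[OF K'(1) continuous_on_subset[OF smooth_on_continuous[OF smooth_on_list[OF u]] K'(2)]]
        by (simp add: ennreal_sum_less_top del: foldr.simps)
      then have fin: "E UNIV G < \<infinity>"
        by (intro order_le_less_trans[OF EG]) (simp add: ennreal_mult_less_top del: foldr.simps)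
      have EGd: "(\<integral>\<^sup>+x. ennreal (G x powr p * v x) \<partial>lborel) = E UNIV G"
        unfolding E_def using G0 by simp
      have ELfin: "AE x in lborel. line_avg G r x < \<infinity>"
        and EL: "E UNIV L \<le> ennreal avg_const * E UNIV G"
        using line_avg_bound[OF G_meas G0 r(1)] fin unfolding EGd by (auto simp: E_def L_def)
      have EP: "E UNIV P \<le> ennreal C1 * E K' u"
      proof -
        have "E UNIV P \<le> ennreal C1 * E UNIV U1"
          unfolding P_def C1_def \<phi>_def
          by (rule E_kernel_bound)
            (use r(1) M1 mollifier_list_zero test_function_measurable[OF test_function_list[OF mollifier_test]] in auto)
        also have "E UNIV U1 = E K' u" unfolding U1_def by (rule E_indicator) simp
        finally show ?thesis .
      qed
      have pw: "\<bar>list_deriv ys u x\<bar> \<le> c * \<bar>P x\<bar> + m * L x" if x: "x \<in> K" "line_avg G r x < \<infinity>" for x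
      proof -
        have cK: "cball x r \<subseteq> K'" using x(1) by (auto simp: K'_def)
        have "ennreal \<bar>list_deriv ys u x\<bar> \<le> ennreal (c * \<bar>P x\<bar>) + ennreal m * line_avg G r x"
          using list_deriv_pointwise_bound[OF D u r(1) K' cK, of ys]
          by (simp only: c_def P_def m_def \<phi>_def U1_def G_def[abs_def])
        also have "line_avg G r x = ennreal (L x)"
          unfolding L_def using x(2) by (intro ennreal_enn2real[symmetric]) simp
        also have "ennreal (c * \<bar>P x\<bar>) + ennreal m * ennreal (L x) = ennreal (c * \<bar>P x\<bar> + m * L x)"
          using nn by (simp flip: ennreal_mult' ennreal_plus add: L_def)
        finally show ?thesis using nn by (subst (asm) ennreal_le_iff) (auto simp: L_def)
      qed
      have "E K (list_deriv ys u) \<le> E K (\<lambda>x. c * \<bar>P x\<bar> + m * L x)"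
      proof (rule E_mono_AE, use ELfin in eventually_elim)
        case (elim x)
        then show ?case using pw[of x] by (auto intro: order_trans[OF _ abs_ge_self])
      qed
      also have "\<dots> \<le> ennreal (2 powr p) * (E K (\<lambda>x. c * \<bar>P x\<bar>) + E K (\<lambda>x. m * L x))"
        by (rule E_add; rule meas_on_borel[OF _ Kl]; measurable)
      also have "E K (\<lambda>x. c * \<bar>P x\<bar>) = ennreal (c powr p) * E K P"
      proof -
        have "meas_on K (\<lambda>x. \<bar>P x\<bar>)" by (rule meas_on_borel[OF _ Kl]) measurable
        then have "E K (\<lambda>x. c * \<bar>P x\<bar>) = ennreal (c powr p) * E K (\<lambda>x. \<bar>P x\<bar>)"
          using nn(1) by (simp add: E_cmult)
        also have "E K (\<lambda>x. \<bar>P x\<bar>) = E K P" by (simp add: E_def)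
        finally show ?thesis .
      qed
      also have "E K (\<lambda>x. m * L x) = ennreal (m powr p) * E K L"
      proof -
        have "meas_on K L" by (rule meas_on_borel[OF _ Kl]) measurable
        then show ?thesis using nn(3) by (simp add: E_cmult)
      qed
      also have "ennreal (2 powr p) * (ennreal (c powr p) * E K P + ennreal (m powr p) * E K L) \<le>
          ennreal (2 powr p) * (ennreal (c powr p) * (ennreal C1 * E K' u) +
            ennreal (m powr p) * (ennreal C2 * (\<Sum>i\<in>UNIV. E K' (?D i))))"
      proof (intro mult_left_mono add_mono)
        show "E K P \<le> ennreal C1 * E K' u" using E_mono_set[of K UNIV P] EP by (auto intro: order_trans)
        have "E K L \<le> ennreal avg_const * E UNIV G" using E_mono_set[of K UNIV L] EL by (auto intro: order_trans)
        also have "\<dots> \<le> ennreal avg_const * (ennreal (real CARD('n) powr p) * (\<Sum>i\<in>UNIV. E K' (?D i)))"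
          by (rule mult_left_mono[OF EG]) simp
        finally show "E K L \<le> ennreal C2 * (\<Sum>i\<in>UNIV. E K' (?D i))"
          using avg_const_nonneg by (simp add: C2_def ennreal_mult mult.assoc)
      qed auto
      also have "\<dots> = ennreal (2 powr p * (c powr p * C1)) * E K' u +
          ennreal (2 powr p * (m powr p * C2)) * (\<Sum>i\<in>UNIV. E K' (?D i))"
        using nn by (simp add: ennreal_mult distrib_left mult.assoc del: foldr.simps)
      also have "\<dots> \<le> ennreal C * E K' u + ennreal C * (\<Sum>i\<in>UNIV. E K' (?D i))"
        using nn by (intro add_mono mult_right_mono ennreal_leI) (auto simp: C_def distrib_left)
      also have "\<dots> = ennreal C * (E K' u + (\<Sum>i\<in>UNIV. E K' (?D i)))"
        by (simp add: distrib_left)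
      finally show "E K (list_deriv ys u) \<le> ennreal C * (E K' u + (\<Sum>i\<in>UNIV. E K' (?D i)))" .
    qed
  qed
qed

text \<open>Indexed by lists rather than multi-indices: each mixed derivative is counted once for
  every order in which it can be taken.\<close>

definition top_energy :: "nat \<Rightarrow> (real^'n) set \<Rightarrow> (real^'n \<Rightarrow> real) \<Rightarrow> ennreal" where
  "top_energy m K u = E K u + (\<Sum>xs | length xs = m. E K (list_deriv xs u))"

lemma finite_lists_length: "finite {xs :: 'n list. length xs = m}"
  using finite_lists_length_eq[of "UNIV :: 'n set" m] by simp

lemma top_energy_mono: "K \<subseteq> L \<Longrightarrow> top_energy m K u \<le> top_energy m L u"
  unfolding top_energy_def by (intro add_mono sum_mono E_mono_set)

text \<open>Induction downwards from order \<open>m\<close>: each step trades a derivative for those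
  of one order more plus a term of order 0, which is already part of \<open>top_energy\<close>. The
  compact set grows at each step.\<close>

lemma interpolation_single:
  assumes D: "open D" and K: "compact K" "K \<subseteq> D" and ys: "length ys \<le> m"
  shows "\<exists>K' C. compact K' \<and> K \<subseteq> K' \<and> K' \<subseteq> D \<and> 0 \<le> C \<and>
    (\<forall>u. smooth_on D u \<longrightarrow> E K (list_deriv ys u) \<le> ennreal C * top_energy m K' u)"
  using ys K
proof (induction "m - length ys" arbitrary: ys K)
  case 0
  then have "length ys = m" by simp
  then have "E K (list_deriv ys u) \<le> top_energy m K u" for u
    unfolding top_energy_def
    by (intro order_trans[OF member_le_sum[of ys "{xs. length xs = m}" "\<lambda>xs. E K (list_deriv xs u)"]])
      (auto intro: finite_lists_length)
  then show ?case using 0 by (intro exI[of _ K] exI[of _ 1]) auto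
next
  case (Suc j)
  obtain K1 where K1: "compact K1" "K \<subseteq> K1" "K1 \<subseteq> D"
    and st: "\<And>ys. \<exists>C\<ge>0. \<forall>u. smooth_on D u \<longrightarrow>
      E K (list_deriv ys u) \<le> ennreal C * (E K1 u + (\<Sum>i\<in>UNIV. E K1 (list_deriv (i # ys) u)))"
    by (rule interpolation_step[OF D Suc.prems(2,3)]) (rule that)
  obtain C0 where C0: "C0 \<ge> 0" "\<And>u. smooth_on D u \<Longrightarrow>
      E K (list_deriv ys u) \<le> ennreal C0 * (E K1 u + (\<Sum>i\<in>UNIV. E K1 (list_deriv (i # ys) u)))"
    using st[of ys] by blast
  have "\<exists>K' C. compact K' \<and> K1 \<subseteq> K' \<and> K' \<subseteq> D \<and> 0 \<le> C \<and>
    (\<forall>u. smooth_on D u \<longrightarrow> E K1 (list_deriv (i # ys) u) \<le> ennreal C * top_energy m K' u)" for i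
    by (rule Suc.hyps(1)) (use Suc.hyps(2) Suc.prems K1 in auto)
  then obtain K2 C2 where K2: "\<And>i. compact (K2 i)" "\<And>i. K1 \<subseteq> K2 i" "\<And>i. K2 i \<subseteq> D" "\<And>i. 0 \<le> C2 i"
    "\<And>i u. smooth_on D u \<Longrightarrow> E K1 (list_deriv (i # ys) u) \<le> ennreal (C2 i) * top_energy m (K2 i) u"
    by metis
  define K' where "K' = (\<Union>i. K2 i)"
  have K': "compact K'" "K1 \<subseteq> K'" "K' \<subseteq> D" "\<And>i. K2 i \<subseteq> K'"
  proof -
    show "compact K'" unfolding K'_def by (intro compact_UN K2(1)) auto
    show "K1 \<subseteq> K'" using K2(2) by (auto simp: K'_def)
    show "K' \<subseteq> D" using K2(3) by (auto simp: K'_def dest!: subsetD)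
    show "K2 i \<subseteq> K'" for i by (auto simp: K'_def)
  qed
  show ?case
  proof (intro exI[of _ K'] exI[of _ "C0 * (1 + (\<Sum>i\<in>UNIV. C2 i))"] conjI allI impI)
    show "0 \<le> C0 * (1 + (\<Sum>i\<in>UNIV. C2 i))" using C0 K2(4) by (simp add: sum_nonneg)
    fix u assume u: "smooth_on D u"
    have "E K (list_deriv ys u) \<le> ennreal C0 * (E K1 u + (\<Sum>i\<in>UNIV. E K1 (list_deriv (i # ys) u)))"
      by (rule C0(2)[OF u])
    also have "\<dots> \<le> ennreal C0 * (top_energy m K' u + (\<Sum>i\<in>UNIV. ennreal (C2 i) * top_energy m K' u))"
    proof (intro mult_left_mono add_mono sum_mono)
      have "E K1 u \<le> E K' u" by (rule E_mono_set[OF K'(2)])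
      also have "\<dots> \<le> top_energy m K' u" by (simp add: top_energy_def)
      finally show "E K1 u \<le> top_energy m K' u" .
      show "E K1 (list_deriv (i # ys) u) \<le> ennreal (C2 i) * top_energy m K' u" for i
        using K2(5)[OF u, of i] mult_left_mono[OF top_energy_mono[OF K'(4)[of i], of m u], of "ennreal (C2 i)"]
        by (auto intro: order_trans)
    qed auto
    also have "\<dots> = ennreal (C0 * (1 + (\<Sum>i\<in>UNIV. C2 i))) * top_energy m K' u"
      using C0(1) K2(4) by (simp add: ennreal_mult sum_nonneg distrib_right mult.assoc ennreal_plus sum_distrib_right flip: sum_ennreal)
    finally show "E K (list_deriv ys u) \<le> ennreal (C0 * (1 + (\<Sum>i\<in>UNIV. C2 i))) * top_energy m K' u" .
  qed (use K' K1 in auto)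
qed

text \<open>There are finitely many lists of length at most \<open>m\<close>; the union of their
  compact sets and the sum of their constants serve all of them.\<close>

theorem interpolation:
  assumes D: "open D" and K: "compact K" "K \<subseteq> D"
  obtains K' C where "compact K'" "K \<subseteq> K'" "K' \<subseteq> D" "0 \<le> C"
    "\<And>u ys. smooth_on D u \<Longrightarrow> length ys \<le> m \<Longrightarrow> E K (list_deriv ys u) \<le> ennreal C * top_energy m K' u"
proof -
  define S where "S = {ys :: 'n list. length ys \<le> m}"
  have S: "finite S" unfolding S_def using finite_lists_length_le[of "UNIV :: 'n set" m] by simp
  have "\<forall>ys\<in>S. \<exists>K' C. compact K' \<and> K \<subseteq> K' \<and> K' \<subseteq> D \<and> 0 \<le> C \<and>
    (\<forall>u. smooth_on D u \<longrightarrow> E K (list_deriv ys u) \<le> ennreal C * top_energy m K' u)"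
    using interpolation_single[OF D K] by (simp add: S_def)
  then obtain K1 C1 where KC: "\<And>ys. ys \<in> S \<Longrightarrow> compact (K1 ys)" "\<And>ys. ys \<in> S \<Longrightarrow> K \<subseteq> K1 ys"
    "\<And>ys. ys \<in> S \<Longrightarrow> K1 ys \<subseteq> D" "\<And>ys. ys \<in> S \<Longrightarrow> 0 \<le> C1 ys"
    "\<And>ys u. ys \<in> S \<Longrightarrow> smooth_on D u \<Longrightarrow> E K (list_deriv ys u) \<le> ennreal (C1 ys) * top_energy m (K1 ys) u"
    by metis
  define K' where "K' = (\<Union>ys\<in>S. K1 ys)"
  show thesis
  proof (rule that[of K' "\<Sum>ys\<in>S. C1 ys"])
    show "compact K'" unfolding K'_def using KC(1) S by (intro compact_UN) auto
    have "[] \<in> S" by (simp add: S_def)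
    then show "K \<subseteq> K'" using KC(2) by (auto simp: K'_def)
    show "K' \<subseteq> D" using KC(3) by (auto simp: K'_def)
    show "0 \<le> (\<Sum>ys\<in>S. C1 ys)" using KC(4) by (intro sum_nonneg)
    fix u :: "real^'n \<Rightarrow> real" and ys :: "'n list" assume u: "smooth_on D u" and "length ys \<le> m"
    then have ys: "ys \<in> S" by (simp add: S_def)
    have "E K (list_deriv ys u) \<le> ennreal (C1 ys) * top_energy m (K1 ys) u" by (rule KC(5)[OF ys u])
    also have "\<dots> \<le> ennreal (\<Sum>ys\<in>S. C1 ys) * top_energy m K' u"
      using ys S KC(4) by (intro mult_mono ennreal_leI top_energy_mono member_le_sum) (auto simp: K'_def)
    finally show "E K (list_deriv ys u) \<le> ennreal (\<Sum>ys\<in>S. C1 ys) * top_energy m K' u" .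
  qed
qed

end

section \<open>Weak derivatives of weighted Lp limits\<close>

lemma locally_summable_continuous:
  fixes f :: "real^'n::finite \<Rightarrow> real"
  assumes "continuous_on D f"
  shows "locally_summable D f"
  unfolding locally_summable_def set_integrable_def
proof (intro allI impI)
  fix K assume K: "compact K \<and> K \<subseteq> D"
  then have c: "continuous_on K f" using assms continuous_on_subset by blast
  have "integrable lborel (\<lambda>x. indicator K x *\<^sub>R f x)" by (rule borel_integrable_compact) (use K c in auto)
  moreover have "(\<lambda>x. indicator K x *\<^sub>R f x) \<in> borel_measurable lborel"
    using calculation by auto
  ultimately show "integrable lebesgue (\<lambda>x. indicator K x *\<^sub>R f x)" by (subst integrable_completion)
qed

lemma test_function_multi_deriv: "test_function D \<phi> \<Longrightarrow> test_function D (multi_deriv \<alpha> \<phi>)"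
  unfolding multi_deriv_eq by (rule test_function_list)

text \<open>The reversal is that of \<open>integration_by_parts_list\<close>; the derivatives are
  not reordered.\<close>

lemma smooth_has_weak_deriv:
  assumes D: "open D" and u: "smooth_on D u"
  shows "has_weak_deriv D \<alpha> u (list_deriv (rev (mi_list \<alpha>)) u)"
  unfolding has_weak_deriv_def
  using integration_by_parts_list[OF D u, of _ "mi_list \<alpha>"]
  by (auto simp: multi_deriv_eq length_mi_list intro!: locally_summable_continuous smooth_on_continuous u smooth_on_list)

lemma set_integral_test_subset:
  fixes f :: "real^'n::finite \<Rightarrow> real"
  assumes "test_function U \<psi>" "U \<subseteq> D"
  shows "(LINT x:D|lebesgue. f x * \<psi> x) = (LINT x:U|lebesgue. f x * \<psi> x)"
  unfolding set_lebesgue_integral_def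
proof (rule Bochner_Integration.integral_cong[OF refl])
  fix x show "indicator D x *\<^sub>R (f x * \<psi> x) = indicator U x *\<^sub>R (f x * \<psi> x)"
    using test_function_zero_outside[OF assms(1), of x] assms(2) by (auto simp: indicator_def)
qed

lemma locally_summable_subset: "locally_summable D f \<Longrightarrow> U \<subseteq> D \<Longrightarrow> locally_summable U f"
  unfolding locally_summable_def by blast

lemma has_weak_deriv_subset:
  assumes "has_weak_deriv D \<alpha> f g" "U \<subseteq> D"
  shows "has_weak_deriv U \<alpha> f g"
  unfolding has_weak_deriv_def
proof (intro conjI allI impI)
  fix \<phi> assume \<phi>: "test_function U \<phi>"
  have "(LINT x:D|lebesgue. f x * multi_deriv \<alpha> \<phi> x) =
      (-1) ^ multiindex_order \<alpha> * (LINT x:D|lebesgue. g x * \<phi> x)"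
    using assms test_function_mono[OF \<phi>] by (auto simp: has_weak_deriv_def)
  then show "(LINT x:U|lebesgue. f x * multi_deriv \<alpha> \<phi> x) =
      (-1) ^ multiindex_order \<alpha> * (LINT x:U|lebesgue. g x * \<phi> x)"
    using set_integral_test_subset[OF test_function_multi_deriv[OF \<phi>] assms(2)]
      set_integral_test_subset[OF \<phi> assms(2)] by simp
qed (use assms locally_summable_subset in \<open>auto simp: has_weak_deriv_def\<close>)

lemma locally_summable_cong_AE:
  assumes f: "locally_summable D f" and eq: "AE x in lebesgue. x \<in> D \<longrightarrow> f x = g x"
  shows "locally_summable D g"
  unfolding locally_summable_def set_integrable_def
proof (intro allI impI)
  fix K assume K: "compact K \<and> K \<subseteq> D"
  have i: "integrable lebesgue (\<lambda>x. indicator K x *\<^sub>R f x)"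
    using f K by (auto simp: locally_summable_def set_integrable_def)
  have ae: "AE x in lebesgue. indicator K x *\<^sub>R f x = indicator K x *\<^sub>R g x"
    using eq by eventually_elim (use K in \<open>auto simp: indicator_def\<close>)
  have "(\<lambda>x. indicator K x *\<^sub>R g x) \<in> borel_measurable lebesgue"
    by (rule borel_measurable_AE[OF _ ae]) (use i in auto)
  then show "integrable lebesgue (\<lambda>x. indicator K x *\<^sub>R g x)"
    using Bochner_Integration.integrable_cong_AE[OF _ _ ae] i by blast
qed

lemma set_integral_mult_cong_AE:
  fixes f g \<psi> :: "real^'n::finite \<Rightarrow> real"
  assumes f: "locally_summable D f" and eq: "AE x in lebesgue. x \<in> D \<longrightarrow> f x = g x" and \<psi>: "test_function D \<psi>"
  shows "(LINT x:D|lebesgue. f x * \<psi> x) = (LINT x:D|lebesgue. g x * \<psi> x)"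
  unfolding set_lebesgue_integral_def
proof (rule integral_cong_AE)
  show "(\<lambda>x. indicator D x *\<^sub>R (f x * \<psi> x)) \<in> borel_measurable lebesgue"
    using locally_summable_mult_test[OF f \<psi>] by (auto simp: set_integrable_def)
  show "(\<lambda>x. indicator D x *\<^sub>R (g x * \<psi> x)) \<in> borel_measurable lebesgue"
    using locally_summable_mult_test[OF locally_summable_cong_AE[OF f eq] \<psi>] by (auto simp: set_integrable_def)
  show "AE x in lebesgue. indicator D x *\<^sub>R (f x * \<psi> x) = indicator D x *\<^sub>R (g x * \<psi> x)"
    using eq by eventually_elim (auto simp: indicator_def)
qed

lemma has_weak_deriv_cong_AE:
  assumes wd: "has_weak_deriv D \<alpha> f g"
    and f: "AE x in lebesgue. x \<in> D \<longrightarrow> f x = f' x" and g: "AE x in lebesgue. x \<in> D \<longrightarrow> g x = g' x"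
  shows "has_weak_deriv D \<alpha> f' g'"
proof -
  have ls: "locally_summable D f" "locally_summable D g" using wd by (auto simp: has_weak_deriv_def)
  show ?thesis
    unfolding has_weak_deriv_def
    using wd locally_summable_cong_AE[OF ls(1) f] locally_summable_cong_AE[OF ls(2) g]
      set_integral_mult_cong_AE[OF ls(1) f test_function_multi_deriv] set_integral_mult_cong_AE[OF ls(2) g]
    by (simp add: has_weak_deriv_def)
qed

text \<open>Weak derivatives on nested open sets agree almost everywhere by uniqueness, and the
  support of a test function, being compact, lies in one of the sets.\<close>

lemma has_weak_deriv_glue:
  fixes D :: "(real^'n::finite) set"
  assumes f: "locally_summable D f"
    and U: "\<And>i::nat. open (U i)" "\<And>i. U i \<subseteq> D" "\<And>i. U i \<subseteq> U (Suc i)"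
      "\<And>K. compact K \<Longrightarrow> K \<subseteq> D \<Longrightarrow> \<exists>i. K \<subseteq> U i"
    and g: "\<And>i. has_weak_deriv (U i) \<alpha> f (g i)"
  shows "\<exists>h. has_weak_deriv D \<alpha> f h"
proof -
  have mono: "U i \<subseteq> U j" if "i \<le> j" for i j
    using that by (induction rule: dec_induct) (use U(3) in auto)
  \<comment> \<open>The value comes from the first set that contains the point. It differs from
    \<open>g j\<close> on \<open>U j\<close> only on a countable union of null sets.\<close>
  define h where "h x = g (LEAST i. x \<in> U i) x" for x
  have h_eq: "AE x in lebesgue. x \<in> U j \<longrightarrow> g j x = h x" for j
  proof -
    have "AE x in lebesgue. i \<le> j \<longrightarrow> x \<in> U i \<longrightarrow> g i x = g j x" for i
    proof (cases "i \<le> j")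
      case True
      have "AE x in lebesgue. x \<in> U i \<longrightarrow> g i x = g j x"
        by (rule has_weak_deriv_unique[OF U(1) g has_weak_deriv_subset[OF g mono[OF True]]])
      then show ?thesis by eventually_elim simp
    qed simp
    then have "AE x in lebesgue. \<forall>i. i \<le> j \<longrightarrow> x \<in> U i \<longrightarrow> g i x = g j x"
      unfolding AE_all_countable by blast
    then show ?thesis
    proof eventually_elim
      case (elim x)
      then show ?case unfolding h_def by (metis LeastI Least_le)
    qed
  qed
  have wd: "has_weak_deriv (U j) \<alpha> f h" for j
    by (rule has_weak_deriv_cong_AE[OF g _ h_eq]) simp
  have "has_weak_deriv D \<alpha> f h"
    unfolding has_weak_deriv_def
  proof (intro conjI allI impI)
    show "locally_summable D f" by (rule f)
    show "locally_summable D h"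
      unfolding locally_summable_def
    proof (intro allI impI)
      fix K assume K: "compact K \<and> K \<subseteq> D"
      then obtain i where "K \<subseteq> U i" using U(4) by blast
      then show "set_integrable lebesgue K h"
        using wd[of i] K by (auto simp: has_weak_deriv_def locally_summable_def)
    qed
    fix \<phi> assume \<phi>: "test_function D \<phi>"
    then obtain i where "closure {x. \<phi> x \<noteq> 0} \<subseteq> U i"
      using U(4)[of "closure {x. \<phi> x \<noteq> 0}"] unfolding test_function_def by blast
    then have \<phi>i: "test_function (U i) \<phi>" using \<phi> by (simp add: test_function_def)
    show "(LINT x:D|lebesgue. f x * multi_deriv \<alpha> \<phi> x) =
        (-1) ^ multiindex_order \<alpha> * (LINT x:D|lebesgue. h x * \<phi> x)"
      unfolding set_integral_test_subset[OF test_function_multi_deriv[OF \<phi>i] U(2)]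
        set_integral_test_subset[OF \<phi>i U(2)]
      using wd[of i] \<phi>i by (simp add: has_weak_deriv_def)
  qed
  then show ?thesis by blast
qed

lemma real_tendsto_0I:
  fixes a :: "'a \<Rightarrow> real"
  assumes "((\<lambda>n. ennreal \<bar>a n\<bar>) \<longlongrightarrow> 0) F"
  shows "(a \<longlongrightarrow> 0) F"
proof (rule tendstoI)
  fix e :: real assume "e > 0"
  then have "\<forall>\<^sub>F n in F. ennreal \<bar>a n\<bar> \<le> ennreal (e / 2)"
    by (intro ennreal_tendsto_0D[OF assms]) simp
  then show "\<forall>\<^sub>F n in F. dist (a n) 0 < e"
    by eventually_elim (use \<open>e > 0\<close> in \<open>auto simp: ennreal_le_iff\<close>)
qed

lemma ennreal_tendsto_0_mult:
  assumes "(X \<longlongrightarrow> (0::ennreal)) F"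
  shows "((\<lambda>n. ennreal c * X n) \<longlongrightarrow> 0) F"
  using ennreal_tendsto_cmult[OF _ assms, of "ennreal c"] by simp

lemma ennreal_tendsto_0_le:
  assumes "(X \<longlongrightarrow> (0::ennreal)) F" "\<And>n. Y n \<le> X n"
  shows "(Y \<longlongrightarrow> 0) F"
  by (rule tendsto_sandwich[OF _ _ tendsto_const assms(1)]) (use assms(2) in auto)

context ap_weight
begin

lemma E_locally_summable:
  assumes "\<And>K. compact K \<Longrightarrow> K \<subseteq> U \<Longrightarrow> meas_on K f \<and> E K f < \<infinity>"
  shows "locally_summable U f"
  unfolding locally_summable_def set_integrable_def
  using E_imp_integrable assms by auto

text \<open>On the compact support of \<psi> the energy controls the L1 distance, and \<psi> is
  bounded. Convergence on compact subsets of \<open>U\<close> is therefore enough.\<close>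

lemma pairing_tendsto:
  assumes f: "\<And>n::nat. locally_summable U (f n)" "locally_summable U h" and \<psi>: "test_function U \<psi>"
    and lim: "\<And>K. compact K \<Longrightarrow> K \<subseteq> U \<Longrightarrow> (\<lambda>n. E K (\<lambda>x. f n x - h x)) \<longlonglongrightarrow> 0"
  shows "(\<lambda>n. LINT x:U|lebesgue. f n x * \<psi> x) \<longlonglongrightarrow> (LINT x:U|lebesgue. h x * \<psi> x)"
proof -
  obtain K where K: "compact K" "K \<subseteq> U" "\<And>x. x \<notin> K \<Longrightarrow> \<psi> x = 0"
    using \<psi> by (rule test_functionE) blast
  obtain M where M: "M > 0" "\<And>x. \<bar>\<psi> x\<bar> \<le> M" using \<psi> by (rule test_function_bounded) blast
  have mK: "meas_on K (\<lambda>x. f n x - h x)" for n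
    using locally_summable_integrable[OF locally_summable_diff[OF f(1) f(2)] K(1,2)]
    by (auto simp: meas_on_def)
  have L1: "(\<lambda>n. ennreal M * (\<integral>\<^sup>+x. ennreal \<bar>indicator K x * (f n x - h x)\<bar> \<partial>lebesgue)) \<longlonglongrightarrow> 0"
    by (intro ennreal_tendsto_0_mult E_tendsto_L1 K mK lim)
  have "(\<lambda>n. ennreal \<bar>(LINT x:U|lebesgue. f n x * \<psi> x) - (LINT x:U|lebesgue. h x * \<psi> x)\<bar>) \<longlonglongrightarrow> 0"
  proof (rule ennreal_tendsto_0_le[OF L1])
    fix n
    have i: "set_integrable lebesgue U (\<lambda>x. (f n x - h x) * \<psi> x)"
      by (rule locally_summable_mult_test[OF locally_summable_diff[OF f] \<psi>])
    have "(LINT x:U|lebesgue. f n x * \<psi> x) - (LINT x:U|lebesgue. h x * \<psi> x) =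
        (LINT x:U|lebesgue. f n x * \<psi> x - h x * \<psi> x)"
      by (rule set_integral_diff(2)[symmetric]; rule locally_summable_mult_test[OF _ \<psi>]; rule f)
    also have "\<dots> = (LINT x|lebesgue. indicator U x *\<^sub>R ((f n x - h x) * \<psi> x))"
      by (simp add: set_lebesgue_integral_def algebra_simps)
    finally have "ennreal \<bar>(LINT x:U|lebesgue. f n x * \<psi> x) - (LINT x:U|lebesgue. h x * \<psi> x)\<bar> \<le>
        (\<integral>\<^sup>+x. ennreal (norm (indicator U x *\<^sub>R ((f n x - h x) * \<psi> x))) \<partial>lebesgue)"
      using integral_norm_bound_ennreal[OF i[unfolded set_integrable_def]] by simp
    also have "\<dots> \<le> (\<integral>\<^sup>+x. ennreal M * ennreal \<bar>indicator K x * (f n x - h x)\<bar> \<partial>lebesgue)"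
    proof (rule nn_integral_mono)
      fix x
      show "ennreal (norm (indicator U x *\<^sub>R ((f n x - h x) * \<psi> x))) \<le> ennreal M * ennreal \<bar>indicator K x * (f n x - h x)\<bar>"
      proof (cases "x \<in> K")
        case True
        have "\<bar>f n x - h x\<bar> * \<bar>\<psi> x\<bar> \<le> \<bar>f n x - h x\<bar> * M" by (intro mult_left_mono M) auto
        then show ?thesis using True K(2) M(1)
          by (auto simp flip: ennreal_mult' simp: abs_mult mult.commute intro!: ennreal_leI)
      qed (use K(3) in auto)
    qed
    also have "\<dots> = ennreal M * (\<integral>\<^sup>+x. ennreal \<bar>indicator K x * (f n x - h x)\<bar> \<partial>lebesgue)"
      using mK[of n] by (intro nn_integral_cmult) (auto simp: meas_on_def)
    finally show "ennreal \<bar>(LINT x:U|lebesgue. f n x * \<psi> x) - (LINT x:U|lebesgue. h x * \<psi> x)\<bar> \<le>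
        ennreal M * (\<integral>\<^sup>+x. ennreal \<bar>indicator K x * (f n x - h x)\<bar> \<partial>lebesgue)" .
  qed
  from real_tendsto_0I[OF this] show ?thesis by (simp add: LIM_zero_iff)
qed

text \<open>Both sides of the defining identity are pairings with fixed test functions, so each
  passes to the limit.\<close>

lemma has_weak_deriv_limit:
  assumes wd: "\<And>n::nat. has_weak_deriv U \<alpha> (f n) (g n)"
    and ls: "locally_summable U f'" "locally_summable U g'"
    and f: "\<And>K. compact K \<Longrightarrow> K \<subseteq> U \<Longrightarrow> (\<lambda>n. E K (\<lambda>x. f n x - f' x)) \<longlonglongrightarrow> 0"
    and g: "\<And>K. compact K \<Longrightarrow> K \<subseteq> U \<Longrightarrow> (\<lambda>n. E K (\<lambda>x. g n x - g' x)) \<longlonglongrightarrow> 0"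
  shows "has_weak_deriv U \<alpha> f' g'"
  unfolding has_weak_deriv_def
proof (intro conjI allI impI ls)
  fix \<phi> assume \<phi>: "test_function U \<phi>"
  have lsn: "locally_summable U (f n)" "locally_summable U (g n)" for n
    using wd[of n] by (auto simp: has_weak_deriv_def)
  have a: "(\<lambda>n. LINT x:U|lebesgue. f n x * multi_deriv \<alpha> \<phi> x) \<longlonglongrightarrow> (LINT x:U|lebesgue. f' x * multi_deriv \<alpha> \<phi> x)"
    by (rule pairing_tendsto[OF lsn(1) ls(1) test_function_multi_deriv[OF \<phi>]]) (rule f)
  have b: "(\<lambda>n. (-1) ^ multiindex_order \<alpha> * (LINT x:U|lebesgue. g n x * \<phi> x)) \<longlonglongrightarrow>
      (-1) ^ multiindex_order \<alpha> * (LINT x:U|lebesgue. g' x * \<phi> x)"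
    by (intro tendsto_mult_left pairing_tendsto[OF lsn(2) ls(2) \<phi>]) (rule g)
  have c: "(LINT x:U|lebesgue. f n x * multi_deriv \<alpha> \<phi> x) = (-1) ^ multiindex_order \<alpha> * (LINT x:U|lebesgue. g n x * \<phi> x)" for n
    using wd[of n] \<phi> by (simp add: has_weak_deriv_def)
  show "(LINT x:U|lebesgue. f' x * multi_deriv \<alpha> \<phi> x) =
      (-1) ^ multiindex_order \<alpha> * (LINT x:U|lebesgue. g' x * \<phi> x)"
    by (rule LIMSEQ_unique[OF a[unfolded c] b])
qed

text \<open>The unweighted completeness theorem is applied to \<open>wt K (f n)\<close>; positivity
  of \<open>v\<close> allows the limit to be divided by v^(1/p).\<close>

lemma E_complete:
  assumes K: "K \<in> sets lebesgue" and f: "\<And>n::nat. meas_on K (f n)"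
    and Cauchy: "\<And>e. e > 0 \<Longrightarrow> \<exists>N. \<forall>i\<ge>N. \<forall>j\<ge>N. E K (\<lambda>x. f i x - f j x) \<le> ennreal e"
  obtains g where "meas_on K g" "(\<lambda>n. E K (\<lambda>x. f n x - g x)) \<longlonglongrightarrow> 0"
proof -
  have wtd: "(\<lambda>x. wt K (f i) x - wt K (f j) x) = wt K (\<lambda>x. f i x - f j x)" for i j
    by (auto simp: wt_def algebra_simps)
  obtain G where G: "G \<in> borel_measurable lebesgue" "(\<lambda>n. Ep p lebesgue (\<lambda>x. wt K (f n) x - G x)) \<longlonglongrightarrow> 0"
  proof (rule riesz_fischer[OF wt_measurable[OF f] p_pos])
    show "\<exists>N. \<forall>m\<ge>N. \<forall>n\<ge>N. Ep p lebesgue (\<lambda>x. wt K (f m) x - wt K (f n) x) \<le> ennreal e" if "e > 0" for e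
      using Cauchy[OF that] by (simp add: wtd E_eq)
  qed (rule that)
  define g where "g x = G x / v x powr (1 / p)" for x
  have vp: "v x powr (1 / p) > 0" for x using v_pos[of x] by simp
  show thesis
  proof
    have "g \<in> borel_measurable lebesgue" unfolding g_def using G(1) by measurable
    then show mg: "meas_on K g" unfolding meas_on_def
      using K by (intro borel_measurable_times borel_measurable_indicator)
    show "(\<lambda>n. E K (\<lambda>x. f n x - g x)) \<longlonglongrightarrow> 0"
    \<comment> \<open>An inequality only: off \<open>K\<close> the left integrand vanishes while the
      limit \<open>G\<close> may not.\<close>
    proof (rule ennreal_tendsto_0_le[OF G(2)])
      fix n
      show "E K (\<lambda>x. f n x - g x) \<le> Ep p lebesgue (\<lambda>x. wt K (f n) x - G x)"
        unfolding E_eq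
      proof (rule Ep_mono[OF p_pos AE_I2])
        fix x
        have "(f n x - g x) * v x powr (1 / p) = f n x * v x powr (1 / p) - G x"
          using vp[of x] by (simp add: g_def field_simps)
        then show "\<bar>wt K (\<lambda>x. f n x - g x) x\<bar> \<le> \<bar>wt K (f n) x - G x\<bar>"
          by (simp add: wt_def indicator_def)
      qed
    qed
  qed
qed

lemma E_Cauchy_of_limit:
  assumes f: "\<And>n::nat. meas_on K (f n)" "meas_on K g" and lim: "(\<lambda>n. E K (\<lambda>x. f n x - g x)) \<longlonglongrightarrow> 0" and e: "0 < e"
  shows "\<exists>N. \<forall>i\<ge>N. \<forall>j\<ge>N. E K (\<lambda>x. f i x - f j x) \<le> ennreal e"
proof -
  define d where "d = e / (2 * 2 powr p)"
  have d: "d > 0" using e by (simp add: d_def)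
  obtain N where N: "\<And>n. n \<ge> N \<Longrightarrow> E K (\<lambda>x. f n x - g x) \<le> ennreal d"
    using ennreal_tendsto_0D[OF lim d] by (auto simp: eventually_sequentially)
  have "E K (\<lambda>x. f i x - f j x) \<le> ennreal e" if ij: "i \<ge> N" "j \<ge> N" for i j
  proof -
    have "E K (\<lambda>x. f i x - f j x) \<le> ennreal (2 powr p) * (E K (\<lambda>x. f i x - g x) + E K (\<lambda>x. g x - f j x))"
      by (rule E_triangle[OF f(1) f(2) f(1)])
    also have "\<dots> \<le> ennreal (2 powr p) * (ennreal d + ennreal d)"
      using N[OF ij(1)] N[OF ij(2)] by (intro mult_left_mono add_mono) (auto simp: E_commute[of K g])
    also have "\<dots> = ennreal e" using d by (simp add: d_def flip: ennreal_mult' ennreal_plus)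
    finally show ?thesis .
  qed
  then show ?thesis by blast
qed

text \<open>The approximants are mollifications. Their derivatives of order \<open>m\<close> are
  mollifications of weak derivatives and converge; \<open>interpolation\<close>, applied to
  differences of approximants, carries this to all lower orders. For those only the Cauchy property
  is claimed, since their limits are not yet known to be weak derivatives of
  \<open>f\<close>.\<close>

theorem local_smooth_approx:
  assumes D: "open D" and f: "meas_on D f" "E D f < \<infinity>"
    and g: "\<And>\<alpha>. multiindex_order \<alpha> = m \<Longrightarrow> has_weak_deriv D \<alpha> f (g \<alpha>)"
      "\<And>\<alpha>. multiindex_order \<alpha> = m \<Longrightarrow> meas_on D (g \<alpha>)" "\<And>\<alpha>. multiindex_order \<alpha> = m \<Longrightarrow> E D (g \<alpha>) < \<infinity>"
    and K: "compact K" "K \<subseteq> D"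
  obtains u where "\<And>j::nat. smooth_on UNIV (u j)" "(\<lambda>j. E K (\<lambda>x. u j x - f x)) \<longlonglongrightarrow> 0"
    "\<And>ys e. length ys \<le> m \<Longrightarrow> e > 0 \<Longrightarrow>
      \<exists>N. \<forall>i\<ge>N. \<forall>j\<ge>N. E K (\<lambda>x. list_deriv ys (u i) x - list_deriv ys (u j) x) \<le> ennreal e"
proof -
  obtain K1 C where K1: "compact K1" "K \<subseteq> K1" "K1 \<subseteq> D" and C: "0 \<le> C"
    "\<And>u ys. smooth_on D u \<Longrightarrow> length ys \<le> m \<Longrightarrow> E K (list_deriv ys u) \<le> ennreal C * top_energy m K1 u"
    by (rule interpolation[OF D K, of m]) (rule that)
  obtain r where r: "r > 0" "compact (\<Union>x\<in>K1. cball x r)" "(\<Union>x\<in>K1. cball x r) \<subseteq> D"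
    by (rule compact_neighbourhood[OF K1(1) D K1(3)]) (rule that)
  \<comment> \<open>Three compact sets are nested: \<open>interpolation\<close> leads from
    \<open>K\<close> to \<open>K1\<close>, and mollifications of radius at most \<open>r\<close> at
    points of \<open>K1\<close> see only values on \<open>K2\<close>.\<close>
  define K2 where "K2 = (\<Union>x\<in>K1. cball x r)"
  have K2: "compact K2" "K2 \<subseteq> D" using r by (auto simp: K2_def)
  have K12: "K1 \<subseteq> K2" using r(1) by (force simp: K2_def)
  have K1l: "K1 \<in> sets lebesgue" and K2l: "K2 \<in> sets lebesgue" and Kl: "K \<in> sets lebesgue"
    using sets_lebesgue_compact K K1 K2 by auto
  define \<epsilon> where "\<epsilon> j = r / (real j + 1)" for j :: nat
  \<comment> \<open>The bound by \<open>r\<close> holds from the start of the sequence, so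
    \<open>list_deriv_mollify\<close> applies on \<open>K1\<close> for every index.\<close>
  have \<epsilon>: "\<epsilon> j > 0" "\<epsilon> j \<le> r" for j using r(1) by (auto simp: \<epsilon>_def field_simps)
  have \<epsilon>_lim: "filterlim \<epsilon> (at_right 0) sequentially"
  proof -
    have "\<epsilon> \<longlonglongrightarrow> 0"
      unfolding \<epsilon>_def by (rule real_tendsto_divide_at_top[OF tendsto_const])
        (use filterlim_tendsto_add_at_top[OF tendsto_const[of 1] filterlim_real_sequentially] in \<open>simp add: add.commute\<close>)
    then show ?thesis using \<epsilon>(1)
      by (auto simp: filterlim_at less_imp_neq[symmetric] intro!: always_eventually)
  qed
  have mol: "(\<lambda>j. E UNIV (\<lambda>x. mollify (\<epsilon> j) (\<lambda>z. indicator K2 z * h z) x - indicator K2 x * h x)) \<longlonglongrightarrow> 0"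
    and int: "integrable lebesgue (\<lambda>z. indicator K2 z * h z)"
    if h: "meas_on D h" "E D h < \<infinity>" for h
  proof -
    have m: "meas_on K2 h" by (rule meas_on_subset[OF h(1) K2(2) K2l])
    have E: "E K2 h < \<infinity>" using E_mono_set[OF K2(2), of h] h(2) by (rule order_le_less_trans)
    show "integrable lebesgue (\<lambda>z. indicator K2 z * h z)" by (rule E_imp_integrable[OF K2(1) m E])
    have "((\<lambda>\<epsilon>. E UNIV (\<lambda>x. mollify \<epsilon> (\<lambda>z. indicator K2 z * h z) x - indicator K2 x * h x)) \<longlongrightarrow> 0) (at_right 0)"
      by (rule mollify_tendsto[OF _ K2(1)]) (use m E in \<open>auto simp: meas_on_def E_indicator\<close>)
    then show "(\<lambda>j. E UNIV (\<lambda>x. mollify (\<epsilon> j) (\<lambda>z. indicator K2 z * h z) x - indicator K2 x * h x)) \<longlonglongrightarrow> 0"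
      by (rule filterlim_compose[OF _ \<epsilon>_lim])
  qed
  define u where "u j = mollify (\<epsilon> j) (\<lambda>z. indicator K2 z * f z)" for j
  have u_smooth: "smooth_on S (u j)" for j S
    unfolding u_def by (rule mollify_smooth[OF int[OF f] \<epsilon>(1)])
  have lim: "(\<lambda>j. E K1 (\<lambda>x. h' j x - h x)) \<longlonglongrightarrow> 0"
    if h: "meas_on D h" "E D h < \<infinity>" and h': "\<And>j x. x \<in> K1 \<Longrightarrow> h' j x = mollify (\<epsilon> j) (\<lambda>z. indicator K2 z * h z) x" for h h'
  proof (rule ennreal_tendsto_0_le[OF mol[OF h]])
    fix j
    have "E K1 (\<lambda>x. h' j x - h x) = E K1 (\<lambda>x. mollify (\<epsilon> j) (\<lambda>z. indicator K2 z * h z) x - indicator K2 x * h x)"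
      using h' K12 by (intro E_cong) (auto simp: indicator_def)
    also have "\<dots> \<le> E UNIV (\<lambda>x. mollify (\<epsilon> j) (\<lambda>z. indicator K2 z * h z) x - indicator K2 x * h x)"
      by (rule E_mono_set) simp
    finally show "E K1 (\<lambda>x. h' j x - h x) \<le> \<dots>" .
  qed
  have u_lim: "(\<lambda>j. E K1 (\<lambda>x. u j x - f x)) \<longlonglongrightarrow> 0"
    by (rule lim[OF f]) (simp add: u_def)
  have meas_u: "meas_on S (list_deriv ys (u j))" if "S \<in> sets lebesgue" for S ys j
    by (rule meas_on_borel[OF borel_measurable_continuous_onI[OF smooth_on_continuous[OF smooth_on_list[OF u_smooth]]] that])
  \<comment> \<open>Each list of length \<open>m\<close> converges to the weak derivative for its
    multiplicities, so several lists may share a limit.\<close>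
  have top_lim: "(\<lambda>j. E K1 (\<lambda>x. list_deriv xs (u j) x - g (count_list xs) x)) \<longlonglongrightarrow> 0" if xs: "length xs = m" for xs
  proof (rule lim)
    have order: "multiindex_order (count_list xs) = m"
      using xs sum_count_set[of xs UNIV] by (simp add: multiindex_order_def)
    show "meas_on D (g (count_list xs))" "E D (g (count_list xs)) < \<infinity>" by (rule g[OF order])+
    fix j x assume "x \<in> K1"
    then have "cball x (\<epsilon> j) \<subseteq> K2" using \<epsilon>(2)[of j] by (force simp: K2_def)
    then show "list_deriv xs (u j) x = mollify (\<epsilon> j) (\<lambda>z. indicator K2 z * g (count_list xs) z) x"
      unfolding u_def by (intro list_deriv_mollify[OF g(1)[OF order] K2 \<epsilon>(1)]) auto
  qed
  have meas_g: "meas_on K1 (g (count_list xs))" if "length xs = m" for xs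
    using that sum_count_set[of xs UNIV]
    by (intro meas_on_subset[OF g(2) K1(3) K1l]) (simp add: multiindex_order_def)
  define S where "S = {xs :: 'n list. length xs = m}"
  have S: "finite S" unfolding S_def by (rule finite_lists_length)
  have top: "\<exists>N. \<forall>i\<ge>N. \<forall>j\<ge>N. top_energy m K1 (\<lambda>x. u i x - u j x) \<le> ennreal e" if e: "e > 0" for e
  proof -
    define d where "d = e / (1 + real (card S))"
    have d: "d > 0" using e by (simp add: d_def add_pos_nonneg)
    obtain N0 where N0: "\<And>i j. i \<ge> N0 \<Longrightarrow> j \<ge> N0 \<Longrightarrow> E K1 (\<lambda>x. u i x - u j x) \<le> ennreal d"
      using E_Cauchy_of_limit[OF _ meas_on_subset[OF f(1) K1(3) K1l] u_lim d] meas_u[OF K1l, of "[]"] by auto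
    have "\<forall>xs\<in>S. \<exists>N. \<forall>i\<ge>N. \<forall>j\<ge>N. E K1 (\<lambda>x. list_deriv xs (u i) x - list_deriv xs (u j) x) \<le> ennreal d"
      using E_Cauchy_of_limit[OF meas_u[OF K1l] meas_g top_lim d] by (auto simp: S_def)
    then obtain N1 where N1: "\<And>xs i j. xs \<in> S \<Longrightarrow> i \<ge> N1 xs \<Longrightarrow> j \<ge> N1 xs \<Longrightarrow>
        E K1 (\<lambda>x. list_deriv xs (u i) x - list_deriv xs (u j) x) \<le> ennreal d"
      by metis
    define N where "N = Max (insert N0 (N1 ` S))"
    have "top_energy m K1 (\<lambda>x. u i x - u j x) \<le> ennreal e" if ij: "i \<ge> N" "j \<ge> N" for i j
    proof -
      have NN: "N0 \<le> N" "\<And>xs. xs \<in> S \<Longrightarrow> N1 xs \<le> N" using S by (auto simp: N_def)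
      have "E K1 (list_deriv xs (\<lambda>x. u i x - u j x)) \<le> ennreal d" if xs: "xs \<in> S" for xs
      proof -
        have "E K1 (list_deriv xs (\<lambda>x. u i x - u j x)) = E K1 (\<lambda>x. list_deriv xs (u i) x - list_deriv xs (u j) x)"
          by (intro E_cong list_deriv_diff[OF open_UNIV u_smooth u_smooth]) simp
        then show ?thesis using N1[OF xs] NN(2)[OF xs] ij by simp
      qed
      then have "(\<Sum>xs\<in>S. E K1 (list_deriv xs (\<lambda>x. u i x - u j x))) \<le> (\<Sum>xs\<in>S. ennreal d)" by (rule sum_mono)
      then have "top_energy m K1 (\<lambda>x. u i x - u j x) \<le> ennreal d + (\<Sum>xs\<in>S. ennreal d)"
        unfolding top_energy_def S_def[symmetric] using N0[of i j] NN(1) ij by (intro add_mono) auto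
      also have "\<dots> = ennreal (d + real (card S) * d)"
        using d by (subst sum_ennreal) (auto simp flip: ennreal_plus)
      also have "d + real (card S) * d = d * (1 + real (card S))" by (simp add: algebra_simps)
      also have "\<dots> = e" by (simp add: d_def add_pos_nonneg less_imp_neq[symmetric])
      finally show ?thesis .
    qed
    then show ?thesis by blast
  qed
  show thesis
  proof (rule that[of u])
    show "smooth_on UNIV (u j)" for j by (rule u_smooth)
    show "(\<lambda>j. E K (\<lambda>x. u j x - f x)) \<longlonglongrightarrow> 0"
      by (rule ennreal_tendsto_0_le[OF u_lim E_mono_set[OF K1(2)]])
    fix ys :: "'n list" and e :: real assume ys: "length ys \<le> m" and e: "e > 0"
    obtain N where N: "\<And>i j. i \<ge> N \<Longrightarrow> j \<ge> N \<Longrightarrow> top_energy m K1 (\<lambda>x. u i x - u j x) \<le> ennreal (e / (C + 1))"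
      using top[of "e / (C + 1)"] e C(1) by auto
    have "E K (\<lambda>x. list_deriv ys (u i) x - list_deriv ys (u j) x) \<le> ennreal e" if ij: "i \<ge> N" "j \<ge> N" for i j
    proof -
      have "E K (\<lambda>x. list_deriv ys (u i) x - list_deriv ys (u j) x) = E K (list_deriv ys (\<lambda>x. u i x - u j x))"
        by (intro E_cong list_deriv_diff[OF open_UNIV u_smooth u_smooth, symmetric]) simp
      also have "\<dots> \<le> ennreal C * top_energy m K1 (\<lambda>x. u i x - u j x)"
        by (intro C(2) ys smooth_on_diff D u_smooth)
      also have "\<dots> \<le> ennreal C * ennreal (e / (C + 1))" by (intro mult_left_mono N ij) auto
      also have "\<dots> \<le> ennreal e"
        using C(1) e by (auto simp flip: ennreal_mult' intro!: ennreal_leI simp: field_simps)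
      finally show ?thesis .
    qed
    then show "\<exists>N. \<forall>i\<ge>N. \<forall>j\<ge>N. E K (\<lambda>x. list_deriv ys (u i) x - list_deriv ys (u j) x) \<le> ennreal e" by blast
  qed
qed

text \<open>On each set of a compact exhaustion the derivatives of order \<beta> of smooth
  approximants form a Cauchy sequence. The limit is a weak derivative of \<open>f\<close> on the
  interior, and the pieces are glued.\<close>

theorem weakly_differentiable_of_top_order:
  assumes D: "open D" and f: "locally_summable D f" "meas_on D f" "E D f < \<infinity>"
    and g: "\<And>\<alpha>. multiindex_order \<alpha> = m \<Longrightarrow> has_weak_deriv D \<alpha> f (g \<alpha>)"
      "\<And>\<alpha>. multiindex_order \<alpha> = m \<Longrightarrow> meas_on D (g \<alpha>)" "\<And>\<alpha>. multiindex_order \<alpha> = m \<Longrightarrow> E D (g \<alpha>) < \<infinity>"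
  shows "weakly_differentiable D m f"
  unfolding weakly_differentiable_def
proof (intro allI impI)
  fix \<beta> :: "'n \<Rightarrow> nat" assume \<beta>: "multiindex_order \<beta> \<le> m"
  obtain C where C: "\<And>n::nat. compact (C n)" "\<And>n. C n \<subseteq> D" "\<And>n. C n \<subseteq> interior (C (Suc n))"
    "\<And>K. compact K \<Longrightarrow> K \<subseteq> D \<Longrightarrow> \<exists>N. \<forall>n\<ge>N. K \<subseteq> C n"
    by (rule open_Union_compact_subsets[OF D]) blast
  have "\<exists>h. has_weak_deriv (interior (C n)) \<beta> f h" for n
  proof -
    let ?U = "interior (C n)"
    obtain u where u: "\<And>j::nat. smooth_on UNIV (u j)" "(\<lambda>j. E (C n) (\<lambda>x. u j x - f x)) \<longlonglongrightarrow> 0"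
      "\<And>ys e. length ys \<le> m \<Longrightarrow> e > 0 \<Longrightarrow>
        \<exists>N. \<forall>i\<ge>N. \<forall>j\<ge>N. E (C n) (\<lambda>x. list_deriv ys (u i) x - list_deriv ys (u j) x) \<le> ennreal e"
      by (rule local_smooth_approx[OF D f(2,3) _ _ _ C(1) C(2), of m g n], erule g, erule g, erule g, rule that)
    define ys where "ys = rev (mi_list \<beta>)"
    have ys: "length ys \<le> m" using \<beta> by (simp add: ys_def length_mi_list)
    have Cl: "C n \<in> sets lebesgue" by (rule sets_lebesgue_compact[OF C(1)])
    have mu: "meas_on (C n) (list_deriv ys (u j))" for ys j
      by (rule meas_on_borel[OF borel_measurable_continuous_onI[OF smooth_on_continuous[OF smooth_on_list[OF u(1)]]] Cl])
    obtain h where h: "meas_on (C n) h" "(\<lambda>j. E (C n) (\<lambda>x. list_deriv ys (u j) x - h x)) \<longlonglongrightarrow> 0"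
      by (rule E_complete[OF Cl mu u(3)[OF ys]]) (assumption | rule that)+
    \<comment> \<open>Finite energy gives the local summability that the definition of a weak
      derivative demands of the limit.\<close>
    have "E (C n) h < \<infinity>"
    proof -
      obtain j where j: "E (C n) (\<lambda>x. h x - list_deriv ys (u j) x) \<le> ennreal 1"
        using ennreal_tendsto_0D[OF h(2), of 1] by (auto simp: E_commute[of _ h] eventually_sequentially)
      have "E (C n) (\<lambda>x. (h x - list_deriv ys (u j) x) + list_deriv ys (u j) x) \<le> ennreal (2 powr p) *
          (E (C n) (\<lambda>x. h x - list_deriv ys (u j) x) + E (C n) (list_deriv ys (u j)))"
        by (intro E_add meas_on_diff h(1) mu)
      also have "\<dots> < \<infinity>"
        using j E_continuous_finite[OF C(1) continuous_on_subset[OF smooth_on_continuous[OF smooth_on_list[OF u(1)]]], of n ys j]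
        by (auto simp: ennreal_mult_less_top order_le_less_trans)
      finally show ?thesis by simp
    qed
    moreover have "E K h \<le> E (C n) h" if "K \<subseteq> ?U" for K
      by (rule E_mono_set) (use that interior_subset in blast)
    moreover have "meas_on K h" if "compact K" "K \<subseteq> ?U" for K
      by (rule meas_on_subset[OF h(1) _ sets_lebesgue_compact[OF that(1)]]) (use that interior_subset in blast)
    ultimately have lsh: "locally_summable ?U h"
      by (intro E_locally_summable) (auto intro: order_le_less_trans)
    have UD: "?U \<subseteq> D" using interior_subset C(2) by blast
    have KC: "E K h' \<le> E (C n) h'" if "K \<subseteq> ?U" for K h'
      by (rule E_mono_set) (use that interior_subset in blast)
    have "has_weak_deriv ?U \<beta> f h"
    proof (rule has_weak_deriv_limit)
      show "has_weak_deriv ?U \<beta> (u j) (list_deriv ys (u j))" for j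
        unfolding ys_def by (rule smooth_has_weak_deriv[OF open_interior smooth_on_subset[OF u(1)]]) simp
      show "locally_summable ?U f" by (rule locally_summable_subset[OF f(1) UD])
      show "(\<lambda>j. E K (\<lambda>x. u j x - f x)) \<longlonglongrightarrow> 0" if "compact K" "K \<subseteq> ?U" for K
        by (rule ennreal_tendsto_0_le[OF u(2) KC[OF that(2)]])
      show "(\<lambda>j. E K (\<lambda>x. list_deriv ys (u j) x - h x)) \<longlonglongrightarrow> 0" if "compact K" "K \<subseteq> ?U" for K
        by (rule ennreal_tendsto_0_le[OF h(2) KC[OF that(2)]])
    qed (rule lsh)
    then show ?thesis by blast
  qed
  then obtain h where h: "\<And>n. has_weak_deriv (interior (C n)) \<beta> f (h n)" by metis
  show "\<exists>g. has_weak_deriv D \<beta> f g"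
  proof (rule has_weak_deriv_glue[where U="\<lambda>n. interior (C n)" and g=h])
    show "interior (C n) \<subseteq> D" for n using interior_subset C(2) by blast
    show "interior (C n) \<subseteq> interior (C (Suc n))" for n using interior_subset C(3) by blast
    show "\<exists>i. K \<subseteq> interior (C i)" if K: "compact K" "K \<subseteq> D" for K
    proof -
      obtain N where "\<forall>n\<ge>N. K \<subseteq> C n" using C(4)[OF K] by blast
      then have "K \<subseteq> C N" by simp
      then show ?thesis using C(3)[of N] by blast
    qed
  qed (use f h in auto)
qed

end

section \<open>The Sobolev norm on functions\<close>

lemma has_weak_deriv_add:
  assumes "has_weak_deriv D \<alpha> f g" "has_weak_deriv D \<alpha> f' g'"
  shows "has_weak_deriv D \<alpha> (\<lambda>x. f x + f' x) (\<lambda>x. g x + g' x)"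
proof -
  have ls: "locally_summable D f" "locally_summable D g" "locally_summable D f'" "locally_summable D g'"
    using assms by (auto simp: has_weak_deriv_def)
  have int: "(LINT x:D|lebesgue. (a x + b x) * \<psi> x) =
      (LINT x:D|lebesgue. a x * \<psi> x) + (LINT x:D|lebesgue. b x * \<psi> x)"
    if "locally_summable D a" "locally_summable D b" "test_function D \<psi>" for a b \<psi> :: "real^'a \<Rightarrow> real"
    using set_integral_add(2)[OF locally_summable_mult_test[OF that(1,3)] locally_summable_mult_test[OF that(2,3)]]
    by (simp add: distrib_right)
  show ?thesis
    unfolding has_weak_deriv_def
  proof (intro conjI allI impI)
    show "locally_summable D (\<lambda>x. f x + f' x)" "locally_summable D (\<lambda>x. g x + g' x)"
      using ls by (auto simp: locally_summable_def intro: set_integral_add)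
    fix \<phi> assume \<phi>: "test_function D \<phi>"
    show "(LINT x:D|lebesgue. (f x + f' x) * multi_deriv \<alpha> \<phi> x) =
        (-1) ^ multiindex_order \<alpha> * (LINT x:D|lebesgue. (g x + g' x) * \<phi> x)"
      using assms \<phi> int[OF ls(1,3) test_function_multi_deriv[OF \<phi>]] int[OF ls(2,4) \<phi>]
      by (simp add: has_weak_deriv_def distrib_left)
  qed
qed

lemma has_weak_deriv_cmult:
  assumes "has_weak_deriv D \<alpha> f g"
  shows "has_weak_deriv D \<alpha> (\<lambda>x. c * f x) (\<lambda>x. c * g x)"
  using assms unfolding has_weak_deriv_def locally_summable_def by (simp add: mult.assoc)

lemma has_weak_deriv_zero: "has_weak_deriv D \<alpha> (\<lambda>x. 0) (\<lambda>x. 0)"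
  by (simp add: has_weak_deriv_def locally_summable_def set_integrable_def)

text \<open>At each point the truncations to a compact exhaustion are eventually equal to the
  truncation to \<open>D\<close>.\<close>

lemma meas_on_locally_summable:
  assumes D: "open D" and f: "locally_summable D f"
  shows "meas_on D f"
proof -
  obtain C where C: "\<And>n::nat. compact (C n)" "\<And>n. C n \<subseteq> D" "\<And>K. compact K \<Longrightarrow> K \<subseteq> D \<Longrightarrow> \<exists>N. \<forall>n\<ge>N. K \<subseteq> C n"
    by (rule open_Union_compact_subsets[OF D]) blast
  show ?thesis
    unfolding meas_on_def
  proof (rule borel_measurable_LIMSEQ_real)
    show "(\<lambda>x. indicator (C n) x * f x) \<in> borel_measurable lebesgue" for n
      using locally_summable_integrable[OF f C(1,2)] by auto
    fix x
    have "\<forall>\<^sub>F n in sequentially. indicator (C n) x * f x = indicator D x * f x"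
    proof (cases "x \<in> D")
      case True
      then obtain N where "\<forall>n\<ge>N. {x} \<subseteq> C n" using C(3)[of "{x}"] by auto
      then show ?thesis using True by (auto simp: eventually_sequentially intro!: exI[of _ N])
    next
      case False
      then have "x \<notin> C n" for n using C(2) by blast
      then show ?thesis using False by simp
    qed
    then show "(\<lambda>n. indicator (C n) x * f x) \<longlonglongrightarrow> indicator D x * f x" by (rule tendsto_eventually)
  qed
qed

context ap_weight
begin

abbreviation Lpn :: "(real^'n) set \<Rightarrow> (real^'n \<Rightarrow> real) \<Rightarrow> real" where
  "Lpn D f \<equiv> weighted_Lp_norm D p v f"

lemma Lpn_lpn: "Lpn D f = lpn p lebesgue (wt D f)"
  by (simp add: weighted_Lp_norm_def set_lebesgue_integral_def lpn_def wt_powr)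

lemma integrable_wt:
  assumes "meas_on D f" "E D f < \<infinity>"
  shows "integrable lebesgue (\<lambda>x. \<bar>wt D f x\<bar> powr p)"
  using assms wt_measurable[OF assms(1)]
  by (intro integrableI_bounded) (auto simp: E_eq Ep_def)

lemma set_integrable_iff_E:
  assumes "meas_on D f"
  shows "set_integrable lebesgue D (\<lambda>x. \<bar>f x\<bar> powr p * v x) \<longleftrightarrow> E D f < \<infinity>"
proof -
  have "set_integrable lebesgue D (\<lambda>x. \<bar>f x\<bar> powr p * v x) \<longleftrightarrow> integrable lebesgue (\<lambda>x. \<bar>wt D f x\<bar> powr p)"
    by (simp add: set_integrable_def wt_powr)
  also have "\<dots> \<longleftrightarrow> E D f < \<infinity>"
    using wt_measurable[OF assms] by (simp add: integrable_iff_bounded E_eq Ep_def)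
  finally show ?thesis .
qed

lemma Lpn_eq: "meas_on D f \<Longrightarrow> Lpn D f = enn2real (E D f) powr (1 / p)"
  using wt_measurable[of D f]
  by (simp add: Lpn_lpn lpn_def integral_eq_nn_integral E_eq Ep_def)

lemma Lpn_nonneg: "0 \<le> Lpn D f" by (simp add: weighted_Lp_norm_def)

lemma Lpn_le:
  assumes "meas_on D f" "0 \<le> e" "E D f \<le> ennreal (e powr p)" shows "Lpn D f \<le> e"
proof -
  have "enn2real (E D f) \<le> e powr p" using enn2real_mono[OF assms(3)] by simp
  then have "enn2real (E D f) powr (1 / p) \<le> (e powr p) powr (1 / p)" using p_pos by (intro powr_mono2) auto
  then show ?thesis using assms p_pos by (simp add: Lpn_eq powr_powr)
qed

lemma E_le_of_Lpn:
  assumes "meas_on D f" "E D f < \<infinity>" "Lpn D f \<le> e" shows "E D f \<le> ennreal (e powr p)"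
proof -
  obtain a where a: "E D f = ennreal a" "0 \<le> a" using assms(2) by (cases "E D f") auto
  have "a powr (1 / p) \<le> e" using assms a by (simp add: Lpn_eq)
  then have "(a powr (1 / p)) powr p \<le> e powr p" using p_pos by (intro powr_mono2) auto
  then show ?thesis using a p_pos by (simp add: powr_powr ennreal_leI)
qed

lemma Lpn_tendsto_0:
  assumes m: "\<And>n. meas_on D (f n)" and lim: "((\<lambda>n. E D (f n)) \<longlongrightarrow> 0) F"
  shows "((\<lambda>n. Lpn D (f n)) \<longlongrightarrow> 0) F"
proof (rule tendstoI)
  fix e :: real assume e: "e > 0"
  have "\<forall>\<^sub>F n in F. E D (f n) \<le> ennreal ((e / 2) powr p)"
    by (rule ennreal_tendsto_0D[OF lim]) (use e in simp)
  then show "\<forall>\<^sub>F n in F. dist (Lpn D (f n)) 0 < e"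
  proof eventually_elim
    case (elim n)
    have "Lpn D (f n) \<le> e / 2" by (rule Lpn_le[OF m _ elim]) (use e in simp)
    then show ?case using e Lpn_nonneg[of D "f n"] by simp
  qed
qed

lemma Lpn_add:
  assumes "meas_on D f" "E D f < \<infinity>" "meas_on D g" "E D g < \<infinity>"
  shows "Lpn D (\<lambda>x. f x + g x) \<le> Lpn D f + Lpn D g"
proof -
  have "wt D (\<lambda>x. f x + g x) = (\<lambda>x. wt D f x + wt D g x)" by (auto simp: wt_def algebra_simps)
  then show ?thesis unfolding Lpn_lpn
    using minkowski[OF wt_measurable wt_measurable, of D f D g p] assms integrable_wt p_gt_1 by simp
qed

lemma Lpn_cmult: "Lpn D (\<lambda>x. c * f x) = \<bar>c\<bar> * Lpn D f"
proof -
  have "(\<lambda>x. \<bar>wt D (\<lambda>x. c * f x) x\<bar> powr p) = (\<lambda>x. \<bar>c\<bar> powr p * \<bar>wt D f x\<bar> powr p)"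
    by (auto simp: wt_def abs_mult powr_mult mult_ac)
  then have "Lpn D (\<lambda>x. c * f x) = (\<bar>c\<bar> powr p * (LINT x|lebesgue. \<bar>wt D f x\<bar> powr p)) powr (1 / p)"
    by (simp add: Lpn_lpn lpn_def)
  then show ?thesis using p_pos by (simp add: powr_mult powr_powr Lpn_lpn lpn_def)
qed

lemma Lpn_eq_0:
  assumes "meas_on D f" "E D f < \<infinity>" "Lpn D f = 0"
  shows "AE x in lebesgue. x \<in> D \<longrightarrow> f x = 0"
  using E_le_of_Lpn[OF assms(1,2), of 0] assms p_pos E_zero_iff[OF assms(1)] by simp

lemma Lpn_cong_AE:
  assumes "meas_on D f" "meas_on D g" "AE x in lebesgue. x \<in> D \<longrightarrow> f x = g x"
  shows "Lpn D f = Lpn D g"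
  using assms E_cong_AE[OF assms(3)] by (simp add: Lpn_eq)

section \<open>The function space: membership, linear structure and completeness\<close>

context
  fixes D :: "(real^'n) set" and m :: nat
  assumes D: "open D"
begin

abbreviation Sob :: "(real^'n \<Rightarrow> real) set" where "Sob \<equiv> sobolev_functions D m p v"
abbreviation Nrm :: "(real^'n \<Rightarrow> real) \<Rightarrow> real" where "Nrm \<equiv> sobolev_norm D m p v"

lemma Sob_D:
  assumes "f \<in> Sob"
  shows "locally_summable D f" "meas_on D f" "E D f < \<infinity>"
    "\<And>\<alpha>. multiindex_order \<alpha> = m \<Longrightarrow> has_weak_deriv D \<alpha> f (weak_deriv D \<alpha> f)"
    "\<And>\<alpha>. multiindex_order \<alpha> = m \<Longrightarrow> meas_on D (weak_deriv D \<alpha> f)"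
    "\<And>\<alpha>. multiindex_order \<alpha> = m \<Longrightarrow> E D (weak_deriv D \<alpha> f) < \<infinity>"
proof -
  show ls: "locally_summable D f" using assms by (simp add: sobolev_functions_def)
  show mf: "meas_on D f" by (rule meas_on_locally_summable[OF D ls])
  show "E D f < \<infinity>" using assms set_integrable_iff_E[OF mf] by (simp add: sobolev_functions_def)
  show wd: "has_weak_deriv D \<alpha> f (weak_deriv D \<alpha> f)" if "multiindex_order \<alpha> = m" for \<alpha>
  proof -
    have "\<exists>g. has_weak_deriv D \<alpha> f g"
      using assms that by (auto simp: sobolev_functions_def weakly_differentiable_def)
    then show ?thesis unfolding weak_deriv_def by (rule someI_ex)
  qed
  show mw: "meas_on D (weak_deriv D \<alpha> f)" if "multiindex_order \<alpha> = m" for \<alpha>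
    using wd[OF that] by (intro meas_on_locally_summable[OF D]) (simp add: has_weak_deriv_def)
  show "E D (weak_deriv D \<alpha> f) < \<infinity>" if "multiindex_order \<alpha> = m" for \<alpha>
    using assms that set_integrable_iff_E[OF mw[OF that]] by (simp add: sobolev_functions_def)
qed

text \<open>The weak derivatives in \<open>sobolev_functions\<close> are arbitrary choices, and
  orders below \<open>m\<close> are asked for as well. This lemma reduces membership and norm to any
  explicit family of derivatives of order \<open>m\<close>: uniqueness handles the choice,
  \<open>weakly_differentiable_of_top_order\<close> the lower orders.\<close>

lemma Sob_I:
  assumes f: "locally_summable D f" "E D f < \<infinity>"
    and g: "\<And>\<alpha>. multiindex_order \<alpha> = m \<Longrightarrow> has_weak_deriv D \<alpha> f (g \<alpha>)" "\<And>\<alpha>. multiindex_order \<alpha> = m \<Longrightarrow> E D (g \<alpha>) < \<infinity>"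
  shows "f \<in> Sob"
    and "\<And>\<alpha>. multiindex_order \<alpha> = m \<Longrightarrow> AE x in lebesgue. x \<in> D \<longrightarrow> weak_deriv D \<alpha> f x = g \<alpha> x"
    and "Nrm f = Lpn D f + (\<Sum>\<alpha> | multiindex_order \<alpha> = m. Lpn D (g \<alpha>))"
proof -
  have mf: "meas_on D f" by (rule meas_on_locally_summable[OF D f(1)])
  have mg: "meas_on D (g \<alpha>)" if "multiindex_order \<alpha> = m" for \<alpha>
    using g(1)[OF that] by (intro meas_on_locally_summable[OF D]) (simp add: has_weak_deriv_def)
  have wdm: "weakly_differentiable D m f"
    by (rule weakly_differentiable_of_top_order[OF D f(1) mf f(2), of m g]) (use g mg in auto)
  have wd: "has_weak_deriv D \<alpha> f (weak_deriv D \<alpha> f)" if "multiindex_order \<alpha> = m" for \<alpha>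
    unfolding weak_deriv_def using g(1)[OF that] by (rule someI[where P="has_weak_deriv D \<alpha> f"])
  show eq: "AE x in lebesgue. x \<in> D \<longrightarrow> weak_deriv D \<alpha> f x = g \<alpha> x" if "multiindex_order \<alpha> = m" for \<alpha>
    by (rule has_weak_deriv_unique[OF D wd g(1)]) (use that in auto)
  have mw: "meas_on D (weak_deriv D \<alpha> f)" if "multiindex_order \<alpha> = m" for \<alpha>
    using wd[OF that] by (intro meas_on_locally_summable[OF D]) (simp add: has_weak_deriv_def)
  show "f \<in> Sob"
    using f g(2) wdm set_integrable_iff_E[OF mf] set_integrable_iff_E[OF mw] E_cong_AE[OF eq]
    by (simp add: sobolev_functions_def)
  show "Nrm f = Lpn D f + (\<Sum>\<alpha> | multiindex_order \<alpha> = m. Lpn D (g \<alpha>))"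
    unfolding sobolev_norm_def by (intro arg_cong2[where f="(+)"] sum.cong refl Lpn_cong_AE mw mg eq) auto
qed

lemma Nrm_nonneg: "0 \<le> Nrm f"
  unfolding sobolev_norm_def by (intro add_nonneg_nonneg sum_nonneg Lpn_nonneg)

lemma Lpn_le_Nrm: "Lpn D f \<le> Nrm f"
  unfolding sobolev_norm_def by (simp add: sum_nonneg Lpn_nonneg)

lemma E_add_finite:
  assumes "meas_on K f" "E K f < \<infinity>" "meas_on K g" "E K g < \<infinity>"
  shows "E K (\<lambda>x. f x + g x) < \<infinity>"
proof -
  have "E K (\<lambda>x. f x + g x) \<le> ennreal (2 powr p) * (E K f + E K g)" using assms by (intro E_add)
  also have "\<dots> < \<infinity>" using assms by (simp add: ennreal_mult_less_top)
  finally show ?thesis .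
qed

lemma Sob_add:
  assumes f: "f \<in> Sob" and g: "g \<in> Sob"
  shows "(\<lambda>x. f x + g x) \<in> Sob" "Nrm (\<lambda>x. f x + g x) \<le> Nrm f + Nrm g"
    "multiindex_order \<alpha> = m \<Longrightarrow> AE x in lebesgue. x \<in> D \<longrightarrow>
      weak_deriv D \<alpha> (\<lambda>x. f x + g x) x = weak_deriv D \<alpha> f x + weak_deriv D \<alpha> g x"
proof -
  have ls: "locally_summable D (\<lambda>x. f x + g x)"
    using Sob_D(1)[OF f] Sob_D(1)[OF g] by (auto simp: locally_summable_def intro: set_integral_add)
  have fin: "E D (\<lambda>x. f x + g x) < \<infinity>"
    by (intro E_add_finite Sob_D f g)
  have wd: "has_weak_deriv D \<alpha> (\<lambda>x. f x + g x) (\<lambda>x. weak_deriv D \<alpha> f x + weak_deriv D \<alpha> g x)"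
    if "multiindex_order \<alpha> = m" for \<alpha>
    by (intro has_weak_deriv_add Sob_D f g that)
  have wfin: "E D (\<lambda>x. weak_deriv D \<alpha> f x + weak_deriv D \<alpha> g x) < \<infinity>" if "multiindex_order \<alpha> = m" for \<alpha>
    by (intro E_add_finite Sob_D f g that)
  note I = Sob_I[OF ls fin, of "\<lambda>\<alpha> x. weak_deriv D \<alpha> f x + weak_deriv D \<alpha> g x", OF wd wfin]
  show "(\<lambda>x. f x + g x) \<in> Sob" by (rule I(1))
  show "multiindex_order \<alpha> = m \<Longrightarrow> AE x in lebesgue. x \<in> D \<longrightarrow>
      weak_deriv D \<alpha> (\<lambda>x. f x + g x) x = weak_deriv D \<alpha> f x + weak_deriv D \<alpha> g x" by (rule I(2))
  have "Nrm (\<lambda>x. f x + g x) = Lpn D (\<lambda>x. f x + g x) +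
      (\<Sum>\<alpha> | multiindex_order \<alpha> = m. Lpn D (\<lambda>x. weak_deriv D \<alpha> f x + weak_deriv D \<alpha> g x))" by (rule I(3))
  also have "\<dots> \<le> (Lpn D f + Lpn D g) +
      (\<Sum>\<alpha> | multiindex_order \<alpha> = m. Lpn D (weak_deriv D \<alpha> f) + Lpn D (weak_deriv D \<alpha> g))"
    by (intro add_mono sum_mono Lpn_add Sob_D f g) auto
  also have "\<dots> = Nrm f + Nrm g" by (simp add: sobolev_norm_def sum.distrib)
  finally show "Nrm (\<lambda>x. f x + g x) \<le> Nrm f + Nrm g" .
qed

lemma Sob_cmult:
  assumes f: "f \<in> Sob"
  shows "(\<lambda>x. c * f x) \<in> Sob" "Nrm (\<lambda>x. c * f x) = \<bar>c\<bar> * Nrm f"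
    "multiindex_order \<alpha> = m \<Longrightarrow> AE x in lebesgue. x \<in> D \<longrightarrow>
      weak_deriv D \<alpha> (\<lambda>x. c * f x) x = c * weak_deriv D \<alpha> f x"
proof -
  have ls: "locally_summable D (\<lambda>x. c * f x)"
    using Sob_D(1)[OF f] by (simp add: locally_summable_def)
  have fin: "E D (\<lambda>x. c * f x) < \<infinity>"
    using Sob_D(2,3)[OF f] by (simp add: E_cmult ennreal_mult_less_top)
  have wd: "has_weak_deriv D \<alpha> (\<lambda>x. c * f x) (\<lambda>x. c * weak_deriv D \<alpha> f x)"
    and wfin: "E D (\<lambda>x. c * weak_deriv D \<alpha> f x) < \<infinity>" if "multiindex_order \<alpha> = m" for \<alpha>
    using that Sob_D(5,6)[OF f that] by (auto intro!: has_weak_deriv_cmult Sob_D f simp: E_cmult ennreal_mult_less_top)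
  note I = Sob_I[OF ls fin, of "\<lambda>\<alpha> x. c * weak_deriv D \<alpha> f x", OF wd wfin]
  show "(\<lambda>x. c * f x) \<in> Sob" by (rule I(1))
  show "multiindex_order \<alpha> = m \<Longrightarrow> AE x in lebesgue. x \<in> D \<longrightarrow>
      weak_deriv D \<alpha> (\<lambda>x. c * f x) x = c * weak_deriv D \<alpha> f x" by (rule I(2))
  have "Nrm (\<lambda>x. c * f x) = Lpn D (\<lambda>x. c * f x) +
      (\<Sum>\<alpha> | multiindex_order \<alpha> = m. Lpn D (\<lambda>x. c * weak_deriv D \<alpha> f x))" by (rule I(3))
  then show "Nrm (\<lambda>x. c * f x) = \<bar>c\<bar> * Nrm f"
    by (simp add: Lpn_cmult sobolev_norm_def sum_distrib_left distrib_left)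
qed

lemma Sob_diff:
  assumes "f \<in> Sob" "g \<in> Sob"
  shows "(\<lambda>x. f x - g x) \<in> Sob"
    "multiindex_order \<alpha> = m \<Longrightarrow> AE x in lebesgue. x \<in> D \<longrightarrow>
      weak_deriv D \<alpha> (\<lambda>x. f x - g x) x = weak_deriv D \<alpha> f x - weak_deriv D \<alpha> g x"
proof -
  note a = Sob_add[OF assms(1) Sob_cmult(1)[OF assms(2), of "-1"]]
  show "(\<lambda>x. f x - g x) \<in> Sob" using a(1) by simp
  assume \<alpha>: "multiindex_order \<alpha> = m"
  show "AE x in lebesgue. x \<in> D \<longrightarrow> weak_deriv D \<alpha> (\<lambda>x. f x - g x) x = weak_deriv D \<alpha> f x - weak_deriv D \<alpha> g x"
    using a(3)[OF \<alpha>] Sob_cmult(3)[OF assms(2) \<alpha>, of "-1"] by eventually_elim simp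
qed

lemma Sob_cong_AE:
  assumes f: "f \<in> Sob" and eq: "AE x in lebesgue. x \<in> D \<longrightarrow> f x = g x"
  shows "g \<in> Sob" "Nrm g = Nrm f"
proof -
  have ls: "locally_summable D g" by (rule locally_summable_cong_AE[OF Sob_D(1)[OF f] eq])
  have mg: "meas_on D g" by (rule meas_on_locally_summable[OF D ls])
  have wd: "has_weak_deriv D \<alpha> g (weak_deriv D \<alpha> f)" if "multiindex_order \<alpha> = m" for \<alpha>
    by (rule has_weak_deriv_cong_AE[OF Sob_D(4)[OF f that] eq]) simp
  have fin: "E D g < \<infinity>" using E_cong_AE[OF eq] Sob_D(3)[OF f] by simp
  note I = Sob_I[OF ls fin, of "\<lambda>\<alpha>. weak_deriv D \<alpha> f", OF wd Sob_D(6)[OF f]]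
  show "g \<in> Sob" by (rule I(1))
  show "Nrm g = Nrm f"
    using I(3) Lpn_cong_AE[OF Sob_D(2)[OF f] mg eq] by (simp add: sobolev_norm_def)
qed

lemma Sob_zero: "(\<lambda>x. 0) \<in> Sob" "Nrm (\<lambda>x. 0) = 0"
proof -
  have ls: "locally_summable D (\<lambda>x. 0 :: real)" by (simp add: locally_summable_def set_integrable_def)
  have E0: "E D (\<lambda>x. 0) < \<infinity>" by (simp add: E_def)
  have W0: "Lpn D (\<lambda>x. 0) = 0" by (simp add: weighted_Lp_norm_def set_lebesgue_integral_def)
  note I = Sob_I[OF ls E0, of "\<lambda>_ _. 0", OF has_weak_deriv_zero E0]
  show "(\<lambda>x. 0) \<in> Sob" "Nrm (\<lambda>x. 0) = 0" using I(1,3) W0 by simp_all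
qed

lemma Nrm_eq_0_iff:
  assumes f: "f \<in> Sob"
  shows "Nrm f = 0 \<longleftrightarrow> (AE x in lebesgue. x \<in> D \<longrightarrow> f x = 0)"
proof
  assume "Nrm f = 0"
  then have "Lpn D f = 0" using Lpn_le_Nrm[of f] Lpn_nonneg[of D f] by simp
  then show "AE x in lebesgue. x \<in> D \<longrightarrow> f x = 0" by (rule Lpn_eq_0[OF Sob_D(2,3)[OF f]])
next
  assume "AE x in lebesgue. x \<in> D \<longrightarrow> f x = 0"
  from Sob_cong_AE(2)[OF f this] show "Nrm f = 0" by (simp add: Sob_zero)
qed

lemma E_limit_finite:
  assumes "\<And>n::nat. meas_on K (f n)" "\<And>n. E K (f n) < \<infinity>" "meas_on K h" "(\<lambda>n. E K (\<lambda>x. f n x - h x)) \<longlonglongrightarrow> 0"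
  shows "E K h < \<infinity>"
proof -
  obtain j where j: "E K (\<lambda>x. h x - f j x) \<le> ennreal 1"
    using ennreal_tendsto_0D[OF assms(4), of 1] by (auto simp: E_commute[of _ h] eventually_sequentially)
  then have "E K (\<lambda>x. h x - f j x) < \<infinity>" by (simp add: order_le_less_trans)
  from E_add_finite[OF meas_on_diff[OF assms(3) assms(1)[of j]] this assms(1)[of j] assms(2)[of j]]
  show ?thesis by simp
qed

text \<open>Stated with energies and an arbitrary family \<open>g\<close> of derivatives, so that it
  applies both to weak derivatives of Cauchy sequences and to classical derivatives of test
  functions. The energy limit of order 0 is kept in the conclusion because it identifies the limit
  function.\<close>

theorem Sob_complete_E:
  assumes f: "\<And>n::nat. locally_summable D (f n)" "\<And>n. E D (f n) < \<infinity>"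
    and g: "\<And>n \<alpha>. multiindex_order \<alpha> = m \<Longrightarrow> has_weak_deriv D \<alpha> (f n) (g n \<alpha>)"
      "\<And>n \<alpha>. multiindex_order \<alpha> = m \<Longrightarrow> E D (g n \<alpha>) < \<infinity>"
    and Cf: "\<And>e. e > 0 \<Longrightarrow> \<exists>N. \<forall>i\<ge>N. \<forall>j\<ge>N. E D (\<lambda>x. f i x - f j x) \<le> ennreal e"
    and Cg: "\<And>e \<alpha>. multiindex_order \<alpha> = m \<Longrightarrow> e > 0 \<Longrightarrow>
      \<exists>N. \<forall>i\<ge>N. \<forall>j\<ge>N. E D (\<lambda>x. g i \<alpha> x - g j \<alpha> x) \<le> ennreal e"
  obtains h where "h \<in> Sob" "(\<lambda>n. E D (\<lambda>x. f n x - h x)) \<longlonglongrightarrow> 0" "(\<lambda>n. Nrm (\<lambda>x. f n x - h x)) \<longlonglongrightarrow> 0"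
proof -
  have Dl: "D \<in> sets lebesgue" using D by simp
  have mf: "meas_on D (f n)" for n by (rule meas_on_locally_summable[OF D f(1)])
  have mg: "meas_on D (g n \<alpha>)" if "multiindex_order \<alpha> = m" for n \<alpha>
    using g(1)[OF that] by (intro meas_on_locally_summable[OF D]) (simp add: has_weak_deriv_def)
  obtain h where h: "meas_on D h" "(\<lambda>n. E D (\<lambda>x. f n x - h x)) \<longlonglongrightarrow> 0"
    by (rule E_complete[OF Dl mf Cf]) (assumption | rule that)+
  have "\<exists>k. meas_on D k \<and> (\<lambda>n. E D (\<lambda>x. g n \<alpha> x - k x)) \<longlonglongrightarrow> 0" if \<alpha>: "multiindex_order \<alpha> = m" for \<alpha>
    by (rule E_complete[OF Dl mg[OF \<alpha>] Cg[OF \<alpha>]]) blast+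
  then have "\<exists>k. \<forall>\<alpha>. multiindex_order \<alpha> = m \<longrightarrow> meas_on D (k \<alpha>) \<and> (\<lambda>n. E D (\<lambda>x. g n \<alpha> x - k \<alpha> x)) \<longlonglongrightarrow> 0"
    by (subst choice_iff'[symmetric]) blast
  then obtain k where k: "\<And>\<alpha>. multiindex_order \<alpha> = m \<Longrightarrow> meas_on D (k \<alpha>)"
    "\<And>\<alpha>. multiindex_order \<alpha> = m \<Longrightarrow> (\<lambda>n. E D (\<lambda>x. g n \<alpha> x - k \<alpha> x)) \<longlonglongrightarrow> 0" by blast
  have hfin: "E D h < \<infinity>" by (rule E_limit_finite[OF mf f(2) h])
  have kfin: "E D (k \<alpha>) < \<infinity>" if "multiindex_order \<alpha> = m" for \<alpha>
    by (rule E_limit_finite[OF mg[OF that] g(2)[OF that] k(1)[OF that] k(2)[OF that]])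
  have ls: "locally_summable D q" if "meas_on D q" "E D q < \<infinity>" for q
  proof (intro E_locally_summable conjI)
    fix K assume K: "compact K" "K \<subseteq> D"
    show "meas_on K q" by (rule meas_on_subset[OF that(1) K(2) sets_lebesgue_compact[OF K(1)]])
    show "E K q < \<infinity>" by (rule order_le_less_trans[OF E_mono_set[OF K(2)] that(2)])
  qed
  have wd: "has_weak_deriv D \<alpha> h (k \<alpha>)" if \<alpha>: "multiindex_order \<alpha> = m" for \<alpha>
  proof (rule has_weak_deriv_limit[OF g(1)[OF \<alpha>] ls[OF h(1) hfin] ls[OF k(1)[OF \<alpha>] kfin[OF \<alpha>]]])
    show "(\<lambda>n. E K (\<lambda>x. f n x - h x)) \<longlonglongrightarrow> 0" if "compact K" "K \<subseteq> D" for K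
      by (rule ennreal_tendsto_0_le[OF h(2) E_mono_set[OF that(2)]])
    show "(\<lambda>n. E K (\<lambda>x. g n \<alpha> x - k \<alpha> x)) \<longlonglongrightarrow> 0" if "compact K" "K \<subseteq> D" for K
      by (rule ennreal_tendsto_0_le[OF k(2)[OF \<alpha>] E_mono_set[OF that(2)]])
  qed
  show thesis
  proof (rule that[OF _ h(2)])
    show "h \<in> Sob" by (rule Sob_I(1)[OF ls[OF h(1) hfin] hfin wd kfin])
    have diff: "Nrm (\<lambda>x. f n x - h x) = Lpn D (\<lambda>x. f n x - h x) + (\<Sum>\<alpha> | multiindex_order \<alpha> = m. Lpn D (\<lambda>x. g n \<alpha> x - k \<alpha> x))" for n
    proof (rule Sob_I(3))
      have neg: "has_weak_deriv D \<alpha> (\<lambda>x. (-1) * h x) (\<lambda>x. (-1) * k \<alpha> x)" if "multiindex_order \<alpha> = m" for \<alpha>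
        by (rule has_weak_deriv_cmult[OF wd[OF that]])
      show "locally_summable D (\<lambda>x. f n x - h x)" by (rule locally_summable_diff[OF f(1) ls[OF h(1) hfin]])
      have "E D (\<lambda>x. f n x + (- h x)) < \<infinity>"
        using meas_on_cmult[OF h(1), of "-1"] hfin by (intro E_add_finite mf f(2)) (simp_all add: E_minus)
      then show "E D (\<lambda>x. f n x - h x) < \<infinity>" by simp
      fix \<alpha> :: "'n \<Rightarrow> nat" assume \<alpha>: "multiindex_order \<alpha> = m"
      show "has_weak_deriv D \<alpha> (\<lambda>x. f n x - h x) (\<lambda>x. g n \<alpha> x - k \<alpha> x)"
        using has_weak_deriv_add[OF g(1)[OF \<alpha>] neg[OF \<alpha>], of n] by simp
      have "E D (\<lambda>x. g n \<alpha> x + (- k \<alpha> x)) < \<infinity>"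
        using meas_on_cmult[OF k(1)[OF \<alpha>], of "-1"] kfin[OF \<alpha>] by (intro E_add_finite mg g(2) \<alpha>) (simp_all add: E_minus)
      then show "E D (\<lambda>x. g n \<alpha> x - k \<alpha> x) < \<infinity>" by simp
    qed
    have a: "(\<lambda>n. Lpn D (\<lambda>x. f n x - h x)) \<longlonglongrightarrow> 0"
      by (rule Lpn_tendsto_0[OF meas_on_diff[OF mf h(1)] h(2)])
    have b: "(\<lambda>n. \<Sum>\<alpha> | multiindex_order \<alpha> = m. Lpn D (\<lambda>x. g n \<alpha> x - k \<alpha> x)) \<longlonglongrightarrow>
        (\<Sum>\<alpha>\<in>{\<alpha> :: 'n \<Rightarrow> nat. multiindex_order \<alpha> = m}. 0)"
    proof (rule tendsto_sum)
      fix \<alpha> :: "'n \<Rightarrow> nat" assume "\<alpha> \<in> {\<alpha>. multiindex_order \<alpha> = m}"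
      then have \<alpha>: "multiindex_order \<alpha> = m" by simp
      show "(\<lambda>n. Lpn D (\<lambda>x. g n \<alpha> x - k \<alpha> x)) \<longlonglongrightarrow> 0"
        by (rule Lpn_tendsto_0[OF meas_on_diff[OF mg[OF \<alpha>] k(1)[OF \<alpha>]] k(2)[OF \<alpha>]])
    qed
    from tendsto_add[OF a b]
    show "(\<lambda>n. Nrm (\<lambda>x. f n x - h x)) \<longlonglongrightarrow> 0" unfolding diff by simp
  qed
qed

theorem Sob_complete:
  assumes f: "\<And>n::nat. f n \<in> Sob"
    and C: "\<And>e. e > 0 \<Longrightarrow> \<exists>N. \<forall>i\<ge>N. \<forall>j\<ge>N. Nrm (\<lambda>x. f i x - f j x) \<le> e"
  obtains h where "h \<in> Sob" "(\<lambda>n. E D (\<lambda>x. f n x - h x)) \<longlonglongrightarrow> 0" "(\<lambda>n. Nrm (\<lambda>x. f n x - h x)) \<longlonglongrightarrow> 0"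
proof (rule Sob_complete_E)
  show "locally_summable D (f n)" "E D (f n) < \<infinity>" for n using Sob_D[OF f] by auto
  show "has_weak_deriv D \<alpha> (f n) (weak_deriv D \<alpha> (f n))" "E D (weak_deriv D \<alpha> (f n)) < \<infinity>"
    if "multiindex_order \<alpha> = m" for n \<alpha> using Sob_D[OF f] that by auto
  fix e :: real assume e: "e > 0"
  \<comment> \<open>The norm and the energy differ by a p-th power, so the threshold is converted
    accordingly.\<close>
  define d where "d = e powr (1 / p)"
  have d: "d > 0" "d powr p = e" using e p_pos by (auto simp: d_def powr_powr)
  obtain N where N: "\<And>i j. i \<ge> N \<Longrightarrow> j \<ge> N \<Longrightarrow> Nrm (\<lambda>x. f i x - f j x) \<le> d" using C[OF d(1)] by blast
  note fd = Sob_diff(1)[OF f f]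
  show "\<exists>N. \<forall>i\<ge>N. \<forall>j\<ge>N. E D (\<lambda>x. f i x - f j x) \<le> ennreal e"
  proof (intro exI[of _ N] allI impI)
    fix i j assume "i \<ge> N" "j \<ge> N"
    from N[OF this] have "Lpn D (\<lambda>x. f i x - f j x) \<le> d" using Lpn_le_Nrm order_trans by blast
    from E_le_of_Lpn[OF Sob_D(2,3)[OF fd] this] show "E D (\<lambda>x. f i x - f j x) \<le> ennreal e" by (simp add: d)
  qed
  fix \<alpha> :: "'n \<Rightarrow> nat" assume \<alpha>: "multiindex_order \<alpha> = m"
  show "\<exists>N. \<forall>i\<ge>N. \<forall>j\<ge>N. E D (\<lambda>x. weak_deriv D \<alpha> (f i) x - weak_deriv D \<alpha> (f j) x) \<le> ennreal e"
  proof (intro exI[of _ N] allI impI)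
    fix i j assume "i \<ge> N" "j \<ge> N"
    have "Lpn D (weak_deriv D \<alpha> (\<lambda>x. f i x - f j x)) \<le> Nrm (\<lambda>x. f i x - f j x)"
    proof -
      have "Lpn D (weak_deriv D \<alpha> (\<lambda>x. f i x - f j x)) \<le>
          (\<Sum>\<alpha> | multiindex_order \<alpha> = m. Lpn D (weak_deriv D \<alpha> (\<lambda>x. f i x - f j x)))"
        using \<alpha> by (intro member_le_sum Lpn_nonneg finite_multiindices) auto
      then show ?thesis unfolding sobolev_norm_def using Lpn_nonneg[of D "\<lambda>x. f i x - f j x"] by linarith
    qed
    also have "\<dots> \<le> d" by (rule N) fact+
    finally have le: "Lpn D (weak_deriv D \<alpha> (\<lambda>x. f i x - f j x)) \<le> d" .
    have "E D (weak_deriv D \<alpha> (\<lambda>x. f i x - f j x)) \<le> ennreal e"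
      using E_le_of_Lpn[OF Sob_D(5)[OF fd \<alpha>] Sob_D(6)[OF fd \<alpha>] le] d(2) by simp
    moreover have "E D (weak_deriv D \<alpha> (\<lambda>x. f i x - f j x)) = E D (\<lambda>x. weak_deriv D \<alpha> (f i) x - weak_deriv D \<alpha> (f j) x)"
      by (rule E_cong_AE[OF Sob_diff(2)[OF f f \<alpha>]])
    ultimately show "E D (\<lambda>x. weak_deriv D \<alpha> (f i) x - weak_deriv D \<alpha> (f j) x) \<le> ennreal e" by simp
  qed
qed (rule that)

end

end

section \<open>Density of smooth functions\<close>

lemma smooth_on_UN:
  assumes "\<And>i. i \<in> I \<Longrightarrow> open (U i)" "\<And>i. i \<in> I \<Longrightarrow> smooth_on (U i) f"
  shows "smooth_on (\<Union>i\<in>I. U i) f"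
proof -
  have "(\<And>i. i \<in> I \<Longrightarrow> Ck_on k (U i) f) \<Longrightarrow> Ck_on k (\<Union>i\<in>I. U i) f" for k
  proof (induction k arbitrary: f)
    case 0
    then show ?case using assms(1) by (auto intro!: continuous_on_open_UN)
  next
    case (Suc k)
    then show ?case by auto
  qed
  then show ?thesis using assms(2) by (simp add: smooth_on_def)
qed

context ap_weight
begin

text \<open>Induction from the end of the list: the innermost derivative falls on the product
  itself, where the product rule applies at once. The two resulting products have the same form,
  with \<psi> or \<open>u\<close> replaced by a partial derivative; hence the cutoff is arbitrary in
  the induction.\<close>

lemma leibniz_bound:
  assumes K: "compact K" and \<psi>: "test_function UNIV \<psi>" "\<And>x. x \<notin> K \<Longrightarrow> \<psi> x = 0"
  shows "\<exists>C\<ge>0. \<forall>u. smooth_on UNIV u \<longrightarrow> E UNIV (list_deriv xs (\<lambda>x. \<psi> x * u x)) \<le>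
    ennreal C * (\<Sum>ys\<in>{ys. length ys \<le> length xs}. E K (list_deriv ys u))"
  using \<psi>
proof (induction xs arbitrary: \<psi> rule: rev_induct)
  case Nil
  obtain M where M: "M > 0" "\<And>x. \<bar>\<psi> x\<bar> \<le> M" using Nil.prems(1) by (rule test_function_bounded) blast
  have "E UNIV (\<lambda>x. \<psi> x * u x) \<le> ennreal (M powr p) * E K u" if u: "smooth_on UNIV u" for u
  proof -
    have "E UNIV (\<lambda>x. \<psi> x * u x) \<le> E UNIV (\<lambda>x. indicator K x * (M * u x))"
    proof (rule E_mono)
      fix x
      show "\<bar>\<psi> x * u x\<bar> \<le> \<bar>indicator K x * (M * u x)\<bar>"
        using M(1) M(2)[of x] Nil.prems(2)[of x] by (cases "x \<in> K") (auto simp: abs_mult intro!: mult_right_mono)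
    qed
    also have "\<dots> = E K (\<lambda>x. M * u x)" by (rule E_indicator) simp
    also have "\<dots> = ennreal (M powr p) * E K u"
      using M(1) meas_on_borel[OF borel_measurable_continuous_onI[OF smooth_on_continuous[OF u]] sets_lebesgue_compact[OF K]]
      by (simp add: E_cmult)
    finally show ?thesis .
  qed
  moreover have "{ys :: 'n list. length ys \<le> length []} = {[]}" by auto
  ultimately show ?case by (intro exI[of _ "M powr p"]) simp
next
  case (snoc i xs)
  have p\<psi>: "test_function UNIV (partial_deriv i \<psi>)"
    using test_function_list[OF snoc.prems(1), of "[i]"] by simp
  have p0: "partial_deriv i \<psi> x = 0" if "x \<notin> K" for x
  proof -
    have "partial_deriv i \<psi> x = partial_deriv i (\<lambda>x. 0) x"
      by (rule partial_deriv_cong[of "- K"]) (use that snoc.prems(2) K in \<open>auto simp: compact_imp_closed open_Compl\<close>)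
    then show ?thesis by simp
  qed
  let ?S = "\<lambda>k u. \<Sum>ys\<in>{ys. length ys \<le> k}. E K (list_deriv ys u)"
  obtain C1 where C1: "C1 \<ge> 0" "\<And>u. smooth_on UNIV u \<Longrightarrow>
      E UNIV (list_deriv xs (\<lambda>x. \<psi> x * u x)) \<le> ennreal C1 * ?S (length xs) u"
    using snoc.IH[OF snoc.prems] by blast
  obtain C2 where C2: "C2 \<ge> 0" "\<And>u. smooth_on UNIV u \<Longrightarrow>
      E UNIV (list_deriv xs (\<lambda>x. partial_deriv i \<psi> x * u x)) \<le> ennreal C2 * ?S (length xs) u"
    using snoc.IH[OF p\<psi> p0] by blast
  have fin: "finite {ys :: 'n list. length ys \<le> k}" for k
    using finite_lists_length_le[of "UNIV :: 'n set" k] by simp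
  show ?case
  proof (intro exI[of _ "2 powr p * (C1 + C2)"] conjI allI impI)
    show "0 \<le> 2 powr p * (C1 + C2)" using C1 C2 by simp
    fix u :: "real^'n \<Rightarrow> real" assume u: "smooth_on UNIV u"
    have pu: "smooth_on UNIV (partial_deriv i u)" by (rule smooth_on_partial[OF u])
    have s\<psi>: "smooth_on UNIV \<psi>" "smooth_on UNIV (partial_deriv i \<psi>)"
      using snoc.prems(1) p\<psi> by (auto intro: test_function_smooth)
    have s1: "smooth_on UNIV (\<lambda>x. \<psi> x * partial_deriv i u x)" and s2: "smooth_on UNIV (\<lambda>x. partial_deriv i \<psi> x * u x)"
      by (intro smooth_on_mult open_UNIV s\<psi> pu u)+
    have "partial_deriv i (\<lambda>x. \<psi> x * u x) = (\<lambda>x. \<psi> x * partial_deriv i u x + partial_deriv i \<psi> x * u x)"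
      by (rule ext, rule partial_deriv_mult) (auto intro: smooth_on_differentiable[OF s\<psi>(1)] smooth_on_differentiable[OF u])
    then have eq: "list_deriv (xs @ [i]) (\<lambda>x. \<psi> x * u x) =
        (\<lambda>x. list_deriv xs (\<lambda>x. \<psi> x * partial_deriv i u x) x + list_deriv xs (\<lambda>x. partial_deriv i \<psi> x * u x) x)"
      using list_deriv_add[OF open_UNIV s1 s2] by auto
    have m: "meas_on UNIV (list_deriv xs h)" if "smooth_on UNIV h" for h
      by (rule meas_on_borel[OF borel_measurable_continuous_onI[OF smooth_on_continuous[OF smooth_on_list[OF that]]]]) simp
    \<comment> \<open>Derivatives of \<open>partial_deriv i u\<close> are the derivatives of
      \<open>u\<close> along lists that end in \<open>i\<close>.\<close>
    have sum1: "?S (length xs) (partial_deriv i u) \<le> ?S (length (xs @ [i])) u"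
    proof -
      have "?S (length xs) (partial_deriv i u) = (\<Sum>ys\<in>(\<lambda>ys. ys @ [i]) ` {ys. length ys \<le> length xs}. E K (list_deriv ys u))"
        by (subst sum.reindex) (auto simp: inj_on_def)
      also have "\<dots> \<le> ?S (length (xs @ [i])) u" by (rule sum_mono2[OF fin]) auto
      finally show ?thesis .
    qed
    have sum2: "?S (length xs) u \<le> ?S (length (xs @ [i])) u" by (rule sum_mono2[OF fin]) auto
    have "E UNIV (list_deriv (xs @ [i]) (\<lambda>x. \<psi> x * u x)) \<le> ennreal (2 powr p) *
        (E UNIV (list_deriv xs (\<lambda>x. \<psi> x * partial_deriv i u x)) + E UNIV (list_deriv xs (\<lambda>x. partial_deriv i \<psi> x * u x)))"
      unfolding eq by (rule E_add[OF m[OF s1] m[OF s2]])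
    also have "\<dots> \<le> ennreal (2 powr p) * (ennreal C1 * ?S (length (xs @ [i])) u + ennreal C2 * ?S (length (xs @ [i])) u)"
      by (intro mult_left_mono add_mono order_trans[OF C1(2)[OF pu]] order_trans[OF C2(2)[OF u]] sum1 sum2) auto
    also have "\<dots> = ennreal (2 powr p * (C1 + C2)) * ?S (length (xs @ [i])) u"
    proof -
      have "ennreal (2 powr p * (C1 + C2)) = ennreal (2 powr p) * (ennreal C1 + ennreal C2)"
        using C1(1) C2(1) by (simp add: ennreal_mult)
      then show ?thesis by (simp only: distrib_right mult.assoc)
    qed
    finally show "E UNIV (list_deriv (xs @ [i]) (\<lambda>x. \<psi> x * u x)) \<le> ennreal (2 powr p * (C1 + C2)) * ?S (length (xs @ [i])) u" .
  qed
qed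

text \<open>The energy of \<open>s - t\<close> does not depend on \<open>n\<close> and is bounded by
  a null sequence.\<close>

lemma E_limit_unique:
  assumes m: "\<And>n::nat. meas_on K (h n)" "meas_on K s" "meas_on K t"
    and s: "(\<lambda>n. E K (\<lambda>x. h n x - s x)) \<longlonglongrightarrow> 0" and t: "(\<lambda>n. E K (\<lambda>x. h n x - t x)) \<longlonglongrightarrow> 0"
  shows "AE x in lebesgue. x \<in> K \<longrightarrow> s x = t x"
proof -
  have "(\<lambda>n. E K (\<lambda>x. h n x - s x) + E K (\<lambda>x. h n x - t x)) \<longlonglongrightarrow> 0 + 0"
    by (rule tendsto_add[OF s t])
  then have "(\<lambda>n. ennreal (2 powr p) * (E K (\<lambda>x. h n x - s x) + E K (\<lambda>x. h n x - t x))) \<longlonglongrightarrow> 0"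
    by (intro ennreal_tendsto_0_mult) simp
  from ennreal_tendsto_0_le[OF this, of "\<lambda>_. E K (\<lambda>x. s x - t x)"]
  have "(\<lambda>_::nat. E K (\<lambda>x. s x - t x)) \<longlonglongrightarrow> 0"
    using E_triangle[OF m(2,1,3)] by (simp add: E_commute[of _ s "h _"])
  then have "E K (\<lambda>x. s x - t x) = 0" by (simp add: LIMSEQ_const_iff)
  then have "AE x in lebesgue. x \<in> K \<longrightarrow> s x - t x = 0" using E_zero_iff[OF meas_on_diff[OF m(2,3)]] by simp
  then show ?thesis by eventually_elim simp
qed

lemma E_test_finite:
  assumes "test_function D h" shows "E S h < \<infinity>"
proof -
  obtain K where K: "smooth_on UNIV h" "compact K" "\<And>x. x \<notin> K \<Longrightarrow> h x = 0"
    using assms by (rule test_functionE) blast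
  have "E S h \<le> E UNIV (\<lambda>x. indicator K x * h x)"
    using K(3) by (intro order_trans[OF E_mono_set[of S UNIV] E_mono]) (auto simp: indicator_def)
  also have "\<dots> = E K h" by (rule E_indicator) simp
  also have "\<dots> < \<infinity>" by (rule E_continuous_finite[OF K(2) continuous_on_subset[OF smooth_on_continuous[OF K(1)]]]) simp
  finally show ?thesis .
qed

lemma meas_on_test: "test_function D h \<Longrightarrow> S \<in> sets lebesgue \<Longrightarrow> meas_on S h"
  by (rule meas_on_borel[OF test_function_measurable])

lemma test_in_Sob:
  assumes D: "open D" and h: "test_function D h"
  shows "h \<in> Sob D m"
proof (rule Sob_I(1)[OF D])
  show "locally_summable D h"
    by (intro locally_summable_continuous smooth_on_continuous test_function_smooth[OF h])
  show "E D h < \<infinity>" by (rule E_test_finite[OF h])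
  show "has_weak_deriv D \<alpha> h (list_deriv (rev (mi_list \<alpha>)) h)" for \<alpha>
    by (rule smooth_has_weak_deriv[OF D test_function_smooth[OF h]])
  show "E D (list_deriv (rev (mi_list \<alpha>)) h) < \<infinity>" for \<alpha>
    by (rule E_test_finite[OF test_function_list[OF h]])
qed

text \<open>Takes the place of a product rule for weak derivatives: the products of \<psi> with
  local smooth approximants of \<open>f\<close> are test functions, Cauchy in the complete space by
  \<open>leibniz_bound\<close>, and their limit is the product of \<psi> and \<open>f\<close>. That
  \<open>h\<close> vanishes wherever \<psi> does keeps sums of such functions locally finite in
  \<open>smooth_dense\<close>.\<close>

lemma cutoff_approx:
  assumes D: "open D" and f: "f \<in> Sob D m" and \<psi>: "test_function D \<psi>"
  shows "(\<lambda>x. \<psi> x * f x) \<in> Sob D m"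
    and "e > 0 \<Longrightarrow> \<exists>h. test_function D h \<and> (\<forall>x. \<psi> x = 0 \<longrightarrow> h x = 0) \<and> Nrm D m (\<lambda>x. h x - \<psi> x * f x) \<le> e"
proof -
  have Dl: "D \<in> sets lebesgue" using D by simp
  obtain K where K: "compact K" "K \<subseteq> D" "\<And>x. x \<notin> K \<Longrightarrow> \<psi> x = 0"
    using \<psi> by (rule test_functionE) blast
  obtain M where M: "M > 0" "\<And>x. \<bar>\<psi> x\<bar> \<le> M" using \<psi> by (rule test_function_bounded) blast
  note fD = Sob_D[OF D f]
  obtain u where u: "\<And>j::nat. smooth_on UNIV (u j)" "(\<lambda>j. E K (\<lambda>x. u j x - f x)) \<longlonglongrightarrow> 0"
    "\<And>ys e. length ys \<le> m \<Longrightarrow> e > 0 \<Longrightarrow>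
      \<exists>N. \<forall>i\<ge>N. \<forall>j\<ge>N. E K (\<lambda>x. list_deriv ys (u i) x - list_deriv ys (u j) x) \<le> ennreal e"
    by (rule local_smooth_approx[OF D fD(2,3) _ _ _ K(1,2), of m "\<lambda>\<alpha>. weak_deriv D \<alpha> f"],
        erule fD, erule fD, erule fD, rule that)
  define h where "h j x = \<psi> x * u j x" for j x
  have \<psi>U: "test_function UNIV \<psi>" by (rule test_function_mono[OF \<psi>]) simp
  have h: "test_function D (h j)" for j
    unfolding h_def by (rule test_function_mult[OF D \<psi> smooth_on_subset[OF u(1)]]) simp
  have Cauchy: "\<exists>N. \<forall>i\<ge>N. \<forall>j\<ge>N. E D (\<lambda>x. list_deriv xs (h i) x - list_deriv xs (h j) x) \<le> ennreal e"
    if xs: "length xs \<le> m" and e: "e > 0" for xs e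
  proof -
    obtain C where C: "C \<ge> 0" "\<And>u. smooth_on UNIV u \<Longrightarrow> E UNIV (list_deriv xs (\<lambda>x. \<psi> x * u x)) \<le>
        ennreal C * (\<Sum>ys\<in>{ys. length ys \<le> length xs}. E K (list_deriv ys u))"
      using leibniz_bound[OF K(1) \<psi>U K(3)] by blast
    define S where "S = {ys :: 'n list. length ys \<le> length xs}"
    have S: "finite S" unfolding S_def using finite_lists_length_le[of "UNIV :: 'n set"] by simp
    define d where "d = e / ((C + 1) * (real (card S) + 1))"
    have d: "d > 0" using e C(1) by (simp add: d_def add_nonneg_pos)
    have "\<forall>ys\<in>S. \<exists>N. \<forall>i\<ge>N. \<forall>j\<ge>N. E K (\<lambda>x. list_deriv ys (u i) x - list_deriv ys (u j) x) \<le> ennreal d"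
      using u(3)[OF _ d] xs by (auto simp: S_def)
    then obtain N where N: "\<And>ys i j. ys \<in> S \<Longrightarrow> i \<ge> N ys \<Longrightarrow> j \<ge> N ys \<Longrightarrow>
        E K (\<lambda>x. list_deriv ys (u i) x - list_deriv ys (u j) x) \<le> ennreal d" by metis
    define N' where "N' = Max (N ` S)"
    have N': "N ys \<le> N'" if "ys \<in> S" for ys using S that by (auto simp: N'_def)
    have "E D (\<lambda>x. list_deriv xs (h i) x - list_deriv xs (h j) x) \<le> ennreal e" if ij: "i \<ge> N'" "j \<ge> N'" for i j
    proof -
      have uij: "smooth_on UNIV (\<lambda>x. u i x - u j x)" by (intro smooth_on_diff open_UNIV u)
      have hU: "smooth_on UNIV (h k)" for k by (rule test_function_smooth[OF h])
      have "E D (\<lambda>x. list_deriv xs (h i) x - list_deriv xs (h j) x) \<le> E UNIV (\<lambda>x. list_deriv xs (h i) x - list_deriv xs (h j) x)"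
        by (rule E_mono_set) simp
      also have "\<dots> = E UNIV (list_deriv xs (\<lambda>x. h i x - h j x))"
        by (intro E_cong list_deriv_diff[OF open_UNIV hU hU, symmetric]) simp
      also have "(\<lambda>x. h i x - h j x) = (\<lambda>x. \<psi> x * (u i x - u j x))" by (auto simp: h_def algebra_simps)
      also have "E UNIV (list_deriv xs (\<lambda>x. \<psi> x * (u i x - u j x))) \<le>
          ennreal C * (\<Sum>ys\<in>S. E K (list_deriv ys (\<lambda>x. u i x - u j x)))"
        unfolding S_def by (rule C(2)[OF uij])
      also have "\<dots> \<le> ennreal C * (\<Sum>ys\<in>S. ennreal d)"
      proof (intro mult_left_mono sum_mono)
        fix ys assume ys: "ys \<in> S"
        have "E K (list_deriv ys (\<lambda>x. u i x - u j x)) = E K (\<lambda>x. list_deriv ys (u i) x - list_deriv ys (u j) x)"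
          by (intro E_cong list_deriv_diff[OF open_UNIV u(1) u(1)]) simp
        also have "\<dots> \<le> ennreal d" using N'[OF ys] ij by (intro N[OF ys]) auto
        finally show "E K (list_deriv ys (\<lambda>x. u i x - u j x)) \<le> ennreal d" .
      qed simp
      also have "\<dots> = ennreal (C * (real (card S) * d))"
        using C(1) d by (subst sum_ennreal) (auto simp flip: ennreal_mult')
      also have "\<dots> \<le> ennreal e"
      proof (rule ennreal_leI)
        have "C * (real (card S) * d) = (C * real (card S)) * d" by simp
        also have "\<dots> \<le> ((C + 1) * (real (card S) + 1)) * d"
          using C(1) d by (intro mult_right_mono mult_mono) auto
        also have "\<dots> = e"
        proof -
          have "(C + 1) * (real (card S) + 1) > 0" using C(1) by (intro mult_pos_pos) auto
          then show ?thesis by (metis d_def less_irrefl mult.commute nonzero_eq_divide_eq)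
        qed
        finally show "C * (real (card S) * d) \<le> e" .
      qed
      finally show ?thesis .
    qed
    then show ?thesis by blast
  qed
  obtain s where s: "s \<in> Sob D m" "(\<lambda>n. E D (\<lambda>x. h n x - s x)) \<longlonglongrightarrow> 0" "(\<lambda>n. Nrm D m (\<lambda>x. h n x - s x)) \<longlonglongrightarrow> 0"
  proof (rule Sob_complete_E[OF D, where f=h and g="\<lambda>n \<alpha>. list_deriv (rev (mi_list \<alpha>)) (h n)"])
    show "locally_summable D (h n)" for n
      by (intro locally_summable_continuous smooth_on_continuous test_function_smooth[OF h])
    show "E D (h n) < \<infinity>" for n by (rule E_test_finite[OF h])
    show "has_weak_deriv D \<alpha> (h n) (list_deriv (rev (mi_list \<alpha>)) (h n))" for n \<alpha>
      by (rule smooth_has_weak_deriv[OF D test_function_smooth[OF h]])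
    show "E D (list_deriv (rev (mi_list \<alpha>)) (h n)) < \<infinity>" for n \<alpha>
      by (rule E_test_finite[OF test_function_list[OF h]])
    show "\<exists>N. \<forall>i\<ge>N. \<forall>j\<ge>N. E D (\<lambda>x. h i x - h j x) \<le> ennreal e" if "e > 0" for e
      using Cauchy[of "[]", OF _ that] by simp
    show "\<exists>N. \<forall>i\<ge>N. \<forall>j\<ge>N. E D (\<lambda>x. list_deriv (rev (mi_list \<alpha>)) (h i) x - list_deriv (rev (mi_list \<alpha>)) (h j) x) \<le> ennreal e"
      if "multiindex_order \<alpha> = m" "e > 0" for \<alpha> e
      using that by (intro Cauchy) (simp_all add: length_mi_list)
  qed (rule that)
  have mh: "meas_on D (h n)" for n by (rule meas_on_test[OF h Dl])
  have m\<psi>f: "meas_on D (\<lambda>x. \<psi> x * f x)"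
    using borel_measurable_times[OF borel_imp_lebesgue_measurable[OF test_function_measurable[OF \<psi>]] fD(2)[unfolded meas_on_def]]
    by (simp add: meas_on_def mult_ac)
  have lim: "(\<lambda>n. E D (\<lambda>x. h n x - \<psi> x * f x)) \<longlonglongrightarrow> 0"
  proof (rule ennreal_tendsto_0_le[OF ennreal_tendsto_0_mult[OF u(2), of "M powr p"]])
    fix n
    have Kl: "K \<in> sets lebesgue" by (rule sets_lebesgue_compact[OF K(1)])
    have mK: "meas_on K (\<lambda>x. u n x - f x)"
      by (intro meas_on_diff meas_on_borel[OF borel_measurable_continuous_onI[OF smooth_on_continuous[OF u(1)]] Kl]
          meas_on_subset[OF fD(2) K(2) Kl])
    have "E D (\<lambda>x. h n x - \<psi> x * f x) \<le> E D (\<lambda>x. indicator K x * (M * (u n x - f x)))"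
    proof (rule E_mono)
      fix x
      have "h n x - \<psi> x * f x = \<psi> x * (u n x - f x)" by (simp add: h_def algebra_simps)
      moreover have "\<bar>\<psi> x * (u n x - f x)\<bar> \<le> \<bar>indicator K x * (M * (u n x - f x))\<bar>"
        using M(1) M(2)[of x] K(3)[of x] by (cases "x \<in> K") (auto simp: abs_mult intro!: mult_right_mono)
      ultimately show "\<bar>h n x - \<psi> x * f x\<bar> \<le> \<bar>indicator K x * (M * (u n x - f x))\<bar>" by simp
    qed
    also have "\<dots> = E K (\<lambda>x. M * (u n x - f x))" by (rule E_indicator[OF K(2)])
    also have "\<dots> = ennreal (M powr p) * E K (\<lambda>x. u n x - f x)" using M(1) by (simp add: E_cmult[OF mK])
    finally show "E D (\<lambda>x. h n x - \<psi> x * f x) \<le> ennreal (M powr p) * E K (\<lambda>x. u n x - f x)" .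
  qed
  \<comment> \<open>The abstract limit \<open>s\<close> from completeness and the product are both
    limits of \<open>h\<close> in the energy of order 0.\<close>
  have eq: "AE x in lebesgue. x \<in> D \<longrightarrow> s x = \<psi> x * f x"
    by (rule E_limit_unique[OF mh Sob_D(2)[OF D s(1)] m\<psi>f s(2) lim])
  show "(\<lambda>x. \<psi> x * f x) \<in> Sob D m" by (rule Sob_cong_AE(1)[OF D s(1) eq])
  assume e: "e > 0"
  obtain n where n: "Nrm D m (\<lambda>x. h n x - s x) \<le> e"
    using order_tendstoD(2)[OF s(3) e] by (auto simp: eventually_sequentially intro: less_imp_le)
  have "Nrm D m (\<lambda>x. h n x - \<psi> x * f x) = Nrm D m (\<lambda>x. h n x - s x)"
    by (rule Sob_cong_AE(2)[OF D Sob_diff(1)[OF D test_in_Sob[OF D h] s(1)]])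
      (use eq in \<open>auto elim: eventually_mono\<close>)
  then show "\<exists>h. test_function D h \<and> (\<forall>x. \<psi> x = 0 \<longrightarrow> h x = 0) \<and> Nrm D m (\<lambda>x. h x - \<psi> x * f x) \<le> e"
    using n h by (intro exI[of _ "h n"]) (auto simp: h_def)
qed

lemma Sob_sum:
  assumes D: "open D" and f: "\<And>i. i \<in> I \<Longrightarrow> f i \<in> Sob D m"
  shows "(\<lambda>x. \<Sum>i\<in>I. f i x) \<in> Sob D m \<and> Nrm D m (\<lambda>x. \<Sum>i\<in>I. f i x) \<le> (\<Sum>i\<in>I. Nrm D m (f i))"
  using f
proof (induction I rule: infinite_finite_induct)
  case (insert i I)
  then have "f i \<in> Sob D m" and IH: "(\<lambda>x. \<Sum>i\<in>I. f i x) \<in> Sob D m"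
    "Nrm D m (\<lambda>x. \<Sum>i\<in>I. f i x) \<le> (\<Sum>i\<in>I. Nrm D m (f i))" by auto
  from Sob_add(1,2)[OF D this(1,2)] IH(2) insert.hyps show ?case by simp
qed (simp_all add: Sob_zero[OF D])

text \<open>Each piece \<psi>_j f of a locally finite decomposition is replaced by a test function
  \<open>w j\<close> with error at most e 2^(-j - 1). The sum \<open>g\<close> of the
  \<open>w j\<close> is smooth because it is locally finite; \<open>g - f\<close> equals almost
  everywhere the sum of the errors, which converges in the space.\<close>

theorem smooth_dense:
  assumes D: "open D" and f: "f \<in> Sob D m" and e: "e > 0"
  obtains h where "h \<in> Sob D m" "smooth_on D h" "Nrm D m (\<lambda>x. h x - f x) \<le> e"
proof -
  obtain C where C: "\<And>n::nat. compact (C n)" "\<And>n. C n \<subseteq> D" "\<And>n. C n \<subseteq> interior (C (Suc n))"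
    "\<Union>(range C) = D"
    by (rule open_Union_compact_subsets[OF D]) blast
  have C_Suc: "C n \<subseteq> C (Suc n)" for n using C(3) interior_subset by blast
  have C_mono: "C i \<subseteq> C j" if "i \<le> j" for i j
    using that by (induction rule: dec_induct) (use C_Suc in auto)
  have "\<exists>\<eta>. test_function D \<eta> \<and> (\<forall>x\<in>C n. \<eta> x = 1)" for n
    by (rule cutoff_exists[OF C(1) open_interior C(3), of n])
      (use C(2)[of "Suc n"] interior_subset in \<open>blast intro: test_function_mono\<close>)
  then obtain \<eta> where \<eta>: "\<And>n. test_function D (\<eta> n)" "\<And>n x. x \<in> C n \<Longrightarrow> \<eta> n x = 1" by metis
  \<comment> \<open>Differences of consecutive cutoffs: the sums telescope to \<eta>_n, which is 1
    on \<open>C n\<close>, so this is a partition of unity without any normalisation.\<close>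
  define \<psi> where "\<psi> n x = (case n of 0 \<Rightarrow> \<eta> 0 x | Suc k \<Rightarrow> \<eta> (Suc k) x - \<eta> k x)" for n x
  have \<psi>_test: "test_function D (\<psi> n)" for n
    unfolding \<psi>_def by (cases n) (auto intro: \<eta> test_function_diff)
  have \<psi>_sum: "(\<Sum>j\<le>n. \<psi> j x) = \<eta> n x" for n x
    by (induction n) (simp_all add: \<psi>_def)
  \<comment> \<open>Both cutoffs in the difference are 1 on \<open>C N\<close> when the index
    exceeds \<open>N\<close>; this gives local finiteness.\<close>
  have \<psi>_zero: "\<psi> j x = 0" if xN: "x \<in> C N" and Nj: "N < j" for j N x
  proof -
    obtain k where k: "j = Suc k" "N \<le> k" using Nj by (cases j) auto
    have "x \<in> C k" "x \<in> C (Suc k)" using C_mono[OF k(2)] C_Suc[of k] xN by auto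
    then show ?thesis by (simp add: \<psi>_def k(1) \<eta>(2))
  qed
  have "\<exists>h. test_function D h \<and> (\<forall>x. \<psi> j x = 0 \<longrightarrow> h x = 0) \<and> Nrm D m (\<lambda>x. h x - \<psi> j x * f x) \<le> e * (1/2) ^ Suc j" for j
    by (rule cutoff_approx(2)[OF D f \<psi>_test]) (use e in simp)
  then obtain w where w: "\<And>j. test_function D (w j)" "\<And>j x. \<psi> j x = 0 \<Longrightarrow> w j x = 0"
    "\<And>j. Nrm D m (\<lambda>x. w j x - \<psi> j x * f x) \<le> e * (1/2) ^ Suc j" by metis
  define d where "d j x = w j x - \<psi> j x * f x" for j x
  have d: "d j \<in> Sob D m" for j
    unfolding d_def by (intro Sob_diff(1)[OF D] test_in_Sob[OF D w(1)] cutoff_approx(1)[OF D f \<psi>_test])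
  define S where "S n x = (\<Sum>j<n. d j x)" for n x
  have S: "S n \<in> Sob D m" for n unfolding S_def[abs_def] using Sob_sum[OF D, of "{..<n}" d m] d by blast
  \<comment> \<open>A geometric sum. It serves the Cauchy property of the partial sums and, with
    \<open>i = 0\<close>, the bound of the whole error by \<open>e\<close>.\<close>
  have tail: "Nrm D m (\<lambda>x. \<Sum>j\<in>{i..<n}. d j x) \<le> e * (1/2) ^ i" if "i \<le> n" for i n
  proof -
    have "Nrm D m (\<lambda>x. \<Sum>j\<in>{i..<n}. d j x) \<le> (\<Sum>j\<in>{i..<n}. Nrm D m (d j))"
      using Sob_sum[OF D, of "{i..<n}" d m] d by blast
    also have "\<dots> \<le> (\<Sum>j\<in>{i..<n}. e * (1/2) ^ Suc j)"
      using w(3) by (intro sum_mono) (simp add: d_def[abs_def])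
    also have "\<dots> = e * (1/2) ^ i - e * (1/2) ^ n"
      using that by (induction rule: dec_induct) (auto simp: algebra_simps)
    also have "\<dots> \<le> e * (1/2) ^ i" using e by simp
    finally show ?thesis .
  qed
  have Sdiff: "(\<lambda>x. S n x - S i x) = (\<lambda>x. \<Sum>j\<in>{i..<n}. d j x)" if "i \<le> n" for i n
  proof
    fix x
    have "{..<n} = {..<i} \<union> {i..<n}" using that by auto
    then have "S n x = S i x + (\<Sum>j\<in>{i..<n}. d j x)"
      unfolding S_def by (simp add: sum.union_disjoint[symmetric] ivl_disj_int)
    then show "S n x - S i x = (\<Sum>j\<in>{i..<n}. d j x)" by simp
  qed
  have sym: "Nrm D m (\<lambda>x. a x - b x) = Nrm D m (\<lambda>x. b x - a x)" if "a \<in> Sob D m" "b \<in> Sob D m" for a b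
    using Sob_cmult(2)[OF D Sob_diff(1)[OF D that], of "-1"] by simp
  obtain s where s: "s \<in> Sob D m" "(\<lambda>n. E D (\<lambda>x. S n x - s x)) \<longlonglongrightarrow> 0" "(\<lambda>n. Nrm D m (\<lambda>x. S n x - s x)) \<longlonglongrightarrow> 0"
  proof (rule Sob_complete[OF D S])
    fix r :: real assume r: "r > 0"
    obtain N where N: "(1/2) ^ N < r / e" using real_arch_pow_inv[of "r / e" "1/2"] r e by auto
    have "Nrm D m (\<lambda>x. S i x - S j x) \<le> r" if ij: "i \<ge> N" "j \<ge> N" for i j
    proof -
      have *: "Nrm D m (\<lambda>x. S n x - S i x) \<le> r" if "i \<le> n" "N \<le> i" for i n
      proof -
        have "Nrm D m (\<lambda>x. S n x - S i x) \<le> e * (1/2) ^ i" unfolding Sdiff[OF that(1)] by (rule tail[OF that(1)])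
        also have "\<dots> \<le> e * (1/2) ^ N" using e that(2) by (intro mult_left_mono power_decreasing) auto
        also have "\<dots> \<le> r" using N e by (simp add: field_simps)
        finally show ?thesis .
      qed
      show ?thesis using *[of j i] *[of i j] ij sym[OF S S, of i j] by (cases "i \<le> j") auto
    qed
    then show "\<exists>N. \<forall>i\<ge>N. \<forall>j\<ge>N. Nrm D m (\<lambda>x. S i x - S j x) \<le> r" by blast
  qed (rule that)
  have s_norm: "Nrm D m s \<le> e"
  proof -
    have "Nrm D m s \<le> e + Nrm D m (\<lambda>x. S n x - s x)" for n
    proof -
      have "Nrm D m (\<lambda>x. S n x + (s x - S n x)) \<le> Nrm D m (S n) + Nrm D m (\<lambda>x. s x - S n x)"
        by (rule Sob_add(2)[OF D S Sob_diff(1)[OF D s(1) S]])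
      moreover have "Nrm D m (S n) \<le> e"
        using tail[of 0 n] unfolding S_def[abs_def] by (simp add: atLeast0LessThan)
      ultimately show ?thesis using sym[OF s(1) S, of n] by simp
    qed
    moreover have "(\<lambda>n. e + Nrm D m (\<lambda>x. S n x - s x)) \<longlonglongrightarrow> e + 0"
      by (intro tendsto_add tendsto_const s(3))
    ultimately show ?thesis by (intro LIMSEQ_le_const[of _ "e"]) auto
  qed
  \<comment> \<open>At a point whose first compact set is number \<open>N x\<close>, all
    \<open>w j\<close> with larger index vanish, so this finite sum is the sum of the whole
    series.\<close>
  define N where "N x = (LEAST n. x \<in> C n)" for x
  define g where "g x = (\<Sum>j\<le>N x. w j x)" for x
  have g_eq: "(\<Sum>j\<le>n. w j x) = g x" if x: "x \<in> C n" for n x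
  proof -
    have Nx: "x \<in> C (N x)" "N x \<le> n" unfolding N_def using x by (auto intro: LeastI Least_le)
    show ?thesis unfolding g_def
    proof (rule sum.mono_neutral_right)
      show "\<forall>i\<in>{..n} - {..N x}. w i x = 0"
        using \<psi>_zero[OF Nx(1)] w(2) by auto
    qed (use Nx in auto)
  qed
  \<comment> \<open>The index is shifted since \<open>S (Suc n)\<close> sums over all indices up to
    \<open>n\<close>, for which the \<psi>_j add up to 1 on \<open>C n\<close>.\<close>
  have S_eq: "S (Suc n) x = g x - f x" if x: "x \<in> C n" for n x
  proof -
    have "S (Suc n) x = (\<Sum>j\<le>n. w j x) - (\<Sum>j\<le>n. \<psi> j x) * f x"
      unfolding S_def d_def by (simp only: lessThan_Suc_atMost sum_subtractf sum_distrib_right)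
    then show ?thesis using g_eq[OF x] \<eta>(2)[OF x] by (simp add: \<psi>_sum)
  qed
  have "AE x in lebesgue. \<forall>n. x \<in> C n \<longrightarrow> s x = g x - f x"
    unfolding AE_all_countable
  proof
    fix n
    have Cl: "C n \<in> sets lebesgue" by (rule sets_lebesgue_compact[OF C(1)])
    have m: "meas_on (C n) (S k)" "meas_on (C n) s" for k
      by (rule meas_on_subset[OF Sob_D(2)[OF D S] C(2) Cl], rule meas_on_subset[OF Sob_D(2)[OF D s(1)] C(2) Cl])
    \<comment> \<open>On \<open>C n\<close> the partial sums are constant from \<open>Suc n\<close>
      on, so the energy limit \<open>s\<close> must be that constant value, namely
      \<open>g - f\<close>.\<close>
    have "\<forall>\<^sub>F k in sequentially. E (C n) (\<lambda>x. S k x - S (Suc n) x) = 0"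
      unfolding eventually_sequentially
    proof (intro exI[of _ "Suc n"] allI impI)
      fix k assume "Suc n \<le> k"
      then obtain k' where k: "k = Suc k'" "n \<le> k'" by (cases k) auto
      have "E (C n) (\<lambda>x. S k x - S (Suc n) x) = E (C n) (\<lambda>x. 0)"
        by (rule E_cong) (use S_eq C_mono[OF k(2)] k(1) in auto)
      then show "E (C n) (\<lambda>x. S k x - S (Suc n) x) = 0" by (simp add: E_def)
    qed
    then have "(\<lambda>k. E (C n) (\<lambda>x. S k x - S (Suc n) x)) \<longlonglongrightarrow> 0" by (rule tendsto_eventually)
    moreover have "(\<lambda>k. E (C n) (\<lambda>x. S k x - s x)) \<longlonglongrightarrow> 0"
      by (rule ennreal_tendsto_0_le[OF s(2) E_mono_set[OF C(2)]])
    ultimately have "AE x in lebesgue. x \<in> C n \<longrightarrow> s x = S (Suc n) x"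
      by (intro E_limit_unique[OF m(1) m(2) m(1)])
    then show "AE x in lebesgue. x \<in> C n \<longrightarrow> s x = g x - f x"
      by eventually_elim (simp add: S_eq)
  qed
  then have ae: "AE x in lebesgue. x \<in> D \<longrightarrow> f x + s x = g x"
    by eventually_elim (use C(4) in force)
  show thesis
  proof (rule that[of g])
    show gS: "g \<in> Sob D m" by (rule Sob_cong_AE(1)[OF D Sob_add(1)[OF D f s(1)] ae])
    have "Nrm D m (\<lambda>x. g x - f x) = Nrm D m s"
      by (rule Sob_cong_AE(2)[OF D s(1)]) (use ae in \<open>auto elim: eventually_mono\<close>)
    then show "Nrm D m (\<lambda>x. g x - f x) \<le> e" using s_norm by simp
    have "smooth_on (\<Union>n\<in>UNIV. interior (C n)) g"
    proof (rule smooth_on_UN)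
      fix n
      have "smooth_on (interior (C n)) (\<lambda>x. \<Sum>j\<le>n. w j x)"
        by (intro smooth_on_sum open_interior test_function_smooth[OF w(1)])
      then show "smooth_on (interior (C n)) g"
        using smooth_on_cong[OF open_interior, of "C n" "\<lambda>x. \<Sum>j\<le>n. w j x" g] g_eq interior_subset by blast
    qed simp
    moreover have "D \<subseteq> (\<Union>n\<in>UNIV. interior (C n))" using C(3,4) by blast
    ultimately show "smooth_on D g" by (rule smooth_on_subset)
  qed
qed

end

section \<open>The space of classes\<close>

context ap_weight
begin

context
  fixes D :: "(real^'n) set" and m :: nat
  assumes D: "open D"
begin

abbreviation Cls :: "(real^'n \<Rightarrow> real) \<Rightarrow> (real^'n \<Rightarrow> real) set" where
  "Cls f \<equiv> ae_rel D m p v `` {f}"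

lemma equiv_ae_rel: "equiv (Sob D m) (ae_rel D m p v)"
proof (rule equivI)
  show "ae_rel D m p v \<subseteq> Sob D m \<times> Sob D m" by (auto simp: ae_rel_def)
  show "refl_on (Sob D m) (ae_rel D m p v)" by (auto simp: refl_on_def ae_rel_def)
  show "sym (ae_rel D m p v)" by (auto simp: sym_def ae_rel_def elim!: eventually_mono)
  show "trans (ae_rel D m p v)"
    unfolding trans_def ae_rel_def by (auto elim!: eventually_elim2)
qed

lemma Cls_iff: "f \<in> Cls g \<longleftrightarrow> g \<in> Sob D m \<and> f \<in> Sob D m \<and> (AE x in lebesgue. x \<in> D \<longrightarrow> g x = f x)"
  by (auto simp: ae_rel_def)

lemma Cls_eq:
  assumes "f \<in> Sob D m" "g \<in> Sob D m"
  shows "Cls f = Cls g \<longleftrightarrow> (AE x in lebesgue. x \<in> D \<longrightarrow> f x = g x)"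
  using eq_equiv_class_iff[OF equiv_ae_rel assms] assms by (simp add: ae_rel_def)

lemma Cls_self: "f \<in> Sob D m \<Longrightarrow> f \<in> Cls f"
  unfolding Cls_iff by simp

lemma space_eq: "sobolev_space D m p v = Cls ` Sob D m"
  by (auto simp: sobolev_space_def quotient_def)

text \<open>All pairs of representatives yield the same class, so the union in the definition of the
  sum consists of equal sets.\<close>

lemma class_add_Cls:
  assumes f: "f \<in> Sob D m" and g: "g \<in> Sob D m"
  shows "class_add D m p v (Cls f) (Cls g) = Cls (\<lambda>x. f x + g x)"
proof -
  have "Cls (\<lambda>x. f' x + g' x) = Cls (\<lambda>x. f x + g x)" if "f' \<in> Cls f" "g' \<in> Cls g" for f' g'
  proof -
    have "AE x in lebesgue. x \<in> D \<longrightarrow> f x = f' x" "AE x in lebesgue. x \<in> D \<longrightarrow> g x = g' x"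
      and S: "f' \<in> Sob D m" "g' \<in> Sob D m"
      using that unfolding Cls_iff by auto
    then have "AE x in lebesgue. x \<in> D \<longrightarrow> f' x + g' x = f x + g x" by (auto elim!: eventually_elim2)
    then show ?thesis by (subst Cls_eq) (intro Sob_add(1)[OF D] S f g)+
  qed
  then show ?thesis
    unfolding class_add_def using Cls_self[OF f] Cls_self[OF g] by blast
qed

lemma class_smul_Cls:
  assumes f: "f \<in> Sob D m"
  shows "class_smul D m p v a (Cls f) = Cls (\<lambda>x. a * f x)"
proof -
  have "Cls (\<lambda>x. a * f' x) = Cls (\<lambda>x. a * f x)" if "f' \<in> Cls f" for f'
  proof -
    have "AE x in lebesgue. x \<in> D \<longrightarrow> f x = f' x" and S: "f' \<in> Sob D m"
      using that unfolding Cls_iff by auto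
    then have "AE x in lebesgue. x \<in> D \<longrightarrow> a * f' x = a * f x" by (auto elim!: eventually_mono)
    then show ?thesis by (subst Cls_eq) (intro Sob_cmult(1)[OF D] S f)+
  qed
  then show ?thesis
    unfolding class_smul_def using Cls_self[OF f] by blast
qed

text \<open>The norm is constant on a class, so its image is a singleton and \<open>the_elem\<close>
  returns the expected value.\<close>

lemma class_norm_Cls:
  assumes f: "f \<in> Sob D m"
  shows "class_norm D m p v (Cls f) = Nrm D m f"
proof -
  have "Nrm D m f' = Nrm D m f" if "f' \<in> Cls f" for f'
    using that Sob_cong_AE(2)[OF D f, of f'] unfolding Cls_iff by blast
  then have "Nrm D m ` Cls f = {Nrm D m f}" using Cls_self[OF f] by blast
  then show ?thesis by (simp add: class_norm_def)
qed

lemma class_zero_Cls: "class_zero D m p v = Cls (\<lambda>x. 0)"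
  by (simp add: class_zero_def)

lemmas Sob_closed = Sob_zero(1)[OF D] Sob_add(1)[OF D] Sob_cmult(1)[OF D]
lemmas Cls_ops = class_add_Cls class_smul_Cls class_norm_Cls class_zero_Cls Sob_closed

lemma normed_space_sobolev:
  "normed_space_on (sobolev_space D m p v) (class_add D m p v) (class_zero D m p v)
    (class_smul D m p v) (class_norm D m p v)"
proof
  show "class_zero D m p v \<in> sobolev_space D m p v"
    by (auto simp: space_eq Cls_ops)
  fix U V Z and a b :: real
  assume "U \<in> sobolev_space D m p v"
  then obtain f where f: "f \<in> Sob D m" "U = Cls f" by (auto simp: space_eq)
  show "class_smul D m p v a U \<in> sobolev_space D m p v"
    unfolding space_eq f(2) using f(1) by (simp add: Cls_ops)
  show "class_add D m p v U (class_zero D m p v) = U"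
    unfolding f(2) using f(1) by (simp add: Cls_ops)
  show "class_add D m p v U (class_smul D m p v (-1) U) = class_zero D m p v"
    unfolding f(2) using f(1) Sob_closed(3)[OF f(1), of "-1"] by (simp add: Cls_ops)
  show "class_smul D m p v (a + b) U = class_add D m p v (class_smul D m p v a U) (class_smul D m p v b U)"
    unfolding f(2) using f(1) by (simp add: Cls_ops distrib_right)
  show "class_smul D m p v a (class_smul D m p v b U) = class_smul D m p v (a * b) U"
    unfolding f(2) using f(1) by (simp add: Cls_ops mult.assoc)
  show "class_smul D m p v 1 U = U"
    unfolding f(2) using f(1) by (simp add: Cls_ops)
  show "0 \<le> class_norm D m p v U"
    unfolding f(2) using f(1) by (simp add: Cls_ops Nrm_nonneg[OF D])
  show "class_norm D m p v U = 0 \<longleftrightarrow> U = class_zero D m p v"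
    unfolding f(2) class_zero_Cls class_norm_Cls[OF f(1)]
    using Nrm_eq_0_iff[OF D f(1)] Cls_eq[OF f(1) Sob_closed(1)] by simp
  show "class_norm D m p v (class_smul D m p v a U) = \<bar>a\<bar> * class_norm D m p v U"
    unfolding f(2) using f(1) by (simp add: Cls_ops Sob_cmult(2)[OF D])
  assume "V \<in> sobolev_space D m p v"
  then obtain g where g: "g \<in> Sob D m" "V = Cls g" by (auto simp: space_eq)
  show "class_add D m p v U V \<in> sobolev_space D m p v"
    unfolding space_eq f(2) g(2) using f(1) g(1) by (simp add: Cls_ops)
  show "class_add D m p v U V = class_add D m p v V U"
    unfolding f(2) g(2) using f(1) g(1) by (simp add: Cls_ops add.commute)
  show "class_smul D m p v a (class_add D m p v U V) = class_add D m p v (class_smul D m p v a U) (class_smul D m p v a V)"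
    unfolding f(2) g(2) using f(1) g(1) by (simp add: Cls_ops distrib_left)
  show "class_norm D m p v (class_add D m p v U V) \<le> class_norm D m p v U + class_norm D m p v V"
    unfolding f(2) g(2) using f(1) g(1) by (simp add: Cls_ops Sob_add(2)[OF D])
  assume "Z \<in> sobolev_space D m p v"
  then obtain h where h: "h \<in> Sob D m" "Z = Cls h" by (auto simp: space_eq)
  show "class_add D m p v (class_add D m p v U V) Z = class_add D m p v U (class_add D m p v V Z)"
    unfolding f(2) g(2) h(2) using f(1) g(1) h(1) by (simp add: Cls_ops add.assoc)
qed

section \<open>Completeness and density for classes\<close>

abbreviation sob_dist :: "(real^'n \<Rightarrow> real) set \<Rightarrow> (real^'n \<Rightarrow> real) set \<Rightarrow> real" where
  "sob_dist \<equiv> norm_dist (sobolev_space D m p v) (class_add D m p v) (class_smul D m p v) (class_norm D m p v)"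

lemma sob_dist_Cls:
  assumes f: "f \<in> Sob D m" and g: "g \<in> Sob D m"
  shows "sob_dist (Cls f) (Cls g) = Nrm D m (\<lambda>x. f x - g x)"
proof -
  have "sob_dist (Cls f) (Cls g) = class_norm D m p v (class_add D m p v (Cls f) (class_smul D m p v (-1) (Cls g)))"
    using f g by (simp add: norm_dist_def space_eq)
  also have "\<dots> = Nrm D m (\<lambda>x. f x + (-1) * g x)"
    using f g Sob_closed(3)[OF g, of "-1"] Sob_closed(2)[OF f Sob_closed(3)[OF g, of "-1"]]
    by (simp only: class_smul_Cls[OF g] class_add_Cls class_norm_Cls)
  finally show ?thesis by simp
qed

text \<open>A Cauchy sequence of classes is lifted to representatives; by
  \<open>sob_dist_Cls\<close> distances of classes are norms of differences, so
  \<open>Sob_complete\<close> provides the limit.\<close>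

theorem banach_space_sobolev:
  "banach_space_on (sobolev_space D m p v) (class_add D m p v) (class_zero D m p v)
    (class_smul D m p v) (class_norm D m p v)"
proof -
  interpret normed_space_on "sobolev_space D m p v" "class_add D m p v" "class_zero D m p v"
    "class_smul D m p v" "class_norm D m p v" by (rule normed_space_sobolev)
  show ?thesis
  proof
    show mcomplete
      unfolding mcomplete_def
    proof (intro allI impI)
      fix \<sigma> assume \<sigma>: "MCauchy \<sigma>"
      then have "\<sigma> n \<in> sobolev_space D m p v" for n by (auto simp: MCauchy_def)
      then have "\<forall>n. \<exists>f. f \<in> Sob D m \<and> \<sigma> n = Cls f" unfolding space_eq by blast
      then obtain f where f: "\<And>n. f n \<in> Sob D m" "\<And>n. \<sigma> n = Cls (f n)" by metis
      obtain h where h: "h \<in> Sob D m" "(\<lambda>n. Nrm D m (\<lambda>x. f n x - h x)) \<longlonglongrightarrow> 0"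
      proof (rule Sob_complete[OF D f(1)])
        fix e :: real assume "e > 0"
        then obtain N where "\<And>i j. i \<ge> N \<Longrightarrow> j \<ge> N \<Longrightarrow> sob_dist (\<sigma> i) (\<sigma> j) < e"
          using \<sigma> unfolding MCauchy_def by blast
        then show "\<exists>N. \<forall>i\<ge>N. \<forall>j\<ge>N. Nrm D m (\<lambda>x. f i x - f j x) \<le> e"
          unfolding f(2) sob_dist_Cls[OF f(1) f(1)] by (intro exI[of _ N]) (auto intro: less_imp_le)
      qed (rule that)
      have "\<exists>N. \<forall>n\<ge>N. \<sigma> n \<in> sobolev_space D m p v \<and> sob_dist (\<sigma> n) (Cls h) < e" if "e > 0" for e
        using order_tendstoD(2)[OF h(2) that] f(1)
        unfolding f(2) sob_dist_Cls[OF f(1) h(1)] by (auto simp: space_eq eventually_sequentially)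
      then show "\<exists>x. limitin mtopology \<sigma> x sequentially"
        unfolding limit_metric_sequentially using h(1) by (intro exI[of _ "Cls h"]) (auto simp: space_eq)
    qed
  qed
qed

theorem smooth_classes_dense:
  "sobolev_topology D m p v closure_of smooth_classes D m p v = sobolev_space D m p v"
proof -
  interpret normed_space_on "sobolev_space D m p v" "class_add D m p v" "class_zero D m p v"
    "class_smul D m p v" "class_norm D m p v" by (rule normed_space_sobolev)
  have "\<exists>y\<in>smooth_classes D m p v. y \<in> mball (Cls f) r" if f: "f \<in> Sob D m" and r: "r > 0" for f r
  proof -
    obtain h where h: "h \<in> Sob D m" "smooth_on D h" "Nrm D m (\<lambda>x. h x - f x) \<le> r / 2"
      by (rule smooth_dense[OF D f, of "r / 2"]) (use r in auto)
    have "sob_dist (Cls f) (Cls h) < r"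
      using h(3) r sob_dist_Cls[OF h(1) f] commute[of "Cls f" "Cls h"] by simp
    moreover have "Cls f \<in> sobolev_space D m p v" "Cls h \<in> sobolev_space D m p v"
      using f h(1) by (simp_all add: space_eq)
    ultimately have "Cls h \<in> mball (Cls f) r" by (simp add: in_mball)
    then show ?thesis using h(1,2) by (auto simp: smooth_classes_def)
  qed
  then show ?thesis
    unfolding sobolev_topology_def metric_closure_of by (auto simp: space_eq)
qed

end

end

section \<open>Reduction to a positive Borel weight\<close>

text \<open>No measurability is assumed: \<open>lebesgue\<close> is complete, so integrability of
  one function makes the other measurable, and where integrability fails both integrals are 0 by
  convention.\<close>

lemma AE_lebesgue_integral_cong:
  fixes f g :: "'a::euclidean_space \<Rightarrow> real"
  assumes ae: "AE x in lebesgue. f x = g x"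
  shows "integrable lebesgue f \<longleftrightarrow> integrable lebesgue g" "integral\<^sup>L lebesgue f = integral\<^sup>L lebesgue g"
proof -
  have ae': "AE x in lebesgue. g x = f x" using ae by eventually_elim simp
  have imp: "integrable lebesgue b" if "integrable lebesgue a" "AE x in lebesgue. a x = b x" for a b :: "'a \<Rightarrow> real"
    using Bochner_Integration.integrable_cong_AE[OF borel_measurable_integrable[OF that(1)]
        borel_measurable_AE[OF borel_measurable_integrable[OF that(1)] that(2)] that(2)] that(1) by simp
  show iff: "integrable lebesgue f \<longleftrightarrow> integrable lebesgue g" using imp ae ae' by blast
  show "integral\<^sup>L lebesgue f = integral\<^sup>L lebesgue g"
    by (cases "integrable lebesgue f")
      (use iff ae in \<open>auto intro: integral_cong_AE simp: not_integrable_integral_eq\<close>)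
qed

text \<open>The weight enters only through integrals, so changing it on a null set gives the same
  set of functions and the same norm, as equalities rather than isomorphisms.\<close>

lemma sobolev_weight_cong:
  fixes w v :: "real^'n::finite \<Rightarrow> real"
  assumes "AE x in lebesgue. w x = v x"
  shows "sobolev_functions D m p w = sobolev_functions D m p v" "sobolev_norm D m p w = sobolev_norm D m p v"
proof -
  have ae: "AE x in lebesgue. indicator D x *\<^sub>R (\<bar>f x\<bar> powr p * w x) = indicator D x *\<^sub>R (\<bar>f x\<bar> powr p * v x)"
    for f :: "real^'n \<Rightarrow> real"
    using assms by eventually_elim simp
  show "sobolev_functions D m p w = sobolev_functions D m p v"
    unfolding sobolev_functions_def set_integrable_def AE_lebesgue_integral_cong(1)[OF ae] ..
  show "sobolev_norm D m p w = sobolev_norm D m p v"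
    unfolding sobolev_norm_def[abs_def] weighted_Lp_norm_def set_lebesgue_integral_def AE_lebesgue_integral_cong(2)[OF ae] ..
qed

lemma sobolev_space_weight_cong:
  fixes w v :: "real^'n::finite \<Rightarrow> real"
  assumes "AE x in lebesgue. w x = v x"
  shows "sobolev_space D m p w = sobolev_space D m p v" "class_add D m p w = class_add D m p v"
    "class_zero D m p w = class_zero D m p v" "class_smul D m p w = class_smul D m p v"
    "class_norm D m p w = class_norm D m p v" "sobolev_topology D m p w = sobolev_topology D m p v"
    "smooth_classes D m p w = smooth_classes D m p v"
proof -
  note eq = sobolev_weight_cong[OF assms, of D m p]
  have R: "ae_rel D m p w = ae_rel D m p v" by (simp add: ae_rel_def eq)
  show a: "sobolev_space D m p w = sobolev_space D m p v" by (simp add: sobolev_space_def eq R)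
  show b: "class_add D m p w = class_add D m p v" by (intro ext) (simp add: class_add_def R)
  show "class_zero D m p w = class_zero D m p v" by (simp add: class_zero_def R)
  show c: "class_smul D m p w = class_smul D m p v" by (intro ext) (simp add: class_smul_def R)
  show d: "class_norm D m p w = class_norm D m p v" by (intro ext) (simp add: class_norm_def eq)
  show "sobolev_topology D m p w = sobolev_topology D m p v" by (simp add: sobolev_topology_def a b c d)
  show "smooth_classes D m p w = smooth_classes D m p v" by (simp add: smooth_classes_def R eq)
qed

text \<open>The averages are multiplied out with the volume \<kappa> r^n of a ball, where \<kappa>
  is the volume of the unit ball, so the constant picks up the factor
  \<open>\<kappa> powr p\<close>. The dual integral is finite because \<open>Ap_product\<close>
  would otherwise be infinite.\<close>

lemma Ap_condition_ball:
  fixes w :: "real^'n::finite \<Rightarrow> real"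
  assumes ap: "Ap_condition p w" and p: "1 < p" and w: "weight w"
  obtains C where "0 \<le> C" "\<And>c r. 0 < r \<Longrightarrow>
      (\<integral>\<^sup>+x. (if w x = 0 then \<infinity> else ennreal (w x powr (1 / (1 - p)))) * indicator (ball c r) x \<partial>lebesgue) < \<infinity>"
    "\<And>c r. 0 < r \<Longrightarrow> (LINT x:ball c r|lebesgue. w x) *
      enn2real (\<integral>\<^sup>+x. (if w x = 0 then \<infinity> else ennreal (w x powr (1 / (1 - p)))) * indicator (ball c r) x \<partial>lebesgue) powr (p - 1)
      \<le> C * (r ^ CARD('n)) powr p"
proof -
  define S where "S = (SUP (c, r) \<in> UNIV \<times> {0<..}. Ap_product w p (ball c r))"
  have "S < \<infinity>" using ap by (simp add: Ap_condition_def S_def)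
  then obtain C where C: "S = ennreal C" "0 \<le> C" by (cases S) auto
  define I where "I c r = (\<integral>\<^sup>+x. (if w x = 0 then \<infinity> else ennreal (w x powr (1 / (1 - p)))) * indicator (ball c r) x \<partial>lebesgue)"
    for c r
  define \<kappa> where "\<kappa> = unit_ball_vol (real CARD('n))"
  have \<kappa>: "\<kappa> > 0" unfolding \<kappa>_def by (rule unit_ball_vol_pos) simp
  have key: "I c r < \<infinity> \<and> (LINT x:ball c r|lebesgue. w x) * enn2real (I c r) powr (p - 1) \<le> (C * \<kappa> powr p) * (r ^ CARD('n)) powr p"
    if r: "0 < r" for c r
  proof -
    define \<beta> where "\<beta> = \<kappa> * r ^ CARD('n)"
    have \<beta>: "\<beta> > 0" using \<kappa> r by (simp add: \<beta>_def)
    have em: "emeasure lebesgue (ball c r) = ennreal \<beta>"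
      using r by (simp add: emeasure_ball \<beta>_def \<kappa>_def)
    have me: "measure lebesgue (ball c r) = \<beta>" using em \<beta> by (simp add: measure_def)
    have da: "dual_average w p (ball c r) = I c r / ennreal \<beta>"
      by (simp add: dual_average_def I_def em)
    have "Ap_product w p (ball c r) \<le> S"
      unfolding S_def using r by (intro SUP_upper2[of "(c, r)"]) auto
    then have le: "Ap_product w p (ball c r) \<le> ennreal C" by (simp add: C)
    then have "Ap_product w p (ball c r) \<noteq> \<infinity>" by (auto simp: top_unique)
    then have fin: "dual_average w p (ball c r) \<noteq> \<infinity>" by (auto simp: Ap_product_def)
    then have Ifin: "I c r < \<infinity>"
      unfolding da using \<beta> by (cases "I c r") (auto simp: ennreal_top_divide)
    then obtain b where b: "I c r = ennreal b" "0 \<le> b" by (cases "I c r") auto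
    define a where "a = (LINT x:ball c r|lebesgue. w x)"
    have a: "a \<ge> 0" unfolding a_def set_lebesgue_integral_def
      using w by (intro Bochner_Integration.integral_nonneg) (auto simp: weight_def)
    have "enn2real (dual_average w p (ball c r)) = b / \<beta>"
      unfolding da b using b \<beta> by (simp add: divide_ennreal)
    then have "Ap_product w p (ball c r) = ennreal (a / \<beta> * (b / \<beta>) powr (p - 1))"
      using fin by (simp add: Ap_product_def me a_def)
    then have "a / \<beta> * (b / \<beta>) powr (p - 1) \<le> C" using le C(2) by (simp add: ennreal_le_iff)
    then have "a * b powr (p - 1) / (\<beta> * \<beta> powr (p - 1)) \<le> C"
      using b \<beta> by (simp add: powr_divide)
    moreover have "\<beta> * \<beta> powr (p - 1) = \<beta> powr p"
      using \<beta> by (simp add: powr_mult_base)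
    ultimately have "a * b powr (p - 1) \<le> C * \<beta> powr p"
      using \<beta> by (simp add: pos_divide_le_eq)
    also have "\<beta> powr p = \<kappa> powr p * (r ^ CARD('n)) powr p"
      unfolding \<beta>_def using \<kappa> r by (simp add: powr_mult)
    finally show ?thesis using Ifin b by (simp add: a_def mult.assoc)
  qed
  show thesis
    by (rule that[of "C * \<kappa> powr p"]) (use key C(2) in \<open>auto simp: I_def\<close>)
qed

text \<open>The dual integrand is infinite at the zeros of \<open>w\<close>, yet its integral over
  every ball is finite; hence \<open>w\<close> is positive almost everywhere and has a Borel
  representative that can be made positive everywhere.\<close>

lemma ap_weight_exists:
  fixes w :: "real^'n::finite \<Rightarrow> real"
  assumes p: "1 < p" and w: "weight w" and ap: "Ap_condition p w"
  obtains v A where "ap_weight v p A" "AE x in lebesgue. w x = v x"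
proof -
  define \<sigma> where "\<sigma> x = (if w x = 0 then \<infinity> else ennreal (w x powr (1 / (1 - p))))" for x
  obtain C where C: "0 \<le> C" "\<And>c r. 0 < r \<Longrightarrow> (\<integral>\<^sup>+x. \<sigma> x * indicator (ball c r) x \<partial>lebesgue) < \<infinity>"
    "\<And>c r. 0 < r \<Longrightarrow> (LINT x:ball c r|lebesgue. w x) *
      enn2real (\<integral>\<^sup>+x. \<sigma> x * indicator (ball c r) x \<partial>lebesgue) powr (p - 1) \<le> C * (r ^ CARD('n)) powr p"
    using Ap_condition_ball[OF ap p w] unfolding \<sigma>_def by blast
  have w0: "0 \<le> w x" for x using w by (simp add: weight_def)
  have wl: "locally_summable UNIV w" using w by (simp add: weight_def)
  have wm [measurable]: "w \<in> borel_measurable lebesgue"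
    using meas_on_locally_summable[OF open_UNIV wl] by (simp add: meas_on_def)
  have \<sigma>m [measurable]: "\<sigma> \<in> borel_measurable lebesgue" unfolding \<sigma>_def by measurable
  \<comment> \<open>The balls of integer radius about the origin cover the space; each contributes
    one null set.\<close>
  have "AE x in lebesgue. \<forall>n::nat. x \<in> ball 0 (real n + 1) \<longrightarrow> w x \<noteq> 0"
    unfolding AE_all_countable
  proof
    fix n :: nat
    have bl: "ball 0 (real n + 1) \<in> sets lebesgue" by simp
    have "AE x in lebesgue. \<sigma> x * indicator (ball 0 (real n + 1)) x \<noteq> \<infinity>"
      using C(2)[of "real n + 1" 0]
      by (intro nn_integral_PInf_AE borel_measurable_times_ennreal borel_measurable_indicator \<sigma>m bl) auto
    then show "AE x in lebesgue. x \<in> ball 0 (real n + 1) \<longrightarrow> w x \<noteq> 0"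
      by eventually_elim (auto simp: \<sigma>_def)
  qed
  then have wpos: "AE x in lebesgue. 0 < w x"
  proof eventually_elim
    case (elim x)
    obtain n :: nat where "norm x \<le> real n" using real_arch_simple by blast
    then have "x \<in> ball 0 (real n + 1)" by simp
    then have "w x \<noteq> 0" using elim by blast
    then show ?case using w0[of x] by (simp add: less_le)
  qed
  obtain v0 where v0 [measurable]: "v0 \<in> borel_measurable borel" "AE x in lebesgue. w x = v0 x"
  proof -
    obtain h where "h \<in> borel_measurable lborel" "AE x in lborel. w x = h x"
      using completion_ex_borel_measurable_real[OF wm] by blast
    then show thesis by (intro that[of h] AE_completion) simp_all
  qed
  \<comment> \<open>The value 1 is an arbitrary positive number, used on a null set only.\<close>
  define v where "v x = (if 0 < v0 x then v0 x else 1)" for x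
  have v_pos: "0 < v x" for x by (simp add: v_def)
  have v_meas [measurable]: "v \<in> borel_measurable borel" unfolding v_def by measurable
  have wv: "AE x in lebesgue. w x = v x"
    using v0(2) wpos by eventually_elim (simp add: v_def)
  have mass: "(\<integral>\<^sup>+z. (if dist c z < r then ennreal (v z) else 0) \<partial>lborel) = ennreal (LINT x:ball c r|lebesgue. w x)" for c r
  proof -
    have i: "integrable lebesgue (\<lambda>x. indicator (ball c r) x *\<^sub>R w x)"
      using set_integrable_subset[of lebesgue "cball c r" w "ball c r"] wl
      by (auto simp: locally_summable_def set_integrable_def)
    have "(\<integral>\<^sup>+z. (if dist c z < r then ennreal (v z) else 0) \<partial>lborel) =
        (\<integral>\<^sup>+z. ennreal (indicator (ball c r) z *\<^sub>R w z) \<partial>lebesgue)"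
      unfolding nn_integral_completion[symmetric, of lborel "\<lambda>z. if dist c z < r then ennreal (v z) else 0"]
      by (rule nn_integral_cong_AE, use wv in eventually_elim) (auto simp: indicator_def)
    also have "\<dots> = ennreal (LINT x:ball c r|lebesgue. w x)"
      unfolding set_lebesgue_integral_def by (rule nn_integral_eq_integral[OF i]) (use w0 in auto)
    finally show ?thesis .
  qed
  have dual: "(\<integral>\<^sup>+z. (if dist c z < r then ennreal (v z powr (1 / (1 - p))) else 0) \<partial>lborel) =
      (\<integral>\<^sup>+x. \<sigma> x * indicator (ball c r) x \<partial>lebesgue)" for c r
    unfolding nn_integral_completion[symmetric, of lborel "\<lambda>z. if dist c z < r then ennreal (v z powr (1 / (1 - p))) else 0"]
  proof (rule nn_integral_cong_AE, use wv in eventually_elim)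
    case (elim x)
    then show ?case using v_pos[of x] by (auto simp: indicator_def \<sigma>_def)
  qed
  have "ap_weight v p C"
  proof
    show "enn2real (\<integral>\<^sup>+z. (if dist c z < r then ennreal (v z) else 0) \<partial>lborel) *
      enn2real (\<integral>\<^sup>+z. (if dist c z < r then ennreal (v z powr (1 / (1 - p))) else 0) \<partial>lborel) powr (p - 1)
        \<le> C * (r ^ CARD('n)) powr p" if "0 < r" for c r
    proof -
      have "0 \<le> (LINT x:ball c r|lebesgue. w x)"
        unfolding set_lebesgue_integral_def by (intro Bochner_Integration.integral_nonneg) (use w0 in auto)
      then show ?thesis unfolding mass dual using C(3)[OF that, of c] by simp
    qed
  qed (use p v_pos v_meas C in \<open>auto simp: mass dual\<close>)
  then show thesis using wv by (rule that)
qed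

theorem theorem1:
  fixes D :: "(real^'n::finite) set" and m :: nat and p :: real and w :: "real^'n \<Rightarrow> real"
  assumes "2 \<le> CARD('n)"
    and "open D"
    and "1 \<le> m"
    and "1 < p"
    and "weight w"
    and "Ap_condition p w"
  shows "banach_space_on (sobolev_space D m p w) (class_add D m p w) (class_zero D m p w)
      (class_smul D m p w) (class_norm D m p w)
    \<and> sobolev_topology D m p w closure_of smooth_classes D m p w = sobolev_space D m p w"
proof -
  obtain v A where v: "ap_weight v p A" "AE x in lebesgue. w x = v x"
    by (rule ap_weight_exists[OF assms(4-6)])
  interpret ap_weight v p A by (rule v(1))
  show ?thesis
    \<comment> \<open>The space, its operations, norm and topology and the smooth classes for
      \<open>w\<close> are equal to those for \<open>v\<close>, so the results for the positive
      weight are the claim itself.\<close>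
    unfolding sobolev_space_weight_cong[OF v(2)]
    using banach_space_sobolev[OF assms(2)] smooth_classes_dense[OF assms(2)] by blast
qed

end
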